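(* Let $\varrho>0$ and $V^\varrho=\frac{1}{(1+\varrho)^2}$. Let $(\underline\omega^-(\cdot),\underline\omega(\cdot))$ be a pair of constant rate totally asymmetric zero range processes (TAZRP), evolving together under the basic coupling and started from the initial distribution $\underline{\hat\mu}_\varrho$, so that $\underline\omega(0)=\underline\omega^-(0)+\underline\delta_0$, and let $Q_a(t)$ be the position at time $t$ of the second class antiparticle between them, $Q_a(0)=0$. Then there exist constants $0<t_0,C<\infty$ such that for all real $1\le m<3$ and all $t\ge t_0$ $$C^{-1}\;\le\;\mathbf E\left\{\left|\frac{Q_a(t)-V^\varrho t}{t^{2/3}}\right|^m\right\}\;\le\; C.$$
   Context: TAZRP: the Markov process on $\Omega=\{0,1,2,\dots\}^{\mathbb Z}$ in which, independently at different sites, the jump $(\omega_i,\omega_{i+1})\to(\omega_i-1,\omega_{i+1}+1)$ occurs with rate $\mathbb I_{(\omega_i>0)}$. It is constructed from independent rate $1$ Poisson processes $N_{i\to i+1}$, $i\in\mathbb Z$, on $[0,\infty)$, independent of the initial state: when $N_{i\to i+1}$ jumps, one particle moves from $i$ to $i+1$ if site $i$ is occupied. The basic coupling runs several such processes with the same Poisson clocks. $\underline\delta_i\in\Omega$ is the configuration with a single particle, located at $i$. If $\underline\omega(0)=\underline\omega^-(0)+\underline\delta_0$, then under the basic coupling for every $t\ge 0$ there is a unique site $Q_a(t)$ with $\underline\omega(t)=\underline\omega^-(t)+\underline\delta_{Q_a(t)}$; this is the position of the second class antiparticle. Measures on $\{0,1,2,\dots\}$: $\mu_\varrho(k)=\left(\frac{\varrho}{1+\varrho}\right)^k\frac1{1+\varrho}$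 (geometric with mean $\varrho$) and $\hat\mu_\varrho(k)=(k+1)\left(\frac{\varrho}{1+\varrho}\right)^k\left(\frac1{1+\varrho}\right)^2$. $\underline{\hat\mu}_\varrho$ is the law of the pair $(\underline\omega^-(0),\underline\omega(0))$ in which the sites of $\underline\omega^-(0)$ are independent, $\omega^-_i(0)\sim\mu_\varrho$ for $i\ne0$, $\omega^-_0(0)\sim\hat\mu_\varrho$, and $\underline\omega(0)=\underline\omega^-(0)+\underline\delta_0$. $\mathbf E$ is the expectation for the pair started from $\underline{\hat\mu}_\varrho$. *)

theory Defs
  imports "HOL-Probability.Probability"
begin

section \<open>Configurations and one-site marginals\<close>

type_synonym config = "int \<Rightarrow> nat"

definition config_space :: "config measure" where
  "config_space = PiM UNIV (\<lambda>_. count_space UNIV)"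

definition single_particle :: "int \<Rightarrow> config" where
  "single_particle i = (\<lambda>j. if j = i then 1 else 0)"

definition add_config :: "config \<Rightarrow> config \<Rightarrow> config" where
  "add_config \<eta> \<xi> = (\<lambda>j. \<eta> j + \<xi> j)"

text \<open>
  The real functions below are probability mass functions for \<open>\<rho> > 0\<close>;
  see \<open>pmf_mu\<close> and \<open>pmf_mu_hat\<close>.
\<close>

definition mu :: "real \<Rightarrow> nat pmf" where
  "mu \<rho> = embed_pmf (\<lambda>k. (\<rho> / (1 + \<rho>)) ^ k * (1 / (1 + \<rho>)))"

definition mu_hat :: "real \<Rightarrow> nat pmf" where
  "mu_hat \<rho> = embed_pmf (\<lambda>k. (real k + 1) * (\<rho> / (1 + \<rho>)) ^ k * (1 / (1 + \<rho>))\<^sup>2)"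

lemma pmf_mu:
  assumes "\<rho> > 0"
  shows "pmf (mu \<rho>) k = (\<rho> / (1 + \<rho>)) ^ k * (1 / (1 + \<rho>))"
proof -
  have p: "0 < 1 / (1 + \<rho>)" "1 / (1 + \<rho>) \<le> 1" using assms by auto
  have "(\<lambda>k. (\<rho> / (1 + \<rho>)) ^ k * (1 / (1 + \<rho>))) = pmf (geometric_pmf (1 / (1 + \<rho>)))"
    using assms by (intro ext, subst pmf_geometric[OF p]) (simp add: field_simps)
  moreover from this have "mu \<rho> = geometric_pmf (1 / (1 + \<rho>))"
    using type_definition.Rep_inverse[OF td_pmf_embed_pmf] by (simp add: mu_def)
  ultimately show ?thesis by metis
qed

lemma pmf_mu_hat:
  assumes "\<rho> > 0"
  shows "pmf (mu_hat \<rho>) k = (real k + 1) * (\<rho> / (1 + \<rho>)) ^ k * (1 / (1 + \<rho>))\<^sup>2"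
proof -
  have p: "1 / (1 + \<rho>) \<in> {0<..1}" using assms by auto
  have "(\<lambda>k. (real k + 1) * (\<rho> / (1 + \<rho>)) ^ k * (1 / (1 + \<rho>))\<^sup>2)
      = pmf (neg_binomial_pmf 2 (1 / (1 + \<rho>)))" (is "?f = _")
  proof
    fix k :: nat
    have eq: "1 - 1 / (1 + \<rho>) = \<rho> / (1 + \<rho>)" using assms by (simp add: field_simps)
    have "(k + 2 - 1) choose k = Suc k"
      using binomial_symmetric[of k "Suc k"] by simp
    then show "?f k = pmf (neg_binomial_pmf 2 (1 / (1 + \<rho>))) k"
      by (subst pmf_neg_binomial[OF p], unfold eq) (simp add: ac_simps)
  qed
  moreover from this have "mu_hat \<rho> = neg_binomial_pmf 2 (1 / (1 + \<rho>))"
    using type_definition.Rep_inverse[OF td_pmf_embed_pmf] by (simp add: mu_hat_def)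
  ultimately show ?thesis by metis
qed

definition initial_law :: "real \<Rightarrow> (config \<times> config) measure" where
  "initial_law \<rho> =
     distr (PiM UNIV (\<lambda>i. measure_pmf (if i = 0 then mu_hat \<rho> else mu \<rho>)))
           (config_space \<Otimes>\<^sub>M config_space)
           (\<lambda>\<eta>. (\<eta>, add_config \<eta> (single_particle 0)))"

lemma prob_space_initial_law: "prob_space (initial_law \<rho>)"
proof -
  interpret P: product_prob_space
    "\<lambda>i::int. measure_pmf (if i = 0 then mu_hat \<rho> else mu \<rho>)" UNIV
    by unfold_locales
  have "sets (PiM UNIV (\<lambda>i::int. measure_pmf (if i = 0 then mu_hat \<rho> else mu \<rho>)))
      = sets config_space"
    unfolding config_space_def by (intro sets_PiM_cong) auto
  moreover have "(\<lambda>\<eta>. (\<eta>, add_config \<eta> (single_particle 0)))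
      \<in> measurable config_space (config_space \<Otimes>\<^sub>M config_space)"
    unfolding config_space_def add_config_def single_particle_def
  proof (intro measurable_Pair measurable_ident_sets refl)
    show "(\<lambda>\<eta> j. \<eta> j + (if j = (0::int) then 1 else 0))
        \<in> PiM UNIV (\<lambda>_. count_space UNIV) \<rightarrow>\<^sub>M PiM UNIV (\<lambda>_. count_space (UNIV :: nat set))"
      by (rule measurable_PiM_single') (auto intro!: measurable_compose[OF measurable_component_singleton])
  qed
  ultimately show ?thesis
    unfolding initial_law_def by (intro P.prob_space_distr) (simp cong: measurable_cong_sets)
qed

section \<open>Poisson clocks\<close>

text \<open>
  Time is \<open>[0,\<infinity>)\<close>; values at negative times are never constrained. The increments
  are natural number differences, which are genuine because the paths are almost
  surely nondecreasing.
\<close>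

definition poisson_process :: "'a measure \<Rightarrow> real \<Rightarrow> (real \<Rightarrow> 'a \<Rightarrow> nat) \<Rightarrow> bool" where
  "poisson_process M r N \<longleftrightarrow>
     (\<forall>t\<ge>0. N t \<in> measurable M (count_space UNIV)) \<and>
     (AE x in M. N 0 x = 0 \<and> mono_on {0..} (\<lambda>t. N t x) \<and>
        (\<forall>t\<ge>0. continuous (at_right t) (\<lambda>u. N u x))) \<and>
     (\<forall>s t. 0 \<le> s \<longrightarrow> s < t \<longrightarrow>
        distr M (count_space UNIV) (\<lambda>x. N t x - N s x) = measure_pmf (poisson_pmf (r * (t - s)))) \<and>
     (\<forall>(\<tau> :: nat \<Rightarrow> real) n. 0 \<le> \<tau> 0 \<longrightarrow> mono \<tau> \<longrightarrow>
        prob_space.indep_vars M (\<lambda>_. count_space UNIV)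
          (\<lambda>k x. N (\<tau> (Suc k)) x - N (\<tau> k) x) {..<n})"

abbreviation path_space :: "(real \<Rightarrow> nat) measure" where
  "path_space \<equiv> PiM {0..} (\<lambda>_. count_space UNIV)"

definition path_of :: "(real \<Rightarrow> 'a \<Rightarrow> nat) \<Rightarrow> 'a \<Rightarrow> real \<Rightarrow> nat" where
  "path_of N x = (\<lambda>t\<in>{0..}. N t x)"

text \<open>\<open>N i\<close> is the clock of the bond \<open>i \<rightarrow> i + 1\<close>.\<close>

definition poisson_clocks :: "'a measure \<Rightarrow> (int \<Rightarrow> real \<Rightarrow> 'a \<Rightarrow> nat) \<Rightarrow> bool" where
  "poisson_clocks M N \<longleftrightarrow>
     (\<forall>i. poisson_process M 1 (N i)) \<and>
     prob_space.indep_vars M (\<lambda>_. path_space) (\<lambda>i. path_of (N i)) UNIV"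

section \<open>The totally asymmetric zero range process and its basic coupling\<close>

definition jump_times :: "(real \<Rightarrow> nat) \<Rightarrow> real set" where
  "jump_times n = {s. 0 < s \<and> \<not> continuous (at_left s) n}"

text \<open>
  Times in \<open>(0,t]\<close> at which a particle moves from \<open>i\<close> to \<open>i + 1\<close>: the clock rings and
  site \<open>i\<close> is occupied immediately before.
\<close>

definition moves :: "(int \<Rightarrow> real \<Rightarrow> nat) \<Rightarrow> (real \<Rightarrow> config) \<Rightarrow> int \<Rightarrow> real \<Rightarrow> real set" where
  "moves n \<omega> i t =
     {s \<in> jump_times (n i). s \<le> t \<and> (\<forall>\<^sub>F u in at_left s. 0 < \<omega> u i)}"

text \<open>
  Particle balance at every site. On almost every realisation of the clocks this
  determines the path from \<open>\<omega> 0\<close>: up to any time there are bonds arbitrarily far to the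
  left whose clocks have not rung, and to the right of such a bond the sites can be
  solved for one after the other, clock ring by clock ring.
\<close>

definition tazrp_path :: "(int \<Rightarrow> real \<Rightarrow> nat) \<Rightarrow> (real \<Rightarrow> config) \<Rightarrow> bool" where
  "tazrp_path n \<omega> \<longleftrightarrow>
     (\<forall>t\<ge>0. \<forall>i. \<omega> t i + card (moves n \<omega> i t) = \<omega> 0 i + card (moves n \<omega> (i - 1) t))"

definition tazrp ::
  "'a measure \<Rightarrow> (int \<Rightarrow> real \<Rightarrow> 'a \<Rightarrow> nat) \<Rightarrow> (real \<Rightarrow> 'a \<Rightarrow> config) \<Rightarrow> bool" where
  "tazrp M N \<omega> \<longleftrightarrow>
     (\<forall>t\<ge>0. \<omega> t \<in> measurable M config_space) \<and>
     (AE x in M. tazrp_path (\<lambda>i t. N i t x) (\<lambda>t. \<omega> t x))"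

definition basic_coupling ::
  "'a measure \<Rightarrow> (int \<Rightarrow> real \<Rightarrow> 'a \<Rightarrow> nat) \<Rightarrow>
   (real \<Rightarrow> 'a \<Rightarrow> config) \<Rightarrow> (real \<Rightarrow> 'a \<Rightarrow> config) \<Rightarrow> bool" where
  "basic_coupling M N \<eta> \<omega> \<longleftrightarrow>
     prob_space M \<and> poisson_clocks M N \<and> tazrp M N \<eta> \<and> tazrp M N \<omega> \<and>
     prob_space.indep_set M
       (sets (vimage_algebra (space M) (\<lambda>x. (\<eta> 0 x, \<omega> 0 x)) (config_space \<Otimes>\<^sub>M config_space)))
       (sets (vimage_algebra (space M) (\<lambda>x i. path_of (N i) x) (PiM UNIV (\<lambda>_. path_space))))"

section \<open>The second class antiparticle\<close>

text \<open>
  Only meaningful on the almost sure event that the two configurations differ by exactly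
  one particle; off that event the value is an unspecified constant.
\<close>

definition antiparticle ::
  "(real \<Rightarrow> 'a \<Rightarrow> config) \<Rightarrow> (real \<Rightarrow> 'a \<Rightarrow> config) \<Rightarrow> real \<Rightarrow> 'a \<Rightarrow> int" where
  "antiparticle \<eta> \<omega> t x = (THE q. \<omega> t x = add_config (\<eta> t x) (single_particle q))"

lemma antiparticle_eqI:
  assumes "\<omega> t x = add_config (\<eta> t x) (single_particle q)"
  shows "antiparticle \<eta> \<omega> t x = q"
  unfolding antiparticle_def
proof (rule the_equality)
  show "\<omega> t x = add_config (\<eta> t x) (single_particle q)" by (fact assms)
next
  fix r assume "\<omega> t x = add_config (\<eta> t x) (single_particle r)"
  then have "add_config (\<eta> t x) (single_particle r) q = add_config (\<eta> t x) (single_particle q) q"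
    using assms by simp
  then show "r = q"
    by (auto simp: add_config_def single_particle_def split: if_splits)
qed

definition char_speed :: "real \<Rightarrow> real" where
  "char_speed \<rho> = 1 / (1 + \<rho>)\<^sup>2"

end

theory Submission
  imports Defs
begin

text \<open>
  Cut the line down to a stretch of \<open>n\<close> sites with a sink on its right and Poisson arrivals of
  density \<open>a = \<rho> / (1 + \<rho>)\<close> on its left; by Burke's theorem a stationary stretch also departs at this
  density, and the critical length at time \<open>T\<close> is \<open>V * T\<close> with \<open>V = (1 - a)\<^sup>2\<close>. Let \<open>J\<close> be the number of
  departures minus the initial number of particles, and let \<open>q m\<close> be the probability that an
  antiparticle started at the left end of a stretch of \<open>m\<close> sites has left it.

  Three facts about \<open>J\<close> suffice. Its variance is \<open>a T (1 - p a) - n a / V + 2 a / V \<Sum>\<^sub>m\<^sub>\<le>\<^sub>n (1 - q m)\<close>, where \<open>p\<close> is the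
  time step of the chain. Changing the initial or the arrival density changes \<open>E J\<close> by at
  least a multiple of \<open>\<Sum>\<^sub>m\<^sub>\<le>\<^sub>n (1 - q m)\<close> or of \<open>\<Sum>\<^sub>s q n (s)\<close>, while a coupling of three
  systems turns this change into one-sided deviations of \<open>J\<close>. Finally, if the arrival density
  is \<open>g\<close> and the initial density is \<open>b\<close>, then \<open>exp (- (ln g - ln b) * J)\<close> has the explicit expectation
  \<open>((1 - b) / (1 - g)) ^ n * (1 + p * (b - g)) ^ K\<close>. With \<open>g - b\<close> of order \<open>T powr (- 1/3)\<close> this shows
  that at the critical length \<open>Var J\<close> is of exact order \<open>T powr (2/3)\<close>, hence so is the expected
  deviation of the antiparticle; at a distance \<open>u\<close> from the critical length it gives the tail
  \<open>T powr (8/3) / u ^ 4\<close>, hence third moments.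

  The clocks are discretised with a mesh so fine that no interval sees two rings of the
  relevant bonds, and a bond far to the left which does not ring at all separates the stretch from
  the rest of the line.
\<close>

section \<open>Jump chains on a stretch of sites\<close>

text \<open>The exponential moment is explicit only for the exponent \<open>ln g - ln b\<close>
  dictated by the two densities, and this exponent vanishes in the stationary system, the one of
  interest. Estimates therefore pass through systems with \<open>g > b\<close>. The link is that the
  flux with the lower arrivals and the higher initial density is the minimum of two fluxes: the one
  with both densities low and the one with both high. Two such neighbours bound the lower deviations
  of the stationary flux, and its known mean transfers the bound to the upper ones. The density step
  \<open>1 / L\<close>, with \<open>L\<close> the cube root of time, comes from a balance. At the
  critical length the mean flux is stationary in the density, so the step changes it by order
  \<open>L ^ 3 * (1 / L) ^ 2 = L\<close>; against an exponent of order \<open>1 / L\<close> this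
  costs only a constant factor. The chains are iterated as linear operators on observables.
  Couplings, marginals and averages over initial data become identities and inequalities between
  functions, and probability spaces enter only when the actual clocks are cut into words.\<close>

text \<open>One step applies the letter \<open>m l\<close> with probability \<open>c l\<close> and idles with the remaining
  probability.\<close>

definition mstep :: "(nat \<Rightarrow> real) \<Rightarrow> (nat \<Rightarrow> 's \<Rightarrow> 's) \<Rightarrow> nat \<Rightarrow> ('s \<Rightarrow> real) \<Rightarrow> 's \<Rightarrow> real" where
  "mstep c m n f s = f s + (\<Sum>l\<le>n. c l * (f (m l s) - f s))"

definition miter :: "(nat \<Rightarrow> real) \<Rightarrow> (nat \<Rightarrow> 's \<Rightarrow> 's) \<Rightarrow> nat \<Rightarrow> nat \<Rightarrow> ('s \<Rightarrow> real) \<Rightarrow> 's \<Rightarrow> real" where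
  "miter c m n K = mstep c m n ^^ K"

definition substoch :: "(nat \<Rightarrow> real) \<Rightarrow> nat \<Rightarrow> bool" where
  "substoch c n \<longleftrightarrow> (\<forall>l\<le>n. 0 \<le> c l) \<and> (\<Sum>l\<le>n. c l) \<le> 1"

lemma miter_0 [simp]: "miter c m n 0 f = f"
  by (simp add: miter_def)

lemma miter_Suc: "miter c m n (Suc K) f = mstep c m n (miter c m n K f)"
  by (simp add: miter_def)

lemma miter_Suc': "miter c m n (Suc K) f = miter c m n K (mstep c m n f)"
  by (simp add: miter_def funpow_swap1)

lemma mstep_add: "mstep c m n (\<lambda>s. f s + g s) = (\<lambda>s. mstep c m n f s + mstep c m n g s)"
  by (simp add: mstep_def fun_eq_iff algebra_simps sum.distrib sum_subtractf)

lemma mstep_cmult: "mstep c m n (\<lambda>s. a * f s) = (\<lambda>s. a * mstep c m n f s)"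
  by (simp add: mstep_def fun_eq_iff algebra_simps sum_distrib_left sum_subtractf)

lemma miter_add: "miter c m n K (\<lambda>s. f s + g s) = (\<lambda>s. miter c m n K f s + miter c m n K g s)"
  by (induction K) (simp_all add: miter_Suc mstep_add)

lemma miter_cmult: "miter c m n K (\<lambda>s. a * f s) = (\<lambda>s. a * miter c m n K f s)"
  by (induction K) (simp_all add: miter_Suc mstep_cmult)

lemma miter_diff: "miter c m n K (\<lambda>s. f s - g s) = (\<lambda>s. miter c m n K f s - miter c m n K g s)"
  using miter_add[of c m n K f "\<lambda>s. (-1) * g s"] miter_cmult[of c m n K "-1" g] by simp

lemma miter_const [simp]: "miter c m n K (\<lambda>_. a) = (\<lambda>_. a)"
  by (induction K) (simp_all add: miter_Suc mstep_def fun_eq_iff)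

lemma mstep_mono:
  assumes "substoch c n" "f s \<le> g s" "\<And>l. l \<le> n \<Longrightarrow> f (m l s) \<le> g (m l s)"
  shows "mstep c m n f s \<le> mstep c m n g s"
proof -
  have eq: "mstep c m n h s = (1 - (\<Sum>l\<le>n. c l)) * h s + (\<Sum>l\<le>n. c l * h (m l s))" for h
    by (simp add: mstep_def algebra_simps sum_subtractf sum_distrib_left)
  have "(1 - (\<Sum>l\<le>n. c l)) * f s \<le> (1 - (\<Sum>l\<le>n. c l)) * g s"
    using assms by (intro mult_left_mono) (auto simp: substoch_def)
  moreover have "(\<Sum>l\<le>n. c l * f (m l s)) \<le> (\<Sum>l\<le>n. c l * g (m l s))"
    using assms by (intro sum_mono mult_left_mono) (auto simp: substoch_def)
  ultimately show ?thesis by (simp add: eq)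
qed

text \<open>The invariant is indexed by the number of elapsed steps, so that bounds growing in time,
  such as one departure per step, can be assumed of the final states.\<close>

lemma miter_mono:
  assumes "substoch c n"
    and "\<And>k s. I k s \<Longrightarrow> I (Suc k) s" "\<And>k s l. l \<le> n \<Longrightarrow> I k s \<Longrightarrow> I (Suc k) (m l s)"
    and "\<And>s. I (k + K) s \<Longrightarrow> f s \<le> g s" "I k s"
  shows "miter c m n K f s \<le> miter c m n K g s"
  using assms(4,5)
proof (induction K arbitrary: k s)
  case (Suc K)
  show ?case unfolding miter_Suc
    by (rule mstep_mono[OF assms(1)]; rule Suc.IH[where k="Suc k"])
      (use Suc.prems assms(2,3) in auto)
qed simp

lemma miter_mono':
  assumes "substoch c n" "\<And>s l. l \<le> n \<Longrightarrow> I s \<Longrightarrow> I (m l s)"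
    and "\<And>s. I s \<Longrightarrow> f s \<le> g s" "I s"
  shows "miter c m n K f s \<le> miter c m n K g s"
  by (rule miter_mono[where I="\<lambda>_. I" and k=0]) (use assms in auto)

text \<open>If \<open>h\<close> intertwines the two families of letters, it projects one chain onto
  the other. This extracts the marginals of the coupled chains.\<close>

lemma miter_lump:
  assumes "\<And>l s. l \<le> n \<Longrightarrow> h (m l s) = m' l (h s)"
  shows "miter c m n K (\<lambda>s. g (h s)) = (\<lambda>s. miter c m' n K g (h s))"
proof (induction K)
  case (Suc K)
  then show ?case using assms by (simp add: miter_Suc mstep_def fun_eq_iff)
qed simp

lemma miter_idle_letters:
  assumes "n \<le> N" "\<And>l s. n < l \<Longrightarrow> l \<le> N \<Longrightarrow> m l s = s"
  shows "miter c m N K f = miter c m n K f"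
proof -
  have "mstep c m N g s = mstep c m n g s" for g s
  proof -
    have "(\<Sum>l\<le>N. c l * (g (m l s) - g s)) = (\<Sum>l\<le>n. c l * (g (m l s) - g s))"
      using assms by (intro sum.mono_neutral_right) auto
    then show ?thesis by (simp add: mstep_def)
  qed
  then have "mstep c m N = mstep c m n" by (intro ext)
  then show ?thesis by (simp add: miter_def)
qed

lemma miter_cong:
  assumes "\<And>l s. l \<le> n \<Longrightarrow> m l s = m' l s" "\<And>l. l \<le> n \<Longrightarrow> c l = c' l"
  shows "miter c m n K f = miter c' m' n K f"
proof -
  have "mstep c m n = mstep c' m' n"
    using assms by (intro ext) (simp add: mstep_def)
  then show ?thesis by (simp add: miter_def)
qed

type_synonym conf = "nat \<Rightarrow> nat"

text \<open>Site \<open>n\<close> of a stretch of sites \<open>0, \<dots>, n - 1\<close> counts the departures. Letter \<open>0\<close> is an arrival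
  from the left, letter \<open>Suc i\<close> a ring of the bond from \<open>i\<close> to \<open>i + 1\<close>.\<close>

fun act :: "nat \<Rightarrow> conf \<Rightarrow> conf" where
  "act 0 \<eta> = \<eta>(0 := Suc (\<eta> 0))"
| "act (Suc i) \<eta> = (if \<eta> i = 0 then \<eta> else \<eta>(i := \<eta> i - 1, Suc i := Suc (\<eta> (Suc i))))"

definition rate :: "real \<Rightarrow> real \<Rightarrow> nat \<Rightarrow> real" where
  "rate p a l = (if l = 0 then p * a else p)"

definition ev :: "real \<Rightarrow> real \<Rightarrow> nat \<Rightarrow> nat \<Rightarrow> (conf \<Rightarrow> real) \<Rightarrow> conf \<Rightarrow> real" where
  "ev p a n K = miter (rate p a) act n K"

definition tot :: "nat \<Rightarrow> conf \<Rightarrow> nat" where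
  "tot n \<eta> = (\<Sum>i<n. \<eta> i)"

section \<open>Averages over independent sites\<close>

definition wavg :: "(nat \<Rightarrow> real) \<Rightarrow> (nat \<Rightarrow> real) \<Rightarrow> real" where
  "wavg w f = (\<Sum>k. w k * f k)"

text \<open>Expectation over independent sites, the leftmost site being averaged first; \<open>\<zeta>\<close> is the
  configuration from the sink on.\<close>

fun pavg :: "(nat \<Rightarrow> real) list \<Rightarrow> (conf \<Rightarrow> real) \<Rightarrow> conf \<Rightarrow> real" where
  "pavg [] f \<zeta> = f \<zeta>"
| "pavg (w # ws) f \<zeta> = pavg ws (\<lambda>\<eta>. wavg w (\<lambda>k. f (case_nat k \<eta>))) \<zeta>"

lemma pavg_Nil [simp]: "pavg [] f = f"
  by (rule ext) simp

text \<open>Weights and observables for which all averages converge absolutely: the weights have an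
  exponential moment \<open>z\<close> per particle, and observables grow at most like \<open>z\<close> to the number of particles.\<close>

definition okw :: "real \<Rightarrow> (nat \<Rightarrow> real) \<Rightarrow> bool" where
  "okw z w \<longleftrightarrow> (\<forall>k. 0 \<le> w k) \<and> summable (\<lambda>k. w k * z ^ k)"

definition tame1 :: "real \<Rightarrow> (nat \<Rightarrow> real) \<Rightarrow> bool" where
  "tame1 z f \<longleftrightarrow> (\<exists>C. \<forall>k. \<bar>f k\<bar> \<le> C * z ^ k)"

definition tame :: "real \<Rightarrow> nat \<Rightarrow> conf \<Rightarrow> (conf \<Rightarrow> real) \<Rightarrow> bool" where
  "tame z n \<zeta> f \<longleftrightarrow> (\<exists>C. \<forall>\<eta>. (\<forall>j. \<eta> (n + j) = \<zeta> j) \<longrightarrow> \<bar>f \<eta>\<bar> \<le> C * z ^ tot n \<eta>)"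

lemma tot_case_nat: "tot (Suc n) (case_nat k \<eta>) = k + tot n \<eta>"
  unfolding tot_def by (subst sum.lessThan_Suc_shift) simp

lemma tot_0 [simp]: "tot 0 \<eta> = 0"
  by (simp add: tot_def)

lemma summable_wavg_abs:
  assumes "okw z w" "tame1 z f"
  shows "summable (\<lambda>k. \<bar>w k * f k\<bar>)"
proof -
  obtain C where C: "\<And>k. \<bar>f k\<bar> \<le> C * z ^ k" using assms by (auto simp: tame1_def)
  have "summable (\<lambda>k. C * (w k * z ^ k))"
    using assms by (intro summable_mult) (auto simp: okw_def)
  moreover have "norm (\<bar>w k * f k\<bar>) \<le> C * (w k * z ^ k)" for k
    using mult_left_mono[OF C[of k], of "w k"] assms
    by (auto simp: okw_def abs_mult mult_ac)
  ultimately show ?thesis by (metis (no_types, lifting) summable_comparison_test)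
qed

lemma summable_wavg:
  assumes "okw z w" "tame1 z f"
  shows "summable (\<lambda>k. w k * f k)"
  using summable_wavg_abs[OF assms] by (rule summable_rabs_cancel)

lemma wavg_mono:
  assumes "okw z w" "tame1 z f" "tame1 z g" "\<And>k. f k \<le> g k"
  shows "wavg w f \<le> wavg w g"
  unfolding wavg_def using assms
  by (intro suminf_le summable_wavg[of z]) (auto intro!: mult_left_mono simp: okw_def)

lemma wavg_add:
  assumes "okw z w" "tame1 z f" "tame1 z g"
  shows "wavg w (\<lambda>k. f k + g k) = wavg w f + wavg w g"
  unfolding wavg_def using suminf_add[OF summable_wavg[OF assms(1,2)] summable_wavg[OF assms(1,3)]]
  by (simp add: algebra_simps)

lemma wavg_cmult:
  assumes "okw z w" "tame1 z f"
  shows "wavg w (\<lambda>k. a * f k) = a * wavg w f"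
  unfolding wavg_def using suminf_mult[OF summable_wavg[OF assms(1,2)], of a]
  by (simp add: algebra_simps)

lemma tame_add:
  assumes "tame z n \<zeta> f" "tame z n \<zeta> g"
  shows "tame z n \<zeta> (\<lambda>\<eta>. f \<eta> + g \<eta>)"
proof -
  obtain C D where C: "\<And>\<eta>. (\<forall>j. \<eta> (n + j) = \<zeta> j) \<Longrightarrow> \<bar>f \<eta>\<bar> \<le> C * z ^ tot n \<eta>"
    and D: "\<And>\<eta>. (\<forall>j. \<eta> (n + j) = \<zeta> j) \<Longrightarrow> \<bar>g \<eta>\<bar> \<le> D * z ^ tot n \<eta>"
    using assms unfolding tame_def by metis
  have "\<bar>f \<eta> + g \<eta>\<bar> \<le> (C + D) * z ^ tot n \<eta>" if "\<forall>j. \<eta> (n + j) = \<zeta> j" for \<eta>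
    using C[OF that] D[OF that] by (smt (verit, best) distrib_right)
  then show ?thesis by (auto simp: tame_def)
qed

lemma tame_cmult:
  assumes "tame z n \<zeta> f" shows "tame z n \<zeta> (\<lambda>\<eta>. a * f \<eta>)"
proof -
  obtain C where C: "\<And>\<eta>. (\<forall>j. \<eta> (n + j) = \<zeta> j) \<Longrightarrow> \<bar>f \<eta>\<bar> \<le> C * z ^ tot n \<eta>"
    using assms by (auto simp: tame_def)
  have "\<bar>a * f \<eta>\<bar> \<le> (\<bar>a\<bar> * C) * z ^ tot n \<eta>" if "\<forall>j. \<eta> (n + j) = \<zeta> j" for \<eta>
    using mult_left_mono[OF C[OF that], of "\<bar>a\<bar>"] by (simp add: abs_mult mult_ac)
  then show ?thesis by (auto simp: tame_def)
qed

lemma tame_diff: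
  assumes "tame z n \<zeta> f" "tame z n \<zeta> g"
  shows "tame z n \<zeta> (\<lambda>\<eta>. f \<eta> - g \<eta>)"
  using tame_add[OF assms(1) tame_cmult[OF assms(2), of "-1"]] by simp

lemma tame_bound:
  assumes "tame z n \<zeta> g" "\<And>\<eta>. (\<And>j. \<eta> (n + j) = \<zeta> j) \<Longrightarrow> \<bar>f \<eta>\<bar> \<le> \<bar>g \<eta>\<bar>"
  shows "tame z n \<zeta> f"
  using assms unfolding tame_def by (meson order_trans)

lemma tame_const: assumes "z \<ge> 1" shows "tame z n \<zeta> (\<lambda>_. a)"
  unfolding tame_def
  by (intro exI[of _ "\<bar>a\<bar>"]) (use one_le_power[OF assms] mult_left_mono[of 1 _ "\<bar>a\<bar>"] in fastforce)

lemma real_le_power: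
  assumes "z > (1::real)" shows "real k \<le> 1 / (z - 1) * z ^ k"
proof -
  have "1 + real k * (z - 1) \<le> z ^ k"
    using Bernoulli_inequality[of "z - 1" k] assms by simp
  then have "real k * (z - 1) \<le> z ^ k" by simp
  then show ?thesis using assms by (simp add: field_simps)
qed

lemma tame_tot: assumes "z > 1" shows "tame z n \<zeta> (\<lambda>\<eta>. real (tot n \<eta>))"
  unfolding tame_def by (intro exI[of _ "1 / (z - 1)"]) (use real_le_power[OF assms] in auto)

lemma tame_tot_sq: assumes "z > 1" shows "tame z n \<zeta> (\<lambda>\<eta>. (real (tot n \<eta>))\<^sup>2)"
proof -
  \<comment> \<open>Two particle numbers share one power of \<open>z\<close>, so each is bounded
    with a square root of it.\<close>
  define y where "y = sqrt z"
  have y: "y > 1" "y ^ 2 = z" using assms by (auto simp: y_def)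
  have "\<bar>(real k)\<^sup>2\<bar> \<le> (1 / (y - 1))\<^sup>2 * z ^ k" for k
  proof -
    have "(real k)\<^sup>2 \<le> (1 / (y - 1) * y ^ k)\<^sup>2"
      by (rule power_mono[OF real_le_power[OF y(1)]]) simp
    also have "(1 / (y - 1) * y ^ k)\<^sup>2 = (1 / (y - 1))\<^sup>2 * (y ^ 2) ^ k"
      unfolding power_mult_distrib by (simp add: power_mult[symmetric] mult.commute[of 2])
    finally show ?thesis by (simp add: y)
  qed
  then show ?thesis unfolding tame_def by blast
qed

lemma tame_caseD:
  assumes "tame z (Suc n) \<zeta> f" "\<And>j. \<eta> (n + j) = \<zeta> j"
  shows "tame1 z (\<lambda>k. f (case_nat k \<eta>))"
proof -
  obtain C where C: "\<And>\<eta>. (\<forall>j. \<eta> (Suc n + j) = \<zeta> j) \<Longrightarrow> \<bar>f \<eta>\<bar> \<le> C * z ^ tot (Suc n) \<eta>"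
    using assms by (auto simp: tame_def)
  have "\<bar>f (case_nat k \<eta>)\<bar> \<le> (C * z ^ tot n \<eta>) * z ^ k" for k
    using C[of "case_nat k \<eta>"] assms(2) by (simp add: tot_case_nat power_add mult_ac)
  then show ?thesis by (auto simp: tame1_def)
qed

lemma tame_wavg:
  assumes "okw z w" "tame z (Suc n) \<zeta> f"
  shows "tame z n \<zeta> (\<lambda>\<eta>. wavg w (\<lambda>k. f (case_nat k \<eta>)))"
proof -
  obtain C where C: "\<And>\<eta>. (\<forall>j. \<eta> (Suc n + j) = \<zeta> j) \<Longrightarrow> \<bar>f \<eta>\<bar> \<le> C * z ^ tot (Suc n) \<eta>"
    using assms by (auto simp: tame_def)
  have sz: "summable (\<lambda>k. w k * z ^ k)" using assms by (auto simp: okw_def)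
  have "\<bar>wavg w (\<lambda>k. f (case_nat k \<eta>))\<bar> \<le> (C * (\<Sum>k. w k * z ^ k)) * z ^ tot n \<eta>"
    if \<eta>: "\<forall>j. \<eta> (n + j) = \<zeta> j" for \<eta>
  proof -
    have t1: "tame1 z (\<lambda>k. f (case_nat k \<eta>))" using tame_caseD[OF assms(2)] \<eta> by auto
    have "\<bar>wavg w (\<lambda>k. f (case_nat k \<eta>))\<bar> \<le> (\<Sum>k. \<bar>w k * f (case_nat k \<eta>)\<bar>)"
      unfolding wavg_def by (rule summable_rabs[OF summable_wavg_abs[OF assms(1) t1]])
    also have "\<dots> \<le> (\<Sum>k. (C * z ^ tot n \<eta>) * (w k * z ^ k))"
    proof (intro suminf_le summable_wavg_abs[OF assms(1) t1] summable_mult sz)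
      fix k
      have "\<bar>f (case_nat k \<eta>)\<bar> \<le> (C * z ^ tot n \<eta>) * z ^ k"
        using C[of "case_nat k \<eta>"] \<eta> by (simp add: tot_case_nat power_add mult_ac)
      from mult_left_mono[OF this, of "w k"] show "\<bar>w k * f (case_nat k \<eta>)\<bar> \<le> (C * z ^ tot n \<eta>) * (w k * z ^ k)"
        using assms(1) by (auto simp: okw_def abs_mult mult_ac)
    qed
    also have "\<dots> = (C * (\<Sum>k. w k * z ^ k)) * z ^ tot n \<eta>"
      using suminf_mult[OF sz, of "C * z ^ tot n \<eta>"] by (simp add: mult_ac)
    finally show ?thesis .
  qed
  then show ?thesis by (auto simp: tame_def)
qed

lemma pavg_append: "pavg (us @ vs) f \<zeta> = pavg vs (pavg us f) \<zeta>"
proof (induction us arbitrary: f)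
  case (Cons w us)
  then show ?case by simp
qed simp

lemma tame_pavg:
  assumes "\<forall>w\<in>set us. okw z w" "tame z (length us + n) \<zeta> f"
  shows "tame z n \<zeta> (pavg us f)"
  using assms
proof (induction us arbitrary: f)
  case (Cons w us)
  then show ?case using tame_wavg[of z w "length us + n" \<zeta> f] by simp
qed simp

lemma pavg_mono:
  assumes "\<forall>w\<in>set ws. okw z w" "tame z (length ws) \<zeta> f" "tame z (length ws) \<zeta> g"
    and "\<And>\<eta>. (\<And>j. \<eta> (length ws + j) = \<zeta> j) \<Longrightarrow> f \<eta> \<le> g \<eta>"
  shows "pavg ws f \<zeta> \<le> pavg ws g \<zeta>"
  using assms
proof (induction ws arbitrary: f g)
  case Nil
  then show ?case by simp
next
  case (Cons w ws)
  show ?case unfolding pavg.simps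
  proof (rule Cons.IH)
    fix \<eta> assume \<eta>: "\<And>j. \<eta> (length ws + j) = \<zeta> j"
    then show "wavg w (\<lambda>k. f (case_nat k \<eta>)) \<le> wavg w (\<lambda>k. g (case_nat k \<eta>))"
      using Cons.prems by (intro wavg_mono[of z] tame_caseD[where n="length ws"]) auto
  qed (use Cons.prems in \<open>auto intro: tame_wavg\<close>)
qed

lemma pavg_cong:
  assumes "\<And>\<eta>. (\<And>j. \<eta> (length ws + j) = \<zeta> j) \<Longrightarrow> f \<eta> = g \<eta>"
  shows "pavg ws f \<zeta> = pavg ws g \<zeta>"
  using assms
proof (induction ws arbitrary: f g)
  case Nil
  then show ?case by simp
next
  case (Cons w ws)
  show ?case unfolding pavg.simps
  proof (rule Cons.IH)
    fix \<eta> assume \<eta>: "\<And>j. \<eta> (length ws + j) = \<zeta> j"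
    then show "wavg w (\<lambda>k. f (case_nat k \<eta>)) = wavg w (\<lambda>k. g (case_nat k \<eta>))"
      using Cons.prems by (intro arg_cong[of _ _ "wavg w"] ext) auto
  qed
qed

lemma pavg_add:
  assumes "\<forall>w\<in>set ws. okw z w" "tame z (length ws) \<zeta> f" "tame z (length ws) \<zeta> g"
  shows "pavg ws (\<lambda>\<eta>. f \<eta> + g \<eta>) \<zeta> = pavg ws f \<zeta> + pavg ws g \<zeta>"
  using assms
proof (induction ws arbitrary: f g)
  case (Cons w ws)
  have "pavg ws (\<lambda>\<eta>. wavg w (\<lambda>k. f (case_nat k \<eta>) + g (case_nat k \<eta>))) \<zeta> =
    pavg ws (\<lambda>\<eta>. wavg w (\<lambda>k. f (case_nat k \<eta>)) + wavg w (\<lambda>k. g (case_nat k \<eta>))) \<zeta>"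
    by (rule pavg_cong, rule wavg_add[of z]) (use Cons.prems in \<open>auto intro: tame_caseD\<close>)
  also have "\<dots> = pavg ws (\<lambda>\<eta>. wavg w (\<lambda>k. f (case_nat k \<eta>))) \<zeta> + pavg ws (\<lambda>\<eta>. wavg w (\<lambda>k. g (case_nat k \<eta>))) \<zeta>"
    by (rule Cons.IH) (use Cons.prems in \<open>auto intro: tame_wavg\<close>)
  finally show ?case by simp
qed simp

lemma pavg_cmult:
  assumes "\<forall>w\<in>set ws. okw z w" "tame z (length ws) \<zeta> f"
  shows "pavg ws (\<lambda>\<eta>. a * f \<eta>) \<zeta> = a * pavg ws f \<zeta>"
  using assms
proof (induction ws arbitrary: f)
  case (Cons w ws)
  have "pavg ws (\<lambda>\<eta>. wavg w (\<lambda>k. a * f (case_nat k \<eta>))) \<zeta> =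
    pavg ws (\<lambda>\<eta>. a * wavg w (\<lambda>k. f (case_nat k \<eta>))) \<zeta>"
    by (rule pavg_cong, rule wavg_cmult[of z]) (use Cons.prems in \<open>auto intro: tame_caseD\<close>)
  also have "\<dots> = a * pavg ws (\<lambda>\<eta>. wavg w (\<lambda>k. f (case_nat k \<eta>))) \<zeta>"
    by (rule Cons.IH) (use Cons.prems in \<open>auto intro: tame_wavg\<close>)
  finally show ?case by simp
qed simp

lemma pavg_diff:
  assumes "\<forall>w\<in>set ws. okw z w" "tame z (length ws) \<zeta> f" "tame z (length ws) \<zeta> g"
  shows "pavg ws (\<lambda>\<eta>. f \<eta> - g \<eta>) \<zeta> = pavg ws f \<zeta> - pavg ws g \<zeta>"
  using pavg_add[OF assms(1,2) tame_cmult[OF assms(3), of "-1"]] pavg_cmult[OF assms(1,3), of "-1"]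
  by simp

lemma pavg_const:
  assumes "\<forall>w\<in>set ws. w sums 1"
  shows "pavg ws (\<lambda>_. a) \<zeta> = a"
proof -
  have "wavg w (\<lambda>_. a) = a" if "w sums 1" for w
    using sums_mult2[OF that, of a] by (simp add: wavg_def sums_iff)
  then show ?thesis using assms by (induction ws) auto
qed

definition incr_at :: "nat \<Rightarrow> conf \<Rightarrow> conf" where
  "incr_at i \<eta> = \<eta>(i := Suc (\<eta> i))"

lemma incr_at_case_nat: "incr_at (Suc i) (case_nat k \<eta>) = case_nat k (incr_at i \<eta>)"
  "incr_at 0 (case_nat k \<eta>) = case_nat (Suc k) \<eta>"
  by (auto simp: incr_at_def fun_eq_iff split: nat.split)

lemma pavg_incr_at: "pavg ws (\<lambda>\<eta>. f (incr_at (length ws + i) \<eta>)) \<zeta> = pavg ws f (incr_at i \<zeta>)"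
  by (induction ws arbitrary: f) (simp_all add: incr_at_case_nat)

text \<open>These are the densities of \<open>mu \<rho>\<close> and \<open>mu_hat \<rho>\<close> for \<open>b = \<rho> / (1 + \<rho>)\<close>.\<close>

definition gw :: "real \<Rightarrow> nat \<Rightarrow> real" where
  "gw b k = (1 - b) * b ^ k"

definition hw :: "real \<Rightarrow> nat \<Rightarrow> real" where
  "hw b k = (real k + 1) * (1 - b)\<^sup>2 * b ^ k"

lemma summable_linear_geometric:
  assumes "\<bar>x\<bar> < (1::real)" shows "summable (\<lambda>k. (real k + 1) * x ^ k)"
  using geometric_deriv_sums[of x] assms
  by (auto simp: sums_iff add.commute)

lemma okw_gw:
  assumes "0 \<le> b" "b < 1" "0 \<le> z" "b * z < 1" shows "okw z (gw b)"
proof -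
  have "summable (\<lambda>k. (1 - b) * (b * z) ^ k)"
    using assms by (intro summable_mult summable_geometric) (auto simp: abs_mult)
  then show ?thesis using assms by (auto simp: okw_def gw_def power_mult_distrib mult_ac)
qed

lemma okw_hw:
  assumes "0 \<le> b" "b < 1" "0 \<le> z" "b * z < 1" shows "okw z (hw b)"
proof -
  have "summable (\<lambda>k. (1 - b)\<^sup>2 * ((real k + 1) * (b * z) ^ k))"
    using assms by (intro summable_mult summable_linear_geometric) (auto simp: abs_mult)
  then show ?thesis using assms by (auto simp: okw_def hw_def power_mult_distrib mult_ac)
qed

lemma gw_sums: assumes "0 \<le> b" "b < 1" shows "gw b sums 1"
  using sums_mult[OF geometric_sums[of b], of "1 - b"] assms by (simp add: gw_def[abs_def])

lemma hw_sums: assumes "0 \<le> b" "b < 1" shows "hw b sums 1"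
proof -
  have "(\<lambda>k. (1 - b)\<^sup>2 * (of_nat (Suc k) * b ^ k)) sums ((1-b)\<^sup>2 * (1 / (1 - b)\<^sup>2))"
    using geometric_deriv_sums[of b] assms by (intro sums_mult) auto
  then show ?thesis using assms by (simp add: hw_def[abs_def] mult_ac add.commute)
qed

section \<open>Burke's theorem\<close>

lemma act_case_nat:
  "act (Suc (Suc j)) (case_nat k \<eta>) = case_nat k (act (Suc j) \<eta>)"
  "act 0 (case_nat k \<eta>) = case_nat (Suc k) \<eta>"
  "act (Suc 0) (case_nat (Suc k) \<eta>) = case_nat k (act 0 \<eta>)"
  "act (Suc 0) (case_nat 0 \<eta>) = case_nat 0 \<eta>"
  by (auto simp: fun_eq_iff split: nat.split)

text \<open>Since \<open>gw a (Suc k) = a * gw a k\<close>, averaging over the leftmost site makes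
  the arrivals and the rings of the first bond cancel except for
  \<open>a * (g (act 0 \<eta>) - g \<eta>)\<close>. Seen from the second site, the departures from
  the first are again arrivals of density \<open>a\<close>, so the averaged observable evolves under
  the chain with one site fewer.\<close>

lemma burke_mstep:
  assumes "\<And>\<eta>. summable (\<lambda>k. gw a k * f (case_nat k \<eta>))"
  defines "g \<equiv> \<lambda>\<eta>. wavg (gw a) (\<lambda>k. f (case_nat k \<eta>))"
  shows "(\<lambda>k. gw a k * mstep (rate p a) act (Suc n) f (case_nat k \<eta>)) sums mstep (rate p a) act n g \<eta>"
proof -
  have s: "(\<lambda>k. gw a k * f (case_nat k \<eta>)) sums g \<eta>" for \<eta>
    using assms(1) by (auto simp: g_def wavg_def intro: summable_sums)
  have sS: "(\<lambda>k. gw a (Suc k) * f (case_nat (Suc k) \<eta>)) sums (g \<eta> - gw a 0 * f (case_nat 0 \<eta>))" for \<eta>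
    using s[of \<eta>] by (subst sums_Suc_iff) auto
  have 1: "(\<lambda>k. gw a k * (a * (f (act 0 (case_nat k \<eta>)) - f (case_nat k \<eta>))))
    sums ((g \<eta> - gw a 0 * f (case_nat 0 \<eta>)) - a * g \<eta>)"
    using sums_diff[OF sS sums_mult[OF s[of \<eta>], of a]] unfolding act_case_nat
    by (simp add: gw_def algebra_simps)
  have "(\<lambda>k. gw a (Suc k) * (f (act 1 (case_nat (Suc k) \<eta>)) - f (case_nat (Suc k) \<eta>)))
     sums (a * g (act 0 \<eta>) - (g \<eta> - gw a 0 * f (case_nat 0 \<eta>)))"
    using sums_diff[OF sums_mult[OF s[of "act 0 \<eta>"], of a] sS[of \<eta>]] unfolding act_case_nat One_nat_def
    by (simp add: gw_def algebra_simps)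
  then have 2: "(\<lambda>k. gw a k * (f (act 1 (case_nat k \<eta>)) - f (case_nat k \<eta>)))
     sums (a * g (act 0 \<eta>) - (g \<eta> - gw a 0 * f (case_nat 0 \<eta>)))"
    by (subst (asm) sums_Suc_iff) (simp add: act_case_nat del: act.simps)
  have 3: "(\<lambda>k. \<Sum>j<n. p * (gw a k * f (act (Suc (Suc j)) (case_nat k \<eta>)) - gw a k * f (case_nat k \<eta>)))
     sums (\<Sum>j<n. p * (g (act (Suc j) \<eta>) - g \<eta>))"
    unfolding act_case_nat by (intro sums_sum sums_mult sums_diff s)
  have "(\<lambda>k. gw a k * f (case_nat k \<eta>)
    + (p * (gw a k * (a * (f (act 0 (case_nat k \<eta>)) - f (case_nat k \<eta>))))
    + (p * (gw a k * (f (act 1 (case_nat k \<eta>)) - f (case_nat k \<eta>)))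
    + (\<Sum>j<n. p * (gw a k * f (act (Suc (Suc j)) (case_nat k \<eta>)) - gw a k * f (case_nat k \<eta>))))))
    sums (g \<eta> + (p * ((g \<eta> - gw a 0 * f (case_nat 0 \<eta>)) - a * g \<eta>)
     + (p * (a * g (act 0 \<eta>) - (g \<eta> - gw a 0 * f (case_nat 0 \<eta>))) + (\<Sum>j<n. p * (g (act (Suc j) \<eta>) - g \<eta>)))))"
    by (intro sums_add sums_mult s 1 2 3)
  moreover have "mstep (rate p a) act n g \<eta> = g \<eta> + (p * ((g \<eta> - gw a 0 * f (case_nat 0 \<eta>)) - a * g \<eta>)
     + (p * (a * g (act 0 \<eta>) - (g \<eta> - gw a 0 * f (case_nat 0 \<eta>))) + (\<Sum>j<n. p * (g (act (Suc j) \<eta>) - g \<eta>))))"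
    by (simp add: mstep_def sum.atMost_shift rate_def algebra_simps del: act.simps)
  moreover have "gw a k * mstep (rate p a) act (Suc n) f (case_nat k \<eta>) = gw a k * f (case_nat k \<eta>)
    + (p * (gw a k * (a * (f (act 0 (case_nat k \<eta>)) - f (case_nat k \<eta>))))
    + (p * (gw a k * (f (act 1 (case_nat k \<eta>)) - f (case_nat k \<eta>)))
    + (\<Sum>j<n. p * (gw a k * f (act (Suc (Suc j)) (case_nat k \<eta>)) - gw a k * f (case_nat k \<eta>)))))" for k
    by (simp add: mstep_def sum.atMost_shift sum.lessThan_Suc_shift rate_def
        algebra_simps sum_distrib_left sum_subtractf sum.distrib del: act.simps sum.lessThan_Suc)
  ultimately show ?thesis by simp
qed

lemma burke_ev:
  assumes "\<And>\<eta>. summable (\<lambda>k. gw a k * f (case_nat k \<eta>))"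
  shows "(\<lambda>k. gw a k * ev p a (Suc n) K f (case_nat k \<eta>)) sums
    ev p a n K (\<lambda>\<eta>. wavg (gw a) (\<lambda>k. f (case_nat k \<eta>))) \<eta>"
proof (induction K arbitrary: \<eta>)
  case 0
  then show ?case using assms by (auto simp: ev_def wavg_def intro: summable_sums)
next
  case (Suc K)
  have sm: "summable (\<lambda>k. gw a k * ev p a (Suc n) K f (case_nat k \<eta>))" for \<eta>
    using Suc by (auto simp: sums_iff)
  have eq: "(\<lambda>\<eta>. wavg (gw a) (\<lambda>k. ev p a (Suc n) K f (case_nat k \<eta>))) =
     ev p a n K (\<lambda>\<eta>. wavg (gw a) (\<lambda>k. f (case_nat k \<eta>)))"
    using Suc by (auto simp: sums_iff wavg_def fun_eq_iff)
  show ?case using burke_mstep[OF sm, of p n \<eta>] unfolding eq by (simp add: ev_def miter_Suc)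
qed

text \<open>Burke's theorem in dual form: \<open>i\<close> geometric sites on the left are averaged
  out of the initial configuration and deleted from the dynamics at the same time.\<close>

lemma burke:
  assumes "\<And>\<zeta>. tame z (i + n) \<zeta> f" "okw z (gw a)"
  shows "pavg (replicate i (gw a)) (ev p a (i + n) K f) \<zeta> = ev p a n K (pavg (replicate i (gw a)) f) \<zeta>"
  using assms(1)
proof (induction i arbitrary: f)
  case (Suc i)
  have sm: "summable (\<lambda>k. gw a k * f (case_nat k \<eta>))" for \<eta>
  proof -
    have "tame1 z (\<lambda>k. f (case_nat k \<eta>))"
      by (rule tame_caseD[of z "i+n" "\<lambda>j. \<eta> (i + n + j)"]) (use Suc.prems in auto)
    from summable_wavg[OF assms(2) this] show ?thesis .
  qed
  have "(\<lambda>\<eta>. wavg (gw a) (\<lambda>k. ev p a (Suc (i + n)) K f (case_nat k \<eta>))) =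
     ev p a (i + n) K (\<lambda>\<eta>. wavg (gw a) (\<lambda>k. f (case_nat k \<eta>)))"
    using burke_ev[OF sm] by (auto simp: sums_iff wavg_def fun_eq_iff)
  moreover have "tame z (i + n) \<zeta> (\<lambda>\<eta>. wavg (gw a) (\<lambda>k. f (case_nat k \<eta>)))" for \<zeta>
    by (rule tame_wavg[OF assms(2)]) (use Suc.prems in auto)
  ultimately show ?case using Suc.IH by simp
qed simp

section \<open>Monotone couplings\<close>

text \<open>Summation by parts. The boundary term is a partial sum of \<open>d\<close> times
  \<open>f\<close>. As \<open>d\<close> has total sum zero, the partial sum is minus a tail, and the
  weight \<open>z\<close> in the summability hypothesis beats the growth of
  \<open>f\<close>.\<close>

lemma abel_sums:
  assumes "z \<ge> 1" "summable (\<lambda>k. \<bar>d k\<bar> * z ^ k)" "d sums 0" "tame1 z f"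
  shows "(\<lambda>m. - (\<Sum>k\<le>m. d k) * (f (Suc m) - f m)) sums (\<Sum>k. d k * f k)"
proof -
  obtain C where C: "\<And>k. \<bar>f k\<bar> \<le> C * z ^ k" using assms by (auto simp: tame1_def)
  have C0: "C \<ge> 0" using C[of 0] by simp
  have zpos: "z ^ k > 0" for k using assms(1) by simp
  have sdf: "summable (\<lambda>k. d k * f k)"
  proof (rule summable_comparison_test[OF _ summable_mult[OF assms(2), of C]], intro exI allI impI)
    fix k show "norm (d k * f k) \<le> C * (\<bar>d k\<bar> * z ^ k)"
      using mult_left_mono[OF C[of k], of "\<bar>d k\<bar>"] by (simp add: abs_mult mult_ac)
  qed
  have sd: "summable (\<lambda>k. \<bar>d k\<bar>)"
  proof (rule summable_comparison_test[OF _ assms(2)], intro exI allI impI)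
    fix k show "norm \<bar>d k\<bar> \<le> \<bar>d k\<bar> * z ^ k"
      using mult_left_mono[of 1 "z ^ k" "\<bar>d k\<bar>"] one_le_power[OF assms(1)] by simp
  qed
  define D where "D m = (\<Sum>k\<le>m. d k)" for m
  \<comment> \<open>The tail of the weighted series. It dominates \<open>z ^ N\<close> times the
    tail of \<open>d\<close>, and hence the boundary term up to the constant
    \<open>C\<close>.\<close>
  define R where "R N = (\<Sum>k. \<bar>d (k + Suc N)\<bar> * z ^ (k + Suc N))" for N
  have Rlim: "R \<longlonglongrightarrow> 0"
  proof -
    have "R N = (\<Sum>k. \<bar>d k\<bar> * z ^ k) - (\<Sum>k<Suc N. \<bar>d k\<bar> * z ^ k)" for N
      using suminf_split_initial_segment[OF assms(2), of "Suc N"] by (simp add: R_def)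
    moreover have "(\<lambda>N. (\<Sum>k. \<bar>d k\<bar> * z ^ k) - (\<Sum>k<Suc N. \<bar>d k\<bar> * z ^ k))
       \<longlonglongrightarrow> (\<Sum>k. \<bar>d k\<bar> * z ^ k) - (\<Sum>k. \<bar>d k\<bar> * z ^ k)"
      by (intro tendsto_diff tendsto_const LIMSEQ_Suc summable_LIMSEQ assms(2))
    moreover have "R = (\<lambda>N. (\<Sum>k. \<bar>d k\<bar> * z ^ k) - (\<Sum>k<Suc N. \<bar>d k\<bar> * z ^ k))"
      using calculation(1) by (rule ext)
    ultimately show ?thesis by (simp only: diff_self)
  qed
  have Dbd: "\<bar>D N * f N\<bar> \<le> C * R N" for N
  proof -
    have "D N = - (\<Sum>k. d (k + Suc N))"
      using suminf_split_initial_segment[of d "Suc N"] assms(3)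
      by (simp add: sums_iff D_def lessThan_Suc_atMost del: sum.lessThan_Suc)
    also have "\<bar>\<dots>\<bar> \<le> (\<Sum>k. \<bar>d (k + Suc N)\<bar>)"
      using summable_rabs[of "\<lambda>k. d (k + Suc N)"] summable_ignore_initial_segment[OF sd, of "Suc N"] by simp
    finally have 1: "\<bar>D N\<bar> \<le> (\<Sum>k. \<bar>d (k + Suc N)\<bar>)" .
    have "z ^ N * \<bar>D N\<bar> \<le> z ^ N * (\<Sum>k. \<bar>d (k + Suc N)\<bar>)"
      using 1 zpos[of N] by (intro mult_left_mono) auto
    also have "\<dots> = (\<Sum>k. z ^ N * \<bar>d (k + Suc N)\<bar>)"
      by (rule suminf_mult[symmetric]) (rule summable_ignore_initial_segment[OF sd])
    also have "\<dots> \<le> R N" unfolding R_def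
    proof (rule suminf_le)
      fix k show "z ^ N * \<bar>d (k + Suc N)\<bar> \<le> \<bar>d (k + Suc N)\<bar> * z ^ (k + Suc N)"
        using power_increasing[of N "k + Suc N" z] assms(1)
        by (metis abs_ge_zero le_add2 le_SucI mult.commute mult_right_mono add_Suc_right)
    qed (intro summable_mult summable_ignore_initial_segment sd assms(2))+
    finally have 2: "z ^ N * \<bar>D N\<bar> \<le> R N" .
    have "\<bar>D N * f N\<bar> \<le> \<bar>D N\<bar> * (C * z ^ N)" unfolding abs_mult
      by (intro mult_left_mono C) auto
    also have "\<dots> = C * (z ^ N * \<bar>D N\<bar>)" by simp
    also have "\<dots> \<le> C * R N" using 2 C0 by (rule mult_left_mono)
    finally show ?thesis .
  qed
  have lim0: "(\<lambda>N. D N * f N) \<longlonglongrightarrow> 0"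
  proof (rule Lim_null_comparison)
    show "\<forall>\<^sub>F N in sequentially. norm (D N * f N) \<le> C * R N" using Dbd by simp
    show "(\<lambda>N. C * R N) \<longlonglongrightarrow> 0" using tendsto_mult_right_zero[OF Rlim] by simp
  qed
  have id: "(\<Sum>m<N. - D m * (f (Suc m) - f m)) = (\<Sum>k<Suc N. d k * f k) - D N * f N" for N
    by (induction N) (simp_all add: D_def algebra_simps)
  have "(\<lambda>N. (\<Sum>k<Suc N. d k * f k) - D N * f N) \<longlonglongrightarrow> (\<Sum>k. d k * f k) - 0"
    by (intro tendsto_diff lim0 LIMSEQ_Suc summable_LIMSEQ sdf)
  then show ?thesis unfolding sums_def id[symmetric] by (simp add: D_def)
qed

lemma wavg_diff_sums:
  assumes "z \<ge> 1" "okw z w" "okw z w'" "w sums 1" "w' sums 1" "tame1 z f"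
  shows "(\<lambda>m. ((\<Sum>k\<le>m. w k) - (\<Sum>k\<le>m. w' k)) * (f (Suc m) - f m)) sums (wavg w' f - wavg w f)"
proof -
  have s: "summable (\<lambda>k. \<bar>w' k - w k\<bar> * z ^ k)"
  proof (rule summable_comparison_test[OF _ summable_add[of "\<lambda>k. w' k * z ^ k" "\<lambda>k. w k * z ^ k"]], intro exI allI impI)
    fix k
    have "\<bar>w' k - w k\<bar> \<le> w' k + w k" using assms(2,3) by (auto simp: okw_def abs_le_iff add_increasing)
    then have "\<bar>w' k - w k\<bar> * z ^ k \<le> (w' k + w k) * z ^ k" using assms(1) by (intro mult_right_mono) auto
    then show "norm (\<bar>w' k - w k\<bar> * z ^ k) \<le> w' k * z ^ k + w k * z ^ k"
      using assms(1) by (simp add: algebra_simps abs_mult)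
  qed (use assms in \<open>auto simp: okw_def\<close>)
  have "(\<lambda>k. w' k - w k) sums 0" using sums_diff[OF assms(5,4)] by simp
  from abel_sums[OF assms(1) s this assms(6)]
  have "(\<lambda>m. - (\<Sum>k\<le>m. w' k - w k) * (f (Suc m) - f m)) sums (\<Sum>k. (w' k - w k) * f k)" .
  moreover have "(\<Sum>k. (w' k - w k) * f k) = wavg w' f - wavg w f"
    using suminf_diff[OF summable_wavg[OF assms(3,6)] summable_wavg[OF assms(2,6)]]
    by (simp add: wavg_def algebra_simps)
  ultimately show ?thesis by (simp add: sum_subtractf)
qed

text \<open>Stochastic domination in terms of distribution functions: the dominating weight has the
  smaller cumulative sums.\<close>

definition wdom :: "(nat \<Rightarrow> real) \<Rightarrow> (nat \<Rightarrow> real) \<Rightarrow> bool" where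
  "wdom w w' \<longleftrightarrow> w sums 1 \<and> w' sums 1 \<and> (\<forall>m. (\<Sum>k\<le>m. w' k) \<le> (\<Sum>k\<le>m. w k))"

lemma wavg_wdom_mono:
  assumes "z \<ge> 1" "okw z w" "okw z w'" "wdom w w'" "tame1 z f" "\<And>k. f k \<le> f (Suc k)"
  shows "wavg w f \<le> wavg w' f"
proof -
  have "(\<lambda>m. ((\<Sum>k\<le>m. w k) - (\<Sum>k\<le>m. w' k)) * (f (Suc m) - f m)) sums (wavg w' f - wavg w f)"
    using assms by (intro wavg_diff_sums) (auto simp: wdom_def)
  then have "0 \<le> wavg w' f - wavg w f"
    by (rule sums_le[OF _ sums_zero, rotated 1]) (use assms in \<open>auto simp: wdom_def\<close>)
  then show ?thesis by simp
qed

text \<open>A monotone coupling of the two weights is replaced by the running maximum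
  \<open>U'\<close> of \<open>U\<close>. The hypothesis places \<open>U'\<close> between
  \<open>U\<close> and \<open>W\<close>, and \<open>U'\<close> is nondecreasing, so the comparison
  of monotone observables suffices.\<close>

lemma wavg_strassen:
  assumes "z \<ge> 1" "okw z w" "okw z w'" "wdom w w'" "tame1 z U" "tame1 z W"
    and le: "\<And>x y. x \<le> y \<Longrightarrow> U x \<le> W y"
  shows "wavg w U \<le> wavg w' W"
proof -
  define U' where "U' y = Max (U ` {..y})" for y
  have U_U': "U y \<le> U' y" for y unfolding U'_def by (rule Max_ge) auto
  have U'_W: "U' y \<le> W y" for y unfolding U'_def using le by (subst Max_le_iff) auto
  have mono: "U' k \<le> U' (Suc k)" for k unfolding U'_def by (rule Max_mono) auto
  obtain C where C: "\<And>k. \<bar>U k\<bar> \<le> C * z ^ k" using assms by (auto simp: tame1_def)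
  obtain C' where C': "\<And>k. \<bar>W k\<bar> \<le> C' * z ^ k" using assms by (auto simp: tame1_def)
  have "\<bar>U' k\<bar> \<le> (\<bar>C\<bar> + \<bar>C'\<bar>) * z ^ k" for k
  proof -
    have 1: "\<bar>U' k\<bar> \<le> \<bar>U k\<bar> + \<bar>W k\<bar>" using U_U'[of k] U'_W[of k] by auto
    have "z ^ k > 0" using assms(1) by simp
    then have "C * z ^ k \<le> \<bar>C\<bar> * z ^ k" "C' * z ^ k \<le> \<bar>C'\<bar> * z ^ k" by (auto intro!: mult_right_mono)
    then show ?thesis using 1 C[of k] C'[of k] by (simp add: algebra_simps)
  qed
  then have t: "tame1 z U'" by (auto simp: tame1_def)
  have "wavg w U \<le> wavg w U'" by (rule wavg_mono[OF assms(2) assms(5) t U_U'])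
  also have "\<dots> \<le> wavg w' U'" by (rule wavg_wdom_mono[OF assms(1-4) t mono])
  also have "\<dots> \<le> wavg w' W" by (rule wavg_mono[OF assms(3) t assms(6) U'_W])
  finally show ?thesis .
qed

text \<open>The hypothesis compares two different observables on ordered pairs, as a coupling would.
  In this form it survives averaging out the leftmost site, so the induction over the sites
  closes.\<close>

lemma pavg_strassen:
  assumes "z \<ge> 1" "list_all2 wdom ws ws'" "\<forall>w\<in>set ws. okw z w" "\<forall>w\<in>set ws'. okw z w"
    and "tame z (length ws) \<zeta> U" "tame z (length ws) \<zeta> W"
    and "\<And>x y. (\<And>j. x (length ws + j) = \<zeta> j) \<Longrightarrow> (\<And>j. y (length ws + j) = \<zeta> j) \<Longrightarrow> x \<le> y \<Longrightarrow> U x \<le> W y"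
  shows "pavg ws U \<zeta> \<le> pavg ws' W \<zeta>"
  using assms(2-7)
proof (induction arbitrary: U W rule: list_all2_induct)
  case Nil
  then show ?case by simp
next
  case (Cons w ws w' ws')
  show ?case unfolding pavg.simps
  proof (rule Cons.IH)
    fix x y assume x: "\<And>j. x (length ws + j) = \<zeta> j" and y: "\<And>j. y (length ws + j) = \<zeta> j" and "x \<le> y"
    show "wavg w (\<lambda>k. U (case_nat k x)) \<le> wavg w' (\<lambda>k. W (case_nat k y))"
    proof (rule wavg_strassen[OF assms(1)])
      fix i j :: nat assume "i \<le> j"
      then have "(case_nat i x :: conf) \<le> case_nat j y"
        using \<open>x \<le> y\<close> by (auto simp: le_fun_def split: nat.split)
      then show "U (case_nat i x) \<le> W (case_nat j y)" using x y by (intro Cons.prems(5)) auto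
    next
      show "tame1 z (\<lambda>k. U (case_nat k x))" "tame1 z (\<lambda>k. W (case_nat k y))"
        using Cons.prems(3,4) x y by (auto intro!: tame_caseD[where n="length ws"])
    qed (use Cons in auto)
  qed (use Cons list_all2_lengthD[OF Cons.hyps(2)] in \<open>auto intro!: tame_wavg\<close>)
qed

lemma gw_cum: "(\<Sum>k\<le>m. gw b k) = 1 - b ^ Suc m"
  by (induction m) (simp_all add: gw_def algebra_simps)

lemma hw_cum: "(\<Sum>k\<le>m. hw b k) = 1 - b ^ Suc m * (1 + (real m + 1) * (1 - b))"
  by (induction m) (simp_all add: hw_def algebra_simps power2_eq_square)

lemma wdom_gw: assumes "0 \<le> a" "a \<le> b" "b < 1" shows "wdom (gw a) (gw b)"
  using assms gw_sums[of a] gw_sums[of b] power_mono[OF assms(2,1), of "Suc _"] unfolding wdom_def gw_cum by simp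

lemma wdom_gw_hw: assumes "0 \<le> a" "a < 1" shows "wdom (gw a) (hw a)"
proof -
  have "a ^ Suc m * 1 \<le> a ^ Suc m * (1 + (real m + 1) * (1 - a))" for m
    using assms by (intro mult_left_mono) auto
  then show ?thesis using assms gw_sums hw_sums unfolding wdom_def gw_cum hw_cum by simp
qed

lemma wdom_refl: "w sums 1 \<Longrightarrow> wdom w w"
  by (simp add: wdom_def)

lemma power_diff_ge:
  assumes "0 \<le> a" "a \<le> (b::real)"
  shows "(real m + 1) * a ^ m * (b - a) \<le> b ^ Suc m - a ^ Suc m"
proof (induction m)
  case (Suc m)
  have "b ^ Suc (Suc m) - a ^ Suc (Suc m) = b ^ Suc m * (b - a) + a * (b ^ Suc m - a ^ Suc m)"
    by (simp add: algebra_simps)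
  moreover have "a ^ Suc m * (b - a) \<le> b ^ Suc m * (b - a)"
    using assms by (intro mult_right_mono power_mono) auto
  moreover have "a * ((real m + 1) * a ^ m * (b - a)) \<le> a * (b ^ Suc m - a ^ Suc m)"
    using Suc assms by (intro mult_left_mono) auto
  ultimately show ?case by (simp add: algebra_simps)
qed simp

text \<open>After summation by parts the increments of \<open>f\<close> carry the weights
  \<open>b ^ Suc m - a ^ Suc m\<close>. Convexity bounds them below by
  \<open>(real m + 1) * a ^ m * (b - a)\<close>, a multiple of \<open>hw a m\<close>. This is how
  \<open>hw\<close> enters: it is the derivative of the geometric family in its density.\<close>

lemma gw_diff_ge:
  assumes "z \<ge> 1" "0 \<le> a" "a \<le> b" "b < 1" "b * z < 1" "tame1 z f" "\<And>k. f k \<le> f (Suc k)"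
  shows "(b - a) / (1 - a)\<^sup>2 * wavg (hw a) (\<lambda>k. f (Suc k) - f k) \<le> wavg (gw b) f - wavg (gw a) f"
proof -
  have "a * z \<le> b * z" using assms by (intro mult_right_mono) auto
  then have az: "a * z < 1" using assms(5) by linarith
  have ok: "okw z (gw a)" "okw z (gw b)" "okw z (hw a)"
    using assms az by (auto intro!: okw_gw okw_hw)
  have s1: "(\<lambda>m. (b ^ Suc m - a ^ Suc m) * (f (Suc m) - f m)) sums (wavg (gw b) f - wavg (gw a) f)"
    using wavg_diff_sums[OF assms(1) ok(1,2) gw_sums gw_sums assms(6)] assms unfolding gw_cum
    by (simp add: algebra_simps)
  have "tame1 z (\<lambda>k. f (Suc k) - f k)"
  proof -
    obtain C where C: "\<And>k. \<bar>f k\<bar> \<le> C * z ^ k" using assms by (auto simp: tame1_def)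
    have "\<bar>f (Suc k) - f k\<bar> \<le> (C * z + C) * z ^ k" for k
      using C[of k] C[of "Suc k"] by (simp add: algebra_simps)
    then show ?thesis by (auto simp: tame1_def)
  qed
  then have s2: "(\<lambda>k. hw a k * (f (Suc k) - f k)) sums wavg (hw a) (\<lambda>k. f (Suc k) - f k)"
    unfolding wavg_def using ok(3) by (intro summable_sums summable_wavg)
  show ?thesis
  proof (rule sums_le[OF _ sums_mult[OF s2] s1])
    fix k
    have eq: "(b - a) / (1 - a)\<^sup>2 * hw a k = (real k + 1) * a ^ k * (b - a)"
      using assms by (simp add: hw_def)
    have "(b - a) / (1 - a)\<^sup>2 * hw a k * (f (Suc k) - f k) \<le> (b ^ Suc k - a ^ Suc k) * (f (Suc k) - f k)"
      unfolding eq using power_diff_ge[of a b k] assms by (intro mult_right_mono) auto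
    then show "(b - a) / (1 - a)\<^sup>2 * (hw a k * (f (Suc k) - f k)) \<le> (b ^ Suc k - a ^ Suc k) * (f (Suc k) - f k)"
      by (simp only: mult.assoc)
  qed
qed

text \<open>The centred weights \<open>d\<close> have partial sums
  \<open>- (a / (1 - a)\<^sup>2 * hw a m)\<close>. Summation by parts thus turns the covariance with
  the particle number into the mean response of \<open>f\<close> to one more particle under
  \<open>hw a\<close>.\<close>

lemma gw_cov:
  assumes "z > 1" "0 \<le> a" "a * z < 1" "tame1 z f"
  shows "wavg (gw a) (\<lambda>k. real k * f k) =
    a / (1 - a) * wavg (gw a) f + a / (1 - a)\<^sup>2 * wavg (hw a) (\<lambda>k. f (Suc k) - f k)"
proof -
  have "a * 1 \<le> a * z" using assms by (intro mult_left_mono) auto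
  then have a1: "a < 1" using assms(3) by linarith
  \<comment> \<open>The factor \<open>real k\<close> costs a slightly larger radius, which must
    still be admissible for the geometric weight.\<close>
  have "\<exists>z'>z. a * z' < 1"
  proof (cases "a = 0")
    case False
    then have "z < 1 / a" using assms by (simp add: field_simps)
    then obtain z' where "z < z'" "z' < 1 / a" using dense by blast
    then show ?thesis using assms False by (intro exI[of _ z']) (auto simp: field_simps)
  qed (auto intro: exI[of _ "z+1"])
  then obtain z' where z': "z' > z" "a * z' < 1" by blast
  define d where "d k = gw a k * (real k - a / (1 - a))" for k
  have dk: "d k = (1 - a) * real k * a ^ k - a ^ Suc k" for k
    using a1 by (simp add: d_def gw_def field_simps)
  have "- (\<Sum>k\<le>m. d k) = (real m + 1) * a ^ Suc m" for m
    by (induction m) (simp_all add: dk algebra_simps)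
  moreover have "a / (1 - a)\<^sup>2 * hw a m = (real m + 1) * a ^ Suc m" for m
    using a1 by (simp add: hw_def)
  ultimately have cum: "- (\<Sum>k\<le>m. d k) = a / (1 - a)\<^sup>2 * hw a m" for m by simp
  have ok: "okw z' (gw a)" "okw z (gw a)" "okw z (hw a)" using assms z' a1 by (auto intro!: okw_gw okw_hw)
  define q where "q = z' / z"
  have q: "q > 1" "q * z = z'" using z' assms by (auto simp: q_def)
  have lin: "\<bar>real k - a / (1 - a)\<bar> * z ^ k \<le> (1 / (q - 1) + a / (1 - a)) * z' ^ k" for k
  proof -
    have "real k * z ^ k \<le> (1 / (q - 1) * q ^ k) * z ^ k"
      using real_le_power[OF q(1), of k] assms by (intro mult_right_mono) auto
    also have "\<dots> = 1 / (q - 1) * z' ^ k" by (simp add: q(2)[symmetric] power_mult_distrib)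
    finally have 1: "real k * z ^ k \<le> 1 / (q - 1) * z' ^ k" .
    have 2: "a / (1 - a) * z ^ k \<le> a / (1 - a) * z' ^ k"
      using assms z' a1 by (intro mult_left_mono power_mono) auto
    have "\<bar>real k - a / (1 - a)\<bar> * z ^ k \<le> (real k + a / (1 - a)) * z ^ k"
      using assms a1 by (intro mult_right_mono) (auto simp: abs_le_iff)
    then show ?thesis using 1 2 by (simp only: ring_distribs)
  qed
  have sd: "summable (\<lambda>k. \<bar>d k\<bar> * z ^ k)"
  proof (rule summable_comparison_test[OF _ summable_mult], intro exI allI impI)
    show "summable (\<lambda>k. gw a k * z' ^ k)" using ok by (auto simp: okw_def)
    fix k
    have "gw a k * (\<bar>real k - a / (1 - a)\<bar> * z ^ k) \<le> gw a k * ((1 / (q - 1) + a / (1 - a)) * z' ^ k)"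
      using ok(1) by (intro mult_left_mono lin) (auto simp: okw_def)
    then show "norm (\<bar>d k\<bar> * z ^ k) \<le> (1 / (q - 1) + a / (1 - a)) * (gw a k * z' ^ k)"
      using ok(1) assms by (auto simp: d_def okw_def abs_mult mult_ac)
  qed
  have d0: "d sums 0"
  proof -
    have sd': "summable d"
    proof (rule summable_comparison_test[OF _ sd], intro exI allI impI)
      fix k show "norm (d k) \<le> \<bar>d k\<bar> * z ^ k"
        using mult_left_mono[OF one_le_power, of z "\<bar>d k\<bar>" k] assms by simp
    qed
    have "(\<lambda>m. (\<Sum>k\<le>m. d k)) \<longlonglongrightarrow> (\<Sum>k. d k)"
      using summable_LIMSEQ'[OF sd'] .
    moreover have "(\<lambda>m. (\<Sum>k\<le>m. d k)) \<longlonglongrightarrow> - (a / (1 - a)\<^sup>2 * 0)"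
    proof -
      have "(\<lambda>m. - (a / (1 - a)\<^sup>2 * hw a m)) \<longlonglongrightarrow> - (a / (1 - a)\<^sup>2 * 0)"
        by (intro tendsto_minus tendsto_mult tendsto_const summable_LIMSEQ_zero sums_summable[OF hw_sums])
          (use assms a1 in auto)
      then show ?thesis unfolding cum[symmetric] by simp
    qed
    ultimately have "(\<Sum>k. d k) = 0" using LIMSEQ_unique by fastforce
    then show ?thesis using sd' by (simp add: sums_iff)
  qed
  have ab: "(\<lambda>m. a / (1 - a)\<^sup>2 * hw a m * (f (Suc m) - f m)) sums (\<Sum>k. d k * f k)"
    using abel_sums[OF _ sd d0 assms(4)] assms(1) unfolding cum by simp
  have tD: "tame1 z (\<lambda>k. f (Suc k) - f k)"
  proof -
    obtain C where C: "\<And>k. \<bar>f k\<bar> \<le> C * z ^ k" using assms by (auto simp: tame1_def)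
    have "\<bar>f (Suc k) - f k\<bar> \<le> (C * z + C) * z ^ k" for k
      using C[of k] C[of "Suc k"] by (simp add: algebra_simps)
    then show ?thesis by (auto simp: tame1_def)
  qed
  have 1: "(\<Sum>k. d k * f k) = a / (1 - a)\<^sup>2 * wavg (hw a) (\<lambda>k. f (Suc k) - f k)"
    using ab suminf_mult[OF summable_wavg[OF ok(3) tD], of "a / (1 - a)\<^sup>2"]
    by (simp add: sums_iff wavg_def mult_ac)
  have tz': "tame1 z' f" "tame1 z' (\<lambda>k. real k * f k)"
  proof -
    obtain C where C: "\<And>k. \<bar>f k\<bar> \<le> C * z ^ k" using assms by (auto simp: tame1_def)
    have C0: "C \<ge> 0" using C[of 0] by simp
    have "z ^ k \<le> z' ^ k" for k using assms z' by (intro power_mono) auto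
    then have "C * z ^ k \<le> C * z' ^ k" for k using C0 by (intro mult_left_mono)
    then show "tame1 z' f" unfolding tame1_def using C order_trans by blast
    have "\<bar>real k * f k\<bar> \<le> (C * (1 / (q - 1))) * z' ^ k" for k
    proof -
      have "\<bar>real k * f k\<bar> \<le> real k * (C * z ^ k)" unfolding abs_mult
        using C[of k] by (intro mult_mono) auto
      also have "\<dots> \<le> C * (1 / (q - 1) * q ^ k * z ^ k)"
        using real_le_power[OF q(1), of k] assms(1) C0
        mult_left_mono[OF mult_right_mono[OF real_le_power[OF q(1), of k], of "z ^ k"], of C]
        by (simp add: mult_ac)
      finally show ?thesis by (simp add: q(2)[symmetric] power_mult_distrib mult_ac)
    qed
    then show "tame1 z' (\<lambda>k. real k * f k)" unfolding tame1_def by blast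
  qed
  have "(\<lambda>k. gw a k * (real k * f k)) sums wavg (gw a) (\<lambda>k. real k * f k)"
    unfolding wavg_def by (intro summable_sums summable_wavg[OF ok(1)] tz')
  moreover have "(\<lambda>k. a / (1 - a) * (gw a k * f k)) sums (a / (1 - a) * wavg (gw a) f)"
    unfolding wavg_def by (intro sums_mult summable_sums summable_wavg[OF ok(1)] tz')
  ultimately have "(\<lambda>k. gw a k * (real k * f k) - a / (1 - a) * (gw a k * f k)) sums
    (wavg (gw a) (\<lambda>k. real k * f k) - a / (1 - a) * wavg (gw a) f)"
    by (rule sums_diff)
  moreover have "(\<lambda>k. gw a k * (real k * f k) - a / (1 - a) * (gw a k * f k)) = (\<lambda>k. d k * f k)"
    by (auto simp: d_def algebra_simps)
  ultimately show ?thesis using 1 by (simp add: sums_iff)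
qed

section \<open>Attractiveness and ordered discrepancies\<close>

lemma act_mono: assumes "x \<le> y" shows "act l x \<le> act l y"
proof (cases l)
  case (Suc i)
  have xi: "x j \<le> y j" for j using assms by (simp add: le_fun_def)
  show ?thesis unfolding Suc le_fun_def
  proof
    fix j show "act (Suc i) x j \<le> act (Suc i) y j"
      using xi[of i] xi[of j] xi[of "Suc i"] by (auto simp: le_diff_conv)
  qed
qed (use assms in \<open>auto simp: le_fun_def\<close>)

lemma tot_act:
  "tot (Suc n) (act 0 x) = Suc (tot (Suc n) x)"
  "i < n \<Longrightarrow> tot (Suc n) (act (Suc i) x) = tot (Suc n) x"
proof -
  show "tot (Suc n) (act 0 x) = Suc (tot (Suc n) x)"
    unfolding tot_def by (simp add: sum.lessThan_Suc_shift del: sum.lessThan_Suc)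
  assume i: "i < n"
  show "tot (Suc n) (act (Suc i) x) = tot (Suc n) x"
  proof (cases "x i = 0")
    case False
    have s: "tot (Suc n) y = y i + y (Suc i) + (\<Sum>j\<in>{..<Suc n} - {i, Suc i}. y j)" for y
      unfolding tot_def using i
      by (subst sum.subset_diff[of "{i, Suc i}"]) auto
    have "(\<Sum>j\<in>{..<Suc n} - {i, Suc i}. act (Suc i) x j) = (\<Sum>j\<in>{..<Suc n} - {i, Suc i}. x j)"
      by (rule sum.cong) auto
    then show ?thesis using False unfolding s[of "act (Suc i) x"] s[of x] by simp
  qed simp
qed

lemma substoch_rate:
  assumes "0 \<le> p" "0 \<le> a" "a \<le> 1" "p * (real n + 1) \<le> 1" shows "substoch (rate p a) n"
proof -
  have "(\<Sum>l\<le>n. rate p a l) = p * a + real n * p"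
    by (simp add: sum.atMost_shift rate_def)
  moreover have "p * a \<le> p" using assms mult_left_mono[of a 1 p] by simp
  ultimately show ?thesis using assms by (auto simp: substoch_def rate_def algebra_simps)
qed

text \<open>Letter \<open>Suc n\<close> is an arrival seen only by the components with arrival density \<open>g\<close>.\<close>

definition crate :: "real \<Rightarrow> real \<Rightarrow> real \<Rightarrow> nat \<Rightarrow> nat \<Rightarrow> real" where
  "crate p a g n l = (if l = 0 then p * a else if l \<le> n then p else p * (g - a))"

definition lo :: "nat \<Rightarrow> nat \<Rightarrow> conf \<Rightarrow> conf" where "lo n l x = (if l \<le> n then act l x else x)"
definition hi :: "nat \<Rightarrow> nat \<Rightarrow> conf \<Rightarrow> conf" where "hi n l x = (if l \<le> n then act l x else act 0 x)"

lemma substoch_crate: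
  assumes "0 \<le> p" "0 \<le> a" "a \<le> g" "g \<le> 1" "p * (real n + 1) \<le> 1" shows "substoch (crate p a g n) (Suc n)"
proof -
  have "(\<Sum>l\<le>Suc n. crate p a g n l) = (\<Sum>l\<le>n. crate p a g n l) + p * (g - a)"
    by (simp add: crate_def)
  also have "(\<Sum>l\<le>n. crate p a g n l) = (\<Sum>l\<le>n. rate p a l)"
    by (rule sum.cong) (auto simp: crate_def rate_def)
  also have "\<dots> = p * a + real n * p"
    by (simp add: sum.atMost_shift rate_def)
  finally have "(\<Sum>l\<le>Suc n. crate p a g n l) = p * g + real n * p" by (simp add: algebra_simps)
  moreover have "p * g \<le> p" using assms mult_left_mono[of g 1 p] by simp
  moreover have "0 \<le> p * (g - a)" using assms by simp
  ultimately show ?thesis using assms unfolding substoch_def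
    by (auto simp: crate_def algebra_simps simp del: sum.atMost_Suc)
qed

lemma miter_lo: "miter (crate p a g n) (lo n) (Suc n) K f = ev p a n K f"
proof -
  have "miter (crate p a g n) (lo n) (Suc n) K f = miter (crate p a g n) (lo n) n K f"
    by (rule miter_idle_letters) (auto simp: lo_def)
  also have "\<dots> = ev p a n K f" unfolding ev_def
    by (rule miter_cong) (auto simp: lo_def crate_def rate_def)
  finally show ?thesis .
qed

lemma miter_hi: "miter (crate p a g n) (hi n) (Suc n) K f = ev p g n K f"
proof -
  have "mstep (crate p a g n) (hi n) (Suc n) h s = mstep (rate p g) act n h s" for h s
  proof -
    have "(\<Sum>l\<le>n. crate p a g n l * (h (hi n l s) - h s)) = (\<Sum>l\<le>n. rate p a l * (h (act l s) - h s))"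
      by (rule sum.cong) (auto simp: crate_def rate_def hi_def)
    then show ?thesis
      by (simp add: mstep_def sum.atMost_shift rate_def)
        (simp add: crate_def hi_def algebra_simps)
  qed
  then have "mstep (crate p a g n) (hi n) (Suc n) = mstep (rate p g) act n" by (intro ext)
  then show ?thesis by (simp add: miter_def ev_def)
qed

definition tri_act :: "nat \<Rightarrow> nat \<Rightarrow> conf \<times> conf \<times> conf \<Rightarrow> conf \<times> conf \<times> conf" where
  "tri_act n l = (\<lambda>(x, y, z). (lo n l x, lo n l y, hi n l z))"

text \<open>The discrepancies between \<open>y\<close> and \<open>z\<close> have lower priority than those between
  \<open>x\<close> and \<open>y\<close> and start behind them, so they never overtake them.\<close>

definition tri_inv :: "nat \<Rightarrow> nat \<Rightarrow> conf \<times> conf \<times> conf \<Rightarrow> bool" where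
  "tri_inv n c = (\<lambda>(x, y, z). x \<le> y \<and> y \<le> z \<and> (\<forall>i j. i < j \<longrightarrow> x i < y i \<longrightarrow> y j = z j)
     \<and> tot (Suc n) y = tot (Suc n) x + c)"

text \<open>When bond \<open>k\<close> rings, the occupation of \<open>k\<close> in the three
  systems decides what moves. If \<open>y\<close> and \<open>z\<close> move but \<open>x\<close>
  does not, an \<open>x\<close>-\<open>y\<close> discrepancy advances, and the invariant says that
  \<open>y\<close> and \<open>z\<close> agree to the right of \<open>k\<close>. If only
  \<open>z\<close> moves, a \<open>y\<close>-\<open>z\<close> discrepancy advances; an
  \<open>x\<close>-\<open>y\<close> discrepancy before \<open>k\<close> would contradict the
  invariant, and there is none at \<open>k\<close> because \<open>y k = 0\<close>.\<close>

lemma tri_inv_step: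
  assumes "tri_inv n c s" "l \<le> Suc n" shows "tri_inv n c (tri_act n l s)"
proof -
  obtain x y z where s: "s = (x, y, z)" by (cases s) auto
  have I: "x \<le> y" "y \<le> z" "\<And>i j. i < j \<Longrightarrow> x i < y i \<Longrightarrow> y j = z j" "tot (Suc n) y = tot (Suc n) x + c"
    using assms(1) by (auto simp: s tri_inv_def)
  have le: "x i \<le> y i" "y i \<le> z i" for i using I by (auto simp: le_fun_def)
  consider "l = Suc n" | "l = 0" | k where "l = Suc k" "k < n" using assms(2) by (cases l) force+
  then show ?thesis
  proof cases
    case 1
    have "y \<le> act 0 z" using le(2) by (auto simp: le_fun_def intro: le_SucI)
    then show ?thesis using I 1 by (auto simp: s tri_act_def tri_inv_def lo_def hi_def)
  next
    case 2
    then show ?thesis using I act_mono[of x y 0] act_mono[of y z 0]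
      by (auto simp: s tri_act_def tri_inv_def lo_def hi_def tot_act simp del: act.simps)
        (metis (no_types, lifting) act.simps(1) fun_upd_apply nat_neq_iff not_less_zero Suc_less_eq)
  next
    case (3 k)
    have ord: "act (Suc k) y j = act (Suc k) z j"
      if ij: "i < j" "act (Suc k) x i < act (Suc k) y i" for i j
    proof -
      consider "x k > 0" | "x k = 0" "y k > 0" | "y k = 0" "z k > 0" | "z k = 0" by linarith
      then show ?thesis
      proof cases
        case 1
        then have "y k > 0" "z k > 0" using le[of k] by auto
        then have "x i < y i" using 1 ij(2) le(1)[of k] by (auto split: if_splits)
        from I(3)[OF ij(1) this] show ?thesis using \<open>y k > 0\<close> \<open>z k > 0\<close> I(3)[of i] ij(1)
          using \<open>x i < y i\<close> by auto
      next
        case 2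
        then have zk: "z k > 0" using le[of k] by auto
        have yz: "y j' = z j'" if "k < j'" for j' using I(3)[OF that] 2 by simp
        show ?thesis
        proof (cases "k < j")
          case True
          then show ?thesis using yz[of j] 2 zk by auto
        next
          case False
          then have "i < k" using ij by simp
          then have "x i < y i" using ij(2) 2 by (auto split: if_splits)
          then show ?thesis using I(3)[OF ij(1)] I(3)[OF \<open>i < k\<close>] 2 zk ij(1) False by auto
        qed
      next
        case 3
        have xk: "x k = 0" using 3 le[of k] by auto
        have "x i < y i" using ij(2) xk 3 by auto
        moreover have "\<not> (i < k)" using I(3)[of i k] 3 calculation by auto
        moreover have "i \<noteq> k" using calculation 3 by auto
        ultimately have "k < i" by simp
        then show ?thesis using I(3)[OF ij(1) \<open>x i < y i\<close>] ij(1) 3 by auto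
      next
        case 4
        then show ?thesis using le[of k] ij I(3)[of i j] by auto
      qed
    qed
    show ?thesis using I act_mono[of x y l] act_mono[of y z l] ord 3 tot_act(2)[of k n]
      unfolding s tri_act_def tri_inv_def lo_def hi_def prod.case
      by (simp del: act.simps)
  qed
qed

text \<open>If the sink has received a \<open>y\<close>-\<open>z\<close> discrepancy, the ordering
  leaves no \<open>x\<close>-\<open>y\<close> discrepancy on the sites, so all \<open>c\<close> of
  them are in the sink.\<close>

lemma tri_inv_sink:
  assumes "tri_inv n c (x, y, z)"
  shows "x n \<le> y n" "y n \<le> z n" "y n \<le> x n + c" "y n = z n \<or> y n = x n + c"
proof -
  have I: "x \<le> y" "y \<le> z" "\<And>i j. i < j \<Longrightarrow> x i < y i \<Longrightarrow> y j = z j" "tot (Suc n) y = tot (Suc n) x + c"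
    using assms by (auto simp: tri_inv_def)
  have le: "x i \<le> y i" "y i \<le> z i" for i using I by (auto simp: le_fun_def)
  show "x n \<le> y n" "y n \<le> z n" using le by auto
  have "tot n x \<le> tot n y" unfolding tot_def by (intro sum_mono le)
  moreover have "tot n y + y n = tot n x + x n + c" using I(4) by (simp add: tot_def)
  ultimately show "y n \<le> x n + c" by simp
  show "y n = z n \<or> y n = x n + c"
  proof (cases "y n = z n")
    case False
    then have "x i = y i" if "i < n" for i using I(3)[OF that] le(1)[of i] by force
    then have "tot n x = tot n y" unfolding tot_def by (intro sum.cong) auto
    then show ?thesis using I(4) by (simp add: tot_def)
  qed simp
qed

text \<open>The configuration \<open>y\<close> starts two of the three systems. Discrepancies
  between these two are then the extra arrivals alone; they enter at the left end and hence behind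
  those between \<open>x\<close> and \<open>y\<close>.\<close>

lemma coupling3:
  assumes "0 \<le> p" "0 \<le> a" "a \<le> g" "g \<le> 1" "p * (real n + 1) \<le> 1" "x \<le> y"
    and "\<And>u v w. u \<le> v \<Longrightarrow> v \<le> w \<Longrightarrow> v \<le> u + (tot (Suc n) y - tot (Suc n) x)
      \<Longrightarrow> v = w \<or> v = u + (tot (Suc n) y - tot (Suc n) x) \<Longrightarrow> 0 \<le> \<phi>1 u + \<phi>2 v + (\<phi>3 w :: real)"
  shows "0 \<le> ev p a n K (\<lambda>\<eta>. \<phi>1 (\<eta> n)) x + ev p a n K (\<lambda>\<eta>. \<phi>2 (\<eta> n)) y + ev p g n K (\<lambda>\<eta>. \<phi>3 (\<eta> n)) y"
proof -
  define c where "c = tot (Suc n) y - tot (Suc n) x"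
  have le: "tot (Suc n) x \<le> tot (Suc n) y" unfolding tot_def using assms(6) by (intro sum_mono) (auto simp: le_fun_def)
  let ?M = "miter (crate p a g n) (tri_act n) (Suc n) K"
  have "?M (\<lambda>_. 0) (x, y, y) \<le> ?M (\<lambda>s. \<phi>1 (fst s n) + \<phi>2 (fst (snd s) n) + \<phi>3 (snd (snd s) n)) (x, y, y)"
  proof (rule miter_mono'[where I="tri_inv n c"])
    show "tri_inv n c (x, y, y)" using assms(6) le by (auto simp: tri_inv_def c_def)
    show "tri_inv n c (tri_act n l s)" if "l \<le> Suc n" "tri_inv n c s" for s l
      using tri_inv_step that by blast
    show "0 \<le> \<phi>1 (fst s n) + \<phi>2 (fst (snd s) n) + \<phi>3 (snd (snd s) n)" if "tri_inv n c s" for s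
      using tri_inv_sink[of n c "fst s" "fst (snd s)" "snd (snd s)"] that
      by (intro assms(7)) (auto simp: c_def)
  qed (rule substoch_crate[OF assms(1-5)])
  moreover have "?M (\<lambda>s. \<phi>1 (fst s n)) = (\<lambda>s. ev p a n K (\<lambda>\<eta>. \<phi>1 (\<eta> n)) (fst s))"
    unfolding miter_lo[of p a g n, symmetric]
    by (rule miter_lump[where h=fst and g="\<lambda>\<eta>. \<phi>1 (\<eta> n)"]) (auto simp: tri_act_def)
  moreover have "?M (\<lambda>s. \<phi>2 (fst (snd s) n)) = (\<lambda>s. ev p a n K (\<lambda>\<eta>. \<phi>2 (\<eta> n)) (fst (snd s)))"
    unfolding miter_lo[of p a g n, symmetric]
    by (rule miter_lump[where h="\<lambda>s. fst (snd s)" and g="\<lambda>\<eta>. \<phi>2 (\<eta> n)"]) (auto simp: tri_act_def)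
  moreover have "?M (\<lambda>s. \<phi>3 (snd (snd s) n)) = (\<lambda>s. ev p g n K (\<lambda>\<eta>. \<phi>3 (\<eta> n)) (snd (snd s)))"
    unfolding miter_hi[of p a g n, symmetric]
    by (rule miter_lump[where h="\<lambda>s. snd (snd s)" and g="\<lambda>\<eta>. \<phi>3 (\<eta> n)"]) (auto simp: tri_act_def)
  ultimately show ?thesis by (simp add: miter_add)
qed

definition quad_act :: "nat \<Rightarrow> nat \<Rightarrow> conf \<times> conf \<times> conf \<times> conf \<Rightarrow> conf \<times> conf \<times> conf \<times> conf" where
  "quad_act n l = (\<lambda>(u, u', v, v'). (lo n l u, lo n l u', hi n l v, hi n l v'))"

definition quad_inv :: "nat \<Rightarrow> conf \<times> conf \<times> conf \<times> conf \<Rightarrow> bool" where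
  "quad_inv n = (\<lambda>(u, u', v, v'). u \<le> v \<and> (\<exists>q r. r \<le> q \<and> q \<le> n \<and> u' = incr_at q u \<and> v' = incr_at r v))"

lemma act_incr_at:
  "act 0 (incr_at q u) = incr_at q (act 0 u)"
  "act (Suc k) (incr_at q u) = incr_at (if q = k \<and> u k = 0 then Suc k else q) (act (Suc k) u)"
  by (auto simp: incr_at_def fun_eq_iff)

text \<open>An antiparticle leaves its site only when the site holds no other particle. In the
  fuller environment \<open>v\<close> it is therefore slower: if both are at \<open>k\<close> and
  the one in \<open>v\<close> leaves, then \<open>u k \<le> v k = 0\<close> and the one in
  \<open>u\<close> leaves as well.\<close>

lemma quad_inv_step:
  assumes "quad_inv n s" "l \<le> Suc n" shows "quad_inv n (quad_act n l s)"
proof -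
  obtain u u' v v' where s: "s = (u, u', v, v')" by (cases s) auto
  obtain q r where I: "u \<le> v" "r \<le> q" "q \<le> n" "u' = incr_at q u" "v' = incr_at r v"
    using assms(1) by (auto simp: s quad_inv_def)
  consider "l = Suc n" | "l = 0" | k where "l = Suc k" "k < n" using assms(2) by (cases l) force+
  then show ?thesis
  proof cases
    case 1
    have "u \<le> act 0 v" using I(1) by (auto simp: le_fun_def intro: le_SucI)
    then show ?thesis using I 1 act_incr_at(1)[of r v]
      by (auto simp: s quad_act_def quad_inv_def lo_def hi_def simp del: act.simps)
  next
    case 2
    then show ?thesis using I act_mono[of u v 0] act_incr_at(1)[of r v] act_incr_at(1)[of q u]
      by (auto simp: s quad_act_def quad_inv_def lo_def hi_def simp del: act.simps)
  next
    case (3 k)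
    have "u k \<le> v k" using I(1) by (simp add: le_fun_def)
    then have "(if r = k \<and> v k = 0 then Suc k else r) \<le> (if q = k \<and> u k = 0 then Suc k else q)"
      using I(2) by auto
    moreover have "(if q = k \<and> u k = 0 then Suc k else q) \<le> n" using I(3) 3 by auto
    moreover have "act l u' = incr_at (if q = k \<and> u k = 0 then Suc k else q) (act l u)"
      "act l v' = incr_at (if r = k \<and> v k = 0 then Suc k else r) (act l v)"
      unfolding I(4,5) 3(1) by (rule act_incr_at)+
    moreover have "lo n l = act l" "hi n l = act l" using 3 by (auto simp: lo_def hi_def fun_eq_iff)
    ultimately show ?thesis using act_mono[OF I(1), of l]
      unfolding s quad_act_def quad_inv_def prod.case by metis
  qed
qed

text \<open>The condition \<open>v' + u \<le> u' + v\<close> says that the discrepancy has reached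
  the sink of the fuller system only if it has reached that of the emptier one.\<close>

lemma coupling4:
  assumes "0 \<le> p" "0 \<le> a" "a \<le> g" "g \<le> 1" "p * (real n + 1) \<le> 1" "x \<le> y" "j \<le> n"
    and "\<And>u u' v v'. u \<le> v \<Longrightarrow> u \<le> u' \<Longrightarrow> u' \<le> Suc u \<Longrightarrow> v \<le> v' \<Longrightarrow> v' + u \<le> u' + v
      \<Longrightarrow> 0 \<le> \<phi>1 u + \<phi>2 u' + \<phi>3 v + (\<phi>4 v' :: real)"
  shows "0 \<le> ev p a n K (\<lambda>\<eta>. \<phi>1 (\<eta> n)) x + ev p a n K (\<lambda>\<eta>. \<phi>2 (\<eta> n)) (incr_at j x)
    + ev p g n K (\<lambda>\<eta>. \<phi>3 (\<eta> n)) y + ev p g n K (\<lambda>\<eta>. \<phi>4 (\<eta> n)) (incr_at j y)"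
proof -
  let ?M = "miter (crate p a g n) (quad_act n) (Suc n) K"
  let ?s = "(x, incr_at j x, y, incr_at j y)"
  have "?M (\<lambda>_. 0) ?s \<le> ?M (\<lambda>s. \<phi>1 (fst s n) + \<phi>2 (fst (snd s) n) + \<phi>3 (fst (snd (snd s)) n) + \<phi>4 (snd (snd (snd s)) n)) ?s"
  proof (rule miter_mono'[where I="quad_inv n"])
    show "quad_inv n ?s" using assms(6,7) by (auto simp: quad_inv_def)
    show "quad_inv n (quad_act n l s)" if "l \<le> Suc n" "quad_inv n s" for s l
      using quad_inv_step that by blast
    show "0 \<le> \<phi>1 (fst s n) + \<phi>2 (fst (snd s) n) + \<phi>3 (fst (snd (snd s)) n) + \<phi>4 (snd (snd (snd s)) n)" if "quad_inv n s" for s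
      using that by (intro assms(8)) (auto simp: quad_inv_def incr_at_def le_fun_def)
  qed (rule substoch_crate[OF assms(1-5)])
  moreover have "?M (\<lambda>s. \<phi>1 (fst s n)) = (\<lambda>s. ev p a n K (\<lambda>\<eta>. \<phi>1 (\<eta> n)) (fst s))"
    unfolding miter_lo[of p a g n, symmetric]
    by (rule miter_lump[where h=fst and g="\<lambda>\<eta>. \<phi>1 (\<eta> n)"]) (auto simp: quad_act_def)
  moreover have "?M (\<lambda>s. \<phi>2 (fst (snd s) n)) = (\<lambda>s. ev p a n K (\<lambda>\<eta>. \<phi>2 (\<eta> n)) (fst (snd s)))"
    unfolding miter_lo[of p a g n, symmetric]
    by (rule miter_lump[where h="\<lambda>s. fst (snd s)" and g="\<lambda>\<eta>. \<phi>2 (\<eta> n)"]) (auto simp: quad_act_def)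
  moreover have "?M (\<lambda>s. \<phi>3 (fst (snd (snd s)) n)) = (\<lambda>s. ev p g n K (\<lambda>\<eta>. \<phi>3 (\<eta> n)) (fst (snd (snd s))))"
    unfolding miter_hi[of p a g n, symmetric]
    by (rule miter_lump[where h="\<lambda>s. fst (snd (snd s))" and g="\<lambda>\<eta>. \<phi>3 (\<eta> n)"]) (auto simp: quad_act_def)
  moreover have "?M (\<lambda>s. \<phi>4 (snd (snd (snd s)) n)) = (\<lambda>s. ev p g n K (\<lambda>\<eta>. \<phi>4 (\<eta> n)) (snd (snd (snd s))))"
    unfolding miter_hi[of p a g n, symmetric]
    by (rule miter_lump[where h="\<lambda>s. snd (snd (snd s))" and g="\<lambda>\<eta>. \<phi>4 (\<eta> n)"]) (auto simp: quad_act_def)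
  ultimately show ?thesis by (simp add: miter_add)
qed

abbreviation snk :: "nat \<Rightarrow> conf \<Rightarrow> real" where "snk n \<equiv> \<lambda>\<eta>. real (\<eta> n)"

text \<open>The probability that a discrepancy started at \<open>j\<close> has reached the sink.\<close>

definition Dsnk :: "real \<Rightarrow> real \<Rightarrow> nat \<Rightarrow> nat \<Rightarrow> nat \<Rightarrow> conf \<Rightarrow> real" where
  "Dsnk p a n K j \<eta> = ev p a n K (snk n) (incr_at j \<eta>) - ev p a n K (snk n) \<eta>"

lemma ev_uminus: "ev p a n K (\<lambda>s. - f s) \<eta> = - ev p a n K f \<eta>"
  unfolding ev_def using miter_cmult[of _ _ _ _ "-1" f] by simp

lemma Dsnk_antimono:
  assumes "0 \<le> p" "0 \<le> a" "a \<le> g" "g \<le> 1" "p * (real n + 1) \<le> 1" "x \<le> y" "j \<le> n"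
  shows "Dsnk p g n K j y \<le> Dsnk p a n K j x"
proof -
  have "0 \<le> ev p a n K (\<lambda>\<eta>. - real (\<eta> n)) x + ev p a n K (\<lambda>\<eta>. real (\<eta> n)) (incr_at j x)
    + ev p g n K (\<lambda>\<eta>. real (\<eta> n)) y + ev p g n K (\<lambda>\<eta>. - real (\<eta> n)) (incr_at j y)"
    by (rule coupling4[OF assms]) linarith
  then show ?thesis by (simp add: Dsnk_def ev_uminus)
qed

lemma ev_0_const: "ev p a n K (\<lambda>_. c) x = c"
  by (simp add: ev_def)

lemma Dsnk_bounds:
  assumes "0 \<le> p" "0 \<le> a" "a \<le> 1" "p * (real n + 1) \<le> 1" "j \<le> n"
  shows "0 \<le> Dsnk p a n K j x" "Dsnk p a n K j x \<le> 1"
proof -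
  have "0 \<le> ev p a n K (\<lambda>\<eta>. - real (\<eta> n)) x + ev p a n K (\<lambda>\<eta>. real (\<eta> n)) (incr_at j x)
    + ev p a n K (\<lambda>\<eta>. 0) x + ev p a n K (\<lambda>\<eta>. 0) (incr_at j x)"
    by (rule coupling4[OF assms(1,2) order_refl assms(3,4) order_refl assms(5)]) linarith
  then show "0 \<le> Dsnk p a n K j x" by (simp add: Dsnk_def ev_uminus ev_0_const)
  have "0 \<le> ev p a n K (\<lambda>\<eta>. real (\<eta> n)) x + ev p a n K (\<lambda>\<eta>. - real (\<eta> n)) (incr_at j x)
    + ev p a n K (\<lambda>\<eta>. 1) x + ev p a n K (\<lambda>\<eta>. 0) (incr_at j x)"
    by (rule coupling4[OF assms(1,2) order_refl assms(3,4) order_refl assms(5)]) linarith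
  then show "Dsnk p a n K j x \<le> 1" by (simp add: Dsnk_def ev_uminus ev_0_const)
qed

lemma ev_mono_conf:
  assumes "0 \<le> p" "0 \<le> a" "a \<le> 1" "p * (real n + 1) \<le> 1" "\<And>x y. x \<le> y \<Longrightarrow> f x \<le> f y" "x \<le> y"
  shows "ev p a n K f x \<le> ev p a n K f y"
proof -
  let ?M = "miter (rate p a) (\<lambda>l s. (act l (fst s), act l (snd s))) n K"
  have "?M (\<lambda>s. f (fst s)) (x, y) \<le> ?M (\<lambda>s. f (snd s)) (x, y)"
    by (rule miter_mono'[where I="\<lambda>s. fst s \<le> snd s"])
      (use assms act_mono substoch_rate in \<open>auto simp del: act.simps\<close>)
  moreover have "?M (\<lambda>s. f (fst s)) = (\<lambda>s. ev p a n K f (fst s))"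
    unfolding ev_def by (rule miter_lump[where h=fst]) auto
  moreover have "?M (\<lambda>s. f (snd s)) = (\<lambda>s. ev p a n K f (snd s))"
    unfolding ev_def by (rule miter_lump[where h=snd]) auto
  ultimately show ?thesis by simp
qed

text \<open>The sink never loses particles and gains at most one per step, so the observables are
  compared only on counts between \<open>\<eta> n\<close> and \<open>\<eta> n + K\<close>.\<close>

lemma ev_snk_mono:
  assumes "0 \<le> p" "0 \<le> a" "a \<le> 1" "p * (real n + 1) \<le> 1"
    and "\<And>c. \<eta> n \<le> c \<Longrightarrow> c \<le> \<eta> n + K \<Longrightarrow> \<phi> c \<le> (\<psi> c :: real)"
  shows "ev p a n K (\<lambda>\<eta>. \<phi> (\<eta> n)) \<eta> \<le> ev p a n K (\<lambda>\<eta>. \<psi> (\<eta> n)) \<eta>"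
proof -
  have "s n \<le> act l s n" "act l s n \<le> Suc (s n)" if "l \<le> n" for l s
    using that by (cases l; auto)+
  note this[intro]
  show ?thesis unfolding ev_def
  proof (rule miter_mono[where I="\<lambda>k s. \<eta> n \<le> s n \<and> s n \<le> \<eta> n + k" and k=0])
    show "\<eta> n \<le> act l s n \<and> act l s n \<le> \<eta> n + Suc k" if "l \<le> n" "\<eta> n \<le> s n \<and> s n \<le> \<eta> n + k" for k s l
      using \<open>l \<le> n \<Longrightarrow> s n \<le> act l s n\<close> \<open>l \<le> n \<Longrightarrow> act l s n \<le> Suc (s n)\<close> that by linarith
  qed (use assms substoch_rate in auto)
qed

lemma ev_snk_abs:
  assumes "0 \<le> p" "0 \<le> a" "a \<le> 1" "p * (real n + 1) \<le> 1"
    and "\<And>c. \<eta> n \<le> c \<Longrightarrow> c \<le> \<eta> n + K \<Longrightarrow> \<bar>\<phi> c\<bar> \<le> B"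
  shows "\<bar>ev p a n K (\<lambda>\<eta>. \<phi> (\<eta> n)) \<eta>\<bar> \<le> B"
proof -
  have "ev p a n K (\<lambda>\<eta>. \<phi> (\<eta> n)) \<eta> \<le> ev p a n K (\<lambda>\<eta>. B) \<eta>"
    by (rule ev_snk_mono[OF assms(1-4), where \<psi>="\<lambda>_. B"]) (use assms(5) in force)
  moreover have "ev p a n K (\<lambda>\<eta>. - B) \<eta> \<le> ev p a n K (\<lambda>\<eta>. \<phi> (\<eta> n)) \<eta>"
    by (rule ev_snk_mono[OF assms(1-4), where \<phi>="\<lambda>_. - B"]) (use assms(5) in force)
  ultimately show ?thesis by (simp add: ev_0_const)
qed

lemma ev_snk_bound:
  assumes "0 \<le> p" "0 \<le> a" "a \<le> 1" "p * (real n + 1) \<le> 1"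
  shows "\<bar>ev p a n K (snk n) \<eta>\<bar> \<le> real (\<eta> n) + real K"
  by (rule ev_snk_abs[OF assms]) auto

lemma wsum_act:
  fixes W :: "conf \<Rightarrow> real" and n :: nat
  defines "W \<equiv> \<lambda>x. \<Sum>i\<le>n. 2 ^ i * real (x i)"
  shows "W (act 0 x) = W x + 1"
    and "k < n \<Longrightarrow> W (act (Suc k) x) = W x + (if x k = 0 then 0 else 2 ^ k)"
proof -
  show "W (act 0 x) = W x + 1" unfolding W_def
    by (cases n) (simp_all add: sum.atMost_shift)
  assume i: "k < n"
  show "W (act (Suc k) x) = W x + (if x k = 0 then 0 else 2 ^ k)"
  proof (cases "x k = 0")
    case False
    have s: "W y = 2 ^ k * real (y k) + 2 ^ Suc k * real (y (Suc k)) + (\<Sum>j\<in>{..n} - {k, Suc k}. 2 ^ j * real (y j))" for y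
      unfolding W_def using i
      by (subst sum.subset_diff[of "{k, Suc k}"]) auto
    have "(\<Sum>j\<in>{..n} - {k, Suc k}. 2 ^ j * real (act (Suc k) x j)) = (\<Sum>j\<in>{..n} - {k, Suc k}. 2 ^ j * real (x j))"
      by (rule sum.cong) auto
    then show ?thesis using False unfolding s[of "act (Suc k) x"] s[of x]
      by (simp add: of_nat_diff algebra_simps)
  qed simp
qed

text \<open>Weighting a discrepancy at site \<open>i\<close> by \<open>2 ^ i\<close>, the total weight grows at rate at most one.\<close>

lemma discrepancy_bound:
  assumes "0 \<le> p" "0 \<le> a" "a \<le> g" "g \<le> 1" "p * (real n + 1) \<le> 1" "x \<le> y"
  shows "ev p g n K (snk n) y - ev p a n K (snk n) x \<le>
    (1 + p) ^ K * ((\<Sum>i\<le>n. 2 ^ i * (real (y i) - real (x i))) + 1) / 2 ^ n"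
proof -
  let ?st = "\<lambda>l s. (lo n l (fst s), hi n l (snd s))"
  let ?M = "miter (crate p a g n) ?st (Suc n)"
  define W where "W x = (\<Sum>i\<le>n. 2 ^ i * real (x i))" for x :: conf
  \<comment> \<open>The added \<open>1\<close> absorbs the extra arrivals of the second system,
    whose contribution \<open>p * (g - a)\<close> per step is at most \<open>p\<close>. One step
    then multiplies \<open>H\<close> by at most \<open>1 + p\<close>.\<close>
  define H where "H s = W (snd s) - W (fst s) + 1" for s :: "conf \<times> conf"
  let ?I = "\<lambda>s :: conf \<times> conf. fst s \<le> snd s"
  have ss: "substoch (crate p a g n) (Suc n)" by (rule substoch_crate[OF assms(1-5)])
  have I: "?I (?st l s)" if "l \<le> Suc n" "?I s" for l s
  proof (cases "l \<le> n")
    case False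
    then show ?thesis using that(2) by (auto simp: lo_def hi_def le_fun_def intro: le_SucI)
  qed (use that act_mono[of "fst s" "snd s" l] in \<open>auto simp: lo_def hi_def\<close>)
  have step: "mstep (crate p a g n) ?st (Suc n) H s \<le> (1 + p) * H s" if Is: "?I s" for s
  proof -
    obtain u v where s: "s = (u, v)" "u \<le> v" using Is by (metis prod.collapse)
    have uv: "u i \<le> v i" for i using s(2) by (simp add: le_fun_def)
    have "(\<Sum>l\<le>Suc n. crate p a g n l * (H (?st l s) - H s)) =
      p * a * (H (?st 0 s) - H s) + (\<Sum>k<n. p * (H (?st (Suc k) s) - H s)) + p * (g - a) * (H (?st (Suc n) s) - H s)"
      by (simp add: sum.atMost_shift crate_def)
    also have "H (?st 0 s) - H s = 0"
      by (simp add: s H_def lo_def hi_def W_def wsum_act del: act.simps)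
    also have "H (?st (Suc n) s) - H s = 1"
      by (simp add: s H_def lo_def hi_def W_def wsum_act del: act.simps)
    also have "(\<Sum>k<n. p * (H (?st (Suc k) s) - H s)) \<le> (\<Sum>k<n. p * (2 ^ k * (real (v k) - real (u k))))"
    proof (intro sum_mono mult_left_mono assms(1))
      fix k assume "k \<in> {..<n}"
      then have k: "k < n" by simp
      have "H (?st (Suc k) s) - H s = (if v k = 0 then 0 else 2 ^ k) - (if u k = 0 then 0 else 2 ^ k)"
        using k by (simp add: s H_def lo_def hi_def W_def wsum_act del: act.simps)
      also have "\<dots> \<le> 2 ^ k * (real (v k) - real (u k))" using uv[of k] by auto
      finally show "H (?st (Suc k) s) - H s \<le> 2 ^ k * (real (v k) - real (u k))" .
    qed
    also have "(\<Sum>k<n. p * (2 ^ k * (real (v k) - real (u k)))) \<le> p * (W v - W u)"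
    proof -
      have "W v - W u = (\<Sum>k\<le>n. 2 ^ k * (real (v k) - real (u k)))"
        by (simp add: W_def sum_subtractf algebra_simps)
      also have "\<dots> \<ge> (\<Sum>k<n. 2 ^ k * (real (v k) - real (u k)))"
        using uv by (intro sum_mono2) auto
      finally show ?thesis using assms(1) by (simp add: sum_distrib_left[symmetric] mult_left_mono)
    qed
    also have "p * (g - a) * 1 \<le> p" using mult_left_mono[of "g - a" 1 p] assms by simp
    finally show ?thesis unfolding mstep_def by (simp add: s H_def algebra_simps)
  qed
  have "?M K (\<lambda>s. 2 ^ n * (real (snd s n) - real (fst s n))) (x, y) \<le> ?M K H (x, y)"
  proof (rule miter_mono'[OF ss, where I="?I"])
    fix s :: "conf \<times> conf" assume "?I s"
    then have "H s - 1 = (\<Sum>k\<le>n. 2 ^ k * (real (snd s k) - real (fst s k)))"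
      by (simp add: H_def W_def sum_subtractf algebra_simps)
    also have "\<dots> \<ge> (\<Sum>k\<in>{n}. 2 ^ k * (real (snd s k) - real (fst s k)))"
      using \<open>?I s\<close> by (intro sum_mono2) (auto simp: le_fun_def)
    finally show "2 ^ n * (real (snd s n) - real (fst s n)) \<le> H s" by simp
  qed (use I assms(6) in auto)
  also have "\<dots> \<le> (1 + p) ^ K * H (x, y)"
  proof (induction K)
    case (Suc K)
    have "?M (Suc K) H (x, y) = ?M K (mstep (crate p a g n) ?st (Suc n) H) (x, y)"
      by (simp only: miter_Suc')
    also have "\<dots> \<le> ?M K (\<lambda>s. (1 + p) * H s) (x, y)"
      by (rule miter_mono'[OF ss, where I="?I"]) (use I assms(6) step in auto)
    also have "\<dots> = (1 + p) * ?M K H (x, y)" by (simp add: miter_cmult)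
    also have "\<dots> \<le> (1 + p) * ((1 + p) ^ K * H (x, y))"
      using Suc assms(1) by (intro mult_left_mono) auto
    finally show ?case by (simp add: mult_ac)
  qed simp
  finally have "?M K (\<lambda>s. 2 ^ n * (real (snd s n) - real (fst s n))) (x, y) \<le> (1 + p) ^ K * H (x, y)" .
  moreover have "?M K (\<lambda>s. real (fst s n)) = (\<lambda>s. ev p a n K (snk n) (fst s))"
    unfolding miter_lo[of p a g n, symmetric]
    by (rule miter_lump[where h=fst and g="snk n"]) auto
  moreover have "?M K (\<lambda>s. real (snd s n)) = (\<lambda>s. ev p g n K (snk n) (snd s))"
    unfolding miter_hi[of p a g n, symmetric]
    by (rule miter_lump[where h=snd and g="snk n"]) auto
  moreover have "H (x, y) = (\<Sum>i\<le>n. 2 ^ i * (real (y i) - real (x i))) + 1"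
    by (simp add: H_def W_def sum_subtractf algebra_simps)
  ultimately have "2 ^ n * (ev p g n K (snk n) y - ev p a n K (snk n) x) \<le>
      (1 + p) ^ K * ((\<Sum>i\<le>n. 2 ^ i * (real (y i) - real (x i))) + 1)"
    unfolding miter_cmult miter_diff by simp
  then show ?thesis by (simp add: field_simps)
qed

lemma ev_arrivals_mono:
  assumes "0 \<le> p" "0 \<le> a" "a \<le> g" "g \<le> 1" "p * (real n + 1) \<le> 1"
  shows "ev p a n K (snk n) x \<le> ev p g n K (snk n) x"
proof -
  have "0 \<le> ev p a n K (\<lambda>\<eta>. 0) x + ev p a n K (\<lambda>\<eta>. - real (\<eta> n)) x + ev p g n K (\<lambda>\<eta>. real (\<eta> n)) x"
    by (rule coupling3[OF assms order_refl]) simp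
  then show ?thesis by (simp add: ev_uminus ev_0_const)
qed

section \<open>Shorter stretches inside longer ones\<close>

definition cut :: "nat \<Rightarrow> conf \<Rightarrow> conf" where
  "cut n \<eta> = (\<lambda>i. if i < n then \<eta> i else 0)"

text \<open>All sites from \<open>n\<close> on are merged into a sink, which does not affect the sites before.\<close>

definition merge_from :: "nat \<Rightarrow> nat \<Rightarrow> conf \<Rightarrow> conf" where
  "merge_from n N \<eta> = (\<lambda>i. if i < n then \<eta> i else if i = n then (\<Sum>j\<in>{n..N}. \<eta> j) else 0)"

lemma merge_from_act:
  assumes "n \<le> N" "l \<le> N"
  shows "merge_from n N (act l \<eta>) = (if l \<le> n then act l (merge_from n N \<eta>) else merge_from n N \<eta>)"
proof (cases l)
  case 0
  have "(\<Sum>j\<in>{0..N}. act 0 \<eta> j) = Suc (\<Sum>j\<in>{0..N}. \<eta> j)"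
    by (simp add: sum.atLeast_Suc_atMost)
  moreover have "(\<Sum>j\<in>{n..N}. act 0 \<eta> j) = (\<Sum>j\<in>{n..N}. \<eta> j)" if "n > 0"
    using that by (intro sum.cong) auto
  ultimately show ?thesis using 0 by (cases "n = 0") (auto simp: merge_from_def fun_eq_iff)
next
  case (Suc k)
  show ?thesis
  proof (cases "\<eta> k = 0")
    case True
    then have "act l \<eta> = \<eta>" by (simp add: Suc)
    then show ?thesis using True by (auto simp: merge_from_def Suc)
  next
    case False
    consider "k < n" "Suc k < n" | "k < n" "Suc k = n" | "n \<le> k" by linarith
    then show ?thesis
    proof cases
      case 1
      then have "(\<Sum>j\<in>{n..N}. act l \<eta> j) = (\<Sum>j\<in>{n..N}. \<eta> j)"
        by (intro sum.cong) (auto simp: Suc)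
      then show ?thesis using 1 by (auto simp: merge_from_def Suc fun_eq_iff)
    next
      case 2
      have "(\<Sum>j\<in>{n..N}. act l \<eta> j) = act l \<eta> n + (\<Sum>j\<in>{Suc n..N}. act l \<eta> j)"
        using assms by (simp add: sum.atLeast_Suc_atMost)
      also have "(\<Sum>j\<in>{Suc n..N}. act l \<eta> j) = (\<Sum>j\<in>{Suc n..N}. \<eta> j)"
        using 2 by (intro sum.cong) (auto simp: Suc)
      also have "act l \<eta> n + \<dots> = Suc (\<Sum>j\<in>{n..N}. \<eta> j)"
        using assms 2 False by (auto simp: sum.atLeast_Suc_atMost Suc)
      finally show ?thesis using 2 False by (auto simp: merge_from_def Suc fun_eq_iff)
    next
      case 3
      have s: "(\<Sum>j\<in>{n..N}. y j) = y k + y (Suc k) + (\<Sum>j\<in>{n..N} - {k, Suc k}. y j)" for y :: conf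
        using 3 assms Suc by (subst sum.subset_diff[of "{k, Suc k}"]) auto
      have "(\<Sum>j\<in>{n..N} - {k, Suc k}. act l \<eta> j) = (\<Sum>j\<in>{n..N} - {k, Suc k}. \<eta> j)"
        by (intro sum.cong) (auto simp: Suc)
      then have "(\<Sum>j\<in>{n..N}. act l \<eta> j) = (\<Sum>j\<in>{n..N}. \<eta> j)"
        unfolding s[of "act l \<eta>"] s[of \<eta>] using False by (simp add: Suc)
      then show ?thesis using 3 by (auto simp: merge_from_def Suc fun_eq_iff)
    qed
  qed
qed

lemma ev_merge_from:
  assumes "n \<le> N"
  shows "ev p a N K (\<lambda>\<eta>. g (merge_from n N \<eta>)) \<eta> = ev p a n K g (merge_from n N \<eta>)"
proof -
  let ?m = "\<lambda>l \<eta>. if l \<le> n then act l \<eta> else \<eta>"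
  have "miter (rate p a) act N K (\<lambda>\<eta>. g (merge_from n N \<eta>)) = (\<lambda>\<eta>. miter (rate p a) ?m N K g (merge_from n N \<eta>))"
    by (rule miter_lump) (use merge_from_act assms in auto)
  also have "miter (rate p a) ?m N K g = miter (rate p a) ?m n K g"
    by (rule miter_idle_letters) (use assms in auto)
  also have "\<dots> = miter (rate p a) act n K g" by (rule miter_cong) auto
  finally show ?thesis by (simp add: ev_def)
qed

lemma ev_snk_shift:
  "ev p a n K (\<lambda>\<eta>. f (\<eta>(n := \<eta> n + c))) \<eta> = ev p a n K f (\<eta>(n := \<eta> n + c))"
proof -
  have "act l (\<eta>(n := \<eta> n + c)) = (act l \<eta>)(n := act l \<eta> n + c)" if "l \<le> n" for l \<eta>
    using that by (cases l) (auto simp: fun_eq_iff)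
  then have "miter (rate p a) act n K (\<lambda>\<eta>. f (\<eta>(n := \<eta> n + c))) = (\<lambda>\<eta>. miter (rate p a) act n K f (\<eta>(n := \<eta> n + c)))"
    by (intro miter_lump[where h="\<lambda>\<eta>. \<eta>(n := \<eta> n + c)"]) (simp only:)
  then show ?thesis by (simp add: ev_def fun_eq_iff)
qed

lemma Dsnk_snk_shift: "Dsnk p a n K j (incr_at n \<eta>) = Dsnk p a n K j \<eta>"
proof -
  have *: "ev p a n K (snk n) (incr_at n \<eta>) = ev p a n K (snk n) \<eta> + 1" for \<eta>
    using ev_snk_shift[of p a n K "snk n" 1 \<eta>] miter_add[of "rate p a" act n K "snk n" "\<lambda>_. 1"]
    by (simp add: ev_def incr_at_def algebra_simps)
  have "incr_at j (incr_at n \<eta>) = incr_at n (incr_at j \<eta>)" by (auto simp: incr_at_def fun_eq_iff)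
  then show ?thesis by (simp add: Dsnk_def *)
qed

section \<open>The flux through a stretch\<close>

text \<open>Arrivals have density \<open>g\<close>, the initial configuration has density \<open>b\<close>.\<close>

definition flux_ev :: "real \<Rightarrow> nat \<Rightarrow> nat \<Rightarrow> real \<Rightarrow> (real \<Rightarrow> real) \<Rightarrow> conf \<Rightarrow> real" where
  "flux_ev p n K g \<phi> \<eta> = ev p g n K (\<lambda>\<eta>'. \<phi> (real (\<eta>' n) - real (tot n \<eta>))) \<eta>"

definition flux_avg :: "real \<Rightarrow> nat \<Rightarrow> nat \<Rightarrow> real \<Rightarrow> real \<Rightarrow> (real \<Rightarrow> real) \<Rightarrow> real" where
  "flux_avg p n K g b \<phi> = pavg (replicate n (gw b)) (flux_ev p n K g \<phi>) (\<lambda>_. 0)"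

text \<open>In \<open>K\<close> steps there are at most \<open>K\<close> departures, so only the
  initial particle number \<open>s\<close> can be large. The radius may depend on the observable, as
  the exponential ones require.\<close>

definition flux_ok :: "real \<Rightarrow> nat \<Rightarrow> (real \<Rightarrow> real) \<Rightarrow> bool" where
  "flux_ok b K \<phi> \<longleftrightarrow> (\<exists>z>1. b * z < 1 \<and> (\<exists>C. \<forall>c\<le>K. \<forall>s. \<bar>\<phi> (real c - real s)\<bar> \<le> C * z ^ s))"

text \<open>The harmonic mean of \<open>1\<close> and \<open>1 / b\<close>, a standard radius for
  observables of polynomial growth.\<close>

definition mid_radius :: "real \<Rightarrow> real" where "mid_radius b = 2 / (1 + b)"

lemma mid_radius: assumes "0 \<le> b" "b < 1" shows "mid_radius b > 1" "b * mid_radius b < 1"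
  using assms by (auto simp: mid_radius_def field_simps)

locale chain =
  fixes p :: real and n :: nat
  assumes p0: "0 \<le> p" and pn: "p * (real n + 1) \<le> 1"
begin

lemma flux_ev_tame:
  assumes "0 \<le> g" "g \<le> 1" "\<And>c s. c \<le> K \<Longrightarrow> \<bar>\<phi> (real c - real s)\<bar> \<le> C * z ^ s"
  shows "tame z n (\<lambda>_. 0) (flux_ev p n K g \<phi>)"
  unfolding tame_def flux_ev_def
proof (intro exI allI impI)
  fix \<eta> :: conf assume "\<forall>j. \<eta> (n + j) = 0"
  then have "\<eta> n = 0" by (metis add_0_right)
  then show "\<bar>ev p g n K (\<lambda>\<eta>'. \<phi> (real (\<eta>' n) - real (tot n \<eta>))) \<eta>\<bar> \<le> C * z ^ tot n \<eta>"
    by (intro ev_snk_abs[OF p0 assms(1,2) pn, where \<phi>="\<lambda>c. \<phi> (real c - real (tot n \<eta>))"]) (use assms(3) in auto)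
qed

lemma flux_okE:
  assumes "flux_ok b K \<phi>" "0 \<le> g" "g \<le> 1"
  obtains z where "z > 1" "b * z < 1" "\<And>z'. z \<le> z' \<Longrightarrow> tame z' n (\<lambda>_. 0) (flux_ev p n K g \<phi>)"
proof -
  obtain z C where z: "z > 1" "b * z < 1" "\<And>c s. c \<le> K \<Longrightarrow> \<bar>\<phi> (real c - real s)\<bar> \<le> C * z ^ s"
    using assms(1) by (auto simp: flux_ok_def)
  have "C \<ge> 0" using z(3)[of 0 0] by simp
  have "tame z' n (\<lambda>_. 0) (flux_ev p n K g \<phi>)" if "z \<le> z'" for z'
  proof (rule flux_ev_tame[OF assms(2,3)])
    fix c s assume "c \<le> K"
    have "C * z ^ s \<le> C * z' ^ s" using that z \<open>C \<ge> 0\<close> by (intro mult_left_mono power_mono) auto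
    then show "\<bar>\<phi> (real c - real s)\<bar> \<le> C * z' ^ s" using z(3)[OF \<open>c \<le> K\<close>, of s] by linarith
  qed
  then show ?thesis using that z by blast
qed

end

lemma flux_ok_add: assumes "flux_ok b K \<phi>" "flux_ok b K \<psi>" shows "flux_ok b K (\<lambda>y. \<phi> y + \<psi> y)"
proof -
  obtain z C where z: "z > 1" "b * z < 1" "\<And>c s. c \<le> K \<Longrightarrow> \<bar>\<phi> (real c - real s)\<bar> \<le> C * z ^ s"
    using assms(1) by (auto simp: flux_ok_def)
  obtain z' C' where z': "z' > 1" "b * z' < 1" "\<And>c s. c \<le> K \<Longrightarrow> \<bar>\<psi> (real c - real s)\<bar> \<le> C' * z' ^ s"
    using assms(2) by (auto simp: flux_ok_def)
  have C: "C \<ge> 0" "C' \<ge> 0" using z(3)[of 0 0] z'(3)[of 0 0] by auto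
  have "\<bar>\<phi> (real c - real s) + \<psi> (real c - real s)\<bar> \<le> (C + C') * max z z' ^ s" if "c \<le> K" for c s
  proof -
    have "C * z ^ s \<le> C * max z z' ^ s" "C' * z' ^ s \<le> C' * max z z' ^ s"
      using z z' C by (auto intro!: mult_left_mono power_mono)
    then show ?thesis using z(3)[OF that, of s] z'(3)[OF that, of s] by (simp add: algebra_simps)
  qed
  moreover have "max z z' > 1" "b * max z z' < 1" using z z' by (auto simp: max_def)
  ultimately show ?thesis unfolding flux_ok_def by blast
qed

lemma flux_ok_cmult: assumes "flux_ok b K \<phi>" shows "flux_ok b K (\<lambda>y. a * \<phi> y)"
proof -
  obtain z C where z: "z > 1" "b * z < 1" "\<And>c s. c \<le> K \<Longrightarrow> \<bar>\<phi> (real c - real s)\<bar> \<le> C * z ^ s"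
    using assms(1) by (auto simp: flux_ok_def)
  have "\<bar>a * \<phi> (real c - real s)\<bar> \<le> (\<bar>a\<bar> * C) * z ^ s" if "c \<le> K" for c s
    using mult_left_mono[OF z(3)[OF that, of s], of "\<bar>a\<bar>"] by (simp add: abs_mult mult_ac)
  then show ?thesis using z unfolding flux_ok_def by blast
qed

lemma flux_ok_quadratic: assumes "0 \<le> b" "b < 1" "\<And>y. \<bar>\<phi> y\<bar> \<le> A + B * y\<^sup>2" shows "flux_ok b K \<phi>"
proof -
  let ?z = "mid_radius b"
  have z: "?z > 1" "b * ?z < 1" using mid_radius assms by auto
  define y where "y = sqrt ?z"
  have y: "y > 1" "y ^ 2 = ?z" using z by (auto simp: y_def)
  define C where "C = \<bar>A\<bar> + \<bar>B\<bar> * (real K + 1 / (y - 1))\<^sup>2"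
  have "\<bar>\<phi> (real c - real s)\<bar> \<le> C * ?z ^ s" if "c \<le> K" for c s
  proof -
    have 1: "1 \<le> y ^ s" using y by (intro one_le_power) auto
    have "\<bar>real c - real s\<bar> \<le> real K + real s" using that by auto
    also have "\<dots> \<le> real K * y ^ s + 1 / (y - 1) * y ^ s"
      using real_le_power[OF y(1), of s] 1 mult_left_mono[of 1 "y ^ s" "real K"] by linarith
    finally have "\<bar>real c - real s\<bar> \<le> (real K + 1 / (y - 1)) * y ^ s" by (simp only: ring_distribs)
    then have "(real c - real s)\<^sup>2 \<le> ((real K + 1 / (y - 1)) * y ^ s)\<^sup>2"
      using power_mono[of "\<bar>real c - real s\<bar>" _ 2] by simp
    also have "\<dots> = (real K + 1 / (y - 1))\<^sup>2 * ?z ^ s"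
      unfolding power_mult_distrib y(2)[symmetric] by (simp add: power_mult[symmetric] mult.commute)
    finally have 2: "(real c - real s)\<^sup>2 \<le> (real K + 1 / (y - 1))\<^sup>2 * ?z ^ s" .
    have "\<bar>\<phi> (real c - real s)\<bar> \<le> A + B * (real c - real s)\<^sup>2" by (rule assms)
    also have "\<dots> \<le> \<bar>A\<bar> * ?z ^ s + \<bar>B\<bar> * ((real K + 1 / (y - 1))\<^sup>2 * ?z ^ s)"
    proof (intro add_mono)
      have "1 \<le> ?z ^ s" using z by (intro one_le_power) auto
      then show "A \<le> \<bar>A\<bar> * ?z ^ s" using mult_left_mono[of 1 "?z ^ s" "\<bar>A\<bar>"] by auto
      have "B * (real c - real s)\<^sup>2 \<le> \<bar>B\<bar> * (real c - real s)\<^sup>2" by (intro mult_right_mono) auto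
      also have "\<dots> \<le> \<bar>B\<bar> * ((real K + 1 / (y - 1))\<^sup>2 * ?z ^ s)" using 2 by (intro mult_left_mono) auto
      finally show "B * (real c - real s)\<^sup>2 \<le> \<bar>B\<bar> * ((real K + 1 / (y - 1))\<^sup>2 * ?z ^ s)" .
    qed
    finally show ?thesis by (simp add: C_def algebra_simps)
  qed
  then show ?thesis using z unfolding flux_ok_def by blast
qed

lemma flux_ok_exp:
  assumes "0 < b" "b < 1" "0 \<le> t" "b * exp t < 1" shows "flux_ok b K (\<lambda>y. exp (- t * (y - r)))"
proof -
  define z where "z = (exp t + 1 / b) / 2"
  have "exp t < 1 / b" using assms by (simp add: field_simps)
  moreover have "1 < 1 / b" "exp t \<ge> 1" using assms by (auto simp: field_simps)
  ultimately have z: "z > 1" "exp t \<le> z" "z < 1 / b" unfolding z_def by (simp_all only: field_sum_of_halves less_divide_eq_numeral1 le_divide_eq_numeral1 divide_less_eq_numeral1)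
  have "b * z < 1" using z(3) assms by (simp add: field_simps)
  moreover have "\<bar>exp (- t * (real c - real s - r))\<bar> \<le> exp (t * r) * z ^ s" for c s :: nat
  proof -
    have "exp (- t * (real c - real s - r)) = exp (- (t * real c)) * exp (t * r) * exp t ^ s"
      by (simp add: exp_of_nat_mult[symmetric] exp_add[symmetric] algebra_simps)
    also have "\<dots> \<le> 1 * exp (t * r) * z ^ s"
      using assms z by (intro mult_mono power_mono) auto
    finally show ?thesis by simp
  qed
  ultimately show ?thesis using z unfolding flux_ok_def by blast
qed

context chain begin

lemma okw_replicate: "0 \<le> b \<Longrightarrow> b < 1 \<Longrightarrow> 1 < z \<Longrightarrow> b * z < 1 \<Longrightarrow> \<forall>w\<in>set (replicate m (gw b)). okw z w"
  using okw_gw by auto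

lemma flux_avg_add:
  assumes "0 \<le> g" "g \<le> 1" "0 \<le> b" "b < 1" "flux_ok b K \<phi>" "flux_ok b K \<psi>"
  shows "flux_avg p n K g b (\<lambda>y. \<phi> y + \<psi> y) = flux_avg p n K g b \<phi> + flux_avg p n K g b \<psi>"
proof -
  obtain z where z: "z > 1" "b * z < 1" "\<And>z'. z \<le> z' \<Longrightarrow> tame z' n (\<lambda>_. 0) (flux_ev p n K g \<phi>)"
    using flux_okE[OF assms(5,1,2)] by blast
  obtain y where y: "y > 1" "b * y < 1" "\<And>z'. y \<le> z' \<Longrightarrow> tame z' n (\<lambda>_. 0) (flux_ev p n K g \<psi>)"
    using flux_okE[OF assms(6,1,2)] by blast
  have m: "max y z > 1" "b * max y z < 1" using y(1,2) z(1,2) by (auto simp: max_def)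
  have "flux_ev p n K g (\<lambda>y. \<phi> y + \<psi> y) = (\<lambda>\<eta>. flux_ev p n K g \<phi> \<eta> + flux_ev p n K g \<psi> \<eta>)"
    unfolding flux_ev_def ev_def miter_add ..
  then show ?thesis unfolding flux_avg_def
    using y(3)[of "max y z"] z(3)[of "max y z"] by (simp add: pavg_add[OF okw_replicate[OF assms(3,4) m]])
qed

lemma flux_avg_cmult:
  assumes "0 \<le> g" "g \<le> 1" "0 \<le> b" "b < 1" "flux_ok b K \<phi>"
  shows "flux_avg p n K g b (\<lambda>y. a * \<phi> y) = a * flux_avg p n K g b \<phi>"
proof -
  obtain z where z: "z > 1" "b * z < 1" "\<And>z'. z \<le> z' \<Longrightarrow> tame z' n (\<lambda>_. 0) (flux_ev p n K g \<phi>)"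
    using flux_okE[OF assms(5,1,2)] by blast
  have "flux_ev p n K g (\<lambda>y. a * \<phi> y) = (\<lambda>\<eta>. a * flux_ev p n K g \<phi> \<eta>)"
    unfolding flux_ev_def ev_def miter_cmult ..
  then show ?thesis unfolding flux_avg_def
    using z(3)[of z] by (simp add: pavg_cmult[OF okw_replicate[OF assms(3,4) z(1,2)]])
qed

lemma flux_avg_const:
  assumes "0 \<le> b" "b < 1" shows "flux_avg p n K g b (\<lambda>_. c) = c"
  unfolding flux_avg_def flux_ev_def ev_0_const by (rule pavg_const) (use gw_sums[OF assms] in auto)

text \<open>The three observables are tested only where \<open>v\<close> is the minimum of
  \<open>u\<close> and \<open>w\<close>. The middle flux falls below the first by the additional
  initial particles that have not left, and below the third by the additional arrivals that have
  left. The ordering of the discrepancies forbids both at once.\<close>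

lemma flux_avg_coupling:
  assumes "0 \<le> a" "a \<le> g" "g \<le> 1" "0 \<le> b" "b \<le> b'" "b' < 1"
    and "flux_ok b' K \<phi>1" "flux_ok b' K \<phi>2" "flux_ok b' K \<phi>3"
    and "\<And>u v w. v \<le> u \<Longrightarrow> v \<le> w \<Longrightarrow> v = w \<or> v = u \<Longrightarrow> 0 \<le> \<phi>1 u + \<phi>2 v + \<phi>3 w"
  shows "0 \<le> flux_avg p n K a b \<phi>1 + flux_avg p n K a b' \<phi>2 + flux_avg p n K g b' \<phi>3"
proof -
  have a1: "a \<le> 1" and g0: "0 \<le> g" and b1: "b < 1" and b0: "0 \<le> b'" using assms(1-6) by auto
  obtain z1 where z1: "z1 > 1" "b' * z1 < 1" "\<And>z'. z1 \<le> z' \<Longrightarrow> tame z' n (\<lambda>_. 0) (flux_ev p n K a \<phi>1)"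
    using flux_okE[OF assms(7,1) a1] by blast
  obtain z2 where z2: "z2 > 1" "b' * z2 < 1" "\<And>z'. z2 \<le> z' \<Longrightarrow> tame z' n (\<lambda>_. 0) (flux_ev p n K a \<phi>2)"
    using flux_okE[OF assms(8,1) a1] by blast
  obtain z3 where z3: "z3 > 1" "b' * z3 < 1" "\<And>z'. z3 \<le> z' \<Longrightarrow> tame z' n (\<lambda>_. 0) (flux_ev p n K g \<phi>3)"
    using flux_okE[OF assms(9) g0 assms(3)] by blast
  define z where "z = max z1 (max z2 z3)"
  have z: "z > 1" "b' * z < 1" "tame z n (\<lambda>_. 0) (flux_ev p n K a \<phi>1)" "tame z n (\<lambda>_. 0) (flux_ev p n K a \<phi>2)"
      "tame z n (\<lambda>_. 0) (flux_ev p n K g \<phi>3)"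
    using z1(1,2) z2(1,2) z3(1,2) z1(3)[of z] z2(3)[of z] z3(3)[of z] unfolding z_def by (auto simp: max_def split: if_splits)
  have "b * z \<le> b' * z" using assms(1-6) z(1) by (intro mult_right_mono) auto
  then have bz: "b * z < 1" using z(2) by linarith
  have ptw: "- flux_ev p n K a \<phi>1 x \<le> flux_ev p n K a \<phi>2 y + flux_ev p n K g \<phi>3 y"
    if xy: "\<And>j. x (n + j) = 0" "\<And>j. y (n + j) = 0" "x \<le> y" for x y
  proof -
    have 0: "x n = 0" "y n = 0" using xy(1)[of 0] xy(2)[of 0] by auto
    have le: "tot n x \<le> tot n y" unfolding tot_def using xy(3) by (intro sum_mono) (auto simp: le_fun_def)
    have "tot (Suc n) y - tot (Suc n) x = tot n y - tot n x" using 0 by (simp add: tot_def)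
    then have "0 \<le> ev p a n K (\<lambda>\<eta>. \<phi>1 (real (\<eta> n) - real (tot n x))) x
      + ev p a n K (\<lambda>\<eta>. \<phi>2 (real (\<eta> n) - real (tot n y))) y
      + ev p g n K (\<lambda>\<eta>. \<phi>3 (real (\<eta> n) - real (tot n y))) y"
      by (intro coupling3[OF p0 assms(1-3) pn xy(3), where ?\<phi>1.0="\<lambda>c. \<phi>1 (real c - real (tot n x))"
         and ?\<phi>2.0="\<lambda>c. \<phi>2 (real c - real (tot n y))" and ?\<phi>3.0="\<lambda>c. \<phi>3 (real c - real (tot n y))"] assms(10))
        (use le in auto)
    then show ?thesis by (simp add: flux_ev_def)
  qed
  have "pavg (replicate n (gw b)) (\<lambda>\<eta>. - flux_ev p n K a \<phi>1 \<eta>) (\<lambda>_. 0) \<le>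
    pavg (replicate n (gw b')) (\<lambda>\<eta>. flux_ev p n K a \<phi>2 \<eta> + flux_ev p n K g \<phi>3 \<eta>) (\<lambda>_. 0)"
  proof (rule pavg_strassen[of z])
    show "list_all2 wdom (replicate n (gw b)) (replicate n (gw b'))"
      using wdom_gw[OF assms(4-6)] by (simp add: list_all2_conv_all_nth)
    show "tame z (length (replicate n (gw b))) (\<lambda>_. 0) (\<lambda>\<eta>. - flux_ev p n K a \<phi>1 \<eta>)"
      using tame_cmult[OF z(3), of "-1"] by simp
    show "\<forall>w\<in>set (replicate n (gw b)). okw z w" by (rule okw_replicate[OF assms(4) b1 z(1) bz])
    show "\<forall>w\<in>set (replicate n (gw b')). okw z w" by (rule okw_replicate[OF b0 assms(6) z(1,2)])
  qed (use tame_add[OF z(4,5)] ptw z(1) in auto)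
  moreover have "pavg (replicate n (gw b')) (\<lambda>\<eta>. flux_ev p n K a \<phi>2 \<eta> + flux_ev p n K g \<phi>3 \<eta>) (\<lambda>_. 0) =
     flux_avg p n K a b' \<phi>2 + flux_avg p n K g b' \<phi>3" unfolding flux_avg_def
    by (rule pavg_add[OF okw_replicate[OF b0 assms(6) z(1,2)]]) (use z in auto)
  moreover have "pavg (replicate n (gw b)) (\<lambda>\<eta>. - flux_ev p n K a \<phi>1 \<eta>) (\<lambda>_. 0) = - flux_avg p n K a b \<phi>1"
    using pavg_cmult[OF okw_replicate[OF assms(4) b1 z(1) bz], of n "\<lambda>_. 0" "flux_ev p n K a \<phi>1" "-1"] z(3)
    by (simp add: flux_avg_def)
  ultimately show ?thesis by simp
qed

lemma flux_avg_mono: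
  assumes "0 \<le> a" "a \<le> 1" "0 \<le> b" "b < 1" "flux_ok b K \<phi>" "flux_ok b K \<psi>" "\<And>y. \<phi> y \<le> \<psi> y"
  shows "flux_avg p n K a b \<phi> \<le> flux_avg p n K a b \<psi>"
proof -
  have j: "flux_ok b K (\<lambda>y. 0)" by (rule flux_ok_quadratic[OF assms(3,4), where A=0 and B=0]) simp
  have j1: "flux_ok b K (\<lambda>y. \<psi> y + - 1 * \<phi> y)" by (rule flux_ok_add[OF assms(6) flux_ok_cmult[OF assms(5)]])
  have "0 \<le> flux_avg p n K a b (\<lambda>_. 0) + flux_avg p n K a b (\<lambda>y. \<psi> y + - 1 * \<phi> y) + flux_avg p n K a b (\<lambda>_. 0)"
    by (rule flux_avg_coupling[OF assms(1) order_refl assms(2,3) order_refl assms(4) j j1 j]) (use assms(7) in simp)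
  then show ?thesis
    by (simp only: flux_avg_const[OF assms(3,4)] flux_avg_add[OF assms(1-4,6) flux_ok_cmult[OF assms(5)]] flux_avg_cmult[OF assms(1-5)])
qed

end

section \<open>Responses to one added particle\<close>

lemma pavg_site: "pavg (us @ w # vs) f \<zeta> = pavg vs (\<lambda>\<eta>. wavg w (\<lambda>k. pavg us f (case_nat k \<eta>))) \<zeta>"
  by (simp add: pavg_append)

lemma pavg_sink:
  assumes "\<forall>w\<in>set ws. w sums 1"
  shows "pavg ws (\<lambda>\<eta>. f (\<eta> (length ws + j))) \<zeta> = f (\<zeta> j)"
proof -
  have "pavg ws (\<lambda>\<eta>. f (\<eta> (length ws + j))) \<zeta> = pavg ws (\<lambda>\<eta>. f (\<zeta> j)) \<zeta>"
    by (rule pavg_cong) simp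
  then show ?thesis by (simp add: pavg_const[OF assms])
qed

lemma tot_add: "tot (i + m) \<eta> = tot i \<eta> + (\<Sum>j<m. \<eta> (i + j))"
  by (induction m) (simp_all add: tot_def)

lemma tame_prefix:
  assumes "tame z (i + m) \<zeta> f" "\<And>j. \<eta> (m + j) = \<zeta> j" "0 \<le> z"
  shows "tame z i \<eta> f"
proof -
  obtain C where C: "\<And>\<eta>. (\<forall>j. \<eta> (i + m + j) = \<zeta> j) \<Longrightarrow> \<bar>f \<eta>\<bar> \<le> C * z ^ tot (i + m) \<eta>"
    using assms(1) by (auto simp: tame_def)
  have "\<bar>f x\<bar> \<le> (C * z ^ tot m \<eta>) * z ^ tot i x" if x: "\<forall>j. x (i + j) = \<eta> j" for x
  proof -
    have "\<forall>j. x (i + m + j) = \<zeta> j" using x assms(2) by (simp add: add.assoc)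
    moreover have "tot (i + m) x = tot i x + tot m \<eta>" using x by (simp add: tot_add) (simp add: tot_def)
    ultimately show ?thesis using C[of x] by (simp add: power_add mult_ac)
  qed
  then show ?thesis by (auto simp: tame_def)
qed

lemma tot_incr_at: "tot n (incr_at i \<eta>) = tot n \<eta> + (if i < n then 1 else 0)"
proof (cases "i < n")
  case True
  have s: "tot n y = y i + (\<Sum>j\<in>{..<n} - {i}. y j)" for y
    unfolding tot_def using True by (subst sum.remove[of _ i]) auto
  have "(\<Sum>j\<in>{..<n} - {i}. incr_at i \<eta> j) = (\<Sum>j\<in>{..<n} - {i}. \<eta> j)"
    by (intro sum.cong) (auto simp: incr_at_def)
  then show ?thesis using True by (simp add: s) (simp add: incr_at_def)
next
  case False
  then show ?thesis by (auto simp: tot_def incr_at_def intro!: sum.cong)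
qed

lemma tame_incr_at:
  assumes "tame z n \<zeta> f" "i < n" "0 \<le> z" shows "tame z n \<zeta> (\<lambda>\<eta>. f (incr_at i \<eta>))"
proof -
  obtain C where C: "\<And>\<eta>. (\<forall>j. \<eta> (n + j) = \<zeta> j) \<Longrightarrow> \<bar>f \<eta>\<bar> \<le> C * z ^ tot n \<eta>"
    using assms(1) by (auto simp: tame_def)
  have "\<bar>f (incr_at i \<eta>)\<bar> \<le> (C * z) * z ^ tot n \<eta>" if x: "\<forall>j. \<eta> (n + j) = \<zeta> j" for \<eta>
  proof -
    have "\<forall>j. incr_at i \<eta> (n + j) = \<zeta> j" using x assms(2) by (simp add: incr_at_def)
    from C[OF this] show ?thesis using assms(2) by (simp add: tot_incr_at mult_ac)
  qed
  then show ?thesis by (auto simp: tame_def)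
qed

lemma tame_incr_at_sink:
  assumes "tame z n (incr_at j \<zeta>) f" shows "tame z n \<zeta> (\<lambda>\<eta>. f (incr_at (n + j) \<eta>))"
proof -
  obtain C where C: "\<And>\<eta>. (\<forall>k. \<eta> (n + k) = incr_at j \<zeta> k) \<Longrightarrow> \<bar>f \<eta>\<bar> \<le> C * z ^ tot n \<eta>"
    using assms(1) by (auto simp: tame_def)
  have "\<bar>f (incr_at (n + j) \<eta>)\<bar> \<le> C * z ^ tot n \<eta>" if x: "\<forall>j. \<eta> (n + j) = \<zeta> j" for \<eta>
  proof -
    have "\<forall>k. incr_at (n + j) \<eta> (n + k) = incr_at j \<zeta> k" using x by (simp add: incr_at_def)
    from C[OF this] show ?thesis by (simp add: tot_incr_at)
  qed
  then show ?thesis by (auto simp: tame_def)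
qed

lemma pavg_incr_at_diff:
  assumes "\<forall>w\<in>set us. okw z w" "tame z (length us) (incr_at 0 \<zeta>) f" "tame z (length us) \<zeta> f"
  shows "pavg us f (incr_at 0 \<zeta>) - pavg us f \<zeta> = pavg us (\<lambda>\<eta>. f (incr_at (length us) \<eta>) - f \<eta>) \<zeta>"
proof -
  have "pavg us f (incr_at 0 \<zeta>) = pavg us (\<lambda>\<eta>. f (incr_at (length us) \<eta>)) \<zeta>"
    using pavg_incr_at[of us f 0 \<zeta>] by simp
  moreover have "tame z (length us) \<zeta> (\<lambda>\<eta>. f (incr_at (length us) \<eta>))"
    using tame_incr_at_sink[OF assms(2)] by simp
  ultimately show ?thesis by (simp add: pavg_diff[OF assms(1) _ assms(3)])
qed

lemma site_increment:
  assumes z: "z > 1" and f: "tame z (Suc (length us + m)) \<zeta> f" and ok: "\<forall>w\<in>set us. okw z w"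
    and \<eta>: "\<And>j. \<eta> (m + j) = \<zeta> j"
  shows "pavg us f (case_nat (Suc k) \<eta>) - pavg us f (case_nat k \<eta>) =
    pavg us (\<lambda>\<eta>. f (incr_at (length us) \<eta>) - f \<eta>) (case_nat k \<eta>)"
proof -
  have "tame z (length us + Suc m) \<zeta> f" using f by simp
  then have t: "tame z (length us) (case_nat k \<eta>) f" for k
    by (rule tame_prefix) (use \<eta> z in auto)
  show ?thesis using pavg_incr_at_diff[OF ok _ t[of k]] t[of "Suc k"] by (simp add: incr_at_case_nat)
qed

lemma tame_site:
  assumes f: "tame z (Suc (length us + m)) \<zeta> f" and ok: "\<forall>w\<in>set us. okw z w"
    and \<eta>: "\<And>j. \<eta> (m + j) = \<zeta> j"
  shows "tame1 z (\<lambda>k. pavg us f (case_nat k \<eta>))"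
proof (rule tame_caseD[where n=m and \<zeta>=\<zeta>])
  have "tame z (length us + Suc m) \<zeta> f" using f by simp
  from tame_pavg[OF ok this] show "tame z (Suc m) \<zeta> (pavg us f)" .
qed (use \<eta> in auto)

lemma tame_site_wavg:
  assumes f: "tame z (Suc (length us + m)) \<zeta> f" and ok: "\<forall>w\<in>set us. okw z w" and w: "okw z w"
  shows "tame z m \<zeta> (\<lambda>\<eta>. wavg w (\<lambda>k. pavg us f (case_nat k \<eta>)))"
proof (rule tame_wavg[OF w])
  have "tame z (length us + Suc m) \<zeta> f" using f by simp
  from tame_pavg[OF ok this] show "tame z (Suc m) \<zeta> (pavg us f)" .
qed

lemma pavg_lincomb:
  assumes "\<forall>w\<in>set ws. okw z w" "tame z (length ws) \<zeta> f" "tame z (length ws) \<zeta> g"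
  shows "pavg ws (\<lambda>\<eta>. c * f \<eta> + d * g \<eta>) \<zeta> = c * pavg ws f \<zeta> + d * pavg ws g \<zeta>"
  using pavg_add[OF assms(1) tame_cmult[OF assms(2)] tame_cmult[OF assms(3)]]
  by (simp only: pavg_cmult[OF assms(1,2)] pavg_cmult[OF assms(1,3)])

text \<open>Sites to the left of \<open>i\<close> are averaged inside and sites to the right
  outside, so the one-site identity \<open>gw_cov\<close> applies with all other sites
  frozen.\<close>

lemma site_cov:
  assumes z: "z > 1" and a: "0 \<le> a" "a < 1" "a * z < 1" and i: "i < n" and f: "tame z n \<zeta> f"
  shows "pavg (replicate n (gw a)) (\<lambda>\<eta>. real (\<eta> i) * f \<eta>) \<zeta> = a / (1 - a) * pavg (replicate n (gw a)) f \<zeta>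
    + a / (1 - a)\<^sup>2 * pavg (replicate i (gw a) @ hw a # replicate (n - Suc i) (gw a)) (\<lambda>\<eta>. f (incr_at i \<eta>) - f \<eta>) \<zeta>"
proof -
  let ?us = "replicate i (gw a)" and ?vs = "replicate (n - Suc i) (gw a)"
  have rep: "replicate n (gw a) = ?us @ gw a # ?vs"
    using i by (metis Suc_diff_Suc replicate_Suc replicate_app_Cons_same replicate_add add_diff_inverse_nat less_imp_le_nat not_less)
  have f': "tame z (Suc (length ?us + (n - Suc i))) \<zeta> f" using f i by simp
  have okg: "okw z (gw a)" and okh: "okw z (hw a)" using a z by (auto intro!: okw_gw okw_hw)
  have oku: "\<forall>w\<in>set ?us. okw z w" and okv: "\<forall>w\<in>set ?vs. okw z w" using okg by auto
  have Df: "tame z (Suc (length ?us + (n - Suc i))) \<zeta> (\<lambda>\<eta>. f (incr_at i \<eta>) - f \<eta>)"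
    using f i z by (simp add: tame_diff tame_incr_at)
  let ?P = "\<lambda>\<eta>. wavg (gw a) (\<lambda>k. pavg ?us f (case_nat k \<eta>))"
  let ?Q = "\<lambda>\<eta>. wavg (hw a) (\<lambda>k. pavg ?us (\<lambda>\<eta>. f (incr_at i \<eta>) - f \<eta>) (case_nat k \<eta>))"
  have tP: "tame z (n - Suc i) \<zeta> ?P" by (rule tame_site_wavg[OF f' oku okg])
  have tQ: "tame z (n - Suc i) \<zeta> ?Q" by (rule tame_site_wavg[OF Df oku okh])
  have "pavg (replicate n (gw a)) (\<lambda>\<eta>. real (\<eta> i) * f \<eta>) \<zeta> =
    pavg ?vs (\<lambda>\<eta>. wavg (gw a) (\<lambda>k. pavg ?us (\<lambda>\<eta>. real (\<eta> i) * f \<eta>) (case_nat k \<eta>))) \<zeta>"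
    unfolding rep by (rule pavg_site)
  also have "\<dots> = pavg ?vs (\<lambda>\<eta>. a / (1 - a) * ?P \<eta> + a / (1 - a)\<^sup>2 * ?Q \<eta>) \<zeta>"
  proof (rule pavg_cong)
    fix \<eta> :: conf assume "\<And>j. \<eta> (length ?vs + j) = \<zeta> j"
    then have \<eta>: "\<And>j. \<eta> (n - Suc i + j) = \<zeta> j" by simp
    have "pavg ?us (\<lambda>\<eta>. real (\<eta> i) * f \<eta>) (case_nat k \<eta>) = real k * pavg ?us f (case_nat k \<eta>)" for k
    proof -
      have "pavg ?us (\<lambda>\<eta>. real (\<eta> i) * f \<eta>) (case_nat k \<eta>) = pavg ?us (\<lambda>\<eta>. real k * f \<eta>) (case_nat k \<eta>)"
      proof (rule pavg_cong)
        fix x assume "\<And>j. x (length ?us + j) = (case_nat k \<eta>) j"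
        from this[of 0] show "real (x i) * f x = real k * f x" by simp
      qed
      also have "\<dots> = real k * pavg ?us f (case_nat k \<eta>)"
      proof (rule pavg_cmult[OF oku])
        have "tame z (length ?us + Suc (n - Suc i)) \<zeta> f" using f' by simp
        then show "tame z (length ?us) (case_nat k \<eta>) f" by (rule tame_prefix) (use \<eta> z in auto)
      qed
      finally show ?thesis .
    qed
    moreover have "wavg (gw a) (\<lambda>k. real k * pavg ?us f (case_nat k \<eta>)) = a / (1 - a) * ?P \<eta> + a / (1 - a)\<^sup>2 * ?Q \<eta>"
      using gw_cov[OF z a(1,3) tame_site[OF f' oku \<eta>]] site_increment[OF z f' oku \<eta>] by simp
    ultimately show "wavg (gw a) (\<lambda>k. pavg ?us (\<lambda>\<eta>. real (\<eta> i) * f \<eta>) (case_nat k \<eta>)) =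
      a / (1 - a) * ?P \<eta> + a / (1 - a)\<^sup>2 * ?Q \<eta>" by simp
  qed
  also have "\<dots> = a / (1 - a) * pavg ?vs ?P \<zeta> + a / (1 - a)\<^sup>2 * pavg ?vs ?Q \<zeta>"
    by (rule pavg_lincomb[OF okv]) (use tP tQ in auto)
  finally show ?thesis unfolding rep pavg_site .
qed

lemma pavg_sum:
  fixes m :: nat
  assumes "\<forall>w\<in>set ws. okw z w" "1 \<le> z" "\<And>i. i < m \<Longrightarrow> tame z (length ws) \<zeta> (f i)"
  shows "pavg ws (\<lambda>\<eta>. \<Sum>i<m. f i \<eta>) \<zeta> = (\<Sum>i<m. pavg ws (f i) \<zeta>) \<and> tame z (length ws) \<zeta> (\<lambda>\<eta>. \<Sum>i<m. f i \<eta>)"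
  using assms(3)
proof (induction m)
  case 0
  have "pavg ws (\<lambda>_. 0) \<zeta> = 0"
    using pavg_cmult[OF assms(1) tame_const[OF assms(2)], where a=0 and \<zeta>=\<zeta>] by simp
  then show ?case using assms by (auto intro: tame_const)
next
  case (Suc m)
  then show ?case using pavg_add[OF assms(1), of \<zeta> "\<lambda>\<eta>. \<Sum>i<m. f i \<eta>" "f m"]
    by (auto intro: tame_add)
qed

lemma geo_cov:
  assumes z: "z > 1" and a: "0 \<le> a" "a < 1" "a * z < 1" and f: "tame z n \<zeta> f"
    and tf: "\<And>i. i < n \<Longrightarrow> tame z n \<zeta> (\<lambda>\<eta>. real (\<eta> i) * f \<eta>)"
  shows "pavg (replicate n (gw a)) (\<lambda>\<eta>. real (tot n \<eta>) * f \<eta>) \<zeta> =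
    real n * (a / (1 - a)) * pavg (replicate n (gw a)) f \<zeta>
    + a / (1 - a)\<^sup>2 * (\<Sum>i<n. pavg (replicate i (gw a) @ hw a # replicate (n - Suc i) (gw a)) (\<lambda>\<eta>. f (incr_at i \<eta>) - f \<eta>) \<zeta>)"
proof -
  have okg: "\<forall>w\<in>set (replicate n (gw a)). okw z w" using a z by (auto intro!: okw_gw)
  have "pavg (replicate n (gw a)) (\<lambda>\<eta>. real (tot n \<eta>) * f \<eta>) \<zeta> =
    pavg (replicate n (gw a)) (\<lambda>\<eta>. \<Sum>i<n. real (\<eta> i) * f \<eta>) \<zeta>"
    by (simp add: tot_def sum_distrib_right)
  also have "\<dots> = (\<Sum>i<n. pavg (replicate n (gw a)) (\<lambda>\<eta>. real (\<eta> i) * f \<eta>) \<zeta>)"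
    using pavg_sum[OF okg, of n \<zeta> "\<lambda>i \<eta>. real (\<eta> i) * f \<eta>"] z tf by auto
  also have "\<dots> = (\<Sum>i<n. a / (1 - a) * pavg (replicate n (gw a)) f \<zeta>
    + a / (1 - a)\<^sup>2 * pavg (replicate i (gw a) @ hw a # replicate (n - Suc i) (gw a)) (\<lambda>\<eta>. f (incr_at i \<eta>) - f \<eta>) \<zeta>)"
    by (intro sum.cong refl site_cov[OF z a _ f]) auto
  finally show ?thesis by (simp add: sum.distrib sum_distrib_left)
qed

lemma site_diff_ge:
  assumes z: "z > 1" and a: "0 \<le> a" "a \<le> b" "b < 1" "b * z < 1" and i: "i < n" and f: "tame z n \<zeta> f"
    and mono: "\<And>\<eta>. (\<And>j. \<eta> (n + j) = \<zeta> j) \<Longrightarrow> f \<eta> \<le> f (incr_at i \<eta>)"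
  shows "(b - a) / (1 - a)\<^sup>2 * pavg (replicate i (gw b) @ hw a # replicate (n - Suc i) (gw a)) (\<lambda>\<eta>. f (incr_at i \<eta>) - f \<eta>) \<zeta>
     \<le> pavg (replicate (Suc i) (gw b) @ replicate (n - Suc i) (gw a)) f \<zeta>
      - pavg (replicate i (gw b) @ replicate (n - i) (gw a)) f \<zeta>"
proof -
  let ?us = "replicate i (gw b)" and ?vs = "replicate (n - Suc i) (gw a)"
  have "a * z \<le> b * z" using a z by (intro mult_right_mono) auto
  then have az: "a * z < 1" using a by linarith
  have r1: "replicate (Suc i) (gw b) @ ?vs = ?us @ gw b # ?vs"
    by (metis append_Cons append_assoc append_Nil replicate_Suc replicate_append_same)
  have r2: "?us @ replicate (n - i) (gw a) = ?us @ gw a # ?vs"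
    using i by (metis Suc_diff_Suc replicate_Suc)
  have f': "tame z (Suc (length ?us + (n - Suc i))) \<zeta> f" using f i by simp
  have oka: "okw z (gw a)" and okh: "okw z (hw a)" and okb: "okw z (gw b)" using a az z by (auto intro!: okw_gw okw_hw)
  have oku: "\<forall>w\<in>set ?us. okw z w" and okv: "\<forall>w\<in>set ?vs. okw z w" using oka okb by auto
  have Df: "tame z (Suc (length ?us + (n - Suc i))) \<zeta> (\<lambda>\<eta>. f (incr_at i \<eta>) - f \<eta>)"
    using f i z by (simp add: tame_diff tame_incr_at)
  let ?P = "\<lambda>w \<eta>. wavg w (\<lambda>k. pavg ?us f (case_nat k \<eta>))"
  let ?Q = "\<lambda>\<eta>. wavg (hw a) (\<lambda>k. pavg ?us (\<lambda>\<eta>. f (incr_at i \<eta>) - f \<eta>) (case_nat k \<eta>))"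
  have tP: "tame z (n - Suc i) \<zeta> (?P w)" if "okw z w" for w by (rule tame_site_wavg[OF f' oku that])
  have tQ: "tame z (n - Suc i) \<zeta> ?Q" by (rule tame_site_wavg[OF Df oku okh])
  have "(b - a) / (1 - a)\<^sup>2 * pavg ?vs ?Q \<zeta> = pavg ?vs (\<lambda>\<eta>. (b - a) / (1 - a)\<^sup>2 * ?Q \<eta>) \<zeta>"
    using tQ by (subst pavg_cmult[OF okv]) auto
  also have "\<dots> \<le> pavg ?vs (\<lambda>\<eta>. ?P (gw b) \<eta> - ?P (gw a) \<eta>) \<zeta>"
  proof (rule pavg_mono[OF okv])
    show "tame z (length ?vs) \<zeta> (\<lambda>\<eta>. (b - a) / (1 - a)\<^sup>2 * ?Q \<eta>)"
      by (rule tame_cmult) (use tQ in simp)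
    show "tame z (length ?vs) \<zeta> (\<lambda>\<eta>. ?P (gw b) \<eta> - ?P (gw a) \<eta>)" using tP oka okb by (auto intro: tame_diff)
    fix \<eta> :: conf assume "\<And>j. \<eta> (length ?vs + j) = \<zeta> j"
    then have \<eta>: "\<And>j. \<eta> (n - Suc i + j) = \<zeta> j" by simp
    have "pavg ?us f (case_nat k \<eta>) \<le> pavg ?us f (case_nat (Suc k) \<eta>)" for k
    proof -
      have "pavg ?us f (case_nat k \<eta>) \<le> pavg ?us (\<lambda>\<eta>. f (incr_at (length ?us) \<eta>)) (case_nat k \<eta>)"
      proof (rule pavg_mono[OF oku])
        have tf: "tame z (length ?us + Suc (n - Suc i)) \<zeta> f" using f' by simp
        show "tame z (length ?us) (case_nat k \<eta>) f" by (rule tame_prefix[OF tf]) (use \<eta> z in auto)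
        show "tame z (length ?us) (case_nat k \<eta>) (\<lambda>\<eta>. f (incr_at (length ?us) \<eta>))"
          using tame_incr_at_sink[of z "length ?us" 0 "case_nat k \<eta>" f] tame_prefix[OF tf, of "case_nat (Suc k) \<eta>"] \<eta> z
          by (simp add: incr_at_case_nat)
        fix x assume x: "\<And>j. x (length ?us + j) = (case_nat k \<eta>) j"
        have "x (n + j) = \<zeta> j" for j using x[of "Suc (n - Suc i + j)"] \<eta>[of j] i by simp
        from mono[OF this] show "f x \<le> f (incr_at (length ?us) x)" by simp
      qed
      then show ?thesis using pavg_incr_at[of ?us f 0 "case_nat k \<eta>"] by (simp add: incr_at_case_nat)
    qed
    from gw_diff_ge[OF _ a tame_site[OF f' oku \<eta>] this] z
    show "(b - a) / (1 - a)\<^sup>2 * ?Q \<eta> \<le> ?P (gw b) \<eta> - ?P (gw a) \<eta>"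
      using site_increment[OF z f' oku \<eta>] by simp
  qed
  also have "\<dots> = pavg ?vs (?P (gw b)) \<zeta> - pavg ?vs (?P (gw a)) \<zeta>"
    using tP oka okb by (subst pavg_diff[OF okv]) auto
  finally show ?thesis unfolding r1 r2 pavg_site .
qed

text \<open>The density is raised site by site from the left. The increment at site \<open>i\<close>
  is taken with \<open>b\<close> before \<open>i\<close> and still with \<open>a\<close> after
  it.\<close>

lemma geo_diff_ge:
  assumes z: "z > 1" and a: "0 \<le> a" "a \<le> b" "b < 1" "b * z < 1" and f: "tame z n \<zeta> f"
    and mono: "\<And>i \<eta>. i < n \<Longrightarrow> (\<And>j. \<eta> (n + j) = \<zeta> j) \<Longrightarrow> f \<eta> \<le> f (incr_at i \<eta>)"
  shows "(b - a) / (1 - a)\<^sup>2 * (\<Sum>i<n. pavg (replicate i (gw b) @ hw a # replicate (n - Suc i) (gw a)) (\<lambda>\<eta>. f (incr_at i \<eta>) - f \<eta>) \<zeta>)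
     \<le> pavg (replicate n (gw b)) f \<zeta> - pavg (replicate n (gw a)) f \<zeta>"
proof -
  define H where "H i = pavg (replicate i (gw b) @ replicate (n - i) (gw a)) f \<zeta>" for i
  have "(b - a) / (1 - a)\<^sup>2 * (\<Sum>i<n. pavg (replicate i (gw b) @ hw a # replicate (n - Suc i) (gw a)) (\<lambda>\<eta>. f (incr_at i \<eta>) - f \<eta>) \<zeta>)
    \<le> (\<Sum>i<n. H (Suc i) - H i)" unfolding sum_distrib_left H_def
    by (intro sum_mono site_diff_ge[OF z a _ f]) (use mono in auto)
  also have "\<dots> = H n - H 0" by (rule sum_lessThan_telescope)
  finally show ?thesis by (simp add: H_def)
qed

text \<open>Exponential tilting site by site: \<open>gw b k * (g / b) ^ k\<close> is
  \<open>(1 - b) / (1 - g)\<close> times \<open>gw g k\<close>.\<close>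

lemma pavg_tilt:
  assumes b: "0 < b" "b < 1" and g: "0 < g" "g < 1" and z: "1 < z" "g * z < 1" and F: "tame z m \<zeta> F"
  shows "pavg (replicate m (gw b)) (\<lambda>\<eta>. (g / b) ^ tot m \<eta> * F \<eta>) \<zeta> =
    ((1 - b) / (1 - g)) ^ m * pavg (replicate m (gw g)) F \<zeta>"
  using F
proof (induction m arbitrary: F)
  case (Suc m)
  have okg: "okw z (gw g)" using g z by (auto intro!: okw_gw)
  let ?F = "\<lambda>\<eta>. wavg (gw g) (\<lambda>k. F (case_nat k \<eta>))"
  have tF: "tame z m \<zeta> ?F" by (rule tame_wavg[OF okg Suc.prems])
  have "pavg (replicate (Suc m) (gw b)) (\<lambda>\<eta>. (g / b) ^ tot (Suc m) \<eta> * F \<eta>) \<zeta> =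
    pavg (replicate m (gw b)) (\<lambda>\<eta>. wavg (gw b) (\<lambda>k. (g / b) ^ (k + tot m \<eta>) * F (case_nat k \<eta>))) \<zeta>"
    by (simp add: tot_case_nat)
  also have "\<dots> = pavg (replicate m (gw b)) (\<lambda>\<eta>. (g / b) ^ tot m \<eta> * ((1 - b) / (1 - g) * ?F \<eta>)) \<zeta>"
  proof (rule pavg_cong)
    fix \<eta> :: conf assume "\<And>j. \<eta> (length (replicate m (gw b)) + j) = \<zeta> j"
    then have t: "tame1 z (\<lambda>k. F (case_nat k \<eta>))"
      by (intro tame_caseD[OF Suc.prems]) auto
    have "gw b k * ((g / b) ^ (k + tot m \<eta>) * F (case_nat k \<eta>)) =
      ((g / b) ^ tot m \<eta> * ((1 - b) / (1 - g))) * (gw g k * F (case_nat k \<eta>))" for k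
      using b g by (simp add: gw_def power_add power_divide)
    then have eq: "(\<lambda>k. gw b k * ((g / b) ^ (k + tot m \<eta>) * F (case_nat k \<eta>))) =
      (\<lambda>k. ((g / b) ^ tot m \<eta> * ((1 - b) / (1 - g))) * (gw g k * F (case_nat k \<eta>)))" by (rule ext)
    show "wavg (gw b) (\<lambda>k. (g / b) ^ (k + tot m \<eta>) * F (case_nat k \<eta>)) =
      (g / b) ^ tot m \<eta> * ((1 - b) / (1 - g) * ?F \<eta>)"
      unfolding wavg_def eq suminf_mult[OF summable_wavg[OF okg t]] by (simp only: mult.assoc)
  qed
  also have "\<dots> = ((1 - b) / (1 - g)) ^ m * pavg (replicate m (gw g)) (\<lambda>\<eta>. (1 - b) / (1 - g) * ?F \<eta>) \<zeta>"
    by (rule Suc.IH) (rule tame_cmult[OF tF])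
  also have "pavg (replicate m (gw g)) (\<lambda>\<eta>. (1 - b) / (1 - g) * ?F \<eta>) \<zeta> =
    (1 - b) / (1 - g) * pavg (replicate m (gw g)) ?F \<zeta>"
    by (rule pavg_cmult[of _ z]) (use okg tF in auto)
  finally show ?case by (simp add: mult_ac)
qed simp

section \<open>The binomial count at the sink, and stationarity\<close>

lemma mstep_0: "mstep (rate p g) act 0 f s = f s + p * g * (f (incr_at 0 s) - f s)"
  by (simp add: mstep_def rate_def incr_at_def)

lemma ev_0_power: "ev p g 0 K (\<lambda>\<zeta>. x ^ \<zeta> 0) \<zeta> = (1 + p * g * (x - 1)) ^ K * x ^ \<zeta> 0"
proof (induction K arbitrary: \<zeta>)
  case (Suc K)
  then show ?case unfolding ev_def miter_Suc mstep_0 by (simp add: incr_at_def algebra_simps)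
qed (simp add: ev_def)

lemma ev_0_linear: "ev p g 0 K (\<lambda>\<zeta>. real (\<zeta> 0)) \<zeta> = real (\<zeta> 0) + real K * (p * g)"
proof (induction K arbitrary: \<zeta>)
  case (Suc K)
  then show ?case unfolding ev_def miter_Suc mstep_0 by (simp add: incr_at_def algebra_simps)
qed (simp add: ev_def)

lemma ev_0_square: "ev p g 0 K (\<lambda>\<zeta>. (real (\<zeta> 0))\<^sup>2) \<zeta> =
   (real (\<zeta> 0) + real K * (p * g))\<^sup>2 + real K * (p * g) * (1 - p * g)"
proof (induction K arbitrary: \<zeta>)
  case (Suc K)
  have "ev p g 0 (Suc K) (\<lambda>\<zeta>. (real (\<zeta> 0))\<^sup>2) \<zeta> = ev p g 0 K (\<lambda>\<zeta>. (real (\<zeta> 0))\<^sup>2) \<zeta> +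
     p * g * (ev p g 0 K (\<lambda>\<zeta>. (real (\<zeta> 0))\<^sup>2) (incr_at 0 \<zeta>) - ev p g 0 K (\<lambda>\<zeta>. (real (\<zeta> 0))\<^sup>2) \<zeta>)"
    unfolding ev_def miter_Suc mstep_0 ..
  then show ?case unfolding Suc by (simp add: incr_at_def power2_eq_square algebra_simps)
qed (simp add: ev_def)

lemma ev_0_invariant:
  assumes "\<And>\<zeta>. h (incr_at 0 \<zeta>) = h \<zeta>" shows "ev p g 0 K h = h"
  by (induction K) (simp_all add: ev_def miter_Suc mstep_0 assms fun_eq_iff)

lemma tame_tail:
  assumes "1 \<le> z" "i \<le> n" shows "tame z i \<zeta> (\<lambda>\<eta>. f (\<eta> n))"
proof -
  have "f (\<eta> n) = f (\<zeta> (n - i))" if "\<And>j. \<eta> (i + j) = \<zeta> j" for \<eta> using that[of "n - i"] assms by simp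
  then show ?thesis using tame_bound[OF tame_const[OF assms(1), of i \<zeta> "f (\<zeta> (n - i))"]] by simp
qed

lemma pavg_snk:
  assumes "0 \<le> a" "a < 1" "i \<le> n"
  shows "pavg (replicate i (gw a)) (\<lambda>\<eta>. f (\<eta> n)) \<zeta> = f (\<zeta> (n - i))"
  using pavg_sink[of "replicate i (gw a)" f "n - i" \<zeta>] gw_sums[OF assms(1,2)] assms(3) by simp

text \<open>Burke's theorem with all \<open>n\<close> sites deleted leaves only the sink, and the
  averaged observable does not see the count there.\<close>

lemma stationary:
  assumes "0 \<le> a" "okw z (gw a)" "\<And>\<zeta>. tame z n \<zeta> f"
    "\<And>\<zeta>. pavg (replicate n (gw a)) f (incr_at 0 \<zeta>) = pavg (replicate n (gw a)) f \<zeta>"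
  shows "pavg (replicate n (gw a)) (ev p a n K f) \<zeta> = pavg (replicate n (gw a)) f \<zeta>"
proof -
  have "pavg (replicate n (gw a)) (ev p a n K f) \<zeta> = ev p a 0 K (pavg (replicate n (gw a)) f) \<zeta>"
    using burke[of z n 0 f a p K \<zeta>] assms by simp
  also have "ev p a 0 K (pavg (replicate n (gw a)) f) = pavg (replicate n (gw a)) f"
    by (rule ev_0_invariant) (rule assms(4))
  finally show ?thesis .
qed

lemma burke_snk:
  assumes "0 \<le> a" "a < 1"
  shows "pavg (replicate n (gw a)) (ev p a n K (\<lambda>\<eta>. f (\<eta> n))) \<zeta> = ev p a 0 K (\<lambda>\<zeta>. f (\<zeta> 0)) \<zeta>"
proof -
  have "pavg (replicate n (gw a)) (ev p a (n + 0) K (\<lambda>\<eta>. f (\<eta> n))) \<zeta> = ev p a 0 K (pavg (replicate n (gw a)) (\<lambda>\<eta>. f (\<eta> n))) \<zeta>"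
    by (rule burke[of "mid_radius a"]) (use mid_radius[OF assms] assms in \<open>auto intro!: tame_tail okw_gw\<close>)
  moreover have "pavg (replicate n (gw a)) (\<lambda>\<eta>. f (\<eta> n)) = (\<lambda>\<zeta>. f (\<zeta> 0))"
    using pavg_snk[OF assms, of n n f] by (intro ext) simp
  ultimately show ?thesis by simp
qed

text \<open>The probability that a discrepancy started at the left end of a stretch of \<open>m\<close> sites has left it.
  By Burke's theorem it does not depend on what lies to the left of the stretch.\<close>

definition qpass :: "real \<Rightarrow> real \<Rightarrow> nat \<Rightarrow> nat \<Rightarrow> real" where
  "qpass p a K m = pavg (hw a # replicate (m - 1) (gw a)) (Dsnk p a m K 0) (\<lambda>_. 0)"

context chain begin

lemma chain_le: "m \<le> n \<Longrightarrow> p * (real m + 1) \<le> 1"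
  using pn p0 mult_left_mono[of "real m + 1" "real n + 1" p] by simp

text \<open>For \<open>c\<close> departures and \<open>s\<close> initial particles the exponential
  is, up to a constant, \<open>(g / b) ^ s * (b / g) ^ c\<close>. The first factor tilts the initial
  density from \<open>b\<close> to the arrival density \<open>g\<close>. The stretch is then
  stationary, and by Burke's theorem the departures are binomial with success probability
  \<open>p * g\<close>.\<close>

lemma flux_avg_exp:
  assumes g: "0 < g" "g < 1" and b: "0 < b" "b < 1"
  shows "flux_avg p n K g b (\<lambda>y. exp (- (ln g - ln b) * (y - r))) =
    exp ((ln g - ln b) * r) * ((1 - b) / (1 - g)) ^ n * (1 + p * (b - g)) ^ K"
proof -
  define t where "t = ln g - ln b"
  define F where "F = ev p g n K (\<lambda>\<eta>'. (b / g) ^ \<eta>' n)"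
  have et: "exp t = g / b" "exp (- t) = b / g" using g b by (simp_all add: t_def exp_diff exp_minus)
  have "exp (- t * (real c - real s - r)) = (exp (t * r) * (g / b) ^ s) * (b / g) ^ c" for c s :: nat
  proof -
    have "exp (- t * (real c - real s - r)) = exp (t * r) * exp (real s * t) * exp (real c * (- t))"
      by (simp add: exp_add[symmetric] algebra_simps)
    then show ?thesis by (simp only: exp_of_nat_mult et)
  qed
  then have flux_ev: "flux_ev p n K g (\<lambda>y. exp (- t * (y - r))) = (\<lambda>\<eta>. exp (t * r) * ((g / b) ^ tot n \<eta> * F \<eta>))"
    unfolding flux_ev_def F_def ev_def by (simp only: miter_cmult mult.assoc)
  have z: "mid_radius g > 1" "g * mid_radius g < 1" using mid_radius g by auto
  have tF: "tame z n (\<lambda>_. 0) F" if z: "z \<ge> 1" for z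
    unfolding tame_def
  proof (intro exI[of _ "max 1 (b / g) ^ K"] allI impI)
    fix \<eta> :: conf assume "\<forall>j. \<eta> (n + j) = 0"
    then have 0: "\<eta> n = 0" by (metis add_0_right)
    have "\<bar>F \<eta>\<bar> \<le> max 1 (b / g) ^ K" unfolding F_def
    proof (rule ev_snk_abs[OF p0 _ _ pn, where \<phi>="\<lambda>c. (b / g) ^ c"])
      fix c assume "\<eta> n \<le> c" "c \<le> \<eta> n + K"
      have "\<bar>(b / g) ^ c\<bar> \<le> max 1 (b / g) ^ c" using g b by (simp, intro power_mono) auto
      also have "\<dots> \<le> max 1 (b / g) ^ K" using \<open>c \<le> \<eta> n + K\<close> 0 by (intro power_increasing) auto
      finally show "\<bar>(b / g) ^ c\<bar> \<le> max 1 (b / g) ^ K" .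
    qed (use g in auto)
    also have "\<dots> \<le> max 1 (b / g) ^ K * z ^ tot n \<eta>"
      using one_le_power[OF z, of "tot n \<eta>"] mult_left_mono[of 1 "z ^ tot n \<eta>" "max 1 (b / g) ^ K"] by simp
    finally show "\<bar>F \<eta>\<bar> \<le> max 1 (b / g) ^ K * z ^ tot n \<eta>" .
  qed
  have "flux_avg p n K g b (\<lambda>y. exp (- t * (y - r))) = exp (t * r) * pavg (replicate n (gw b)) (\<lambda>\<eta>. (g / b) ^ tot n \<eta> * F \<eta>) (\<lambda>_. 0)"
  proof -
    \<comment> \<open>The tilted observable grows like \<open>(g / b) ^ tot n \<eta>\<close>, so its
      radius must reach \<open>g / b\<close> and stay below \<open>1 / b\<close>. There is room
      because \<open>g < 1\<close>.\<close>
    have "1 < 1 / b" "g / b < 1 / b" using g b by (auto simp: field_simps)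
    then obtain y where y: "max 1 (g / b) < y" "y < 1 / b" using dense[of "max 1 (g / b)" "1 / b"] by auto
    have by1: "b * y < 1" using y(2) b by (simp add: field_simps)
    obtain C where C: "\<And>\<eta>. (\<forall>j. \<eta> (n + j) = 0) \<Longrightarrow> \<bar>F \<eta>\<bar> \<le> C * 1 ^ tot n \<eta>"
      using tF[of 1] by (auto simp: tame_def)
    have "tame y n (\<lambda>_. 0) (\<lambda>\<eta>. (g / b) ^ tot n \<eta> * F \<eta>)" unfolding tame_def
    proof (intro exI[of _ C] allI impI)
      fix \<eta> :: conf assume "\<forall>j. \<eta> (n + j) = 0"
      then have 1: "\<bar>F \<eta>\<bar> \<le> C" using C by simp
      have "(g / b) ^ tot n \<eta> \<le> y ^ tot n \<eta>" using y g b by (intro power_mono) auto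
      then have "(g / b) ^ tot n \<eta> * \<bar>F \<eta>\<bar> \<le> y ^ tot n \<eta> * C" using 1 y by (intro mult_mono) auto
      then show "\<bar>(g / b) ^ tot n \<eta> * F \<eta>\<bar> \<le> C * y ^ tot n \<eta>" using g b by (simp add: abs_mult mult_ac)
    qed
    then show ?thesis unfolding flux_avg_def flux_ev
      by (intro pavg_cmult[of _ y]) (use okw_replicate[of b y n] b y by1 in auto)
  qed
  also have "pavg (replicate n (gw b)) (\<lambda>\<eta>. (g / b) ^ tot n \<eta> * F \<eta>) (\<lambda>_. 0) =
     ((1 - b) / (1 - g)) ^ n * pavg (replicate n (gw g)) F (\<lambda>_. 0)"
    by (rule pavg_tilt[OF b g z tF]) (use z in auto)
  also have "pavg (replicate n (gw g)) F (\<lambda>_. 0) = (1 + p * g * (b / g - 1)) ^ K"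
    unfolding F_def using burke_snk[of g n p K "\<lambda>c. (b / g) ^ c"] g by (simp add: ev_0_power)
  also have "p * g * (b / g - 1) = p * (b - g)" using g by (simp add: field_simps)
  finally show ?thesis by (simp add: t_def mult.assoc)
qed

section \<open>Passage probabilities, variance and density dependence of the flux\<close>

lemma tame_ev_snk:
  assumes "0 \<le> a" "a \<le> 1" "1 \<le> z" "i \<le> n" shows "tame z i \<zeta> (ev p a n K (snk n))"
proof (rule tame_bound[OF tame_tail[OF assms(3,4), of _ "\<lambda>c. real c + real K"]])
  fix \<eta> show "\<bar>ev p a n K (snk n) \<eta>\<bar> \<le> \<bar>real (\<eta> n) + real K\<bar>"
    using ev_snk_bound[OF p0 assms(1,2) pn, of K \<eta>] by simp
qed

lemma tame_Dsnk:
  assumes "0 \<le> a" "a \<le> 1" "1 \<le> z" "j \<le> n" shows "tame z i \<zeta> (Dsnk p a n K j)"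
  by (rule tame_bound[OF tame_const[OF assms(3), of i \<zeta> 1]])
    (use Dsnk_bounds[OF p0 assms(1,2) pn assms(4)] in \<open>auto simp: abs_le_iff intro: order_trans[of _ 0]\<close>)

text \<open>Once the \<open>i\<close> sites before it are averaged out, a discrepancy at
  \<open>i\<close> sits at the left end of the remaining stretch. Burke's theorem applies to both
  terms of \<open>Dsnk\<close>.\<close>

lemma Dsnk_burke:
  assumes "0 \<le> a" "a < 1" "i \<le> n"
  shows "pavg (replicate i (gw a)) (Dsnk p a n K i) \<zeta> = Dsnk p a (n - i) K 0 \<zeta>"
proof -
  have z: "mid_radius a > 1" "a * mid_radius a < 1" using mid_radius assms by auto
  let ?F = "ev p a n K (snk n)"
  have ok: "\<forall>w\<in>set (replicate i (gw a)). okw (mid_radius a) w" using assms z by (auto intro!: okw_gw)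
  have B: "pavg (replicate i (gw a)) ?F \<zeta> = ev p a (n - i) K (snk (n - i)) \<zeta>" for \<zeta>
  proof -
    have "pavg (replicate i (gw a)) (ev p a (i + (n - i)) K (snk n)) \<zeta> = ev p a (n - i) K (pavg (replicate i (gw a)) (snk n)) \<zeta>"
      by (rule burke[of "mid_radius a"]) (use z assms in \<open>auto intro!: tame_tail okw_gw\<close>)
    moreover have "pavg (replicate i (gw a)) (snk n) = snk (n - i)"
      using pavg_snk[OF assms, of real] by (rule ext)
    ultimately show ?thesis using assms by simp
  qed
  have "pavg (replicate i (gw a)) (\<lambda>\<eta>. ?F (incr_at (length (replicate i (gw a))) \<eta>) - ?F \<eta>) \<zeta> =
     pavg (replicate i (gw a)) ?F (incr_at 0 \<zeta>) - pavg (replicate i (gw a)) ?F \<zeta>"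
    by (rule pavg_incr_at_diff[OF ok, symmetric]) (use z assms in \<open>auto intro!: tame_ev_snk\<close>)
  then show ?thesis unfolding B by (simp add: Dsnk_def[abs_def])
qed

lemma site_qpass:
  assumes "0 \<le> a" "a < 1" "i < n"
  shows "pavg (replicate i (gw a) @ hw a # replicate (n - Suc i) (gw a)) (Dsnk p a n K i) (\<lambda>_. 0) = qpass p a K (n - i)"
  unfolding pavg_site Dsnk_burke[OF assms(1,2) less_imp_le[OF assms(3)]] qpass_def by simp

lemma sum_qpass:
  assumes "0 \<le> a" "a < 1"
  shows "(\<Sum>i<n. f (pavg (replicate i (gw a) @ hw a # replicate (n - Suc i) (gw a)) (Dsnk p a n K i) (\<lambda>_. 0)))
    = (\<Sum>m\<in>{1..n}. f (qpass p a K m))"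
proof -
  have "(\<Sum>i<n. f (pavg (replicate i (gw a) @ hw a # replicate (n - Suc i) (gw a)) (Dsnk p a n K i) (\<lambda>_. 0))) =
    (\<Sum>i<n. f (qpass p a K (n - i)))" using site_qpass[OF assms] by simp
  also have "\<dots> = (\<Sum>m\<in>{1..n}. f (qpass p a K m))"
    by (rule sum.reindex_bij_witness[where i="\<lambda>m. n - m" and j="\<lambda>i. n - i"]) auto
  finally show ?thesis .
qed

lemma pavg_tot:
  assumes "0 \<le> b" "b < 1"
  shows "pavg (replicate n (gw b)) (\<lambda>\<eta>. real (tot n \<eta>)) \<zeta> = real n * (b / (1 - b))"
proof -
  have z: "mid_radius b > 1" "b * mid_radius b < 1" using mid_radius assms by auto
  have "tame (mid_radius b) n \<zeta> (\<lambda>\<eta>. real (\<eta> i))" if "i < n" for i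
  proof (rule tame_bound[OF tame_tot[OF z(1)]])
    fix \<eta> :: conf
    have "\<eta> i \<le> tot n \<eta>" unfolding tot_def using that by (intro member_le_sum) auto
    then show "\<bar>real (\<eta> i)\<bar> \<le> \<bar>real (tot n \<eta>)\<bar>" by simp
  qed
  moreover have "pavg (replicate i (gw b) @ hw b # replicate (n - Suc i) (gw b)) (\<lambda>_. 0) \<zeta> = 0" for i
    by (rule pavg_const) (use gw_sums hw_sums assms in auto)
  moreover have "pavg (replicate n (gw b)) (\<lambda>_. 1) \<zeta> = 1"
    by (rule pavg_const) (use gw_sums assms in auto)
  ultimately show ?thesis using geo_cov[OF z(1) assms z(2) tame_const[of "mid_radius b" n \<zeta> 1]] z by simp
qed

lemma flux_ev_id: "flux_ev p n K g (\<lambda>y. y) \<eta> = ev p g n K (snk n) \<eta> - real (tot n \<eta>)"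
  by (simp add: flux_ev_def ev_def miter_diff)

lemma flux_avg_id:
  assumes "0 \<le> g" "g \<le> 1" "0 \<le> b" "b < 1"
  shows "flux_avg p n K g b (\<lambda>y. y) = pavg (replicate n (gw b)) (ev p g n K (snk n)) (\<lambda>_. 0) - real n * (b / (1 - b))"
proof -
  have z: "mid_radius b > 1" "b * mid_radius b < 1" using mid_radius assms by auto
  have "flux_avg p n K g b (\<lambda>y. y) = pavg (replicate n (gw b)) (\<lambda>\<eta>. ev p g n K (snk n) \<eta> - real (tot n \<eta>)) (\<lambda>_. 0)"
    by (simp add: flux_avg_def flux_ev_id[abs_def])
  also have "\<dots> = pavg (replicate n (gw b)) (ev p g n K (snk n)) (\<lambda>_. 0) - pavg (replicate n (gw b)) (\<lambda>\<eta>. real (tot n \<eta>)) (\<lambda>_. 0)"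
    by (rule pavg_diff[of _ "mid_radius b"]) (use okw_replicate[OF assms(3,4) z] assms z in \<open>auto intro!: tame_ev_snk tame_tot\<close>)
  finally show ?thesis by (simp add: pavg_tot[OF assms(3,4)])
qed

lemma flux_avg_mean:
  assumes "0 \<le> a" "a < 1"
  shows "flux_avg p n K a a (\<lambda>y. y) = real K * p * a - real n * (a / (1 - a))"
  using flux_avg_id[of a a K] burke_snk[OF assms, of n p K real "\<lambda>_. 0"] assms by (simp add: ev_0_linear)

text \<open>Minus the flux, as a function of the initial configuration, grows by
  \<open>1 - Dsnk\<close> when a particle is added. Raising the density site by site yields these
  responses with density \<open>b\<close> to the left of the site. Lowering it to \<open>a\<close>
  there only decreases them, by \<open>Dsnk_antimono\<close>, and the stationary responses are
  \<open>1 - qpass\<close>.\<close>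

lemma flux_avg_diff_ge:
  assumes "0 \<le> a" "a \<le> b" "b < 1"
  shows "(b - a) / (1 - a)\<^sup>2 * (\<Sum>m\<in>{1..n}. 1 - qpass p a K m) \<le> flux_avg p n K a a (\<lambda>y. y) - flux_avg p n K a b (\<lambda>y. y)"
proof -
  have a1: "a < 1" "a \<le> 1" and b0: "0 \<le> b" using assms by auto
  define z where "z = mid_radius b"
  have z: "z > 1" "b * z < 1" using mid_radius assms by (auto simp: z_def)
  have "a * z \<le> b * z" using assms z by (intro mult_right_mono) auto
  then have az: "a * z < 1" using z by linarith
  define F where "F \<eta> = real (tot n \<eta>) - ev p a n K (snk n) \<eta>" for \<eta>
  have tF: "tame z n (\<lambda>_. 0) F" unfolding F_def
    by (intro tame_diff tame_tot tame_ev_snk) (use assms z in auto)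
  have DF: "F (incr_at i \<eta>) - F \<eta> = 1 - Dsnk p a n K i \<eta>" if "i < n" for i \<eta>
    using that by (simp add: F_def Dsnk_def tot_incr_at)
  have oka: "okw z (gw a)" "okw z (gw b)" "okw z (hw a)" using assms z az by (auto intro!: okw_gw okw_hw)
  have "(\<Sum>m\<in>{1..n}. 1 - qpass p a K m) =
    (\<Sum>i<n. 1 - pavg (replicate i (gw a) @ hw a # replicate (n - Suc i) (gw a)) (Dsnk p a n K i) (\<lambda>_. 0))"
    by (rule sum_qpass[OF assms(1) a1(1), symmetric])
  also have "\<dots> \<le> (\<Sum>i<n. pavg (replicate i (gw b) @ hw a # replicate (n - Suc i) (gw a)) (\<lambda>\<eta>. F (incr_at i \<eta>) - F \<eta>) (\<lambda>_. 0))"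
  proof (intro sum_mono)
    fix i assume "i \<in> {..<n}"
    then have i: "i < n" by simp
    let ?ws = "\<lambda>b. replicate i (gw b) @ hw a # replicate (n - Suc i) (gw a)"
    have ok: "\<forall>w\<in>set (?ws a). okw z w" "\<forall>w\<in>set (?ws b). okw z w" using oka by auto
    have tD: "tame z (length (?ws b)) (\<lambda>_. 0) (Dsnk p a n K i)" for b
      using i by (intro tame_Dsnk) (use assms a1 z in auto)
    have tD1: "tame z (length (?ws b)) (\<lambda>_. 0) (\<lambda>\<eta>. 1 - Dsnk p a n K i \<eta>)" for b
      by (rule tame_diff[OF tame_const tD]) (use z in auto)
    have "pavg (?ws a) (\<lambda>_. 1) (\<lambda>_. 0) = 1"
      by (rule pavg_const) (use gw_sums[OF assms(1) a1(1)] hw_sums[OF assms(1) a1(1)] in auto)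
    then have "1 - pavg (?ws a) (Dsnk p a n K i) (\<lambda>_. 0) = pavg (?ws a) (\<lambda>\<eta>. 1 - Dsnk p a n K i \<eta>) (\<lambda>_. 0)"
      using pavg_diff[OF ok(1) tame_const tD, of 1] z by simp
    also have "\<dots> \<le> pavg (?ws b) (\<lambda>\<eta>. 1 - Dsnk p a n K i \<eta>) (\<lambda>_. 0)"
    proof (rule pavg_strassen[of z])
      show "list_all2 wdom (?ws a) (?ws b)"
        using wdom_gw[OF assms] wdom_refl gw_sums[OF assms(1) a1(1)] hw_sums[OF assms(1) a1(1)]
        by (intro list_all2_appendI list_all2_Cons[THEN iffD2] conjI) (auto simp: list_all2_conv_all_nth)
      fix x y :: conf assume "x \<le> y"
      show "1 - Dsnk p a n K i x \<le> 1 - Dsnk p a n K i y"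
        using Dsnk_antimono[OF p0 assms(1) order_refl a1(2) pn \<open>x \<le> y\<close>, of i] i by simp
    next
      show "tame z (length (?ws a)) (\<lambda>_. 0) (\<lambda>\<eta>. 1 - Dsnk p a n K i \<eta>)" by (rule tD1)
      then show "tame z (length (?ws a)) (\<lambda>_. 0) (\<lambda>\<eta>. 1 - Dsnk p a n K i \<eta>)" .
    qed (use z ok in auto)
    finally show "1 - pavg (?ws a) (Dsnk p a n K i) (\<lambda>_. 0) \<le> pavg (?ws b) (\<lambda>\<eta>. F (incr_at i \<eta>) - F \<eta>) (\<lambda>_. 0)"
      using i by (simp add: DF)
  qed
  finally have "(b - a) / (1 - a)\<^sup>2 * (\<Sum>m\<in>{1..n}. 1 - qpass p a K m) \<le>
    (b - a) / (1 - a)\<^sup>2 * (\<Sum>i<n. pavg (replicate i (gw b) @ hw a # replicate (n - Suc i) (gw a)) (\<lambda>\<eta>. F (incr_at i \<eta>) - F \<eta>) (\<lambda>_. 0))"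
    using assms by (intro mult_left_mono) auto
  also have "\<dots> \<le> pavg (replicate n (gw b)) F (\<lambda>_. 0) - pavg (replicate n (gw a)) F (\<lambda>_. 0)"
  proof (rule geo_diff_ge[OF z(1) assms z(2) tF])
    fix i \<eta> assume "i < n"
    then show "F \<eta> \<le> F (incr_at i \<eta>)"
      using DF[of i \<eta>] Dsnk_bounds(2)[OF p0 assms(1) a1(2) pn, of i K \<eta>] by simp
  qed
  finally have "(b - a) / (1 - a)\<^sup>2 * (\<Sum>m\<in>{1..n}. 1 - qpass p a K m) \<le>
     pavg (replicate n (gw b)) F (\<lambda>_. 0) - pavg (replicate n (gw a)) F (\<lambda>_. 0)" .
  moreover have "pavg (replicate n (gw c)) F (\<lambda>_. 0) = - flux_avg p n K a c (\<lambda>y. y)" if "okw z (gw c)" for c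
  proof -
    have "flux_ev p n K a (\<lambda>y. y) = (\<lambda>\<eta>. - 1 * F \<eta>)" by (simp add: flux_ev_id F_def fun_eq_iff)
    then show ?thesis using pavg_cmult[of "replicate n (gw c)" z "\<lambda>_. 0" F "-1"] tF that by (simp add: flux_avg_def)
  qed
  ultimately show ?thesis using oka by simp
qed

end

context chain begin

lemma qpass_bounds:
  assumes "0 \<le> a" "a < 1" "1 \<le> m" "m \<le> n"
  shows "0 \<le> qpass p a K m" "qpass p a K m \<le> 1"
proof -
  interpret m: chain p m using p0 chain_le[OF assms(4)] by unfold_locales
  have z: "mid_radius a > 1" "a * mid_radius a < 1" using mid_radius assms by auto
  let ?ws = "hw a # replicate (m - 1) (gw a)"
  have ok: "\<forall>w\<in>set ?ws. okw (mid_radius a) w" using assms z by (auto intro!: okw_gw okw_hw)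
  have c: "pavg ?ws (\<lambda>_. c) (\<lambda>_. 0) = c" for c
    by (rule pavg_const) (use gw_sums hw_sums assms in auto)
  have t: "tame (mid_radius a) (length ?ws) (\<lambda>_. 0) (Dsnk p a m K 0)"
    by (rule m.tame_Dsnk) (use assms z in auto)
  have "pavg ?ws (\<lambda>_. 0) (\<lambda>_. 0) \<le> qpass p a K m" unfolding qpass_def
    by (rule pavg_mono[OF ok tame_const t]) (use z Dsnk_bounds[OF p0 _ _ m.pn] assms in auto)
  then show "0 \<le> qpass p a K m" using c by simp
  have "qpass p a K m \<le> pavg ?ws (\<lambda>_. 1) (\<lambda>_. 0)" unfolding qpass_def
    by (rule pavg_mono[OF ok t tame_const]) (use z Dsnk_bounds[OF p0 _ _ m.pn] assms in auto)
  then show "qpass p a K m \<le> 1" using c by simp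
qed

text \<open>The mean departure of one more step is \<open>p\<close> times the indicator that the
  last site is occupied, an increasing observable. An added particle can therefore only increase its
  expectation.\<close>

lemma Dsnk_time_mono:
  assumes "0 \<le> a" "a \<le> 1" "1 \<le> n"
  shows "Dsnk p a n K 0 \<eta> \<le> Dsnk p a n (Suc K) 0 \<eta>"
proof -
  define \<psi> where "\<psi> \<eta> = (if \<eta> (n - 1) = 0 then 0 else p)" for \<eta> :: conf
  have "mstep (rate p a) act n (snk n) \<eta> = real (\<eta> n) + \<psi> \<eta>" for \<eta>
  proof -
    have "(\<Sum>l\<le>n. rate p a l * (real (act l \<eta> n) - real (\<eta> n))) = (\<Sum>l\<in>{n}. rate p a l * (real (act l \<eta> n) - real (\<eta> n)))"
    proof (rule sum.mono_neutral_right)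
      show "\<forall>l\<in>{..n} - {n}. rate p a l * (real (act l \<eta> n) - real (\<eta> n)) = 0"
      proof
        fix l assume "l \<in> {..n} - {n}"
        then have "act l \<eta> n = \<eta> n" using assms(3) by (cases l) auto
        then show "rate p a l * (real (act l \<eta> n) - real (\<eta> n)) = 0" by simp
      qed
    qed auto
    also have "\<dots> = \<psi> \<eta>" using assms(3) by (cases n) (auto simp: \<psi>_def rate_def)
    finally show ?thesis by (simp add: mstep_def)
  qed
  then have "mstep (rate p a) act n (snk n) = (\<lambda>\<eta>. real (\<eta> n) + \<psi> \<eta>)" by (rule ext)
  then have *: "ev p a n (Suc K) (snk n) \<eta> = ev p a n K (snk n) \<eta> + ev p a n K \<psi> \<eta>" for \<eta>
    unfolding ev_def miter_Suc' by (simp add: miter_add)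
  have "ev p a n K \<psi> \<eta> \<le> ev p a n K \<psi> (incr_at 0 \<eta>)"
  proof (rule ev_mono_conf[OF p0 assms(1,2) pn])
    show "\<psi> x \<le> \<psi> y" if "x \<le> y" for x y
      using that p0 unfolding \<psi>_def le_fun_def by (metis le_zero_eq order_refl)
  qed (auto simp: incr_at_def le_fun_def)
  then show ?thesis by (simp add: Dsnk_def *)
qed

lemma qpass_time_mono:
  assumes "0 \<le> a" "a < 1" "1 \<le> n" "K \<le> K'"
  shows "qpass p a K n \<le> qpass p a K' n"
  using assms(4)
proof (induction K' rule: dec_induct)
  case (step K')
  have z: "mid_radius a > 1" "a * mid_radius a < 1" using mid_radius assms by auto
  have "qpass p a K' n \<le> qpass p a (Suc K') n" unfolding qpass_def
    by (rule pavg_mono[of _ "mid_radius a"])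
      (use assms z in \<open>auto intro!: okw_gw okw_hw tame_Dsnk Dsnk_time_mono\<close>)
  then show ?case using step by simp
qed simp

text \<open>The departures are binomial by Burke's theorem and the initial particle number has a
  product law, so only their covariance is not explicit. By \<open>geo_cov\<close> it is a sum of
  responses of the departures to an added particle, which are the passage probabilities.\<close>

lemma flux_avg_sq:
  assumes a: "0 \<le> a" "a < 1"
  shows "flux_avg p n K a a (\<lambda>y. y\<^sup>2) = (flux_avg p n K a a (\<lambda>y. y))\<^sup>2
     + real K * p * a * (1 - p * a) - real n * (a / (1 - a)\<^sup>2)
     + 2 * (a / (1 - a)\<^sup>2) * (\<Sum>m\<in>{1..n}. 1 - qpass p a K m)"
proof -
  define z where "z = mid_radius a"
  have z: "z > 1" "a * z < 1" using mid_radius assms by (auto simp: z_def)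
  define r where "r = a / (1 - a)"
  define c where "c = a / (1 - a)\<^sup>2"
  define mu where "mu = real K * (p * a)"
  let ?g = "replicate n (gw a)"
  let ?A = "ev p a n K (snk n)"
  have okg: "\<forall>w\<in>set ?g. okw z w" using okw_replicate[OF a z] .
  have tot0: "\<And>\<eta>::conf. (\<forall>j. \<eta> (n + j) = 0) \<Longrightarrow> \<eta> n = 0" by (metis add_0_right)
  have hs: "\<forall>w\<in>set (replicate i (gw a) @ hw a # replicate (n - Suc i) (gw a)). w sums 1" for i
    using gw_sums[OF a] hw_sums[OF a] by auto
  have si: "\<eta> i \<le> tot n \<eta>" if "i < n" for i \<eta> unfolding tot_def using that by (intro member_le_sum) auto
  have tA: "tame z n (\<lambda>_. 0) ?A" by (rule tame_ev_snk) (use a z in auto)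
  have bA: "\<bar>?A \<eta>\<bar> \<le> real K" if "\<And>j. \<eta> (n + j) = 0" for \<eta>
    using ev_snk_bound[OF p0 _ _ pn, of a K \<eta>] a that[of 0] by simp
  have tK: "tame z n (\<lambda>_. 0) (\<lambda>\<eta>. real K * real (tot n \<eta>))" by (rule tame_cmult[OF tame_tot[OF z(1)]])
  have tfA: "tame z n (\<lambda>_. 0) (\<lambda>\<eta>. real (\<eta> i) * ?A \<eta>)" if "i < n" for i
  proof (rule tame_bound[OF tK])
    fix \<eta> :: conf assume "\<And>j. \<eta> (n + j) = (\<lambda>_. 0) j"
    then have "\<bar>?A \<eta>\<bar> \<le> real K" using bA by simp
    then show "\<bar>real (\<eta> i) * ?A \<eta>\<bar> \<le> \<bar>real K * real (tot n \<eta>)\<bar>"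
      using mult_mono[of "real (\<eta> i)" "real (tot n \<eta>)" "\<bar>?A \<eta>\<bar>" "real K"] si[OF that, of \<eta>]
      by (simp add: abs_mult mult_ac)
  qed
  have ttA: "tame z n (\<lambda>_. 0) (\<lambda>\<eta>. real (tot n \<eta>) * ?A \<eta>)"
  proof (rule tame_bound[OF tK])
    fix \<eta> :: conf assume "\<And>j. \<eta> (n + j) = (\<lambda>_. 0) j"
    then have "\<bar>?A \<eta>\<bar> \<le> real K" using bA by simp
    then show "\<bar>real (tot n \<eta>) * ?A \<eta>\<bar> \<le> \<bar>real K * real (tot n \<eta>)\<bar>"
      using mult_left_mono[of "\<bar>?A \<eta>\<bar>" "real K" "real (tot n \<eta>)"] by (simp add: abs_mult mult_ac)
  qed
  have tft: "tame z n (\<lambda>_. 0) (\<lambda>\<eta>. real (\<eta> i) * real (tot n \<eta>))" if "i < n" for i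
  proof (rule tame_bound[OF tame_tot_sq[OF z(1)]])
    fix \<eta> :: conf show "\<bar>real (\<eta> i) * real (tot n \<eta>)\<bar> \<le> \<bar>(real (tot n \<eta>))\<^sup>2\<bar>"
      using si[OF that, of \<eta>] mult_right_mono[of "real (\<eta> i)" "real (tot n \<eta>)" "real (tot n \<eta>)"] by (simp add: power2_eq_square)
  qed
  have EA: "pavg ?g ?A (\<lambda>_. 0) = mu" using burke_snk[OF a, of n p K real "\<lambda>_. 0"] by (simp add: ev_0_linear mu_def)
  have EA2: "pavg ?g (ev p a n K (\<lambda>\<eta>. (real (\<eta> n))\<^sup>2)) (\<lambda>_. 0) = mu\<^sup>2 + mu * (1 - p * a)"
    using burke_snk[OF a, of n p K "\<lambda>c. (real c)\<^sup>2" "\<lambda>_. 0"] by (simp add: ev_0_square mu_def)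
  have Et: "pavg ?g (\<lambda>\<eta>. real (tot n \<eta>)) (\<lambda>_. 0) = real n * r" using pavg_tot[OF a] by (simp add: r_def)
  have EtA: "pavg ?g (\<lambda>\<eta>. real (tot n \<eta>) * ?A \<eta>) (\<lambda>_. 0) = real n * r * mu + c * (\<Sum>m\<in>{1..n}. qpass p a K m)"
    using geo_cov[OF z(1) a z(2) tA tfA] sum_qpass[OF a, where f="\<lambda>x. x"] EA
    by (simp add: r_def c_def Dsnk_def[abs_def])
  have Ett: "pavg ?g (\<lambda>\<eta>. real (tot n \<eta>) * real (tot n \<eta>)) (\<lambda>_. 0) = real n * r * (real n * r) + c * real n"
  proof -
    have "pavg (replicate i (gw a) @ hw a # replicate (n - Suc i) (gw a)) (\<lambda>\<eta>. real (tot n (incr_at i \<eta>)) - real (tot n \<eta>)) (\<lambda>_. 0) = 1"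
      if "i < n" for i using pavg_const[OF hs, of i 1] that by (simp add: tot_incr_at)
    then show ?thesis using geo_cov[OF z(1) a z(2) tame_tot[OF z(1)] tft] Et by (simp add: r_def c_def)
  qed
  have tA2: "tame z n (\<lambda>_. 0) (ev p a n K (\<lambda>\<eta>. (real (\<eta> n))\<^sup>2))"
  proof (rule tame_bound[OF tame_const[of z n _ "(real K)\<^sup>2"]])
    fix \<eta> :: conf assume "\<And>j. \<eta> (n + j) = (\<lambda>_. 0) j"
    then have "\<eta> n = 0" using tot0 by simp
    have "\<bar>ev p a n K (\<lambda>\<eta>. (real (\<eta> n))\<^sup>2) \<eta>\<bar> \<le> (real K)\<^sup>2"
      by (rule ev_snk_abs[OF p0 _ _ pn, where \<phi>="\<lambda>c. (real c)\<^sup>2"]) (use a \<open>\<eta> n = 0\<close> in \<open>auto intro: power_mono\<close>)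
    then show "\<bar>ev p a n K (\<lambda>\<eta>. (real (\<eta> n))\<^sup>2) \<eta>\<bar> \<le> \<bar>(real K)\<^sup>2\<bar>" by simp
  qed (use z in auto)
  have "flux_ev p n K a (\<lambda>y. y\<^sup>2) \<eta> = (ev p a n K (\<lambda>\<eta>. (real (\<eta> n))\<^sup>2) \<eta> - 2 * (real (tot n \<eta>) * ?A \<eta>)) + real (tot n \<eta>) * real (tot n \<eta>)" for \<eta>
  proof -
    have "flux_ev p n K a (\<lambda>y. y\<^sup>2) \<eta> = ev p a n K (\<lambda>\<eta>'. ((real (\<eta>' n))\<^sup>2 - 2 * (real (tot n \<eta>) * real (\<eta>' n))) + real (tot n \<eta>) * real (tot n \<eta>)) \<eta>"
      unfolding flux_ev_def by (simp add: power2_eq_square algebra_simps)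
    then show ?thesis unfolding ev_def by (simp only: miter_add miter_diff miter_cmult miter_const)
  qed
  then have "flux_avg p n K a a (\<lambda>y. y\<^sup>2) = pavg ?g (\<lambda>\<eta>. (ev p a n K (\<lambda>\<eta>. (real (\<eta> n))\<^sup>2) \<eta> - 2 * (real (tot n \<eta>) * ?A \<eta>)) + real (tot n \<eta>) * real (tot n \<eta>)) (\<lambda>_. 0)"
    unfolding flux_avg_def by (intro pavg_cong) simp
  also have "\<dots> = (pavg ?g (ev p a n K (\<lambda>\<eta>. (real (\<eta> n))\<^sup>2)) (\<lambda>_. 0) - 2 * pavg ?g (\<lambda>\<eta>. real (tot n \<eta>) * ?A \<eta>) (\<lambda>_. 0))
     + pavg ?g (\<lambda>\<eta>. real (tot n \<eta>) * real (tot n \<eta>)) (\<lambda>_. 0)"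
  proof -
    have t1: "tame z (length ?g) (\<lambda>_. 0) (\<lambda>\<eta>. 2 * (real (tot n \<eta>) * ?A \<eta>))" using tame_cmult[OF ttA] by simp
    have t2: "tame z (length ?g) (\<lambda>_. 0) (ev p a n K (\<lambda>\<eta>. (real (\<eta> n))\<^sup>2))" using tA2 by simp
    have t3: "tame z (length ?g) (\<lambda>_. 0) (\<lambda>\<eta>. real (tot n \<eta>) * real (tot n \<eta>))"
      using tame_tot_sq[OF z(1), of n] by (simp add: power2_eq_square)
    have t4: "tame z (length ?g) (\<lambda>_. 0) (\<lambda>\<eta>. real (tot n \<eta>) * ?A \<eta>)" using ttA by simp
    show ?thesis
      by (simp only: pavg_add[OF okg tame_diff[OF t2 t1] t3] pavg_diff[OF okg t2 t1] pavg_cmult[OF okg t4])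
  qed
  also have "\<dots> = (mu - real n * r)\<^sup>2 + mu * (1 - p * a) + c * real n - 2 * c * (\<Sum>m\<in>{1..n}. qpass p a K m)"
    unfolding EA2 EtA Ett by (simp add: power2_eq_square algebra_simps)
  also have "(mu - real n * r) = flux_avg p n K a a (\<lambda>y. y)" using flux_avg_mean[OF a] by (simp add: mu_def r_def)
  also have "(\<Sum>m\<in>{1..n}. qpass p a K m) = real n - (\<Sum>m\<in>{1..n}. 1 - qpass p a K m)" by (simp add: sum_subtractf)
  finally show ?thesis by (simp add: c_def mu_def algebra_simps)
qed

text \<open>Induction on the number of steps, splitting off the first. There the two arrival
  densities differ by an arrival of probability \<open>p * (a - a')\<close>, whose effect on the
  later steps is \<open>Dsnk\<close>; stationarity at density \<open>a\<close> removes the first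
  step from the remaining difference \<open>G\<close>. The effect is at least \<open>qpass\<close>,
  because fewer arrivals and \<open>gw a\<close> in place of \<open>hw a\<close> at the first site
  can only speed up the discrepancy.\<close>

lemma flux_avg_arrivals_diff_ge:
  assumes a: "0 \<le> a'" "a' \<le> a" "a < 1" and n: "1 \<le> n"
  shows "p * (a - a') * (\<Sum>s<K. qpass p a s n) \<le> flux_avg p n K a a (\<lambda>y. y) - flux_avg p n K a' a (\<lambda>y. y)"
proof -
  have a0: "0 \<le> a" "a \<le> 1" "a' \<le> 1" using a by auto
  define z where "z = mid_radius a"
  have z: "z > 1" "a * z < 1" using mid_radius a a0 by (auto simp: z_def)
  let ?g = "replicate n (gw a)"
  have okg: "\<forall>w\<in>set ?g. okw z w" using okw_replicate[OF a0(1) a(3) z] .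
  have okga: "okw z (gw a)" using a0 a z by (auto intro: okw_gw)
  have tam: "tame z n \<zeta> (ev p b n K (snk n))" if "0 \<le> b" "b \<le> 1" for b K \<zeta>
    by (rule tame_ev_snk) (use that z in auto)
  have sh: "ev p b n K (snk n) (incr_at n \<eta>) = ev p b n K (snk n) \<eta> + 1" for b K \<eta>
    using ev_snk_shift[of p b n K "snk n" 1 \<eta>] miter_add[of "rate p b" act n K "snk n" "\<lambda>_. 1"]
    by (simp add: ev_def incr_at_def algebra_simps)
  have "p * (a - a') * (\<Sum>s<K. qpass p a s n) \<le> pavg ?g (\<lambda>\<eta>. ev p a n K (snk n) \<eta> - ev p a' n K (snk n) \<eta>) (\<lambda>_. 0)"
  proof (induction K)
    case 0
    have "pavg ?g (\<lambda>_. 0) (\<lambda>_. 0) = 0"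
      by (rule pavg_const) (use gw_sums[OF a0(1) a(3)] in auto)
    then show ?case by (simp add: ev_def)
  next
    case (Suc K)
    define G where "G \<eta> = ev p a n K (snk n) \<eta> - ev p a' n K (snk n) \<eta>" for \<eta>
    have tG: "tame z n \<zeta> G" for \<zeta> unfolding G_def by (intro tame_diff tam) (use a a0 in auto)
    have G1: "ev p a n 1 G = mstep (rate p a) act n G" by (simp add: ev_def miter_Suc)
    have rr: "mstep (rate p a) act n h \<eta> = mstep (rate p a') act n h \<eta> + p * (a - a') * (h (incr_at 0 \<eta>) - h \<eta>)" for h \<eta>
      by (simp add: mstep_def sum.atMost_shift rate_def incr_at_def algebra_simps)
    have dec: "ev p a n (Suc K) (snk n) \<eta> - ev p a' n (Suc K) (snk n) \<eta> = ev p a n 1 G \<eta> + p * (a - a') * Dsnk p a' n K 0 \<eta>" for \<eta>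
    proof -
      have "mstep (rate p a) act n G \<eta> = mstep (rate p a) act n (ev p a n K (snk n)) \<eta> - mstep (rate p a) act n (ev p a' n K (snk n)) \<eta>"
        unfolding G_def mstep_def by (simp add: algebra_simps sum_subtractf sum.distrib)
      then show ?thesis unfolding G1
        using rr[of "ev p a' n K (snk n)" \<eta>] by (simp add: ev_def miter_Suc Dsnk_def)
    qed
    have tD: "tame z n \<zeta> (Dsnk p b n K 0)" if "0 \<le> b" "b \<le> 1" for b \<zeta>
      by (rule tame_Dsnk) (use that z in auto)
    have t1: "tame z n (\<lambda>_. 0) (ev p a n 1 G)"
    proof -
      have "ev p a n 1 G \<eta> = ev p a n (Suc K) (snk n) \<eta> - ev p a' n (Suc K) (snk n) \<eta> - p * (a - a') * Dsnk p a' n K 0 \<eta>" for \<eta>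
        using dec[of \<eta>] by simp
      then have "ev p a n 1 G = (\<lambda>\<eta>. ev p a n (Suc K) (snk n) \<eta> - ev p a' n (Suc K) (snk n) \<eta> - p * (a - a') * Dsnk p a' n K 0 \<eta>)"
        by (rule ext)
      then show ?thesis by (simp only:) (intro tame_diff tam tame_cmult tD; use a a0 in auto)
    qed
    have "pavg ?g (\<lambda>\<eta>. ev p a n (Suc K) (snk n) \<eta> - ev p a' n (Suc K) (snk n) \<eta>) (\<lambda>_. 0) =
      pavg ?g (ev p a n 1 G) (\<lambda>_. 0) + p * (a - a') * pavg ?g (Dsnk p a' n K 0) (\<lambda>_. 0)"
      using pavg_lincomb[OF okg, of "\<lambda>_. 0" "ev p a n 1 G" "Dsnk p a' n K 0" 1 "p * (a - a')"] t1 tD[of a'] a a0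
      unfolding dec by simp
    moreover have "pavg ?g (ev p a n 1 G) (\<lambda>_. 0) = pavg ?g G (\<lambda>_. 0)"
    proof (rule stationary[OF a0(1) okga tG])
      fix \<zeta>
      have "pavg ?g G (incr_at 0 \<zeta>) = pavg ?g (\<lambda>\<eta>. G (incr_at n \<eta>)) \<zeta>" using pavg_incr_at[of ?g G 0 \<zeta>] by simp
      also have "(\<lambda>\<eta>. G (incr_at n \<eta>)) = G" by (auto simp: G_def sh)
      finally show "pavg ?g G (incr_at 0 \<zeta>) = pavg ?g G \<zeta>" .
    qed
    moreover have "qpass p a K n \<le> pavg ?g (Dsnk p a' n K 0) (\<lambda>_. 0)"
    proof -
      have g': "?g = gw a # replicate (n - 1) (gw a)" using n by (cases n) auto
      have len: "length ?g = n" "length (hw a # replicate (n - 1) (gw a)) = n" using n by auto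
      have okh: "\<forall>w\<in>set (hw a # replicate (n - 1) (gw a)). okw z w" using okga a0 a z by (auto intro!: okw_hw)
      have "pavg ?g (\<lambda>\<eta>. - 1 * Dsnk p a' n K 0 \<eta>) (\<lambda>_. 0) \<le> pavg (hw a # replicate (n - 1) (gw a)) (\<lambda>\<eta>. - 1 * Dsnk p a n K 0 \<eta>) (\<lambda>_. 0)"
      proof (rule pavg_strassen[of z])
        show "list_all2 wdom ?g (hw a # replicate (n - 1) (gw a))"
          unfolding g' using wdom_gw_hw[OF a0(1) a(3)] wdom_refl[OF gw_sums[OF a0(1) a(3)]] by (auto simp: list_all2_conv_all_nth nth_Cons split: nat.split)
        fix x y :: conf assume "x \<le> y"
        show "- 1 * Dsnk p a' n K 0 x \<le> - 1 * Dsnk p a n K 0 y"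
          using Dsnk_antimono[OF p0 a(1,2) a0(2) pn \<open>x \<le> y\<close>, of 0] by simp
      next
        show "tame z (length ?g) (\<lambda>_. 0) (\<lambda>\<eta>. - 1 * Dsnk p a' n K 0 \<eta>)"
          unfolding len by (intro tame_cmult tD) (use a a0 in auto)
        show "tame z (length ?g) (\<lambda>_. 0) (\<lambda>\<eta>. - 1 * Dsnk p a n K 0 \<eta>)"
          unfolding len by (intro tame_cmult tD) (use a a0 in auto)
      qed (use z okg okh in auto)
      also have "\<dots> = - qpass p a K n" unfolding qpass_def
        using pavg_cmult[OF okh, of "\<lambda>_. 0" "Dsnk p a n K 0" "-1"] tD[of a] len a0 by simp
      also have "pavg ?g (\<lambda>\<eta>. - 1 * Dsnk p a' n K 0 \<eta>) (\<lambda>_. 0) = - pavg ?g (Dsnk p a' n K 0) (\<lambda>_. 0)"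
        using pavg_cmult[OF okg, of "\<lambda>_. 0" "Dsnk p a' n K 0" "-1"] tD[of a'] a a0 by simp
      finally show ?thesis by simp
    qed
    moreover have "p * (a - a') * qpass p a K n \<le> p * (a - a') * pavg ?g (Dsnk p a' n K 0) (\<lambda>_. 0)"
      using calculation(3) p0 a by (intro mult_left_mono) auto
    ultimately show ?case using Suc.IH by (simp add: G_def[abs_def] algebra_simps)
  qed
  also have "\<dots> = pavg ?g (ev p a n K (snk n)) (\<lambda>_. 0) - pavg ?g (ev p a' n K (snk n)) (\<lambda>_. 0)"
    by (rule pavg_diff[OF okg]) (use tam a a0 in auto)
  also have "\<dots> = flux_avg p n K a a (\<lambda>y. y) - flux_avg p n K a' a (\<lambda>y. y)"
    using flux_avg_id[of a a K] flux_avg_id[of a' a K] a a0 by simp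
  finally show ?thesis .
qed

section \<open>Comparison of two lengths\<close>

lemma ev_tot_bound:
  assumes "0 \<le> a" "a \<le> 1" "1 \<le> z" "0 \<le> C" "\<And>\<eta>. \<bar>f \<eta>\<bar> \<le> C * z ^ tot n \<eta>"
  shows "\<bar>ev p a n K f \<eta>\<bar> \<le> C * z ^ K * z ^ tot n \<eta>"
proof -
  let ?B = "C * z ^ (tot n \<eta> + K)"
  have step: "tot n (act l s) \<le> Suc (tot n s)" if "l \<le> n" for l s
  proof -
    have T: "tot (Suc n) (act l s) \<le> Suc (tot (Suc n) s)" "s n \<le> act l s n"
      using that tot_act(1)[of n s] tot_act(2)[of _ n s] by (cases l; force)+
    then show ?thesis by (simp add: tot_def)
  qed
  have B: "\<bar>f s\<bar> \<le> ?B" if "tot n s \<le> tot n \<eta> + K" for s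
    using assms(5)[of s] mult_left_mono[OF power_increasing[OF that assms(3)] assms(4)] by linarith
  have "ev p a n K f \<eta> \<le> ev p a n K (\<lambda>_. ?B) \<eta>" "ev p a n K (\<lambda>_. - ?B) \<eta> \<le> ev p a n K f \<eta>"
    unfolding ev_def
    by (rule miter_mono[where I="\<lambda>k s. tot n s \<le> tot n \<eta> + k" and k=0, OF substoch_rate[OF p0 assms(1,2) pn]];
        use step B in \<open>force simp: abs_le_iff dest: order_trans[OF step]\<close>)+
  then show ?thesis unfolding ev_0_const by (simp add: power_add abs_le_iff mult_ac)
qed

end

lemma pavg_cut: "pavg ws (\<lambda>\<eta>. f (cut (length ws) \<eta>)) \<zeta> = pavg ws f (\<lambda>_. 0)"
proof (induction ws arbitrary: f)
  case Nil
  then show ?case by (simp add: cut_def)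
next
  case (Cons w ws)
  have "cut (Suc n) (case_nat k \<eta>) = case_nat k (cut n \<eta>)" for n k \<eta>
    by (auto simp: cut_def fun_eq_iff split: nat.split)
  then show ?case using Cons.IH[of "\<lambda>\<eta>. wavg w (\<lambda>k. f (case_nat k \<eta>))"] by simp
qed

lemma tot_cut: "tot n (cut n \<eta>) = tot n \<eta>"
  by (simp add: tot_def cut_def)

context chain begin

lemma flux_ev_merge:
  assumes "m \<le> n" "\<eta> n = 0"
  shows "ev p a n K (\<lambda>\<eta>'. \<phi> (real (\<Sum>j\<in>{m..n}. \<eta>' j) - real (tot n \<eta>))) \<eta> = flux_ev p m K a \<phi> (cut m \<eta>)"
proof -
  define c where "c = (\<Sum>j\<in>{m..n}. \<eta> j)"
  have tn: "tot n \<eta> = tot m \<eta> + c"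
  proof -
    have "{m..n} = insert n {m..<n}" using assms by auto
    then have "c = (\<Sum>j\<in>{m..<n}. \<eta> j)" using assms by (simp add: c_def)
    moreover have "tot n \<eta> = tot m \<eta> + (\<Sum>j\<in>{m..<n}. \<eta> j)"
      unfolding tot_def using assms by (metis lessThan_atLeast0 le0 sum.atLeastLessThan_concat)
    ultimately show ?thesis by simp
  qed
  have mc: "merge_from m n \<eta> = (cut m \<eta>)(m := cut m \<eta> m + c)"
    by (auto simp: merge_from_def cut_def c_def fun_eq_iff)
  have "ev p a n K (\<lambda>\<eta>'. \<phi> (real (\<Sum>j\<in>{m..n}. \<eta>' j) - real (tot n \<eta>))) \<eta> =
    ev p a n K (\<lambda>\<eta>'. (\<lambda>y. \<phi> (real (y m) - real (tot n \<eta>))) (merge_from m n \<eta>')) \<eta>"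
    by (simp add: merge_from_def)
  also have "\<dots> = ev p a m K (\<lambda>y. \<phi> (real (y m) - real (tot n \<eta>))) (merge_from m n \<eta>)"
    by (rule ev_merge_from[OF assms(1)])
  also have "\<dots> = ev p a m K (\<lambda>y. \<phi> (real ((y(m := y m + c)) m) - real (tot n \<eta>))) (cut m \<eta>)"
    unfolding mc by (rule ev_snk_shift[symmetric])
  finally show ?thesis by (simp add: flux_ev_def tot_cut tn)
qed

text \<open>One run is observed at \<open>m\<close> and at \<open>n\<close>. The two fluxes differ
  by the number of particles on the sites from \<open>m\<close> to \<open>n - 1\<close> at the final
  time, and by stationarity this number has the same law as initially.\<close>

lemma flux_avg_split:
  assumes a: "0 \<le> a" "a < 1" and m: "m \<le> n" and j: "flux_ok a K \<phi>1" "flux_ok a K \<phi>2"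
    and \<psi>: "z > 1" "a * z < 1" "\<And>s. \<bar>\<psi> s\<bar> \<le> C * z ^ s"
    and nn: "\<And>y s. 0 \<le> \<phi>1 y + \<phi>2 (y + real s) + \<psi> s"
  shows "0 \<le> flux_avg p n K a a \<phi>1 + flux_avg p m K a a \<phi>2 + pavg (replicate (n - m) (gw a)) (\<lambda>\<eta>. \<psi> (tot (n - m) \<eta>)) (\<lambda>_. 0)"
proof -
  interpret m: chain p m using p0 chain_le[OF m] by unfold_locales
  have a1: "a \<le> 1" using a by simp
  have C0: "C \<ge> 0" using \<psi>(3)[of 0] by simp
  obtain z1 where z1: "z1 > 1" "a * z1 < 1" "\<And>z'. z1 \<le> z' \<Longrightarrow> tame z' n (\<lambda>_. 0) (flux_ev p n K a \<phi>1)"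
    using flux_okE[OF j(1) a(1) a1] by blast
  obtain z2 where z2: "z2 > 1" "a * z2 < 1" "\<And>z'. z2 \<le> z' \<Longrightarrow> tame z' m (\<lambda>_. 0) (flux_ev p m K a \<phi>2)"
    using m.flux_okE[OF j(2) a(1) a1] by blast
  define y where "y = max z (max z1 z2)"
  have y: "y > 1" "a * y < 1" "z \<le> y" "z1 \<le> y" "z2 \<le> y" using z1(1,2) z2(1,2) \<psi>(1,2) by (auto simp: y_def max_def)
  let ?g = "replicate n (gw a)"
  have okga: "okw y (gw a)" using a y by (auto intro!: okw_gw)
  have okg: "\<forall>w\<in>set ?g. okw y w" using okga by auto
  define S where "S \<eta> = (\<Sum>j\<in>{m..<n}. \<eta> j)" for \<eta> :: conf
  define U2 where "U2 \<eta> = flux_ev p m K a \<phi>2 (cut m \<eta>)" for \<eta>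
  define U3 where "U3 = ev p a n K (\<lambda>\<eta>'. \<psi> (S \<eta>'))"
  have totS: "tot n \<eta> = tot m \<eta> + S \<eta>" for \<eta>
    unfolding tot_def S_def using m by (metis lessThan_atLeast0 le0 sum.atLeastLessThan_concat)
  have \<psi>S: "\<bar>\<psi> (S \<eta>)\<bar> \<le> C * y ^ tot n \<eta>" for \<eta>
  proof -
    have "z ^ S \<eta> \<le> y ^ S \<eta>" using y \<psi> by (intro power_mono) auto
    also have "\<dots> \<le> y ^ tot n \<eta>" using y totS[of \<eta>] by (intro power_increasing) auto
    finally show ?thesis using \<psi>(3)[of "S \<eta>"] mult_left_mono[of "z ^ S \<eta>" "y ^ tot n \<eta>" C] C0 by linarith
  qed
  have t1: "tame y (length ?g) (\<lambda>_. 0) (flux_ev p n K a \<phi>1)" using z1(3) y by simp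
  have t2: "tame y (length ?g) (\<lambda>_. 0) U2"
  proof -
    obtain C2 where C2: "\<And>\<eta>. (\<forall>j. \<eta> (m + j) = 0) \<Longrightarrow> \<bar>flux_ev p m K a \<phi>2 \<eta>\<bar> \<le> C2 * y ^ tot m \<eta>"
      using z2(3)[OF y(5)] by (auto simp: tame_def)
    have "C2 \<ge> 0" using C2[of "\<lambda>_. 0"] y by (simp add: tot_def)
    have "\<bar>U2 \<eta>\<bar> \<le> C2 * y ^ tot n \<eta>" for \<eta>
    proof -
      have "\<bar>U2 \<eta>\<bar> \<le> C2 * y ^ tot m \<eta>" using C2[of "cut m \<eta>"] by (simp add: U2_def tot_cut) (simp add: cut_def)
      also have "\<dots> \<le> C2 * y ^ tot n \<eta>" using y totS[of \<eta>] \<open>C2 \<ge> 0\<close> by (intro mult_left_mono power_increasing) auto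
      finally show ?thesis .
    qed
    then show ?thesis by (auto simp: tame_def)
  qed
  have t3: "tame y (length ?g) (\<lambda>_. 0) U3"
    using ev_tot_bound[OF a(1) a1 _ C0 \<psi>S, of K] y(1) unfolding U3_def tame_def by (auto intro!: exI[of _ "C * y ^ K"])
  have "pavg ?g (\<lambda>_. 0) (\<lambda>_. 0) \<le> pavg ?g (\<lambda>\<eta>. flux_ev p n K a \<phi>1 \<eta> + U2 \<eta> + U3 \<eta>) (\<lambda>_. 0)"
  proof (rule pavg_mono[OF okg])
    fix \<eta> :: conf assume "\<And>j. \<eta> (length ?g + j) = (\<lambda>_. 0) j"
    from this[of 0] have "\<eta> n = 0" by simp
    have "U2 \<eta> = ev p a n K (\<lambda>\<eta>'. \<phi>2 (real (\<Sum>j\<in>{m..n}. \<eta>' j) - real (tot n \<eta>))) \<eta>"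
      unfolding U2_def by (rule flux_ev_merge[OF m, of \<eta>, OF \<open>\<eta> n = 0\<close>, symmetric])
    moreover have "ev p a n K (\<lambda>_. 0) \<eta> \<le> ev p a n K (\<lambda>\<eta>'. \<phi>1 (real (\<eta>' n) - real (tot n \<eta>))
       + \<phi>2 (real (\<Sum>j\<in>{m..n}. \<eta>' j) - real (tot n \<eta>)) + \<psi> (S \<eta>')) \<eta>"
      unfolding ev_def
    proof (rule miter_mono'[OF substoch_rate[OF p0 a(1) a1 pn], where I="\<lambda>_. True"])
      fix \<eta>' :: conf
      have "{m..n} = insert n {m..<n}" using m by auto
      then have "real (\<Sum>j\<in>{m..n}. \<eta>' j) - real (tot n \<eta>) = real (\<eta>' n) - real (tot n \<eta>) + real (S \<eta>')"
        by (simp add: S_def)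
      then show "0 \<le> \<phi>1 (real (\<eta>' n) - real (tot n \<eta>)) + \<phi>2 (real (\<Sum>j\<in>{m..n}. \<eta>' j) - real (tot n \<eta>)) + \<psi> (S \<eta>')"
        using nn[of "real (\<eta>' n) - real (tot n \<eta>)" "S \<eta>'"] by (simp only:)
    qed auto
    ultimately show "0 \<le> flux_ev p n K a \<phi>1 \<eta> + U2 \<eta> + U3 \<eta>"
      unfolding flux_ev_def U3_def ev_def by (simp add: miter_add)
  qed (use y(1) tame_add[OF tame_add[OF t1 t2] t3] in \<open>auto intro: tame_const\<close>)
  also have "pavg ?g (\<lambda>\<eta>. flux_ev p n K a \<phi>1 \<eta> + U2 \<eta> + U3 \<eta>) (\<lambda>_. 0) = flux_avg p n K a a \<phi>1 + pavg ?g U2 (\<lambda>_. 0) + pavg ?g U3 (\<lambda>_. 0)"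
    by (simp only: pavg_add[OF okg tame_add[OF t1 t2] t3] pavg_add[OF okg t1 t2] flux_avg_def)
  also have "pavg ?g (\<lambda>_. 0) (\<lambda>_. 0) = 0" by (rule pavg_const) (use gw_sums[OF a] in auto)
  also have rep: "?g = replicate m (gw a) @ replicate (n - m) (gw a)" using m by (simp add: replicate_add[symmetric])
  have "pavg ?g U2 (\<lambda>_. 0) = flux_avg p m K a a \<phi>2"
  proof -
    have "pavg (replicate m (gw a)) U2 = (\<lambda>_. flux_avg p m K a a \<phi>2)"
      using pavg_cut[of "replicate m (gw a)" "flux_ev p m K a \<phi>2"] by (auto simp: U2_def[abs_def] flux_avg_def)
    then show ?thesis unfolding rep pavg_append by (simp add: pavg_const gw_sums[OF a])
  qed
  moreover have "pavg ?g U3 (\<lambda>_. 0) = pavg (replicate (n - m) (gw a)) (\<lambda>\<eta>. \<psi> (tot (n - m) \<eta>)) (\<lambda>_. 0)"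
  proof -
    have E: "pavg ?g (\<lambda>\<eta>. \<psi> (S \<eta>)) \<zeta> = pavg (replicate (n - m) (gw a)) (\<lambda>\<eta>. \<psi> (tot (n - m) \<eta>)) \<zeta>" for \<zeta>
    proof -
      have "pavg (replicate m (gw a)) (\<lambda>\<eta>. \<psi> (S \<eta>)) \<xi> = \<psi> (tot (n - m) \<xi>)" for \<xi>
      proof -
        have "pavg (replicate m (gw a)) (\<lambda>\<eta>. \<psi> (S \<eta>)) \<xi> = pavg (replicate m (gw a)) (\<lambda>\<eta>. \<psi> (tot (n - m) \<xi>)) \<xi>"
        proof (rule pavg_cong)
          fix \<eta> :: conf assume t: "\<And>j. \<eta> (length (replicate m (gw a)) + j) = \<xi> j"
          have "S \<eta> = (\<Sum>j<n - m. \<eta> (m + j))" unfolding S_def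
            by (rule sum.reindex_bij_witness[where i="\<lambda>j. m + j" and j="\<lambda>j. j - m"]) auto
          then show "\<psi> (S \<eta>) = \<psi> (tot (n - m) \<xi>)" using t by (simp add: tot_def)
        qed
        then show ?thesis by (simp add: pavg_const gw_sums[OF a])
      qed
      then show ?thesis unfolding rep pavg_append by (simp cong: pavg_cong)
    qed
    have "pavg ?g U3 (\<lambda>_. 0) = pavg ?g (\<lambda>\<eta>. \<psi> (S \<eta>)) (\<lambda>_. 0)" unfolding U3_def
    proof (rule stationary[OF a(1) okga])
      show "tame y n \<zeta> (\<lambda>\<eta>. \<psi> (S \<eta>))" for \<zeta> using \<psi>S by (auto simp: tame_def)
      show "pavg ?g (\<lambda>\<eta>. \<psi> (S \<eta>)) (incr_at 0 \<zeta>) = pavg ?g (\<lambda>\<eta>. \<psi> (S \<eta>)) \<zeta>" for \<zeta>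
      proof -
        have "S (incr_at n \<eta>) = S \<eta>" for \<eta> by (simp add: S_def incr_at_def)
        then show ?thesis using pavg_incr_at[of ?g "\<lambda>\<eta>. \<psi> (S \<eta>)" 0 \<zeta>] by simp
      qed
    qed
    then show ?thesis using E by simp
  qed
  ultimately show ?thesis by simp
qed

end

section \<open>Exponential tails of the flux and of particle numbers\<close>

definition geo_avg :: "nat \<Rightarrow> real \<Rightarrow> (real \<Rightarrow> real) \<Rightarrow> real" where
  "geo_avg k a \<psi> = pavg (replicate k (gw a)) (\<lambda>\<eta>. \<psi> (real (tot k \<eta>))) (\<lambda>_. 0)"

lemma geo_avg_exp:
  assumes "0 < a" "a < 1" "0 < s" "s < 1"
  shows "geo_avg k a (\<lambda>x. exp ((ln s - ln a) * (x - R))) = exp (- (ln s - ln a) * R) * ((1 - a) / (1 - s)) ^ k"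
proof -
  have z: "mid_radius s > 1" "s * mid_radius s < 1" using mid_radius assms by auto
  have e: "exp ((ln s - ln a) * (real k - R)) = (s / a) ^ k * exp (- (ln s - ln a) * R)" for k
  proof -
    have "exp ((ln s - ln a) * (real k - R)) = exp (real k * (ln s - ln a)) * exp (- (ln s - ln a) * R)"
      by (simp add: exp_add[symmetric] algebra_simps)
    then show ?thesis using assms by (simp only: exp_of_nat_mult) (simp add: exp_diff)
  qed
  have "pavg (replicate k (gw a)) (\<lambda>\<eta>. (s / a) ^ tot k \<eta> * exp (- (ln s - ln a) * R)) (\<lambda>_. 0) =
    ((1 - a) / (1 - s)) ^ k * pavg (replicate k (gw s)) (\<lambda>\<eta>. exp (- (ln s - ln a) * R)) (\<lambda>_. 0)"
    by (rule pavg_tilt[OF assms z tame_const]) (use z in auto)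
  also have "pavg (replicate k (gw s)) (\<lambda>\<eta>. exp (- (ln s - ln a) * R)) (\<lambda>_. 0) = exp (- (ln s - ln a) * R)"
    by (rule pavg_const) (use gw_sums assms in auto)
  finally show ?thesis unfolding geo_avg_def e by simp
qed

lemma geo_avg_mono:
  assumes "0 \<le> a" "a < 1" "z > 1" "a * z < 1" "\<And>s::nat. \<bar>f (real s)\<bar> \<le> C * z ^ s" "\<And>s::nat. \<bar>g (real s)\<bar> \<le> D * z ^ s"
    "\<And>x. f x \<le> g x"
  shows "geo_avg k a f \<le> geo_avg k a g"
  unfolding geo_avg_def
  by (rule pavg_mono[of _ z]) (use assms in \<open>auto simp: tame_def intro!: okw_gw\<close>)

lemma pos_part_le_exp: assumes "t > (0::real)" shows "max 0 x \<le> exp (t * x) / t"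
proof -
  have "t * x \<le> exp (t * x)" using exp_ge_add_one_self[of "t * x"] by linarith
  then have "x \<le> exp (t * x) / t" using assms by (simp add: field_simps)
  then show ?thesis using assms by (simp add: field_simps)
qed

text \<open>The two sides differ by the integral over densities \<open>s\<close> from
  \<open>b\<close> to \<open>g\<close> of \<open>(T * s - N * s / (1 - s) - R) / s\<close>, whose
  numerator is the mean flux at density \<open>s\<close> minus \<open>R\<close>. A bound on the mean
  flux at all intermediate densities thus controls the exponent of the explicit expectation.\<close>

lemma monotone_ln_combination:
  fixes b g T N R :: real
  assumes "0 < b" "b \<le> g" "g < 1" "\<And>s. b \<le> s \<Longrightarrow> s \<le> g \<Longrightarrow> R \<le> T * s - N * s / (1 - s)"
  shows "R * (ln g - ln b) \<le> T * (g - b) + N * (ln (1 - g) - ln (1 - b))"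
proof -
  define G where "G s = T * s + N * ln (1 - s) - R * ln s" for s
  have "G b \<le> G g"
  proof (rule DERIV_nonneg_imp_nondecreasing[where f=G, OF assms(2)])
    fix s assume s: "b \<le> s" "s \<le> g"
    then have s1: "0 < s" "s < 1" using assms(1,3) by auto
    have "(G has_real_derivative (T - N / (1 - s) - R / s)) (at s)"
      unfolding G_def using s1 by (auto intro!: derivative_eq_intros simp: field_simps)
    moreover have "T - N / (1 - s) - R / s = (T * s - N * s / (1 - s) - R) / s" using s1 by (simp add: field_simps)
    moreover have "0 \<le> (T * s - N * s / (1 - s) - R) / s" using assms(4)[OF s] s1 by simp
    ultimately show "\<exists>y. (G has_real_derivative y) (at s) \<and> 0 \<le> y" by metis
  qed
  then show ?thesis by (simp add: G_def algebra_simps)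
qed

lemma pow_ratio_exp: "0 < x \<Longrightarrow> 0 < y \<Longrightarrow> (x / y) ^ n = exp (real n * (ln x - ln (y::real)))"
  by (simp add: exp_of_nat_mult exp_diff)

lemma ln_diff_bounds:
  assumes "0 < b" "b \<le> (g::real)" shows "(g - b) / g \<le> ln g - ln b" "ln g - ln b \<le> (g - b) / b"
proof -
  have "ln g - ln b = - ln (b / g)" "ln g - ln b = ln (g / b)" using assms by (auto simp: ln_div)
  moreover have "ln (b / g) \<le> b / g - 1" "ln (g / b) \<le> g / b - 1" using assms by (auto intro: ln_le_minus_one)
  moreover have "(g - b) / g = 1 - b / g" "(g - b) / b = g / b - 1" using assms by (auto simp: diff_divide_distrib)
  ultimately show "(g - b) / g \<le> ln g - ln b" "ln g - ln b \<le> (g - b) / b" by linarith+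
qed

context chain begin

text \<open>\<open>d\<close> is the margin by which the mean flux at all intermediate densities
  exceeds \<open>r\<close>. It may be negative, and it is so near the critical length.\<close>

lemma flux_avg_lower_exp:
  assumes "0 < b" "b < g" "g < 1"
    and d: "\<And>s. b \<le> s \<Longrightarrow> s \<le> g \<Longrightarrow> r + d \<le> (real K * p) * s - real n * s / (1 - s)"
  shows "flux_avg p n K g b (\<lambda>y. exp (- (ln g - ln b) * (y - r))) \<le> exp (- d * (ln g - ln b))"
proof -
  have bg: "0 < g" "b < 1" using assms(1-3) by auto
  have pg: "p * (g - b) \<le> 1"
  proof -
    have "p * (g - b) \<le> p * (real n + 1)" using p0 assms(1-3) by (intro mult_left_mono) auto
    then show ?thesis using pn by linarith
  qed
  have "(1 + p * (b - g)) ^ K \<le> exp (p * (b - g)) ^ K"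
  proof (rule power_mono)
    show "1 + p * (b - g) \<le> exp (p * (b - g))" by (rule exp_ge_add_one_self)
    show "0 \<le> 1 + p * (b - g)" using pg by (simp add: algebra_simps)
  qed
  also have "\<dots> = exp (- (real K * p * (g - b)))" by (simp add: exp_of_nat_mult[symmetric] algebra_simps)
  finally have 1: "(1 + p * (b - g)) ^ K \<le> exp (- (real K * p * (g - b)))" .
  have "flux_avg p n K g b (\<lambda>y. exp (- (ln g - ln b) * (y - r))) =
    exp ((ln g - ln b) * r) * exp (real n * (ln (1 - b) - ln (1 - g))) * (1 + p * (b - g)) ^ K"
    using flux_avg_exp[OF bg(1) assms(3,1) bg(2), of K r] pow_ratio_exp[of "1 - b" "1 - g" n] assms(1-3) bg by simp
  also have "\<dots> \<le> exp ((ln g - ln b) * r) * exp (real n * (ln (1 - b) - ln (1 - g))) * exp (- (real K * p * (g - b)))"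
    using 1 by (intro mult_left_mono) auto
  also have "\<dots> = exp ((ln g - ln b) * r + real n * (ln (1 - b) - ln (1 - g)) - real K * p * (g - b))"
    by (simp add: exp_add[symmetric])
  also have "\<dots> \<le> exp (- d * (ln g - ln b))"
    using monotone_ln_combination[of b g "r + d" "real K * p" "real n", OF assms(1) less_imp_le[OF assms(2)] assms(3) d] by (simp add: algebra_simps)
  finally show ?thesis .
qed

lemma flux_ok_pos_part:
  assumes "0 \<le> b" "b < 1" shows "flux_ok b K (\<lambda>y. max 0 (y - r))" "flux_ok b K (\<lambda>y. max 0 (r - y))" "flux_ok b K (\<lambda>y. y)" "flux_ok b K (\<lambda>y. y\<^sup>2)" "flux_ok b K (\<lambda>_. c)"
proof -
  have *: "\<bar>y\<bar> \<le> 1 + y\<^sup>2" for y :: real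
    using zero_le_power2[of "\<bar>y\<bar> - 1"] zero_le_power2[of y] by (simp add: power2_diff)
  have "\<bar>max 0 (y - r)\<bar> \<le> (1 + \<bar>r\<bar>) + 1 * y\<^sup>2" "\<bar>max 0 (r - y)\<bar> \<le> (1 + \<bar>r\<bar>) + 1 * y\<^sup>2" for y
    using *[of y] by (auto simp: max_def)
  then show "flux_ok b K (\<lambda>y. max 0 (y - r))" "flux_ok b K (\<lambda>y. max 0 (r - y))"
    by (blast intro: flux_ok_quadratic[OF assms])+
  show "flux_ok b K (\<lambda>y. y)" using flux_ok_quadratic[OF assms, of "\<lambda>y. y" 1 1] * by simp
  show "flux_ok b K (\<lambda>y. y\<^sup>2)" using flux_ok_quadratic[OF assms, of "\<lambda>y. y\<^sup>2" 0 1] by simp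
  show "flux_ok b K (\<lambda>_. c)" using flux_ok_quadratic[OF assms, of "\<lambda>y. c" "\<bar>c\<bar>" 0] by simp
qed

lemma flux_avg_lower_tail:
  assumes "0 < b" "b < g" "g < 1"
    and d: "\<And>s. b \<le> s \<Longrightarrow> s \<le> g \<Longrightarrow> r + d \<le> (real K * p) * s - real n * s / (1 - s)"
  shows "flux_avg p n K g b (\<lambda>y. max 0 (r - y)) \<le> exp (- d * (ln g - ln b)) / (ln g - ln b)"
proof -
  define t where "t = ln g - ln b"
  have t: "t > 0" "b * exp t < 1" using assms(1-3) by (auto simp: t_def exp_diff)
  have b1: "b < 1" "0 \<le> b" "0 \<le> g" "g \<le> 1" using assms(1-3) by auto
  have je: "flux_ok b K (\<lambda>y. exp (- t * (y - r)))" using flux_ok_exp[of b t] assms(1-3) b1 t by simp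
  have "flux_avg p n K g b (\<lambda>y. max 0 (r - y)) \<le> flux_avg p n K g b (\<lambda>y. 1 / t * exp (- t * (y - r)))"
  proof (rule flux_avg_mono[OF b1(3,4,2,1) flux_ok_pos_part(2)[OF b1(2,1)] flux_ok_cmult[OF je]])
    fix y show "max 0 (r - y) \<le> 1 / t * exp (- t * (y - r))"
      using pos_part_le_exp[OF t(1), of "r - y"] by (simp add: algebra_simps)
  qed
  also have "\<dots> = 1 / t * flux_avg p n K g b (\<lambda>y. exp (- t * (y - r)))" by (rule flux_avg_cmult[OF b1(3,4,2,1) je])
  also have "\<dots> \<le> 1 / t * exp (- d * t)"
    using flux_avg_lower_exp[OF assms] t by (intro mult_left_mono) (auto simp: t_def)
  finally show ?thesis by (simp add: t_def)
qed

end

text \<open>The scheme of the flux bound for a plain sum of geometric variables: the tilt from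
  \<open>a\<close> to \<open>s\<close> is explicit, and the mean \<open>real k * x / (1 - x)\<close>
  at intermediate densities controls its exponent.\<close>

lemma geo_avg_upper_tail:
  assumes a: "0 < a" "a < s" "s < 1"
    and d: "\<And>x. a \<le> x \<Longrightarrow> x \<le> s \<Longrightarrow> real k * x / (1 - x) \<le> R - d"
  shows "geo_avg k a (\<lambda>x. max 0 (x - R)) \<le> exp (- d * (ln s - ln a)) / (ln s - ln a)"
    and "\<exists>z>1. a * z < 1 \<and> (\<exists>C. \<forall>x::nat. \<bar>max 0 (real x - R)\<bar> \<le> C * z ^ x)"
proof -
  define t where "t = ln s - ln a"
  have t: "t > 0" using a by (auto simp: t_def)
  define z where "z = s / a"
  have z: "z > 1" "a * z < 1" using a by (auto simp: z_def)
  have ez: "exp (t * (real x - R)) = exp (- t * R) * z ^ x" for x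
  proof -
    have "exp (t * (real x - R)) = exp (- t * R) * exp (real x * t)" by (simp add: exp_add[symmetric] algebra_simps)
    then show ?thesis using a by (simp only: exp_of_nat_mult) (simp add: t_def z_def exp_diff)
  qed
  have le: "max 0 (x - R) \<le> 1 / t * exp (t * (x - R))" for x
    using pos_part_le_exp[OF t, of "x - R"] by simp
  have b1: "\<bar>max 0 (real x - R)\<bar> \<le> (1 / t * exp (- t * R)) * z ^ x" for x
    using le[of "real x"] ez[of x] by (simp add: mult.assoc)
  then show "\<exists>z>1. a * z < 1 \<and> (\<exists>C. \<forall>x::nat. \<bar>max 0 (real x - R)\<bar> \<le> C * z ^ x)" using z by blast
  have b2: "\<bar>1 / t * exp (t * (real x - R))\<bar> \<le> (1 / t * exp (- t * R)) * z ^ x" for x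
    unfolding ez using t z by (simp add: abs_mult)
  have a1: "0 \<le> a" "a < 1" "0 < s" using a by auto
  have "geo_avg k a (\<lambda>x. max 0 (x - R)) \<le> geo_avg k a (\<lambda>x. 1 / t * exp (t * (x - R)))"
    by (rule geo_avg_mono[OF a1(1,2) z b1 b2 le])
  also have "\<dots> = 1 / t * geo_avg k a (\<lambda>x. exp (t * (x - R)))" unfolding geo_avg_def
  proof (rule pavg_cmult[of _ z])
    show "\<forall>w\<in>set (replicate k (gw a)). okw z w" using a1 z by (auto intro!: okw_gw)
    show "tame z (length (replicate k (gw a))) (\<lambda>_. 0) (\<lambda>\<eta>. exp (t * (real (tot k \<eta>) - R)))"
      unfolding tame_def ez by (intro exI[of _ "exp (- t * R)"]) (use z in auto)
  qed
  also have "geo_avg k a (\<lambda>x. exp (t * (x - R))) = exp (- t * R) * ((1 - a) / (1 - s)) ^ k"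
    using geo_avg_exp[OF a(1) a1(2,3) a(3), of k R] by (simp add: t_def)
  also have "\<dots> = exp (- t * R + real k * (ln (1 - a) - ln (1 - s)))"
    using pow_ratio_exp[of "1 - a" "1 - s" k] a(1-3) a1 by (simp add: exp_add[symmetric])
  also have "\<dots> \<le> exp (- d * t)"
  proof -
    have "- (R - d) \<le> 0 * x - real k * x / (1 - x)" if "a \<le> x" "x \<le> s" for x using d[OF that] by simp
    from monotone_ln_combination[OF a(1) less_imp_le[OF a(2)] a(3) this] show ?thesis by (simp add: t_def algebra_simps)
  qed
  finally show "geo_avg k a (\<lambda>x. max 0 (x - R)) \<le> exp (- d * (ln s - ln a)) / (ln s - ln a)"
    using t by (simp add: t_def divide_right_mono)
qed

lemma geo_avg_lower_tail:
  assumes a: "0 < s" "s < a" "a < 1"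
    and d: "\<And>x. s \<le> x \<Longrightarrow> x \<le> a \<Longrightarrow> R + d \<le> real k * x / (1 - x)"
  shows "geo_avg k a (\<lambda>x. max 0 (R - x)) \<le> exp (- d * (ln a - ln s)) / (ln a - ln s)"
    and "\<exists>z>1. a * z < 1 \<and> (\<exists>C. \<forall>x::nat. \<bar>max 0 (R - real x)\<bar> \<le> C * z ^ x)"
proof -
  define t where "t = ln a - ln s"
  have t: "t > 0" using a by (auto simp: t_def)
  have a1: "0 \<le> a" "a < 1" "0 < a" "s < 1" using a by auto
  define z where "z = mid_radius a"
  have z: "z > 1" "a * z < 1" using mid_radius a1 by (auto simp: z_def)
  have ez: "exp (t * (R - real x)) \<le> exp (t * R) * z ^ x" for x
  proof -
    have "exp (t * (R - real x)) \<le> exp (t * R) * 1" using t by (simp add: algebra_simps)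
    also have "\<dots> \<le> exp (t * R) * z ^ x" using z by (intro mult_left_mono one_le_power) auto
    finally show ?thesis .
  qed
  have le: "max 0 (R - x) \<le> 1 / t * exp (t * (R - x))" for x
    using pos_part_le_exp[OF t, of "R - x"] by simp
  have b2: "\<bar>1 / t * exp (t * (R - real x))\<bar> \<le> (1 / t * exp (t * R)) * z ^ x" for x
    using mult_left_mono[OF ez[of x], of "1 / t"] t by (simp add: abs_mult)
  have b1: "\<bar>max 0 (R - real x)\<bar> \<le> (1 / t * exp (t * R)) * z ^ x" for x
    using le[of "real x"] b2[of x] by linarith
  then show "\<exists>z>1. a * z < 1 \<and> (\<exists>C. \<forall>x::nat. \<bar>max 0 (R - real x)\<bar> \<le> C * z ^ x)" using z by blast
  have "geo_avg k a (\<lambda>x. max 0 (R - x)) \<le> geo_avg k a (\<lambda>x. 1 / t * exp (t * (R - x)))"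
    by (rule geo_avg_mono[OF a1(1,2) z b1 b2 le])
  also have "\<dots> = 1 / t * geo_avg k a (\<lambda>x. exp (t * (R - x)))" unfolding geo_avg_def
  proof (rule pavg_cmult[of _ z])
    show "\<forall>w\<in>set (replicate k (gw a)). okw z w" using a1 z by (auto intro!: okw_gw)
    show "tame z (length (replicate k (gw a))) (\<lambda>_. 0) (\<lambda>\<eta>. exp (t * (R - real (tot k \<eta>))))"
      unfolding tame_def using ez by (intro exI[of _ "exp (t * R)"]) auto
  qed
  also have "geo_avg k a (\<lambda>x. exp (t * (R - x))) = exp (t * R) * ((1 - a) / (1 - s)) ^ k"
    using geo_avg_exp[OF a1(3,2) a(1) a1(4), of k R] by (simp add: t_def algebra_simps)
  also have "\<dots> = exp (t * R + real k * (ln (1 - a) - ln (1 - s)))"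
    using pow_ratio_exp[of "1 - a" "1 - s" k] a(1-3) a1 by (simp add: exp_add[symmetric])
  also have "\<dots> \<le> exp (- d * t)"
  proof -
    have "R + d \<le> 0 * x - (- real k) * x / (1 - x)" if "s \<le> x" "x \<le> a" for x using d[OF that] by simp
    from monotone_ln_combination[OF a(1) less_imp_le[OF a(2)] a(3) this] show ?thesis by (simp add: t_def algebra_simps)
  qed
  finally show "geo_avg k a (\<lambda>x. max 0 (R - x)) \<le> exp (- d * (ln a - ln s)) / (ln a - ln s)"
    using t by (simp add: t_def divide_right_mono)
qed

section \<open>Stretches near the critical length\<close>

definition qsum :: "real \<Rightarrow> real \<Rightarrow> nat \<Rightarrow> nat \<Rightarrow> real" where
  "qsum p a K n = (\<Sum>m\<in>{1..n}. 1 - qpass p a K m)"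

text \<open>\<open>L\<close> is the cube root of the elapsed time. Its lower bound makes
  \<open>3 / L\<close> at most \<open>a / 2\<close> and at most \<open>(1 - a) / 2\<close>, so
  densities within \<open>3 / L\<close> of \<open>a\<close> stay away from \<open>0\<close> and
  \<open>1\<close>.\<close>

locale scaled_chain = chain +
  fixes a :: real and K :: nat and L :: real
  assumes a0: "0 < a" and a1: "a < 1" and L: "6 / min a (1 - a) \<le> L" and T: "real K * p = L ^ 3"
begin

text \<open>The mean flux of the stationary system of density \<open>s\<close>. Its derivative in
  \<open>s\<close> vanishes at \<open>a\<close> exactly at the critical length
  \<open>(1 - a)\<^sup>2 * L ^ 3\<close>.\<close>

definition mean_flux :: "real \<Rightarrow> real" where "mean_flux s = L ^ 3 * s - real n * s / (1 - s)"

abbreviation "J \<equiv> flux_avg p n K"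
abbreviation "m0 \<equiv> mean_flux a"

lemma mean: "J a a (\<lambda>y. y) = m0"
  using flux_avg_mean[of a K] a0 a1 T by (simp add: mean_flux_def)

lemma mean_flux_diff: assumes "s < 1" shows "mean_flux s - m0 = (s - a) * (L ^ 3 * ((1 - a) * (1 - s)) - real n) / ((1 - s) * (1 - a))"
proof -
  have "(1 - s) * (1 - a) * (mean_flux s - m0) = (s - a) * (L ^ 3 * ((1 - a) * (1 - s)) - real n)"
  proof -
    have "(1 - s) * (1 - a) * (real n * s / (1 - s)) = (1 - a) * (real n * s)" "(1 - s) * (1 - a) * (real n * a / (1 - a)) = (1 - s) * (real n * a)"
      using assms a1 by auto
    then show ?thesis unfolding mean_flux_def by (simp add: algebra_simps)
  qed
  moreover have "(1 - s) * (1 - a) > 0" using assms a1 by simp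
  ultimately show ?thesis by (metis eq_divide_imp mult.commute less_irrefl)
qed

lemma L_bounds: "L \<ge> 6" "L > 0" "6 \<le> a * L" "6 \<le> (1 - a) * L" "3 / L \<le> a / 2" "3 / L \<le> (1 - a) / 2" "1 / L \<le> 1"
proof -
  let ?\<mu> = "min a (1 - a)"
  have mu: "0 < ?\<mu>" "?\<mu> \<le> 1" using a0 a1 by auto
  have mL: "6 \<le> L * ?\<mu>" using L mu by (simp add: field_simps)
  show L0: "L > 0" using mu mL by (smt (verit) mult_nonneg_nonpos mult_nonneg_nonneg mult.commute)
  have 1: "L * ?\<mu> \<le> L * a" "L * ?\<mu> \<le> L * (1 - a)" "L * ?\<mu> \<le> L * 1" using L0 mu by (auto intro!: mult_left_mono)
  have "6 \<le> L * a" "6 \<le> L * (1 - a)" "6 \<le> L" using 1 mL by linarith+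
  then show "L \<ge> 6" "6 \<le> a * L" "6 \<le> (1 - a) * L" by (simp_all add: mult.commute)
  then show "3 / L \<le> a / 2" "3 / L \<le> (1 - a) / 2" "1 / L \<le> 1" using L0 by (auto simp: field_simps)
qed

lemma flux_ok_basic:
  assumes "0 < b" "b < 1" shows "flux_ok b K (\<lambda>y. max 0 (y - r))" "flux_ok b K (\<lambda>y. max 0 (r - y))" "flux_ok b K (\<lambda>y. y)" "flux_ok b K (\<lambda>y. y\<^sup>2)" "flux_ok b K (\<lambda>_. c)"
  using flux_ok_pos_part assms by auto

text \<open>If \<open>v\<close> is the minimum of \<open>u\<close> and \<open>w\<close>, then
  \<open>u - v \<le> max 0 (u - r) + max 0 (r - w)\<close> for every level \<open>r\<close>. The
  third system has arrivals \<open>g > b\<close>, so the explicit exponential moment applies to its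
  lower deviations.\<close>

lemma qsum_le:
  assumes b: "a < b" "b < g" "g < 1"
  shows "(b - a) / (1 - a)\<^sup>2 * qsum p a K n \<le> J a a (\<lambda>y. max 0 (y - r)) + J g b (\<lambda>y. max 0 (r - y))"
proof -
  have b': "0 \<le> a" "a \<le> g" "g \<le> 1" "a \<le> b" "b < 1" "0 < b" "a \<le> 1" "0 \<le> b" "0 \<le> g" using b a0 a1 by auto
  have j: "flux_ok b K (\<lambda>y. max 0 (y - r) + -1 * y)" "flux_ok a K (\<lambda>y. max 0 (y - r) + -1 * y)"
    by (intro flux_ok_add flux_ok_cmult flux_ok_basic; use b' a0 a1 in simp)+
  have "0 \<le> J a a (\<lambda>y. max 0 (y - r) + -1 * y) + J a b (\<lambda>y. y) + J g b (\<lambda>y. max 0 (r - y))"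
    by (rule flux_avg_coupling[OF b'(1-3) b'(1,4,5) j(1)]) (use b' in \<open>auto intro!: flux_ok_basic\<close>)
  also have "J a a (\<lambda>y. max 0 (y - r) + -1 * y) = J a a (\<lambda>y. max 0 (y - r)) + -1 * J a a (\<lambda>y. y)"
    using flux_avg_add[OF b'(1,7,1) a1 flux_ok_basic(1)[OF a0 a1] flux_ok_cmult[OF flux_ok_basic(3)[OF a0 a1]], of r "-1"]
      flux_avg_cmult[OF b'(1,7,1) a1 flux_ok_basic(3)[OF a0 a1], of "-1"] by simp
  finally have "J a a (\<lambda>y. y) - J a b (\<lambda>y. y) \<le> J a a (\<lambda>y. max 0 (y - r)) + J g b (\<lambda>y. max 0 (r - y))" by simp
  then show ?thesis using flux_avg_diff_ge[OF b'(1,4,5), of K] by (simp add: qsum_def)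
qed

text \<open>The same inequality with \<open>w - v\<close> in place of \<open>u - v\<close>. The
  stationary system is now the third one, and the first, with arrivals \<open>g > b\<close>, is
  accessible to the exponential moment.\<close>

lemma arrivals_le:
  assumes b: "0 < b" "b < g" "g < a" "1 \<le> n"
  shows "p * (a - g) * (\<Sum>s<K. qpass p a s n) \<le> J a a (\<lambda>y. max 0 (y - r)) + J g b (\<lambda>y. max 0 (r - y))"
proof -
  have b': "0 \<le> g" "g \<le> a" "a \<le> 1" "0 \<le> b" "b \<le> a" "0 \<le> a" "g \<le> 1" using b a0 a1 by auto
  have j: "flux_ok a K (\<lambda>y. max 0 (y - r) + -1 * y)"
    by (intro flux_ok_add flux_ok_cmult flux_ok_basic a0 a1)
  have "0 \<le> J g b (\<lambda>y. max 0 (r - y)) + J g a (\<lambda>y. y) + J a a (\<lambda>y. max 0 (y - r) + -1 * y)"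
    by (rule flux_avg_coupling[OF b'(1-5) a1 _ _ j]) (use a0 a1 in \<open>auto intro!: flux_ok_basic\<close>)
  also have "J a a (\<lambda>y. max 0 (y - r) + -1 * y) = J a a (\<lambda>y. max 0 (y - r)) + -1 * J a a (\<lambda>y. y)"
    using flux_avg_add[OF b'(6,3,6) a1 flux_ok_basic(1)[OF a0 a1] flux_ok_cmult[OF flux_ok_basic(3)[OF a0 a1]], of r "-1"]
      flux_avg_cmult[OF b'(6,3,6) a1 flux_ok_basic(3)[OF a0 a1], of "-1"] by simp
  finally have "J a a (\<lambda>y. y) - J g a (\<lambda>y. y) \<le> J a a (\<lambda>y. max 0 (y - r)) + J g b (\<lambda>y. max 0 (r - y))" by simp
  then show ?thesis using flux_avg_arrivals_diff_ge[OF b'(1,2) a1 b(4), of K] by simp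
qed

lemma J_sq: "J a a (\<lambda>y. (y - m0)\<^sup>2) = a * L ^ 3 * (1 - p * a) - real n * (a / (1 - a)\<^sup>2) + 2 * (a / (1 - a)\<^sup>2) * qsum p a K n"
proof -
  have a': "0 \<le> a" "a \<le> 1" using a0 a1 by auto
  have "J a a (\<lambda>y. (y - m0)\<^sup>2) = J a a (\<lambda>y. y\<^sup>2 + ((- 2 * m0) * y + m0\<^sup>2))"
    by (simp add: power2_diff algebra_simps)
  also have "\<dots> = J a a (\<lambda>y. y\<^sup>2) + ((- 2 * m0) * J a a (\<lambda>y. y) + m0\<^sup>2)"
    using a' a0 a1 by (simp only: flux_avg_add[OF a' a'(1) a1] flux_avg_cmult[OF a' a'(1) a1] flux_avg_const[OF a'(1) a1] flux_ok_add flux_ok_cmult flux_ok_basic)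
  finally show ?thesis using flux_avg_sq[OF a'(1) a1, of K] mean T unfolding qsum_def[symmetric]
    by (simp add: power2_eq_square algebra_simps)
qed

end

section \<open>Upper bounds at the critical length\<close>

locale critical_chain = scaled_chain +
  assumes near: "\<bar>(1 - a)\<^sup>2 * L ^ 3 - real n\<bar> \<le> 3"
begin

abbreviation "D \<equiv> 36 / (1 - a)\<^sup>2"
abbreviation "h \<equiv> 1 / L"

text \<open>Up to the slack in \<open>near\<close> the mean flux has no first-order term at
  \<open>a\<close>. A density change of order \<open>1 / L\<close> thus changes it by order
  \<open>L ^ 3 * (1 / L)\<^sup>2 = L\<close>.\<close>

lemma mean_flux_near:
  assumes "\<bar>s - a\<bar> \<le> 3 / L" shows "\<bar>mean_flux s - m0\<bar> \<le> D * L"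
proof -
  have s: "1 - s \<ge> (1 - a) / 2" "s < 1" using assms L_bounds(6) a1 by (auto simp: abs_le_iff)
  have "L ^ 3 * ((1 - a) * (1 - s)) - real n = ((1 - a)\<^sup>2 * L ^ 3 - real n) + L ^ 3 * (1 - a) * (a - s)"
    by (simp add: algebra_simps power2_eq_square)
  moreover have "\<bar>L ^ 3 * (1 - a) * (a - s)\<bar> \<le> 3 * L\<^sup>2"
  proof -
    have "\<bar>L ^ 3 * (1 - a) * (a - s)\<bar> = L ^ 3 * (1 - a) * \<bar>s - a\<bar>" using L_bounds a1 by (simp add: abs_mult)
    also have "\<dots> \<le> L ^ 3 * 1 * (3 / L)" using L_bounds a0 a1 assms by (intro mult_mono) auto
    also have "\<dots> = 3 * L\<^sup>2" using L_bounds by (simp add: power2_eq_square power3_eq_cube)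
    finally show ?thesis .
  qed
  moreover have "3 \<le> 3 * L\<^sup>2" using L_bounds by (simp add: one_le_power)
  ultimately have 1: "\<bar>L ^ 3 * ((1 - a) * (1 - s)) - real n\<bar> \<le> 6 * L\<^sup>2" using near by linarith
  have 2: "(1 - a)\<^sup>2 / 2 \<le> (1 - s) * (1 - a)" using mult_right_mono[OF s(1), of "1 - a"] a1 by (simp add: power2_eq_square)
  have "\<bar>mean_flux s - m0\<bar> = \<bar>s - a\<bar> * \<bar>L ^ 3 * ((1 - a) * (1 - s)) - real n\<bar> / ((1 - s) * (1 - a))"
    unfolding mean_flux_diff[OF s(2)] using s a1 by (simp add: abs_mult)
  also have "\<dots> \<le> (3 / L * (6 * L\<^sup>2)) / ((1 - a)\<^sup>2 / 2)"
    using 1 2 assms a1 s L_bounds by (intro frac_le mult_mono) auto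
  also have "\<dots> = D * L" using L_bounds by (simp add: field_simps power2_eq_square)
  finally show ?thesis .
qed

text \<open>The margin is \<open>- (D * L)\<close> and the exponent \<open>ln g - ln b\<close> is of
  order \<open>1 / L\<close>. Their product stays bounded, and division by the exponent gives the
  order \<open>L\<close>.\<close>

lemma J_near_lower_tail:
  assumes "a - 3 / L \<le> b" "g \<le> a + 3 / L" "g - b = h"
  shows "J g b (\<lambda>y. max 0 (m0 - y)) \<le> exp (2 * D / a) * L"
proof -
  have b: "a / 2 \<le> b" "b < g" "g < 1" "0 < b"
  proof -
    have "0 < h" using L_bounds by simp
    then show "b < g" using assms(3) by linarith
    show "a / 2 \<le> b" using assms(1) L_bounds(5) by argo
    then show "0 < b" using a0 by linarith
    show "g < 1" using assms(2) L_bounds(6) a1 by argo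
  qed
  have "J g b (\<lambda>y. max 0 (m0 - y)) \<le> exp (- (- (D * L)) * (ln g - ln b)) / (ln g - ln b)"
  proof (rule flux_avg_lower_tail[OF b(4,2,3)])
    fix s assume "b \<le> s" "s \<le> g"
    then have "\<bar>mean_flux s - m0\<bar> \<le> D * L" using assms by (intro mean_flux_near) auto
    moreover have "real K * p * s - real n * s / (1 - s) = mean_flux s" using T by (simp add: mean_flux_def)
    ultimately show "m0 + - (D * L) \<le> real K * p * s - real n * s / (1 - s)" by linarith
  qed
  also have "\<dots> \<le> exp (2 * D / a) / h"
  proof (rule frac_le)
    have "ln g - ln b \<le> h / b" using ln_diff_bounds(2)[of b g] b assms(3) by simp
    also have "\<dots> \<le> h / (a / 2)" using b a0 L_bounds by (intro divide_left_mono) auto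
    finally have "(D * L) * (ln g - ln b) \<le> (D * L) * (h / (a / 2))" using L_bounds by (intro mult_left_mono) auto
    also have "\<dots> = 2 * D / a" using L_bounds by simp
    finally show "exp (- (- (D * L)) * (ln g - ln b)) \<le> exp (2 * D / a)" by simp
    have "h \<le> h / g" using b L_bounds by (simp add: field_simps)
    also have "\<dots> \<le> ln g - ln b" using ln_diff_bounds(1)[of b g] b assms(3) by simp
    finally show "h \<le> ln g - ln b" .
  qed (use L_bounds in auto)
  finally show ?thesis by simp
qed

text \<open>The stationary flux is the minimum of the fluxes with arrivals \<open>a\<close>, initial
  density \<open>a - h\<close> and with arrivals \<open>a + h\<close>, initial density
  \<open>a\<close>. Both have more arrivals than initial density, so both lower tails are known. As
  the mean is \<open>m0\<close>, the upper deviation equals the lower one.\<close>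

lemma J_pos_part: "J a a (\<lambda>y. max 0 (y - m0)) \<le> 2 * exp (2 * D / a) * L"
proof -
  have b: "0 \<le> a" "a \<le> a + h" "a + h \<le> 1" "0 \<le> a - h" "a - h \<le> a" "a \<le> 1" using a0 a1 L_bounds by (auto simp: field_simps)
  have j: "flux_ok a K (\<lambda>y. max 0 (m0 - y))" "flux_ok a K (\<lambda>y. - 1 * max 0 (m0 - y))"
    by (intro flux_ok_cmult flux_ok_basic a0 a1)+
  have "0 \<le> J a (a - h) (\<lambda>y. max 0 (m0 - y)) + J a a (\<lambda>y. - 1 * max 0 (m0 - y)) + J (a + h) a (\<lambda>y. max 0 (m0 - y))"
    by (rule flux_avg_coupling[OF b(1-5) a1 j(1,2,1)]) auto
  also have "J a a (\<lambda>y. - 1 * max 0 (m0 - y)) = - 1 * J a a (\<lambda>y. max 0 (m0 - y))"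
    by (rule flux_avg_cmult[OF b(1,6,1) a1 j(1)])
  also have "J a (a - h) (\<lambda>y. max 0 (m0 - y)) \<le> exp (2 * D / a) * L"
    by (rule J_near_lower_tail) (use L_bounds in \<open>auto simp: field_simps\<close>)
  also have "J (a + h) a (\<lambda>y. max 0 (m0 - y)) \<le> exp (2 * D / a) * L"
    by (rule J_near_lower_tail) (use L_bounds in \<open>auto simp: field_simps\<close>)
  finally have 1: "J a a (\<lambda>y. max 0 (m0 - y)) \<le> 2 * exp (2 * D / a) * L" by linarith
  have "J a a (\<lambda>y. max 0 (y - m0)) = J a a (\<lambda>y. max 0 (m0 - y) + (y + (- m0)))"
    by (intro arg_cong[of _ _ "J a a"] ext) auto
  also have "\<dots> = J a a (\<lambda>y. max 0 (m0 - y)) + (J a a (\<lambda>y. y) + (- m0))"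
    using a0 a1 by (simp only: flux_avg_add[OF b(1,6,1) a1] flux_avg_const[OF b(1) a1] flux_ok_add flux_ok_basic)
  finally show ?thesis using 1 mean by simp
qed

lemma qsum_upper: "qsum p a K n \<le> 3 * (1 - a)\<^sup>2 * exp (2 * D / a) * L\<^sup>2"
proof -
  have b: "a < a + h" "a + h < a + 2 * h" "a + 2 * h < 1" using a0 a1 L_bounds by (auto simp: field_simps)
  have "J (a + 2 * h) (a + h) (\<lambda>y. max 0 (m0 - y)) \<le> exp (2 * D / a) * L"
    by (rule J_near_lower_tail) (use L_bounds in \<open>auto simp: field_simps\<close>)
  then have "(a + h - a) / (1 - a)\<^sup>2 * qsum p a K n \<le> 3 * exp (2 * D / a) * L"
    using qsum_le[OF b, of m0] J_pos_part by simp
  then have "(h / (1 - a)\<^sup>2 * qsum p a K n) * ((1 - a)\<^sup>2 * L) \<le> (3 * exp (2 * D / a) * L) * ((1 - a)\<^sup>2 * L)"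
    using L_bounds by (intro mult_right_mono) auto
  moreover have "(h / (1 - a)\<^sup>2 * qsum p a K n) * ((1 - a)\<^sup>2 * L) = qsum p a K n" using L_bounds a1 by simp
  moreover have "(3 * exp (2 * D / a) * L) * ((1 - a)\<^sup>2 * L) = 3 * (1 - a)\<^sup>2 * exp (2 * D / a) * L\<^sup>2"
    by (simp add: power2_eq_square[of L])
  ultimately show ?thesis by linarith
qed

text \<open>At the critical length the two explicit terms of the variance cancel up to a bounded
  amount, and the sum \<open>qsum\<close> alone sets the order.\<close>

lemma variance_upper: "J a a (\<lambda>y. (y - m0)\<^sup>2) \<le> (3 * a / (1 - a)\<^sup>2 + 6 * a * exp (2 * D / a)) * L\<^sup>2"
proof -
  let ?c = "a / (1 - a)\<^sup>2"
  have "a * L ^ 3 * (1 - p * a) \<le> a * L ^ 3 * 1" using a0 L_bounds p0 by (intro mult_left_mono) auto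
  also have "\<dots> = ?c * ((1 - a)\<^sup>2 * L ^ 3)" using a1 by simp
  finally have "J a a (\<lambda>y. (y - m0)\<^sup>2) \<le> ?c * ((1 - a)\<^sup>2 * L ^ 3 - real n) + 2 * ?c * qsum p a K n"
    unfolding J_sq by (simp add: algebra_simps)
  also have "?c * ((1 - a)\<^sup>2 * L ^ 3 - real n) \<le> ?c * (3 * L\<^sup>2)"
  proof (rule mult_left_mono)
    have "1 \<le> L\<^sup>2" using L_bounds by (simp add: one_le_power)
    then show "(1 - a)\<^sup>2 * L ^ 3 - real n \<le> 3 * L\<^sup>2" using near by linarith
  qed (use a0 in auto)
  also have "2 * ?c * qsum p a K n \<le> 2 * ?c * (3 * (1 - a)\<^sup>2 * exp (2 * D / a) * L\<^sup>2)"
    using qsum_upper a0 by (intro mult_left_mono) auto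
  also have "?c * (3 * L\<^sup>2) + 2 * ?c * (3 * (1 - a)\<^sup>2 * exp (2 * D / a) * L\<^sup>2) =
    (3 * a / (1 - a)\<^sup>2 + 6 * a * exp (2 * D / a)) * L\<^sup>2" using a1 by (simp add: field_simps)
  finally show ?thesis by simp
qed

lemma J_pos_part_shifted:
  assumes "g > 0"
  shows "J a a (\<lambda>y. max 0 (y - m0 - g)) \<le> (3 * a / (1 - a)\<^sup>2 + 6 * a * exp (2 * D / a)) * L\<^sup>2 / (4 * g)"
proof -
  have a': "0 \<le> a" "a \<le> 1" using a0 a1 by auto
  have j1: "flux_ok a K (\<lambda>y. max 0 (y - m0 - g))" using flux_ok_basic(1)[OF a0 a1, of "m0 + g"] by (simp add: algebra_simps)
  have j2: "flux_ok a K (\<lambda>y. (y - m0)\<^sup>2)"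
  proof -
    have "flux_ok a K (\<lambda>y. y\<^sup>2 + ((- 2 * m0) * y + m0\<^sup>2))" using a0 a1 by (intro flux_ok_add flux_ok_cmult flux_ok_basic)
    then show ?thesis by (simp add: power2_diff algebra_simps)
  qed
  have "J a a (\<lambda>y. max 0 (y - m0 - g)) \<le> J a a (\<lambda>y. 1 / (4 * g) * (y - m0)\<^sup>2)"
  proof (rule flux_avg_mono[OF a' a'(1) a1 j1 flux_ok_cmult[OF j2]])
    fix y
    have "0 \<le> (y - m0 - 2 * g)\<^sup>2" by simp
    also have "(y - m0 - 2 * g)\<^sup>2 = (y - m0)\<^sup>2 - 4 * g * (y - m0 - g)" by (simp add: power2_eq_square algebra_simps)
    finally have "y - m0 - g \<le> 1 / (4 * g) * (y - m0)\<^sup>2" using assms by (simp add: field_simps)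
    then show "max 0 (y - m0 - g) \<le> 1 / (4 * g) * (y - m0)\<^sup>2" using assms by simp
  qed
  also have "\<dots> = 1 / (4 * g) * J a a (\<lambda>y. (y - m0)\<^sup>2)" by (rule flux_avg_cmult[OF a' a'(1) a1 j2])
  also have "\<dots> \<le> 1 / (4 * g) * ((3 * a / (1 - a)\<^sup>2 + 6 * a * exp (2 * D / a)) * L\<^sup>2)"
    using variance_upper assms by (intro mult_left_mono) auto
  finally show ?thesis by simp
qed

lemma ln_1_minus_ge: fixes x :: real assumes "0 \<le> x" "x \<le> 1/2" shows "exp (- x - 2 * x\<^sup>2) \<le> 1 - x"
  using ln_one_minus_pos_lower_bound[OF assms] assms by (simp add: ln_ge_iff)

text \<open>Up to the level \<open>R\<close> this is a second-order Taylor bound. Beyond it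
  \<open>exp Y = exp (2 * Y) * exp (- Y) \<le> exp (- R) * exp (2 * Y)\<close>.\<close>

lemma exp_remainder: fixes Y R :: real assumes "0 \<le> R" shows "exp Y - 1 - Y \<le> exp R * Y\<^sup>2 + exp (- R) * exp (2 * Y)"
proof (cases "Y \<le> R")
  case True
  have "exp Y - 1 - Y \<le> exp R * Y\<^sup>2"
  proof (cases "Y = 0")
    case False
    show ?thesis
    proof (cases "Y < 0")
      case True
      define y where "y = - Y"
      have y: "y > 0" using True by (simp add: y_def)
      have q: "1 + y + y\<^sup>2 / 2 \<le> exp y" by (rule exp_lower_Taylor_quadratic) (use y in simp)
      have "1 \<le> (1 - y + y\<^sup>2) * (1 + y + y\<^sup>2 / 2)"
      proof -
        have "(1 - y + y\<^sup>2) * (1 + y + y\<^sup>2 / 2) = 1 + y\<^sup>2 / 2 + y ^ 3 / 2 + y ^ 4 / 2"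
          by (simp add: field_simps power2_eq_square power3_eq_cube power4_eq_xxxx)
        then show ?thesis using y by simp
      qed
      also have "\<dots> \<le> (1 - y + y\<^sup>2) * exp y"
      proof (rule mult_left_mono[OF q])
        have "0 \<le> (1 - y / 2)\<^sup>2 + 3 / 4 * y\<^sup>2" by simp
        also have "\<dots> = 1 - y + y\<^sup>2" by (simp add: power2_eq_square algebra_simps)
        finally show "0 \<le> 1 - y + y\<^sup>2" .
      qed
      finally have "exp Y \<le> 1 + Y + Y\<^sup>2" by (simp add: y_def exp_minus field_simps)
      moreover have "Y\<^sup>2 \<le> exp R * Y\<^sup>2" using assms mult_right_mono[of 1 "exp R" "Y\<^sup>2"] by simp
      ultimately show ?thesis by linarith
    next
      case Y: False
      obtain t where t: "\<bar>t\<bar> \<le> \<bar>Y\<bar>" "exp Y = (\<Sum>m<2. Y ^ m / fact m) + exp t / fact 2 * Y ^ 2"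
        using Maclaurin_exp_le[of Y 2] by blast
      have "exp t \<le> exp R" using t(1) Y True by auto
      then have "exp t / 2 \<le> exp R" using exp_gt_zero[of t] by linarith
      then have "exp t / 2 * Y\<^sup>2 \<le> exp R * Y\<^sup>2" by (intro mult_right_mono) auto
      then show ?thesis using t(2) by (simp add: numeral_2_eq_2)
    qed
  qed simp
  then show ?thesis by (simp add: add_increasing2)
next
  case False
  have "exp Y = exp (2 * Y) * exp (- Y)" by (simp add: exp_add[symmetric])
  also have "\<dots> \<le> exp (2 * Y) * exp (- R)" using False by (intro mult_left_mono) auto
  finally have "exp Y \<le> exp (- R) * exp (2 * Y)" by (simp add: mult.commute)
  moreover have "0 \<le> exp R * Y\<^sup>2" by simp
  ultimately show ?thesis using False assms by linarith
qed

end

section \<open>Tails away from the critical length\<close>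

lemma exp_div_le:
  assumes "0 < d" "0 < (\<sigma>::real)" "\<sigma> \<le> t" shows "exp (- d * t) / t \<le> 1 / (d * \<sigma>\<^sup>2)"
proof -
  have t: "t > 0" using assms by simp
  have "d * t \<le> exp (d * t)" using exp_ge_add_one_self[of "d * t"] by linarith
  then have "exp (- d * t) \<le> 1 / (d * t)" using assms t by (simp add: exp_minus field_simps)
  then have "exp (- d * t) / t \<le> 1 / (d * t) / t" using t by (intro divide_right_mono) auto
  also have "\<dots> = 1 / (d * t\<^sup>2)" by (simp add: power2_eq_square)
  also have "\<dots> \<le> 1 / (d * \<sigma>\<^sup>2)" using assms t by (intro divide_left_mono mult_left_mono power_mono) auto
  finally show ?thesis .
qed

lemma ln_diff_ge: assumes "0 < b" "b \<le> g" "g \<le> (1::real)" shows "g - b \<le> ln g - ln b"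
proof -
  have "(g - b) * 1 \<le> (g - b) * (1 / g)" using assms by (intro mult_left_mono) (auto simp: field_simps)
  then show ?thesis using ln_diff_bounds(1)[OF assms(1,2)] by simp
qed

lemma geo_const:
  fixes u X V :: real
  assumes "u > 0" "X > 0" "V > 0"
  shows "1 / (u\<^sup>2 / (32 * X) / 2 * (V * u / (256 * X))\<^sup>2) = 4194304 / V\<^sup>2 * (X ^ 3 / u ^ 4)"
  using assms by (simp add: power2_eq_square power3_eq_cube power4_eq_xxxx field_simps)

lemma exp_const:
  fixes u X :: real
  assumes "u > 0" "X > 0"
  shows "1 / (u\<^sup>2 / (16 * X) * (u / (4 * X))\<^sup>2) = 256 * (X ^ 3 / u ^ 4)"
  using assms by (simp add: power2_eq_square power3_eq_cube power4_eq_xxxx field_simps)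

lemma pow_ratio_le:
  assumes "0 < u" "0 < L" "L\<^sup>2 \<le> (u::real)" shows "L ^ 9 / u ^ 4 \<le> L ^ 5 / u\<^sup>2"
proof -
  have "(L\<^sup>2)\<^sup>2 \<le> u\<^sup>2" using assms by (intro power_mono) auto
  then have "L ^ 4 / u\<^sup>2 \<le> 1" using assms by (simp add: power_mult[symmetric])
  then have "L ^ 5 / u\<^sup>2 * (L ^ 4 / u\<^sup>2) \<le> L ^ 5 / u\<^sup>2 * 1" using assms by (intro mult_left_mono) auto
  moreover have "L ^ 9 / u ^ 4 = L ^ 5 / u\<^sup>2 * (L ^ 4 / u\<^sup>2)" by (simp add: power_add[symmetric])
  ultimately show ?thesis by linarith
qed

context critical_chain begin

abbreviation "var_const \<equiv> 3 * a / (1 - a)\<^sup>2 + 6 * a * exp (2 * D / a)"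

lemma lower_chain: "m \<le> n \<Longrightarrow> scaled_chain p m a K L"
  using chain_le p0 L T a0 a1 unfolding scaled_chain_def chain_def scaled_chain_axioms_def by simp

lemma geo_term_bound:
  assumes "0 < u" "g = u\<^sup>2 / (32 * L ^ 3)" "\<sigma> = (1 - a)\<^sup>2 * u / (256 * L ^ 3)" "L\<^sup>2 \<le> u"
  shows "1 / (g / 2 * \<sigma>\<^sup>2) \<le> 4194304 / (1 - a) ^ 4 * (L ^ 5 / u\<^sup>2)"
proof -
  have "1 / (g / 2 * \<sigma>\<^sup>2) = 4194304 / (1 - a) ^ 4 * (L ^ 9 / u ^ 4)"
    using geo_const[of u "L ^ 3" "(1 - a)\<^sup>2"] assms(1) L_bounds a1 unfolding assms(2,3) by (simp add: power_mult[symmetric])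
  also have "\<dots> \<le> 4194304 / (1 - a) ^ 4 * (L ^ 5 / u\<^sup>2)"
    by (intro mult_left_mono pow_ratio_le) (use assms L_bounds in auto)
  finally show ?thesis .
qed

end

lemma exp_term_bound:
  assumes "0 < u" "0 < L" "L\<^sup>2 \<le> u" shows "1 / (u\<^sup>2 / (16 * L ^ 3) * (u / (4 * L ^ 3))\<^sup>2) \<le> 256 * (L ^ 5 / (u::real)\<^sup>2)"
proof -
  have "1 / (u\<^sup>2 / (16 * L ^ 3) * (u / (4 * L ^ 3))\<^sup>2) = 256 * (L ^ 9 / u ^ 4)"
    using exp_const[of u "L ^ 3"] assms by (simp add: power_mult[symmetric])
  also have "L ^ 9 / u ^ 4 \<le> L ^ 5 / u\<^sup>2" by (rule pow_ratio_le[OF assms])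
  finally show ?thesis by simp
qed

text \<open>The three contributions are the variance at the critical length, the particle number
  between the two lengths, and the exponential bound at shifted densities.\<close>

definition tail_const :: "real \<Rightarrow> real" where
  "tail_const a = 8 * (3 * a / (1 - a)\<^sup>2 + 6 * a * exp (2 * (36 / (1 - a)\<^sup>2) / a)) + 4194304 / (1 - a) ^ 4 + 256"

text \<open>Below the critical length by \<open>u\<close>, raising the density increases the mean
  flux to first order: densities between \<open>b\<close> and \<open>c\<close> gain at least
  \<open>u\<^sup>2 / (8 * L ^ 3)\<close>, and the level \<open>r\<close> takes half of this gain.
  Deviations of the stationary flux above \<open>r\<close> are traced back to the critical length,
  where the variance of order \<open>L\<^sup>2\<close> bounds them by order
  \<open>L ^ 5 / u\<^sup>2\<close>. Division by the density step \<open>u / (4 * L ^ 3)\<close>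
  gives the claim.\<close>

lemma qsum_left:
  assumes crit: "critical_chain p N a K L" and n: "n \<le> N" and u: "u = (1 - a)\<^sup>2 * L ^ 3 - real n" "L\<^sup>2 \<le> u"
  shows "qsum p a K n \<le> 4 * tail_const a * (L ^ 8 / u ^ 3)"
proof -
  interpret big: critical_chain p N a K L by (rule crit)
  interpret sm: scaled_chain p n a K L by (rule big.lower_chain[OF n])
  note L_bounds = big.L_bounds and a0 = big.a0 and a1 = big.a1
  define V where "V = (1 - a)\<^sup>2"
  have V: "0 < V" "V \<le> 1 - a" "V \<le> 1" using a0 a1 by (auto simp: V_def power2_eq_square mult_le_one mult_left_le)
  have L2: "36 \<le> L\<^sup>2" using power_mono[OF L_bounds(1), of 2] by simp
  have u36: "36 \<le> u" using L2 u by linarith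
  have u0: "0 < u" using u36 by simp
  have uV: "u / L ^ 3 \<le> V" using u(1) L_bounds by (simp add: V_def field_simps)
  have L3: "L ^ 3 > 0" using L_bounds by simp
  \<comment> \<open>A quarter of the gain. The level \<open>r\<close> exceeds the mean flux at the
    critical length plus the mean particle number in between by \<open>2 * g\<close>, one
    \<open>g\<close> for each of the two.\<close>
  define g where "g = u\<^sup>2 / (32 * L ^ 3)"
  define r where "r = sm.mean_flux a + u\<^sup>2 / (16 * L ^ 3)"
  \<comment> \<open>Chosen so that tilting from \<open>a\<close> to \<open>a + \<sigma>\<close>
    raises the mean number of particles on the \<open>k\<close> sites in between by at most
    \<open>g / 2\<close>.\<close>
  define \<sigma> where "\<sigma> = V * u / (256 * L ^ 3)"
  define k where "k = N - n"
  have g0: "g > 0" and s0: "\<sigma> > 0" using u0 L3 V by (auto simp: g_def \<sigma>_def)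
  have ku: "real k \<le> 2 * u"
  proof -
    have "real k \<le> u + 3" using big.near n u(1) by (simp add: k_def of_nat_diff abs_le_iff)
    then show ?thesis using u36 by linarith
  qed
  have mm: "sm.mean_flux a = big.mean_flux a + real k * (a / (1 - a))"
    using n by (simp add: sm.mean_flux_def big.mean_flux_def k_def of_nat_diff algebra_simps diff_divide_distrib)
  have r: "r = big.mean_flux a + g + (real k * (a / (1 - a)) + g)"
  proof -
    have "u\<^sup>2 / (16 * L ^ 3) = g + g" by (simp add: g_def)
    then show ?thesis by (simp add: r_def mm)
  qed
  let ?R = "real k * (a / (1 - a)) + g"
  have s1: "a + \<sigma> < 1" "\<sigma> \<le> (1 - a) / 2"
  proof -
    have "\<sigma> = V * (u / L ^ 3) / 256" by (simp add: \<sigma>_def)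
    also have "\<dots> \<le> 1 * V / 256" using V uV u0 L3 by (intro divide_right_mono mult_mono) auto
    finally show "a + \<sigma> < 1" "\<sigma> \<le> (1 - a) / 2" using V a0 a1 by auto
  qed
  have dGE: "real k * x / (1 - x) \<le> ?R - g / 2" if x: "a \<le> x" "x \<le> a + \<sigma>" for x
  proof -
    have x1: "(1 - a) / 2 \<le> 1 - x" using x s1 by argo
    then have x2: "1 - x > 0" using a1 by auto
    have "real k * x / (1 - x) - real k * (a / (1 - a)) = real k * (x - a) / ((1 - x) * (1 - a))"
      using x2 a1 by (simp add: field_simps)
    also have "\<dots> \<le> (2 * u * \<sigma>) / ((1 - a) / 2 * (1 - a))"
      using ku x x1 x2 a1 s0 u0 by (intro frac_le mult_mono mult_right_mono) auto
    also have "\<dots> = 4 * u * \<sigma> / V" by (simp add: V_def power2_eq_square)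
    also have "\<dots> = g / 2" using V L3 by (simp add: \<sigma>_def g_def field_simps power2_eq_square)
    finally show ?thesis by linarith
  qed
  note geo_avg = geo_avg_upper_tail[of a "a + \<sigma>" k ?R "g / 2", OF a0 _ s1(1) dGE]
  have GEb: "geo_avg k a (\<lambda>x. max 0 (x - ?R)) \<le> 4194304 / (1 - a) ^ 4 * (L ^ 5 / u\<^sup>2)"
  proof -
    have "geo_avg k a (\<lambda>x. max 0 (x - ?R)) \<le> exp (- (g / 2) * (ln (a + \<sigma>) - ln a)) / (ln (a + \<sigma>) - ln a)"
      by (rule geo_avg(1)) (use s0 in auto)
    also have "\<dots> \<le> 1 / (g / 2 * \<sigma>\<^sup>2)"
      using ln_diff_ge[of a "a + \<sigma>"] a0 s0 s1 g0 by (intro exp_div_le) auto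
    also have "\<dots> \<le> 4194304 / (1 - a) ^ 4 * (L ^ 5 / u\<^sup>2)"
      using big.geo_term_bound[OF u0 g_def _ u(2), of \<sigma>] by (simp add: \<sigma>_def V_def)
    finally show ?thesis .
  qed
  have J1: "flux_avg p n K a a (\<lambda>y. max 0 (y - r)) \<le> (8 * big.var_const + 4194304 / (1 - a) ^ 4) * (L ^ 5 / u\<^sup>2)"
  proof -
    obtain z C where z: "z > 1" "a * z < 1" "\<And>x::nat. \<bar>max 0 (real x - ?R)\<bar> \<le> C * z ^ x"
      using geo_avg(2) s0 by auto
    have ja: "flux_ok a K (\<lambda>y. max 0 (y - big.mean_flux a - g))" using big.flux_ok_basic(1)[OF a0 a1, of "big.mean_flux a + g"] by (simp add: algebra_simps)
    have jb: "flux_ok a K (\<lambda>y. -1 * max 0 (y - r))" by (intro flux_ok_cmult big.flux_ok_basic a0 a1)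
    have "0 \<le> flux_avg p N K a a (\<lambda>y. max 0 (y - big.mean_flux a - g)) + flux_avg p n K a a (\<lambda>y. -1 * max 0 (y - r))
      + pavg (replicate (N - n) (gw a)) (\<lambda>\<eta>. max 0 (real (tot (N - n) \<eta>) - ?R)) (\<lambda>_. 0)"
      by (rule big.flux_avg_split[OF less_imp_le[OF a0] a1 n ja jb z])
        (auto simp: r max_def)
    then have "flux_avg p n K a a (\<lambda>y. max 0 (y - r)) \<le> flux_avg p N K a a (\<lambda>y. max 0 (y - big.mean_flux a - g)) + geo_avg k a (\<lambda>x. max 0 (x - ?R))"
      using sm.flux_avg_cmult[OF less_imp_le[OF a0] less_imp_le[OF a1] less_imp_le[OF a0] a1 big.flux_ok_basic(1)[OF a0 a1], of "-1" r]
      by (simp add: geo_avg_def k_def)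
    also have "flux_avg p N K a a (\<lambda>y. max 0 (y - big.mean_flux a - g)) \<le> big.var_const * L\<^sup>2 / (4 * g)"
      by (rule big.J_pos_part_shifted[OF g0])
    also have "big.var_const * L\<^sup>2 / (4 * g) = 8 * big.var_const * (L ^ 5 / u\<^sup>2)"
      using L3 u0 L_bounds(2) unfolding g_def by (simp add: field_simps eval_nat_numeral)
    finally show ?thesis using GEb unfolding distrib_right[of "8 * _"] by linarith
  qed
  \<comment> \<open>Two equal density steps: the one from \<open>a\<close> to \<open>b\<close>
    divides the final bound, the one from \<open>b\<close> to \<open>c\<close> supplies the
    exponent.\<close>
  define b where "b = a + u / (4 * L ^ 3)"
  define c where "c = a + u / (2 * L ^ 3)"
  have bc: "a < b" "b < c" "c < 1" "b - a = u / (4 * L ^ 3)" "c - b = u / (4 * L ^ 3)"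
  proof -
    have "u / (2 * L ^ 3) \<le> V / 2" using uV by simp
    then show "c < 1" using V a1 by (simp add: c_def)
    show "a < b" "b < c" "b - a = u / (4 * L ^ 3)" "c - b = u / (4 * L ^ 3)" using u0 L3 by (auto simp: b_def c_def field_simps)
  qed
  have J2: "flux_avg p n K c b (\<lambda>y. max 0 (r - y)) \<le> 256 * (L ^ 5 / u\<^sup>2)"
  proof -
    have "flux_avg p n K c b (\<lambda>y. max 0 (r - y)) \<le> exp (- (u\<^sup>2 / (16 * L ^ 3)) * (ln c - ln b)) / (ln c - ln b)"
    proof (rule sm.flux_avg_lower_tail)
      fix s assume s: "b \<le> s" "s \<le> c"
      define x where "x = s - a"
      have x: "u / (4 * L ^ 3) \<le> x" "x \<le> u / (2 * L ^ 3)" using s by (auto simp: x_def b_def c_def)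
      have x0: "0 < x" using x(1) u0 L3 by (meson divide_pos_pos less_le_trans mult_pos_pos zero_less_numeral)
      have s1: "s < 1" "a < s" using s bc by auto
      have "L ^ 3 * ((1 - a) * (1 - s)) - real n = u - L ^ 3 * (1 - a) * x"
        by (simp add: u(1) x_def power2_eq_square algebra_simps)
      moreover have "L ^ 3 * (1 - a) * x \<le> L ^ 3 * 1 * (u / (2 * L ^ 3))"
        using x x0 L3 a0 a1 by (intro mult_mono) auto
      moreover have "L ^ 3 * 1 * (u / (2 * L ^ 3)) = u / 2" using L3 by simp
      ultimately have 1: "u / 2 \<le> L ^ 3 * ((1 - a) * (1 - s)) - real n" by linarith
      have "u\<^sup>2 / (8 * L ^ 3) = u / (4 * L ^ 3) * (u / 2)" by (simp add: power2_eq_square)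
      also have "\<dots> \<le> x * (L ^ 3 * ((1 - a) * (1 - s)) - real n)"
        using x x0 1 u0 by (intro mult_mono) auto
      also have "\<dots> \<le> x * (L ^ 3 * ((1 - a) * (1 - s)) - real n) / ((1 - s) * (1 - a))"
      proof -
        have "(1 - s) * (1 - a) \<le> 1 * 1" using s1 a0 a1 by (intro mult_mono) auto
        moreover have "0 < (1 - s) * (1 - a)" using s1 a1 by simp
        moreover have "0 \<le> x * (L ^ 3 * ((1 - a) * (1 - s)) - real n)" using x0 1 u0 by simp
        ultimately show ?thesis by (simp add: le_divide_eq mult_left_le)
      qed
      also have "\<dots> = sm.mean_flux s - sm.mean_flux a" using sm.mean_flux_diff[OF s1(1)] by (simp add: x_def)
      finally have "sm.mean_flux a + u\<^sup>2 / (8 * L ^ 3) \<le> sm.mean_flux s" by simp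
      moreover have "u\<^sup>2 / (8 * L ^ 3) = u\<^sup>2 / (16 * L ^ 3) + u\<^sup>2 / (16 * L ^ 3)" by simp
      moreover have "real K * p * s - real n * s / (1 - s) = sm.mean_flux s" using sm.T by (simp add: sm.mean_flux_def)
      ultimately show "r + u\<^sup>2 / (16 * L ^ 3) \<le> real K * p * s - real n * s / (1 - s)" unfolding r_def by linarith
    qed (use bc a0 in auto)
    also have "\<dots> \<le> 1 / (u\<^sup>2 / (16 * L ^ 3) * (u / (4 * L ^ 3))\<^sup>2)"
      using ln_diff_ge[of b c] bc a0 u0 L3 by (intro exp_div_le) auto
    also have "\<dots> \<le> 256 * (L ^ 5 / u\<^sup>2)" by (rule exp_term_bound[OF u0 L_bounds(2) u(2)])
    finally show ?thesis .
  qed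
  have "(b - a) / (1 - a)\<^sup>2 * qsum p a K n \<le> tail_const a * (L ^ 5 / u\<^sup>2)"
    using sm.qsum_le[OF bc(1-3), of r] J1 J2 by (simp add: tail_const_def algebra_simps)
  then have "((b - a) / V * qsum p a K n) * (V * (4 * L ^ 3 / u)) \<le> (tail_const a * (L ^ 5 / u\<^sup>2)) * (V * (4 * L ^ 3 / u))"
    using V L3 u0 unfolding V_def[symmetric] by (intro mult_right_mono) auto
  moreover have "((b - a) / V * qsum p a K n) * (V * (4 * L ^ 3 / u)) = qsum p a K n"
    unfolding bc(4) using V L3 u0 by simp
  moreover have "(tail_const a * (L ^ 5 / u\<^sup>2)) * (V * (4 * L ^ 3 / u)) = V * (4 * tail_const a * (L ^ 8 / u ^ 3))"
    by (simp add: eval_nat_numeral mult_ac)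
  moreover have "V * (4 * tail_const a * (L ^ 8 / u ^ 3)) \<le> 1 * (4 * tail_const a * (L ^ 8 / u ^ 3))"
    using V u0 L_bounds a0 a1 by (intro mult_right_mono) (auto simp: tail_const_def)
  ultimately show ?thesis by linarith
qed

text \<open>Above the critical length it is a lower density that raises the mean flux. The arrivals
  now take the part of the initial density, so the response is a sum over starting times instead of
  starting sites. The flux at \<open>n\<close> is the flux at \<open>N\<close> minus the particles
  in between, hence a shortage of those particles has to be excluded.\<close>

lemma qsum_right:
  assumes crit: "critical_chain p N a K L" and n: "N \<le> n" and pn: "p * (real n + 1) \<le> 1"
    and u: "u = real n - (1 - a)\<^sup>2 * L ^ 3" "L\<^sup>2 \<le> u" "u \<le> a * L ^ 3"
  shows "p * (\<Sum>s<K. qpass p a s n) \<le> 4 * tail_const a * (L ^ 8 / u ^ 3)"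
proof -
  interpret cr: critical_chain p N a K L by (rule crit)
  interpret big: scaled_chain p n a K L using pn cr.p0 cr.a0 cr.a1 cr.L cr.T by unfold_locales
  note L_bounds = cr.L_bounds and a0 = cr.a0 and a1 = cr.a1
  define V where "V = (1 - a)\<^sup>2"
  have V: "0 < V" "V \<le> 1 - a" "V \<le> 1" using a0 a1 by (auto simp: V_def power2_eq_square mult_le_one mult_left_le)
  have L2: "36 \<le> L\<^sup>2" using power_mono[OF L_bounds(1), of 2] by simp
  have u36: "36 \<le> u" using L2 u by linarith
  have u0: "0 < u" using u36 by simp
  have L3: "L ^ 3 > 0" using L_bounds by simp
  have ua: "u / L ^ 3 \<le> a" using u(3) L3 by (simp add: field_simps)
  have n1: "1 \<le> n"
  proof -
    have "real n \<ge> u" using u(1) L3 a1 by simp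
    then show ?thesis using u36 by linarith
  qed
  define g where "g = u\<^sup>2 / (32 * L ^ 3)"
  define r where "r = big.mean_flux a + u\<^sup>2 / (16 * L ^ 3)"
  define \<sigma> where "\<sigma> = V * u / (256 * L ^ 3)"
  define k where "k = n - N"
  have g0: "g > 0" and s0: "\<sigma> > 0" using u0 L3 V by (auto simp: g_def \<sigma>_def)
  have ku: "real k \<le> 2 * u"
  proof -
    have "real k \<le> u + 3" using cr.near n u(1) by (simp add: k_def of_nat_diff abs_le_iff)
    then show ?thesis using u36 by linarith
  qed
  have mm: "big.mean_flux a = cr.mean_flux a - real k * (a / (1 - a))"
    using n by (simp add: cr.mean_flux_def big.mean_flux_def k_def of_nat_diff algebra_simps diff_divide_distrib)
  let ?R = "real k * (a / (1 - a)) - g"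
  have r: "r = cr.mean_flux a + g - ?R"
  proof -
    have "u\<^sup>2 / (16 * L ^ 3) = g + g" by (simp add: g_def)
    then show ?thesis by (simp add: r_def mm)
  qed
  have s1: "\<sigma> < a"
  proof -
    have "\<sigma> = V * (u / L ^ 3) / 256" by (simp add: \<sigma>_def)
    also have "\<dots> \<le> 1 * a / 256" using V ua u0 L3 by (intro divide_right_mono mult_mono) auto
    finally show ?thesis using a0 by auto
  qed
  have dGE: "?R + g / 2 \<le> real k * x / (1 - x)" if x: "a - \<sigma> \<le> x" "x \<le> a" for x
  proof -
    have x1: "1 - a \<le> 1 - x" "1 - x > 0" using x a1 by auto
    have "real k * (a / (1 - a)) - real k * x / (1 - x) = real k * (a - x) / ((1 - x) * (1 - a))"
      using x1 a1 by (simp add: field_simps)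
    also have "\<dots> \<le> (2 * u * \<sigma>) / ((1 - a) * (1 - a))"
      using ku x x1 a1 s0 u0 by (intro frac_le mult_mono mult_right_mono) auto
    also have "\<dots> = 2 * u * \<sigma> / V" by (simp add: V_def power2_eq_square)
    also have "\<dots> = g / 4" using V L3 by (simp add: \<sigma>_def g_def field_simps power2_eq_square)
    finally show ?thesis using g0 by linarith
  qed
  note geo_avg = geo_avg_lower_tail[of "a - \<sigma>" a ?R "g / 2" k, OF _ _ a1 dGE]
  have GEb: "geo_avg k a (\<lambda>x. max 0 (?R - x)) \<le> 4194304 / (1 - a) ^ 4 * (L ^ 5 / u\<^sup>2)"
  proof -
    have "geo_avg k a (\<lambda>x. max 0 (?R - x)) \<le> exp (- (g / 2) * (ln a - ln (a - \<sigma>))) / (ln a - ln (a - \<sigma>))"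
      by (rule geo_avg(1)) (use s0 s1 in auto)
    also have "\<dots> \<le> 1 / (g / 2 * \<sigma>\<^sup>2)"
      using ln_diff_ge[of "a - \<sigma>" a] a0 a1 s0 s1 g0 by (intro exp_div_le) auto
    also have "\<dots> \<le> 4194304 / (1 - a) ^ 4 * (L ^ 5 / u\<^sup>2)"
      using cr.geo_term_bound[OF u0 g_def _ u(2), of \<sigma>] by (simp add: \<sigma>_def V_def)
    finally show ?thesis .
  qed
  have J1: "flux_avg p n K a a (\<lambda>y. max 0 (y - r)) \<le> (8 * cr.var_const + 4194304 / (1 - a) ^ 4) * (L ^ 5 / u\<^sup>2)"
  proof -
    obtain z C where z: "z > 1" "a * z < 1" "\<And>x::nat. \<bar>max 0 (?R - real x)\<bar> \<le> C * z ^ x"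
      using geo_avg(2) s0 s1 by auto
    have ja: "flux_ok a K (\<lambda>y. max 0 (y - cr.mean_flux a - g))" using cr.flux_ok_basic(1)[OF a0 a1, of "cr.mean_flux a + g"] by (simp add: algebra_simps)
    have jb: "flux_ok a K (\<lambda>y. -1 * max 0 (y - r))" by (intro flux_ok_cmult cr.flux_ok_basic a0 a1)
    have "0 \<le> flux_avg p n K a a (\<lambda>y. -1 * max 0 (y - r)) + flux_avg p N K a a (\<lambda>y. max 0 (y - cr.mean_flux a - g))
      + pavg (replicate (n - N) (gw a)) (\<lambda>\<eta>. max 0 (?R - real (tot (n - N) \<eta>))) (\<lambda>_. 0)"
      by (rule big.flux_avg_split[OF less_imp_le[OF a0] a1 n jb ja z])
        (auto simp: r max_def)
    then have "flux_avg p n K a a (\<lambda>y. max 0 (y - r)) \<le> flux_avg p N K a a (\<lambda>y. max 0 (y - cr.mean_flux a - g)) + geo_avg k a (\<lambda>x. max 0 (?R - x))"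
      using big.flux_avg_cmult[OF less_imp_le[OF a0] less_imp_le[OF a1] less_imp_le[OF a0] a1 cr.flux_ok_basic(1)[OF a0 a1], of "-1" r]
      by (simp add: geo_avg_def k_def)
    also have "flux_avg p N K a a (\<lambda>y. max 0 (y - cr.mean_flux a - g)) \<le> cr.var_const * L\<^sup>2 / (4 * g)"
      by (rule cr.J_pos_part_shifted[OF g0])
    also have "cr.var_const * L\<^sup>2 / (4 * g) = 8 * cr.var_const * (L ^ 5 / u\<^sup>2)"
      using L3 u0 L_bounds(2) unfolding g_def by (simp add: field_simps eval_nat_numeral)
    finally show ?thesis using GEb unfolding distrib_right[of "8 * _"] by linarith
  qed
  define b where "b = a - u / (2 * L ^ 3)"
  define c where "c = a - u / (4 * L ^ 3)"
  have bc: "0 < b" "b < c" "c < a" "a - c = u / (4 * L ^ 3)" "c - b = u / (4 * L ^ 3)"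
  proof -
    have "u / (2 * L ^ 3) \<le> a / 2" using ua by simp
    then show "0 < b" using a0 by (simp add: b_def)
    show "b < c" "c < a" "a - c = u / (4 * L ^ 3)" "c - b = u / (4 * L ^ 3)" using u0 L3 by (auto simp: b_def c_def field_simps)
  qed
  have J2: "flux_avg p n K c b (\<lambda>y. max 0 (r - y)) \<le> 256 * (L ^ 5 / u\<^sup>2)"
  proof -
    have "flux_avg p n K c b (\<lambda>y. max 0 (r - y)) \<le> exp (- (u\<^sup>2 / (16 * L ^ 3)) * (ln c - ln b)) / (ln c - ln b)"
    proof (rule big.flux_avg_lower_tail)
      fix s assume s: "b \<le> s" "s \<le> c"
      define x where "x = a - s"
      have x: "u / (4 * L ^ 3) \<le> x" "x \<le> u / (2 * L ^ 3)" using s by (auto simp: x_def b_def c_def)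
      have x0: "0 < x" using x(1) u0 L3 by (meson divide_pos_pos less_le_trans mult_pos_pos zero_less_numeral)
      have s1: "s < 1" "s < a" "0 < s" using s bc a1 by auto
      have "real n - L ^ 3 * ((1 - a) * (1 - s)) = u - L ^ 3 * (1 - a) * x"
        by (simp add: u(1) x_def power2_eq_square algebra_simps)
      moreover have "L ^ 3 * (1 - a) * x \<le> L ^ 3 * 1 * (u / (2 * L ^ 3))"
        using x x0 L3 a0 a1 by (intro mult_mono) auto
      moreover have "L ^ 3 * 1 * (u / (2 * L ^ 3)) = u / 2" using L3 by simp
      ultimately have 1: "u / 2 \<le> real n - L ^ 3 * ((1 - a) * (1 - s))" by linarith
      have "u\<^sup>2 / (8 * L ^ 3) = u / (4 * L ^ 3) * (u / 2)" by (simp add: power2_eq_square)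
      also have "\<dots> \<le> x * (real n - L ^ 3 * ((1 - a) * (1 - s)))"
        using x x0 1 u0 by (intro mult_mono) auto
      also have "\<dots> \<le> x * (real n - L ^ 3 * ((1 - a) * (1 - s))) / ((1 - s) * (1 - a))"
      proof -
        have "(1 - s) * (1 - a) \<le> 1 * 1" using s1 a0 a1 by (intro mult_mono) auto
        moreover have "0 < (1 - s) * (1 - a)" using s1 a1 by simp
        moreover have "0 \<le> x * (real n - L ^ 3 * ((1 - a) * (1 - s)))" using x0 1 u0 by simp
        ultimately show ?thesis by (simp add: le_divide_eq mult_left_le)
      qed
      also have "\<dots> = big.mean_flux s - big.mean_flux a"
      proof -
        have "x * (real n - L ^ 3 * ((1 - a) * (1 - s))) = (s - a) * (L ^ 3 * ((1 - a) * (1 - s)) - real n)"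
          by (simp add: x_def algebra_simps)
        then show ?thesis using big.mean_flux_diff[OF s1(1)] by simp
      qed
      finally have "big.mean_flux a + u\<^sup>2 / (8 * L ^ 3) \<le> big.mean_flux s" by simp
      moreover have "u\<^sup>2 / (8 * L ^ 3) = u\<^sup>2 / (16 * L ^ 3) + u\<^sup>2 / (16 * L ^ 3)" by simp
      moreover have "real K * p * s - real n * s / (1 - s) = big.mean_flux s" using big.T by (simp add: big.mean_flux_def)
      ultimately show "r + u\<^sup>2 / (16 * L ^ 3) \<le> real K * p * s - real n * s / (1 - s)" unfolding r_def by linarith
    qed (use bc a1 in auto)
    also have "\<dots> \<le> 1 / (u\<^sup>2 / (16 * L ^ 3) * (u / (4 * L ^ 3))\<^sup>2)"
      using ln_diff_ge[of b c] bc a0 a1 u0 L3 by (intro exp_div_le) auto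
    also have "\<dots> \<le> 256 * (L ^ 5 / u\<^sup>2)" by (rule exp_term_bound[OF u0 L_bounds(2) u(2)])
    finally show ?thesis .
  qed
  have "p * (a - c) * (\<Sum>s<K. qpass p a s n) \<le> tail_const a * (L ^ 5 / u\<^sup>2)"
    using big.arrivals_le[OF bc(1-3) n1, of r] J1 J2 by (simp add: tail_const_def algebra_simps)
  then have "(p * (a - c) * (\<Sum>s<K. qpass p a s n)) * (4 * L ^ 3 / u) \<le> (tail_const a * (L ^ 5 / u\<^sup>2)) * (4 * L ^ 3 / u)"
    using L3 u0 by (intro mult_right_mono) auto
  moreover have "(p * (a - c) * (\<Sum>s<K. qpass p a s n)) * (4 * L ^ 3 / u) = p * (\<Sum>s<K. qpass p a s n)"
    unfolding bc(4) using L3 u0 by simp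
  moreover have "(tail_const a * (L ^ 5 / u\<^sup>2)) * (4 * L ^ 3 / u) = 4 * tail_const a * (L ^ 8 / u ^ 3)"
    by (simp add: eval_nat_numeral mult_ac)
  ultimately show ?thesis by linarith
qed

section \<open>Lower bounds at the critical length\<close>

lemma flux_ok_bound:
  assumes "flux_ok b K \<psi>" "\<And>y. \<bar>\<phi> y\<bar> \<le> \<bar>\<psi> y\<bar>" shows "flux_ok b K \<phi>"
  using assms unfolding flux_ok_def by (meson order_trans)

context scaled_chain begin

text \<open>\<open>monotone_ln_combination\<close> with all signs reversed: an upper bound on the
  mean flux gives a lower bound on the exponent.\<close>

lemma mean_flux_below:
  assumes c: "0 < b" "b \<le> c" "c < 1" "\<And>s. b \<le> s \<Longrightarrow> s \<le> c \<Longrightarrow> mean_flux s \<le> m0 - e"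
  shows "(e - m0) * (ln c - ln b) \<le> - (L ^ 3 * (c - b)) - real n * (ln (1 - c) - ln (1 - b))"
proof -
  have "e - m0 \<le> (- (L ^ 3)) * s - (- real n) * s / (1 - s)" if "b \<le> s" "s \<le> c" for s
    using c(4)[OF that] by (simp add: mean_flux_def)
  from monotone_ln_combination[OF c(1-3) this] show ?thesis by simp
qed

end

context critical_chain begin

text \<open>With arrivals \<open>a\<close> and initial density \<open>a - h\<close> the exponential
  moment is explicit. Below \<open>a\<close> the mean flux falls short of \<open>m0\<close> by at
  least \<open>(a - s)\<^sup>2 * L ^ 3\<close>, and the accumulated shortfall contributes at least
  \<open>1 / 8\<close> to the exponent. Half of this is given up in comparing
  \<open>(1 - p * h) ^ K\<close> with \<open>exp (- L\<^sup>2)\<close>. Raising the initial density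
  to \<open>a\<close> lowers the flux, so the stationary moment is at least as large.\<close>

lemma fluctuation:
  assumes n: "real n \<le> (1 - a)\<^sup>2 * L ^ 3" and pL: "p * L \<le> 1 / 32"
  shows "1 + 1 / 16 \<le> J a a (\<lambda>y. exp (- (ln a - ln (a - h)) * (y - m0)))"
proof -
  define hh where "hh = h"
  have hL: "hh * L = 1" "hh = 1 / L" using L_bounds by (auto simp: hh_def)
  define b where "b = a - hh"
  define c where "c = a - hh / 2"
  define \<theta> where "\<theta> = ln a - ln b"
  have h0: "0 < hh" using L_bounds by (simp add: hL)
  have h1: "3 * hh \<le> a / 2" "3 * hh \<le> (1 - a) / 2" using L_bounds(5,6) by (simp_all add: hL)
  have b: "0 < b" "b < c" "c < a" "c < 1" "b < a" "b < 1" using h0 h1 a0 a1 unfolding b_def c_def by linarith+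
  have \<theta>: "\<theta> > 0" "exp \<theta> = a / b" using b a0 by (auto simp: \<theta>_def exp_diff)
  have below: "mean_flux s - m0 \<le> - ((a - s)\<^sup>2 * L ^ 3)" if s: "0 < s" "s \<le> a" for s
  proof -
    have s1: "s < 1" "0 < 1 - s" using s a1 by auto
    have "L ^ 3 * ((1 - a) * (1 - s)) - real n \<ge> L ^ 3 * (1 - a) * (a - s)"
      using n by (simp add: power2_eq_square algebra_simps)
    then have "(a - s) * (L ^ 3 * (1 - a) * (a - s)) \<le> (a - s) * (L ^ 3 * ((1 - a) * (1 - s)) - real n)"
      using s by (intro mult_left_mono) auto
    then have "(a - s) * (L ^ 3 * (1 - a) * (a - s)) / ((1 - s) * (1 - a)) \<le> (a - s) * (L ^ 3 * ((1 - a) * (1 - s)) - real n) / ((1 - s) * (1 - a))"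
      using s1 a1 by (intro divide_right_mono) auto
    also have "\<dots> = - ((s - a) * (L ^ 3 * ((1 - a) * (1 - s)) - real n) / ((1 - s) * (1 - a)))"
      by (metis minus_diff_eq minus_divide_left mult_minus_left)
    also have "\<dots> = m0 - mean_flux s" using mean_flux_diff[OF s1(1)] by linarith
    finally have 1: "(a - s) * (L ^ 3 * (1 - a) * (a - s)) / ((1 - s) * (1 - a)) \<le> m0 - mean_flux s" .
    have "(a - s) * (L ^ 3 * (1 - a) * (a - s)) / ((1 - s) * (1 - a)) = ((a - s)\<^sup>2 * L ^ 3) / (1 - s)"
      using a1 by (simp add: power2_eq_square)
    moreover have "(a - s)\<^sup>2 * L ^ 3 \<le> ((a - s)\<^sup>2 * L ^ 3) / (1 - s)"
      using s s1 L_bounds by (simp add: le_divide_eq mult_left_le)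
    ultimately show ?thesis using 1 by linarith
  qed
  \<comment> \<open>On the lower half of the density interval the shortfall is at least
    \<open>L / 4\<close>, and \<open>ln c - ln b\<close> is at least \<open>hh / 2\<close>; the
    product is \<open>1 / 8\<close>. On the upper half the sign of the shortfall suffices.\<close>
  have e1: "(L / 4 - m0) * (ln c - ln b) \<le> - (L ^ 3 * (c - b)) - real n * (ln (1 - c) - ln (1 - b))"
  proof (rule mean_flux_below)
    fix s assume s: "b \<le> s" "s \<le> c"
    have "hh / 2 \<le> a - s" using s by (simp add: c_def)
    then have "(hh / 2)\<^sup>2 \<le> (a - s)\<^sup>2" using h0 by (intro power_mono) auto
    then have "(hh / 2)\<^sup>2 * L ^ 3 \<le> (a - s)\<^sup>2 * L ^ 3" using L_bounds by (intro mult_right_mono) auto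
    moreover have "(hh / 2)\<^sup>2 * L ^ 3 = L / 4" using L_bounds by (simp add: hL(2) power2_eq_square power3_eq_cube)
    ultimately show "mean_flux s \<le> m0 - L / 4" using below[of s] s b by linarith
  qed (use b in auto)
  have e2: "(0 - m0) * (ln a - ln c) \<le> - (L ^ 3 * (a - c)) - real n * (ln (1 - a) - ln (1 - c))"
  proof (rule mean_flux_below)
    fix s assume s: "c \<le> s" "s \<le> a"
    have "0 \<le> (a - s)\<^sup>2 * L ^ 3" using L_bounds by simp
    then show "mean_flux s \<le> m0 - 0" using below[of s] s b by linarith
  qed (use b a1 in auto)
  have "L / 4 * (hh / 2) \<le> L / 4 * (ln c - ln b)"
    using ln_diff_ge[of b c] b L_bounds by (intro mult_left_mono) (auto simp: b_def c_def)
  have "L / 4 * (hh / 2) = 1 / 8" using L_bounds by (simp add: hL(2))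
  have "L ^ 3 * (c - b) + L ^ 3 * (a - c) = L\<^sup>2"
  proof -
    have "L ^ 3 * (c - b) + L ^ 3 * (a - c) = (hh * L) * L\<^sup>2" by (simp add: b_def c_def power2_eq_square power3_eq_cube algebra_simps)
    then show ?thesis by (simp add: hL(1))
  qed
  have ex: "1 / 8 \<le> \<theta> * m0 + real n * (ln (1 - b) - ln (1 - a)) - L\<^sup>2"
  proof -
    have "\<theta> * m0 = m0 * (ln c - ln b) + m0 * (ln a - ln c)" by (simp add: \<theta>_def algebra_simps)
    moreover have "real n * (ln (1 - b) - ln (1 - a)) = - (real n * (ln (1 - c) - ln (1 - b))) - real n * (ln (1 - a) - ln (1 - c))"
      by (simp add: algebra_simps)
    moreover have "L / 4 * (ln c - ln b) - m0 * (ln c - ln b) \<le> - (L ^ 3 * (c - b)) - real n * (ln (1 - c) - ln (1 - b))"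
      using e1 by (simp add: left_diff_distrib)
    moreover have "- (m0 * (ln a - ln c)) \<le> - (L ^ 3 * (a - c)) - real n * (ln (1 - a) - ln (1 - c))"
      using e2 by simp
    ultimately show ?thesis
      using \<open>L / 4 * (hh / 2) \<le> L / 4 * (ln c - ln b)\<close> \<open>L / 4 * (hh / 2) = 1 / 8\<close> \<open>L ^ 3 * (c - b) + L ^ 3 * (a - c) = L\<^sup>2\<close>
      by linarith
  qed
  have ph: "0 \<le> p * hh" "p * hh \<le> 1 / 2"
  proof -
    show "0 \<le> p * hh" using p0 h0 by simp
    have "p * hh \<le> 1 * hh" using pn p0 h0 by (intro mult_right_mono) (auto simp: distrib_left intro: order_trans[of p "p * (real n + 1)"])
    then show "p * hh \<le> 1 / 2" using h1 a1 a0 by linarith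
  qed
  \<comment> \<open>The quadratic correction in
    \<open>1 - x \<ge> exp (- x - 2 * x\<^sup>2)\<close>, taken over \<open>K\<close> steps, is
    \<open>2 * (p * L)\<close>, at most \<open>1 / 16\<close>.\<close>
  have K: "exp (- L\<^sup>2 - 1 / 16) \<le> (1 - p * hh) ^ K"
  proof -
    have "real K * (p * hh) = L\<^sup>2"
    proof -
      have "real K * (p * hh) = (real K * p) * hh" by simp
      then show ?thesis using L_bounds unfolding T by (simp add: hL(2) power2_eq_square power3_eq_cube)
    qed
    moreover have "real K * (2 * (p * hh)\<^sup>2) = 2 * (p * L)"
    proof -
      have "real K * (2 * (p * hh)\<^sup>2) = 2 * (real K * p) * p * hh\<^sup>2" by (simp add: power2_eq_square)
      then show ?thesis using L_bounds unfolding T by (simp add: hL(2) power2_eq_square power3_eq_cube)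
    qed
    ultimately have "exp (- L\<^sup>2 - 1 / 16) \<le> exp (real K * (- (p * hh) - 2 * (p * hh)\<^sup>2))"
      using pL by (simp add: right_diff_distrib)
    also have "\<dots> = exp (- (p * hh) - 2 * (p * hh)\<^sup>2) ^ K" by (rule exp_of_nat_mult)
    also have "\<dots> \<le> (1 - p * hh) ^ K" using ln_1_minus_ge[OF ph] by (intro power_mono) auto
    finally show ?thesis .
  qed
  have "exp (1 / 16) \<le> exp (\<theta> * m0 + real n * (ln (1 - b) - ln (1 - a)) + (- L\<^sup>2 - 1 / 16))"
    using ex by simp
  also have "\<dots> = exp (\<theta> * m0) * exp (real n * (ln (1 - b) - ln (1 - a))) * exp (- L\<^sup>2 - 1 / 16)"
    by (simp only: exp_add)
  also have "\<dots> \<le> exp (\<theta> * m0) * exp (real n * (ln (1 - b) - ln (1 - a))) * (1 - p * hh) ^ K"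
    using K by (intro mult_left_mono) auto
  also have "\<dots> = J a b (\<lambda>y. exp (- \<theta> * (y - m0)))"
    using flux_avg_exp[OF a0 a1 b(1,6), of K m0] pow_ratio_exp[of "1 - b" "1 - a" n] a1 b
    by (simp add: \<theta>_def b_def)
  also have "\<dots> \<le> J a a (\<lambda>y. exp (- \<theta> * (y - m0)))"
  proof -
    have "a * exp \<theta> < 1"
    proof -
      have "3 * hh \<le> a * (1 - a)"
      proof (cases "a \<le> 1 / 2")
        case True
        then have "a * (1 / 2) \<le> a * (1 - a)" using a0 by (intro mult_left_mono) auto
        then show ?thesis using h1 by linarith
      next
        case False
        then have "1 / 2 * (1 - a) \<le> a * (1 - a)" using a1 by (intro mult_right_mono) auto
        then show ?thesis using h1 by linarith
      qed
      then have "a * a < b" using h0 by (simp add: b_def algebra_simps)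
      then show ?thesis using b unfolding \<theta>(2) by simp
    qed
    then have je: "flux_ok a K (\<lambda>y. exp (- \<theta> * (y - m0)))" using flux_ok_exp[OF a0 a1] \<theta> by simp
    have j0: "flux_ok a K (\<lambda>_. 0)" by (rule flux_ok_basic(5)[OF a0 a1])
    have a': "0 \<le> a" "a \<le> 1" "0 \<le> b" "b \<le> a" using a0 a1 b by auto
    have jb: "flux_ok b K (\<lambda>y. exp (- \<theta> * (y - m0)))" using flux_ok_exp[OF b(1,6)] \<theta> b a1 by simp
    have "0 \<le> J a b (\<lambda>y. - 1 * exp (- \<theta> * (y - m0))) + J a a (\<lambda>y. exp (- \<theta> * (y - m0))) + J a a (\<lambda>_. 0)"
      by (rule flux_avg_coupling[OF a'(1) order_refl a'(2-4) a1 flux_ok_cmult[OF je] je j0]) (use \<theta>(1) in auto)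
    then show ?thesis using flux_avg_cmult[OF a'(1,2,3) b(6) jb, of "-1"] flux_avg_const[OF a'(1) a1] by simp
  qed
  finally have "exp (1 / 16) \<le> J a a (\<lambda>y. exp (- \<theta> * (y - m0)))" .
  moreover have "1 + 1 / 16 \<le> exp (1 / 16 :: real)" by (rule exp_ge_add_one_self)
  ultimately show ?thesis by (simp add: \<theta>_def b_def hh_def)
qed

text \<open>Twice the exponent of \<open>fluctuation\<close> is the logarithmic density ratio both
  for \<open>b2 = b\<^sup>2 / a\<close> against \<open>a\<close> and for \<open>a\<close> against
  \<open>g = a ^ 3 / b\<^sup>2\<close>. The stationary flux is the minimum of the fluxes with these
  pairs as initial density and arrivals, so its exponential moment is at most the sum of
  theirs.\<close>

lemma exp_moment:
  shows "J a a (\<lambda>y. exp (- (2 * (ln a - ln (a - h))) * (y - m0))) \<le> 2 * exp (4 * D / a)"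
    and "flux_ok a K (\<lambda>y. exp (- (2 * (ln a - ln (a - h))) * (y - m0)))"
proof -
  define hh where "hh = h"
  have hL: "hh * L = 1" "hh = 1 / L" using L_bounds by (auto simp: hh_def)
  define b where "b = a - hh"
  define \<theta> where "\<theta> = ln a - ln b"
  have h0: "0 < hh" using L_bounds by (simp add: hL)
  have h1: "6 * hh \<le> a" "6 * hh \<le> 1 - a" using L_bounds(5,6) by (simp_all add: hL)
  have b: "0 < b" "b < a" "a / 2 \<le> b" using h0 h1 a0 unfolding b_def by linarith+
  define b2 where "b2 = b\<^sup>2 / a"
  define g where "g = a ^ 3 / b\<^sup>2"
  have lb2: "ln a - ln b2 = 2 * \<theta>" using b a0 by (simp add: b2_def \<theta>_def ln_div ln_realpow)
  have lg: "ln g - ln a = 2 * \<theta>" using b a0 by (simp add: g_def \<theta>_def ln_div ln_realpow)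
  have b2: "a - 2 * hh \<le> b2" "b2 < a" "0 < b2"
  proof -
    have "(a - x)\<^sup>2 / a = a - 2 * x + x\<^sup>2 / a" for x using a0 by (simp add: field_simps power2_eq_square)
    then have "b2 = a - 2 * hh + hh\<^sup>2 / a" unfolding b2_def b_def .
    moreover have "0 \<le> hh\<^sup>2 / a" using a0 by simp
    ultimately show "a - 2 * hh \<le> b2" by linarith
    have "b * b < a * a" using b by (intro mult_strict_mono) auto
    then show "b2 < a" using a0 by (simp add: b2_def power2_eq_square field_simps)
    show "0 < b2" using b a0 by (simp add: b2_def)
  qed
  have g: "a < g" "g \<le> a + 3 * hh" "g < 1"
  proof -
    have "b\<^sup>2 < a\<^sup>2" using b by (intro power_strict_mono) auto
    then have "a * b\<^sup>2 < a * a\<^sup>2" using a0 by (rule mult_strict_left_mono)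
    then show "a < g" using b by (simp add: g_def field_simps power2_eq_square power3_eq_cube)
    have "(a + 3 * hh) * b\<^sup>2 = a ^ 3 + hh * (a * (a - 5 * hh)) + 3 * hh ^ 3"
      unfolding b_def by (simp add: power2_eq_square power3_eq_cube algebra_simps)
    moreover have "0 \<le> hh * (a * (a - 5 * hh))" using h0 h1 a0 by simp
    moreover have "0 \<le> 3 * hh ^ 3" using h0 by simp
    ultimately have "a ^ 3 \<le> (a + 3 * hh) * b\<^sup>2" by linarith
    then show "g \<le> a + 3 * hh" using b by (simp add: g_def divide_le_eq)
    then show "g < 1" using h1 a1 by linarith
  qed
  have \<theta>: "0 < \<theta>" "2 * \<theta> * L \<le> 4 / a"
  proof -
    show "0 < \<theta>" using b by (simp add: \<theta>_def)
    have "\<theta> \<le> hh / b" using ln_diff_bounds(2)[of b a] b by (simp add: \<theta>_def) (simp add: b_def)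
    also have "\<dots> \<le> hh / (a / 2)" using b h0 a0 by (intro divide_left_mono) auto
    finally have "2 * \<theta> * L \<le> 2 * (hh / (a / 2)) * L" using L_bounds by (intro mult_right_mono) auto
    also have "\<dots> = 4 / a" using L_bounds by (simp add: hL(2))
    finally show "2 * \<theta> * L \<le> 4 / a" .
  qed
  have up: "exp (- (- (D * L)) * (2 * \<theta>)) \<le> exp (4 * D / a)"
  proof -
    have "D * (2 * \<theta> * L) \<le> D * (4 / a)" using \<theta> by (intro mult_left_mono) auto
    then show ?thesis by (simp add: mult_ac)
  qed
  have h3: "3 / L = 3 * hh" by (simp add: hL(2))
  have mT: "real K * p * s - real n * s / (1 - s) = mean_flux s" for s using T by (simp add: mean_flux_def)
  have 1: "J a b2 (\<lambda>y. exp (- (2 * \<theta>) * (y - m0))) \<le> exp (4 * D / a)"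
  proof -
    have "m0 + - (D * L) \<le> real K * p * s - real n * s / (1 - s)" if "b2 \<le> s" "s \<le> a" for s
    proof -
      have "\<bar>s - a\<bar> \<le> 3 / L" using that b2 h0 unfolding abs_le_iff by (simp add: h3)
      from mean_flux_near[OF this] show ?thesis unfolding mT by (simp add: abs_le_iff)
    qed
    from flux_avg_lower_exp[OF b2(3,2) a1 this] show ?thesis using up unfolding lb2 by linarith
  qed
  have 2: "J g a (\<lambda>y. exp (- (2 * \<theta>) * (y - m0))) \<le> exp (4 * D / a)"
  proof -
    have "m0 + - (D * L) \<le> real K * p * s - real n * s / (1 - s)" if "a \<le> s" "s \<le> g" for s
    proof -
      have "\<bar>s - a\<bar> \<le> 3 / L" using that g h0 unfolding abs_le_iff by (simp add: h3)
      from mean_flux_near[OF this] show ?thesis unfolding mT by (simp add: abs_le_iff)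
    qed
    from flux_avg_lower_exp[OF a0 g(1,3) this] show ?thesis using up unfolding lg by linarith
  qed
  have "a * exp (2 * \<theta>) < 1"
  proof -
    have "a * exp (2 * \<theta>) = g" using lg[symmetric] a0 g by (simp add: exp_diff)
    then show ?thesis using g by simp
  qed
  then have je: "flux_ok a K (\<lambda>y. exp (- (2 * \<theta>) * (y - m0)))" using flux_ok_exp[OF a0 a1, of "2 * \<theta>"] \<theta> by simp
  then show "flux_ok a K (\<lambda>y. exp (- (2 * (ln a - ln (a - h))) * (y - m0)))" by (simp add: \<theta>_def b_def hh_def)
  have a': "0 \<le> a" "a \<le> g" "g \<le> 1" "0 \<le> b2" "b2 \<le> a" "a \<le> 1" using a0 a1 b2 g by auto
  have "0 \<le> J a b2 (\<lambda>y. exp (- (2 * \<theta>) * (y - m0))) + J a a (\<lambda>y. - 1 * exp (- (2 * \<theta>) * (y - m0)))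
     + J g a (\<lambda>y. exp (- (2 * \<theta>) * (y - m0)))"
    by (rule flux_avg_coupling[OF a'(1-5) a1 je flux_ok_cmult[OF je] je]) auto
  then have "J a a (\<lambda>y. exp (- (2 * \<theta>) * (y - m0))) \<le> 2 * exp (4 * D / a)"
    using 1 2 flux_avg_cmult[OF a'(1,6,1) a1 je, of "-1"] by simp
  then show "J a a (\<lambda>y. exp (- (2 * (ln a - ln (a - h))) * (y - m0))) \<le> 2 * exp (4 * D / a)"
    by (simp add: \<theta>_def b_def hh_def)
qed

lemma flux_ok_center: "flux_ok a K (\<lambda>y. (y - m0)\<^sup>2)" "flux_ok a K (\<lambda>y. y - m0)"
proof -
  have "flux_ok a K (\<lambda>y. y\<^sup>2 + ((- 2 * m0) * y + m0\<^sup>2))" by (intro flux_ok_add flux_ok_cmult flux_ok_basic a0 a1)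
  then show "flux_ok a K (\<lambda>y. (y - m0)\<^sup>2)" by (simp add: power2_diff algebra_simps)
  have "flux_ok a K (\<lambda>y. y + (- m0))" by (intro flux_ok_add flux_ok_basic a0 a1)
  then show "flux_ok a K (\<lambda>y. y - m0)" by simp
qed

abbreviation "C2 \<equiv> 2 * exp (4 * D / a)"

text \<open>For \<open>Y = - \<theta> * (y - m0)\<close> the mean of \<open>exp Y - 1 - Y\<close> is
  at least \<open>1 / 16\<close>, by \<open>fluctuation\<close> and because the flux has mean
  \<open>m0\<close>. In the bound of \<open>exp_remainder\<close> the level \<open>R\<close> is
  chosen so that the term with \<open>exp (2 * Y)\<close> has mean at most \<open>1 / 32\<close>;
  the rest must come from the variance.\<close>

lemma variance_lower:
  assumes n: "real n \<le> (1 - a)\<^sup>2 * L ^ 3" and pL: "p * L \<le> 1 / 32"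
  shows "a\<^sup>2 / (4096 * C2) * L\<^sup>2 \<le> J a a (\<lambda>y. (y - m0)\<^sup>2)"
proof -
  define hh where "hh = h"
  have hL: "hh * L = 1" "hh = 1 / L" using L_bounds by (auto simp: hh_def)
  define \<theta> where "\<theta> = ln a - ln (a - hh)"
  have h0: "0 < hh" using L_bounds by (simp add: hL)
  have h1: "6 * hh \<le> a" using L_bounds(5) by (simp add: hL)
  have \<theta>: "0 < \<theta>" "\<theta> \<le> 2 * hh / a"
  proof -
    have b: "0 < a - hh" "a / 2 \<le> a - hh" "a - hh < a" using h0 h1 a0 by linarith+
    have "ln (a - hh) < ln a" using b a0 by (subst ln_less_cancel_iff) auto
    then show "0 < \<theta>" by (simp add: \<theta>_def)
    have "\<theta> \<le> hh / (a - hh)" using ln_diff_bounds(2)[of "a - hh" a] b h0 by (simp add: \<theta>_def)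
    also have "\<dots> \<le> hh / (a / 2)" using b h0 a0 by (intro divide_left_mono) auto
    finally show "\<theta> \<le> 2 * hh / a" by (simp add: mult.commute)
  qed
  define R where "R = ln (32 * C2)"
  have "1 \<le> exp (4 * D / a)" using a0 by simp
  then have C2: "1 \<le> 32 * C2" by linarith
  have R: "0 \<le> R" "exp R = 32 * C2" using C2 by (auto simp: R_def)
  have a': "0 \<le> a" "a \<le> 1" using a0 a1 by auto
  let ?E1 = "\<lambda>y. exp (- \<theta> * (y - m0))" and ?E2 = "\<lambda>y. exp (- (2 * \<theta>) * (y - m0))"
  have j2: "flux_ok a K ?E2" using exp_moment(2) by (simp add: \<theta>_def hh_def)
  have j1: "flux_ok a K ?E1"
  proof -
    have le: "?E1 y \<le> 1 + ?E2 y" for y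
    proof -
      have "?E2 y = (?E1 y)\<^sup>2" by (simp add: power2_eq_square exp_add[symmetric])
      moreover have "e \<le> 1 + e\<^sup>2" for e :: real
        using zero_le_power2[of "e - 1 / 2"] by (simp add: power2_eq_square algebra_simps)
      ultimately show ?thesis by simp
    qed
    show ?thesis
    proof (rule flux_ok_bound)
      show "flux_ok a K (\<lambda>y. 1 + ?E2 y)" by (intro flux_ok_add flux_ok_basic a0 a1 j2)
      show "\<bar>?E1 y\<bar> \<le> \<bar>1 + ?E2 y\<bar>" for y
        unfolding abs_of_pos[OF exp_gt_zero] using le[of y] by linarith
    qed
  qed
  have "J a a (\<lambda>y. ?E1 y + (\<theta> * (y - m0) + (- 1))) \<le> J a a (\<lambda>y. (exp R * \<theta>\<^sup>2) * (y - m0)\<^sup>2 + exp (- R) * ?E2 y)"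
  proof (rule flux_avg_mono[OF a' a'(1) a1])
    show "flux_ok a K (\<lambda>y. ?E1 y + (\<theta> * (y - m0) + (- 1)))" by (intro flux_ok_add flux_ok_cmult j1 flux_ok_center flux_ok_basic a0 a1)
    show "flux_ok a K (\<lambda>y. (exp R * \<theta>\<^sup>2) * (y - m0)\<^sup>2 + exp (- R) * ?E2 y)" by (intro flux_ok_add flux_ok_cmult j2 flux_ok_center)
    fix y show "?E1 y + (\<theta> * (y - m0) + (- 1)) \<le> (exp R * \<theta>\<^sup>2) * (y - m0)\<^sup>2 + exp (- R) * ?E2 y"
      using exp_remainder[OF R(1), of "- \<theta> * (y - m0)"] by (simp add: power_mult_distrib mult_ac)
  qed
  moreover have "J a a (\<lambda>y. ?E1 y + (\<theta> * (y - m0) + (- 1))) = J a a ?E1 + (\<theta> * J a a (\<lambda>y. y - m0) + (- 1))"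
    by (simp only: flux_avg_add[OF a' a'(1) a1] flux_avg_cmult[OF a' a'(1) a1] flux_avg_const[OF a'(1) a1] flux_ok_add flux_ok_cmult j1 flux_ok_center flux_ok_basic[OF a0 a1])
  moreover have "\<theta> * J a a (\<lambda>y. y - m0) = 0"
  proof -
    have "J a a (\<lambda>y. y + (- m0)) = J a a (\<lambda>y. y) + (- m0)"
      by (simp only: flux_avg_add[OF a' a'(1) a1] flux_avg_const[OF a'(1) a1] flux_ok_basic[OF a0 a1])
    then show ?thesis using mean by simp
  qed
  moreover have "J a a (\<lambda>y. (exp R * \<theta>\<^sup>2) * (y - m0)\<^sup>2 + exp (- R) * ?E2 y) = (exp R * \<theta>\<^sup>2) * J a a (\<lambda>y. (y - m0)\<^sup>2) + exp (- R) * J a a ?E2"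
    by (simp only: flux_avg_add[OF a' a'(1) a1] flux_avg_cmult[OF a' a'(1) a1] flux_ok_add flux_ok_cmult j2 flux_ok_center)
  moreover have "1 + 1 / 16 \<le> J a a ?E1" using fluctuation[OF n pL] by (simp add: \<theta>_def hh_def)
  moreover have "exp (- R) * J a a ?E2 \<le> 1 / 32"
  proof -
    have "exp (- R) * J a a ?E2 \<le> exp (- R) * C2" using exp_moment(1) by (intro mult_left_mono) (auto simp: \<theta>_def hh_def)
    also have "\<dots> = 1 / 32" using R C2 by (simp add: exp_minus field_simps)
    finally show ?thesis .
  qed
  ultimately have 1: "1 / 32 \<le> (exp R * \<theta>\<^sup>2) * J a a (\<lambda>y. (y - m0)\<^sup>2)" by linarith
  have "0 \<le> J a a (\<lambda>y. (y - m0)\<^sup>2)"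
  proof -
    have "J a a (\<lambda>_. 0) \<le> J a a (\<lambda>y. (y - m0)\<^sup>2)" by (rule flux_avg_mono[OF a' a'(1) a1 flux_ok_basic(5)[OF a0 a1] flux_ok_center(1)]) simp
    then show ?thesis by (simp add: flux_avg_const[OF a'(1) a1])
  qed
  moreover have "exp R * \<theta>\<^sup>2 \<le> exp R * (2 * hh / a)\<^sup>2" using \<theta> by (intro mult_left_mono power_mono) auto
  ultimately have "(exp R * \<theta>\<^sup>2) * J a a (\<lambda>y. (y - m0)\<^sup>2) \<le> (exp R * (2 * hh / a)\<^sup>2) * J a a (\<lambda>y. (y - m0)\<^sup>2)"
    by (intro mult_right_mono)
  then have 2: "1 / 32 \<le> (32 * C2 * (4 * hh\<^sup>2 / a\<^sup>2)) * J a a (\<lambda>y. (y - m0)\<^sup>2)"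
    using 1 R by (simp add: power_divide power_mult_distrib)
  have "a\<^sup>2 / (4096 * C2) * L\<^sup>2 = 1 / 32 * (a\<^sup>2 / (128 * C2) * L\<^sup>2)" by simp
  also have "\<dots> \<le> ((32 * C2 * (4 * hh\<^sup>2 / a\<^sup>2)) * J a a (\<lambda>y. (y - m0)\<^sup>2)) * (a\<^sup>2 / (128 * C2) * L\<^sup>2)"
    using C2 by (intro mult_right_mono[OF 2]) auto
  also have "\<dots> = J a a (\<lambda>y. (y - m0)\<^sup>2)"
    using a0 L_bounds by (simp add: hL(2) power_divide)
  finally show ?thesis .
qed

lemma qsum_lower:
  assumes n: "real n \<le> (1 - a)\<^sup>2 * L ^ 3" and pL: "p * L \<le> 1 / 32"
  shows "(1 - a)\<^sup>2 * a / (8192 * C2) * L\<^sup>2 - 3 \<le> qsum p a K n"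
proof -
  define c where "c = a / (1 - a)\<^sup>2"
  have c0: "c > 0" using a0 a1 by (simp add: c_def)
  have "a * L ^ 3 * (1 - p * a) \<le> a * L ^ 3 * 1" using a0 L_bounds p0 by (intro mult_left_mono) auto
  also have "\<dots> = c * ((1 - a)\<^sup>2 * L ^ 3)" using a1 by (simp add: c_def)
  finally have "a\<^sup>2 / (4096 * C2) * L\<^sup>2 \<le> c * ((1 - a)\<^sup>2 * L ^ 3 - real n) + 2 * c * qsum p a K n"
    using variance_lower[OF n pL] unfolding J_sq c_def[symmetric] by (simp add: algebra_simps)
  also have "c * ((1 - a)\<^sup>2 * L ^ 3 - real n) \<le> c * 3" using near c0 by (intro mult_left_mono) auto
  finally have "a\<^sup>2 / (4096 * C2) * L\<^sup>2 \<le> 2 * c * (3 / 2 + qsum p a K n)" by (simp add: algebra_simps)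
  then have "a\<^sup>2 / (4096 * C2) * L\<^sup>2 / (2 * c) \<le> 2 * c * (3 / 2 + qsum p a K n) / (2 * c)" using c0 by (intro divide_right_mono) auto
  also have "\<dots> = 3 / 2 + qsum p a K n" using c0 by simp
  finally have "a\<^sup>2 / (4096 * C2) * L\<^sup>2 / (2 * c) \<le> 3 / 2 + qsum p a K n" .
  moreover have "a\<^sup>2 / (4096 * C2) * L\<^sup>2 / (2 * c) = (1 - a)\<^sup>2 * a / (8192 * C2) * L\<^sup>2"
    using a0 a1 by (simp add: c_def power2_eq_square)
  ultimately show ?thesis by linarith
qed

end

section \<open>Paths of the zero range process as words\<close>

definition good_clock :: "(real \<Rightarrow> nat) \<Rightarrow> bool" where
  "good_clock n \<longleftrightarrow> n 0 = 0 \<and> mono_on {0..} n \<and> (\<forall>t\<ge>0. continuous (at_right t) n)"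

lemma good_clock_mono: "good_clock n \<Longrightarrow> 0 \<le> s \<Longrightarrow> s \<le> t \<Longrightarrow> n s \<le> n t"
  by (auto simp: good_clock_def mono_on_def)

lemma no_jump:
  assumes "good_clock n" "0 \<le> s" "n s' = n s"
  shows "jump_times n \<inter> {s<..s'} = {}"
proof -
  have "continuous (at_left \<tau>) n" if "s < \<tau>" "\<tau> \<le> s'" for \<tau>
  proof -
    have c: "n u = n s" if "s \<le> u" "u \<le> s'" for u
      using good_clock_mono[OF assms(1), of s u] good_clock_mono[OF assms(1), of u s'] that assms(2,3) by simp
    have "eventually (\<lambda>u. n u = n \<tau>) (at_left \<tau>)"
      unfolding eventually_at_left_field
    proof (intro exI[of _ s] conjI allI impI)
      fix u assume u: "s < u" "u < \<tau>"
      show "n u = n \<tau>" using c[of u] c[of \<tau>] u that by simp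
    qed (fact that(1))
    then show ?thesis unfolding continuous_within by (rule tendsto_eventually)
  qed
  then show ?thesis by (auto simp: jump_times_def)
qed

text \<open>The jump time is the infimum of the times at which the new value is taken. Right
  continuity gives the new value at that time, and monotonicity fixes the values before and
  after.\<close>

lemma one_jump:
  assumes n: "good_clock n" "0 \<le> s" "s \<le> s'" "n s' = Suc (n s)"
  obtains \<tau> where "s < \<tau>" "\<tau> \<le> s'" "jump_times n \<inter> {s<..s'} = {\<tau>}" "\<And>u. s \<le> u \<Longrightarrow> u < \<tau> \<Longrightarrow> n u = n s"
proof -
  define A where "A = {u \<in> {s..s'}. n u = Suc (n s)}"
  define \<tau> where "\<tau> = Inf A"
  have A: "s' \<in> A" "bdd_below A" using n(3,4) by (auto simp: A_def intro!: bdd_belowI[of _ s])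
  have \<tau>: "s \<le> \<tau>" "\<tau> \<le> s'"
    unfolding \<tau>_def using A by (auto simp: A_def intro!: cInf_greatest intro: cInf_lower)
  have before: "n u = n s" if "s \<le> u" "u < \<tau>" for u
  proof -
    have "u \<notin> A" using that(2) cInf_lower[OF _ A(2), of u] by (auto simp: \<tau>_def)
    then have "n u \<noteq> Suc (n s)" using that \<tau> by (auto simp: A_def)
    then show ?thesis using good_clock_mono[OF n(1,2) that(1)] good_clock_mono[OF n(1), of u s'] that \<tau> n(2,4) by linarith
  qed
  have after: "n u = Suc (n s)" if tu: "\<tau> < u" "u \<le> s'" for u
  proof -
    have "A \<noteq> {}" using A(1) by blast
    then obtain v where v: "v \<in> A" "v < u" using tu(1) cInf_lessD[of A u] unfolding \<tau>_def by blast
    then have v': "s \<le> v" "n v = Suc (n s)" by (simp_all add: A_def)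
    have "n v \<le> n u" using good_clock_mono[OF n(1), of v u] n(2) v v' by linarith
    moreover have "n u \<le> n s'" using good_clock_mono[OF n(1), of u s'] that \<tau> n(2) by linarith
    ultimately show ?thesis using v' n(4) by linarith
  qed
  have at: "n \<tau> = Suc (n s)"
  proof (cases "\<tau> = s'")
    case False
    then have "\<tau> < s'" using \<tau> by simp
    then have "eventually (\<lambda>u. n u = Suc (n s)) (at_right \<tau>)"
      unfolding eventually_at_right_field using after by (intro exI[of _ s'] conjI allI impI) simp_all
    then have "(n \<longlongrightarrow> Suc (n s)) (at_right \<tau>)" by (rule tendsto_eventually)
    moreover have "(n \<longlongrightarrow> n \<tau>) (at_right \<tau>)"
      using n(1,2) \<tau>(1) unfolding good_clock_def continuous_within by simp
    ultimately show ?thesis using tendsto_unique[OF trivial_limit_at_right_real] by blast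
  qed (use n in simp)
  have less: "s < \<tau>" using at \<tau> by (metis less_le n_not_Suc_n)
  have "\<not> continuous (at_left \<tau>) n"
  proof
    assume "continuous (at_left \<tau>) n"
    then have "(n \<longlongrightarrow> n \<tau>) (at_left \<tau>)" unfolding continuous_within .
    moreover have "eventually (\<lambda>u. n u = n s) (at_left \<tau>)"
      unfolding eventually_at_left_field using less by (intro exI[of _ s] conjI allI impI before) simp_all
    then have "(n \<longlongrightarrow> n s) (at_left \<tau>)" by (rule tendsto_eventually)
    ultimately have "n \<tau> = n s" using tendsto_unique[OF trivial_limit_at_left_real] by blast
    then show False using at by simp
  qed
  then have jump: "\<tau> \<in> jump_times n" using less n(2) by (simp add: jump_times_def)
  have uniq: "u = \<tau>" if u: "u \<in> jump_times n" "s < u" "u \<le> s'" for u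
  proof (rule ccontr)
    assume "u \<noteq> \<tau>"
    then consider "u < \<tau>" | "\<tau> < u" by linarith
    then show False
    proof cases
      case 1
      then have "n u = n s" using before[of u] u by simp
      then show False using no_jump[OF n(1,2), of u] u by (metis IntI emptyE greaterThanAtMost_iff order_refl)
    next
      case 2
      then have "n u = n \<tau>" using after[of u] u at by simp
      moreover have "0 \<le> \<tau>" using less n(2) by simp
      ultimately show False using no_jump[OF n(1), of \<tau> u] u 2 by (metis IntI emptyE greaterThanAtMost_iff order_refl)
    qed
  qed
  have "jump_times n \<inter> {s<..s'} = {\<tau>}"
  proof (intro equalityI subsetI)
    fix u assume "u \<in> jump_times n \<inter> {s<..s'}"
    then show "u \<in> {\<tau>}" using uniq[of u] by simp
  next
    fix u assume "u \<in> {\<tau>}"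
    then show "u \<in> jump_times n \<inter> {s<..s'}" using jump less \<tau>(2) by simp
  qed
  then show ?thesis by (rule that[OF less \<tau>(2) _ before])
qed

text \<open>Letter \<open>0\<close> stands for a time interval in which no bond rings.\<close>

definition bond_act :: "nat \<Rightarrow> conf \<Rightarrow> conf" where
  "bond_act l \<eta> = (if l = 0 then \<eta> else act l \<eta>)"

definition run :: "nat list \<Rightarrow> conf \<Rightarrow> conf" where
  "run ls = fold bond_act ls"

lemma moves_split:
  assumes "s \<le> s'"
  shows "moves n \<xi> i s' = moves n \<xi> i s \<union> {\<tau> \<in> jump_times (n i) \<inter> {s<..s'}. \<forall>\<^sub>F u in at_left \<tau>. 0 < \<xi> u i}"
  using assms by (auto simp: moves_def)

text \<open>When bond \<open>b\<close> rings, bond \<open>b - 1\<close> is silent throughout and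
  \<open>b\<close> is silent before its ring, so the occupation of \<open>b\<close> just before the
  ring is the one at time \<open>s\<close>. Bond \<open>j\<close> is a barrier: the inflow into site
  \<open>j\<close> is unknown, but only sites strictly to its right are described.\<close>

lemma interval_step:
  assumes tz: "tazrp_path nn \<xi>" and good: "\<And>i. i \<in> {j..r} \<Longrightarrow> good_clock (nn i)"
    and s: "0 \<le> s" "s \<le> s'" and fin: "\<And>i. i \<in> {j..r} \<Longrightarrow> finite (moves nn \<xi> i s)"
    and ring: "\<And>i. i \<in> {j..r} \<Longrightarrow> nn i s' = nn i s + (if i = b then 1 else 0)" and b: "b \<noteq> j"
  shows "i \<in> {j..r} \<Longrightarrow> finite (moves nn \<xi> i s')"
    and "i \<in> {j<..r} \<Longrightarrow>
      \<xi> s' i + (if i = b \<and> 0 < \<xi> s b then 1 else 0) = \<xi> s i + (if i - 1 = b \<and> 0 < \<xi> s b then 1 else 0)"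
proof -
  have bal: "\<xi> u i + card (moves nn \<xi> i u) = \<xi> 0 i + card (moves nn \<xi> (i - 1) u)" if "0 \<le> u" for u i
    using tz that by (auto simp: tazrp_path_def)
  have quiet: "moves nn \<xi> i u = moves nn \<xi> i s" if "i \<in> {j..r}" "s \<le> u" "nn i u = nn i s" for i u
    unfolding moves_split[OF that(2), of nn \<xi> i] using no_jump[OF good[OF that(1)] s(1) that(3)] by simp
  have mv: "finite (moves nn \<xi> i s') \<and> card (moves nn \<xi> i s') = card (moves nn \<xi> i s) + (if i = b \<and> 0 < \<xi> s b then 1 else 0)"
    if i: "i \<in> {j..r}" for i
  proof (cases "i = b")
    case False
    then show ?thesis using quiet[OF i s(2)] ring[OF i] fin[OF i] by simp
  next
    case True
    then have bi: "b \<in> {j..r}" "b - 1 \<in> {j..r}" using i b by auto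
    obtain \<tau> where \<tau>: "s < \<tau>" "\<tau> \<le> s'" "jump_times (nn b) \<inter> {s<..s'} = {\<tau>}" "\<And>u. s \<le> u \<Longrightarrow> u < \<tau> \<Longrightarrow> nn b u = nn b s"
      using one_jump[OF good[OF bi(1)] s] ring[OF bi(1)] by auto
    have const: "\<xi> u b = \<xi> s b" if u: "s \<le> u" "u < \<tau>" for u
    proof -
      have "nn (b - 1) u = nn (b - 1) s"
        using good_clock_mono[OF good[OF bi(2)], of s u] good_clock_mono[OF good[OF bi(2)], of u s'] ring[OF bi(2)] u \<tau> s by simp
      then have "moves nn \<xi> (b - 1) u = moves nn \<xi> (b - 1) s" using quiet[OF bi(2), of u] u by simp
      moreover have "moves nn \<xi> b u = moves nn \<xi> b s" using quiet[OF bi(1), of u] \<tau>(4)[of u] u by simp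
      ultimately show ?thesis using bal[of u b] bal[of s b] s u by simp
    qed
    have ev: "(\<forall>\<^sub>F u in at_left \<tau>. 0 < \<xi> u b) \<longleftrightarrow> 0 < \<xi> s b"
    proof -
      have "\<forall>\<^sub>F u in at_left \<tau>. \<xi> u b = \<xi> s b"
        unfolding eventually_at_left_field using \<tau>(1) by (intro exI[of _ s] conjI allI impI const) simp_all
      then have "(\<forall>\<^sub>F u in at_left \<tau>. 0 < \<xi> u b) \<longleftrightarrow> (\<forall>\<^sub>F u in at_left \<tau>. 0 < \<xi> s b)"
        by (intro eventually_subst) (auto elim: eventually_mono)
      then show ?thesis by (simp add: trivial_limit_at_left_real)
    qed
    have "moves nn \<xi> b s' = moves nn \<xi> b s \<union> (if 0 < \<xi> s b then {\<tau>} else {})"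
      unfolding moves_split[OF s(2), of nn \<xi> b] \<tau>(3) using ev by auto
    moreover have "\<tau> \<notin> moves nn \<xi> b s" using \<tau>(1) by (auto simp: moves_def)
    ultimately show ?thesis using fin[OF bi(1)] True by auto
  qed
  show "finite (moves nn \<xi> i s')" if "i \<in> {j..r}" using mv[OF that] by simp
  show "\<xi> s' i + (if i = b \<and> 0 < \<xi> s b then 1 else 0) = \<xi> s i + (if i - 1 = b \<and> 0 < \<xi> s b then 1 else 0)"
    if i: "i \<in> {j<..r}"
  proof -
    have ii: "i \<in> {j..r}" "i - 1 \<in> {j..r}" using i by auto
    have "0 \<le> s'" using s by simp
    then show ?thesis using conjunct2[OF mv[OF ii(1)]] conjunct2[OF mv[OF ii(2)]] bal[OF s(1), of i] bal[of s' i] by linarith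
  qed
qed

text \<open>The word may contain letters of bonds on both sides of the range. As bond
  \<open>j\<close> never rings, those before \<open>j\<close> do not influence the sites after
  \<open>j\<close>, and those after \<open>r\<close> change no site up to \<open>r\<close>.\<close>

lemma chain_follows:
  assumes tz: "tazrp_path nn \<xi>" and good: "\<And>i. i \<in> {j..r} \<Longrightarrow> good_clock (nn i)"
    and h: "0 \<le> h" and L: "- int L \<le> j"
    and ring: "\<And>k i. k < length ls \<Longrightarrow> i \<in> {j..r} \<Longrightarrow>
      nn i (real (Suc k) * h) = nn i (real k * h) + (if ls ! k = Suc (nat (i + int L)) then 1 else 0)"
    and block: "\<And>k. k < length ls \<Longrightarrow> ls ! k \<noteq> Suc (nat (j + int L))"
    and init: "\<And>i. i \<in> {j<..r} \<Longrightarrow> \<xi> 0 i = \<eta> (nat (i + int L))"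
    and k: "k \<le> length ls"
  shows "(\<forall>i\<in>{j<..r}. \<xi> (real k * h) i = run (take k ls) \<eta> (nat (i + int L))) \<and> (\<forall>i\<in>{j..r}. finite (moves nn \<xi> i (real k * h)))"
  using k
proof (induction k)
  case 0
  have "moves nn \<xi> i 0 = {}" for i by (auto simp: moves_def jump_times_def)
  then show ?case using init by (simp add: run_def)
next
  case (Suc k)
  then have k: "k < length ls" by simp
  define \<zeta> where "\<zeta> = run (take k ls) \<eta>"
  have IH: "\<And>i. i \<in> {j<..r} \<Longrightarrow> \<xi> (real k * h) i = \<zeta> (nat (i + int L))" "\<And>i. i \<in> {j..r} \<Longrightarrow> finite (moves nn \<xi> i (real k * h))"
    using Suc.IH k by (auto simp: \<zeta>_def)
  have run: "run (take (Suc k) ls) \<eta> = bond_act (ls ! k) \<zeta>"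
    using k by (simp add: run_def \<zeta>_def take_Suc_conv_app_nth)
  \<comment> \<open>For the idle letter \<open>b\<close> is a bond outside the range, whose ring
    would reach at most site \<open>j\<close>.\<close>
  define b where "b = (if ls ! k = 0 then j - 1 else int (ls ! k - 1) - int L)"
  have bj: "b \<noteq> j"
  proof
    assume "b = j"
    then have "ls ! k \<noteq> 0" by (auto simp: b_def split: if_splits)
    then have "ls ! k = Suc (nat (j + int L))" using \<open>b = j\<close> by (auto simp: b_def)
    then show False using block[OF k] by simp
  qed
  have eqb: "(ls ! k = Suc (nat (i + int L))) = (i = b)" if "i \<in> {j..r}" for i
    using that L by (auto simp: b_def)
  define s1 where "s1 = real k * h"
  define s2 where "s2 = real (Suc k) * h"
  have st: "0 \<le> s1" "s1 \<le> s2" using h by (auto simp: s1_def s2_def mult_right_mono)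
  have rg: "\<And>i. i \<in> {j..r} \<Longrightarrow> nn i s2 = nn i s1 + (if i = b then 1 else 0)"
    unfolding s1_def s2_def using ring[OF k] eqb by simp
  note IH = IH[folded s1_def]
  note step = interval_step[where j = j and r = r, OF tz good st IH(2) rg bj]
  have "\<xi> s2 i = bond_act (ls ! k) \<zeta> (nat (i + int L))" if i: "i \<in> {j<..r}" for i
  proof -
    have e: "\<xi> s2 i + (if i = b \<and> 0 < \<xi> s1 b then 1 else 0) = \<zeta> (nat (i + int L)) + (if i - 1 = b \<and> 0 < \<xi> s1 b then 1 else 0)"
      using step(2)[OF _ _ _ i] IH(1)[OF i] by simp
    have i0: "0 \<le> i + int L" using i L by auto
    show ?thesis
    proof (cases "ls ! k")
      case 0
      then have "b = j - 1" by (simp add: b_def)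
      then show ?thesis using e i 0 by (auto simp: bond_act_def)
    next
      case (Suc c)
      then have b: "b = int c - int L" by (simp add: b_def)
      have ii: "nat (i + int L) = c \<longleftrightarrow> i = b" "nat (i + int L) = Suc c \<longleftrightarrow> i - 1 = b" using i0 b by auto
      consider "b < j" | "j < b" "b \<le> r" | "r < b" using bj by linarith
      then show ?thesis
      proof cases
        case 2
        then have "b \<in> {j<..r}" by simp
        from IH(1)[OF this] have xb: "\<xi> s1 b = \<zeta> c" by (simp add: b)
        show ?thesis using e ii unfolding xb by (auto simp: bond_act_def Suc split: if_splits)
      qed (use e ii i Suc in \<open>auto simp: bond_act_def\<close>)
    qed
  qed
  moreover have "finite (moves nn \<xi> i s2)" if "i \<in> {j..r}" for i
    using step(1)[OF _ _ _ that] by simp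
  ultimately show ?case unfolding run s2_def by blast
qed

text \<open>The word of a realisation lists the bonds that ring in the successive intervals of length \<open>h\<close>;
  \<open>letter_prob n h l\<close> is the probability of the letter \<open>l\<close> for \<open>n\<close> independent clocks.\<close>

definition words :: "nat \<Rightarrow> nat \<Rightarrow> nat list set" where
  "words n K = {ls. set ls \<subseteq> {..n} \<and> length ls = K}"

definition letter_prob :: "nat \<Rightarrow> real \<Rightarrow> nat \<Rightarrow> real" where
  "letter_prob n h l = exp (- (real n * h)) * (if l = 0 then 1 else h)"

section \<open>Law of the word and passage of a discrepancy\<close>

lemma finite_words: "finite (words n K)"
  unfolding words_def by (rule finite_lists_length_eq) simp

lemma run_Cons: "run (l # ls) \<eta> = run ls (bond_act l \<eta>)"
  by (simp add: run_def)

lemma sum_words_Suc: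
  "(\<Sum>ls\<in>words n (Suc K). g ls) = (\<Sum>l\<le>n. \<Sum>ls\<in>words n K. g (l # ls))"
proof -
  have "words n (Suc K) = (\<lambda>(l, ls). l # ls) ` ({..n} \<times> words n K)"
    by (auto simp: words_def length_Suc_conv image_iff)
  moreover have "inj_on (\<lambda>(l, ls). l # ls) ({..n} \<times> words n K)" by (auto simp: inj_on_def)
  ultimately have "sum g (words n (Suc K)) = (\<Sum>(l, ls)\<in>{..n} \<times> words n K. g (l # ls))"
    by (simp add: sum.reindex case_prod_unfold)
  then show ?thesis by (simp add: sum.cartesian_product)
qed

text \<open>Given that no interval contains two rings, the letters are independent and each bond has
  probability \<open>h / (1 + real n * h)\<close>: this is a step of the chain without arrivals. The
  prefactor is the probability of the condition.\<close>

lemma sum_words: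
  assumes "0 \<le> h"
  shows "(\<Sum>ls\<in>words n K. prod_list (map (letter_prob n h) ls) * f (run ls \<eta>)) =
    (exp (- (real n * h)) * (1 + real n * h)) ^ K * ev (h / (1 + real n * h)) 0 n K f \<eta>"
proof (induction K arbitrary: \<eta>)
  case 0
  have "words n 0 = {[]}" by (auto simp: words_def)
  then show ?case by (simp add: run_def ev_def)
next
  case (Suc K)
  define e where "e = exp (- (real n * h))"
  define v where "v = 1 + real n * h"
  define g where "g = ev (h / v) 0 n K f"
  have v: "v > 0" using assms by (simp add: v_def add_pos_nonneg)
  have "(\<Sum>ls\<in>words n (Suc K). prod_list (map (letter_prob n h) ls) * f (run ls \<eta>)) =
    (\<Sum>l\<le>n. letter_prob n h l * (\<Sum>ls\<in>words n K. prod_list (map (letter_prob n h) ls) * f (run ls (bond_act l \<eta>))))"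
    by (simp add: sum_words_Suc run_Cons sum_distrib_left mult_ac)
  also have "\<dots> = (\<Sum>l\<le>n. letter_prob n h l * ((e * v) ^ K * g (bond_act l \<eta>)))"
    unfolding Suc.IH e_def v_def g_def by simp
  also have "\<dots> = (e * v) ^ K * (\<Sum>l\<le>n. letter_prob n h l * g (bond_act l \<eta>))" by (simp add: sum_distrib_left mult_ac)
  also have "(\<Sum>l\<le>n. letter_prob n h l * g (bond_act l \<eta>)) = e * g \<eta> + (\<Sum>l<n. e * h * g (act (Suc l) \<eta>))"
    by (simp add: sum.atMost_shift letter_prob_def e_def bond_act_def del: act.simps)
  also have "\<dots> = e * v * mstep (rate (h / v) 0) act n g \<eta>"
  proof -
    have "mstep (rate (h / v) 0) act n g \<eta> = g \<eta> + (\<Sum>l<n. h / v * (g (act (Suc l) \<eta>) - g \<eta>))"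
      by (simp add: mstep_def sum.atMost_shift rate_def del: act.simps)
    also have "\<dots> = g \<eta> + h / v * (\<Sum>l<n. g (act (Suc l) \<eta>)) - real n * (h / v) * g \<eta>"
      unfolding sum_distrib_left[symmetric] sum_subtractf by (simp add: right_diff_distrib del: act.simps)
    finally have ms: "mstep (rate (h / v) 0) act n g \<eta> = g \<eta> + h / v * (\<Sum>l<n. g (act (Suc l) \<eta>)) - real n * (h / v) * g \<eta>" .
    have "e * v * mstep (rate (h / v) 0) act n g \<eta> = e * (v * g \<eta> + (v * (h / v)) * (\<Sum>l<n. g (act (Suc l) \<eta>)) - real n * (v * (h / v)) * g \<eta>)"
      unfolding ms by (simp only: algebra_simps)
    also have "v * (h / v) = h" using v by simp
    finally have "e * v * mstep (rate (h / v) 0) act n g \<eta> = e * (v * g \<eta> + h * (\<Sum>l<n. g (act (Suc l) \<eta>)) - real n * h * g \<eta>)" .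
    then show ?thesis by (simp add: v_def algebra_simps sum_distrib_left del: act.simps)
  qed
  finally show ?case using v unfolding e_def[symmetric] v_def[symmetric] g_def by (simp add: ev_def miter_Suc)
qed

lemma run_incr_at:
  assumes "set ls \<subseteq> {..n}" "j \<le> n"
  shows "\<exists>q. j \<le> q \<and> q \<le> n \<and> run ls (incr_at j \<eta>) = incr_at q (run ls \<eta>)"
  using assms
proof (induction ls arbitrary: j \<eta>)
  case Nil
  then show ?case by (auto simp: run_def)
next
  case (Cons l ls)
  have "\<exists>j'. j \<le> j' \<and> j' \<le> n \<and> bond_act l (incr_at j \<eta>) = incr_at j' (bond_act l \<eta>)"
  proof (cases l)
    case 0
    then show ?thesis using Cons.prems by (auto simp: bond_act_def)
  next
    case (Suc k)
    then show ?thesis using Cons.prems act_incr_at(2)[of k j \<eta>]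
      by (intro exI[of _ "if j = k \<and> \<eta> k = 0 then Suc k else j"]) (auto simp: bond_act_def simp del: act.simps)
  qed
  then obtain j' where j': "j \<le> j'" "j' \<le> n" "bond_act l (incr_at j \<eta>) = incr_at j' (bond_act l \<eta>)" by blast
  from Cons.IH[OF _ j'(2), of "bond_act l \<eta>"] Cons.prems(1) obtain q where
    "j' \<le> q" "q \<le> n" "run ls (incr_at j' (bond_act l \<eta>)) = incr_at q (run ls (bond_act l \<eta>))" by auto
  then show ?case using j' by (intro exI[of _ q]) (simp add: run_Cons)
qed

definition passes :: "nat \<Rightarrow> nat \<Rightarrow> nat \<Rightarrow> nat list \<Rightarrow> conf \<Rightarrow> real" where
  "passes m n j ls \<eta> = real (\<Sum>i\<in>{m..n}. run ls (incr_at j \<eta>) i) - real (\<Sum>i\<in>{m..n}. run ls \<eta> i)"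

lemma passes_iff:
  assumes "q \<le> n" "run ls (incr_at j \<eta>) = incr_at q (run ls \<eta>)"
  shows "passes m n j ls \<eta> = (if m \<le> q then 1 else 0)"
proof -
  have "(\<Sum>i\<in>{m..n}. incr_at q \<zeta> i) = (\<Sum>i\<in>{m..n}. \<zeta> i) + (if m \<le> q then 1 else 0)" for \<zeta>
  proof -
    have "(\<Sum>i\<in>{m..n}. incr_at q \<zeta> i) = (\<Sum>i\<in>{m..n}. \<zeta> i + (if i = q then 1 else 0))"
      by (rule sum.cong) (auto simp: incr_at_def)
    then show ?thesis using assms(1) by (simp add: sum.distrib)
  qed
  then show ?thesis unfolding passes_def assms(2) by simp
qed

lemma Dsnk_merge_from:
  "Dsnk p a m K j (merge_from m n \<eta>) = Dsnk p a m K j (cut m \<eta>)"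
proof -
  have "Dsnk p a m K j ((cut m \<eta>)(m := c)) = Dsnk p a m K j (cut m \<eta>)" for c
  proof (induction c)
    case 0
    have "(cut m \<eta>)(m := 0) = cut m \<eta>" by (auto simp: cut_def)
    then show ?case by simp
  next
    case (Suc c)
    have "(cut m \<eta>)(m := Suc c) = incr_at m ((cut m \<eta>)(m := c))" by (auto simp: incr_at_def)
    then show ?case unfolding Suc.IH[symmetric] by (simp only: Dsnk_snk_shift)
  qed
  moreover have "merge_from m n \<eta> = (cut m \<eta>)(m := \<Sum>j\<in>{m..n}. \<eta> j)"
    by (auto simp: merge_from_def cut_def)
  ultimately show ?thesis by simp
qed

text \<open>Counting all sites from \<open>m\<close> on as passed merges them into a sink and
  reduces the chain to \<open>m\<close> sites. Initial particles from \<open>m\<close> on only shift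
  the sink count, which \<open>Dsnk\<close> does not see.\<close>

lemma sum_passes:
  assumes "0 \<le> h" "j < m" "m \<le> n"
  shows "(\<Sum>ls\<in>words n K. prod_list (map (letter_prob n h) ls) * passes m n j ls \<eta>) =
    (exp (- (real n * h)) * (1 + real n * h)) ^ K * Dsnk (h / (1 + real n * h)) 0 m K j (cut m \<eta>)"
proof -
  let ?p = "h / (1 + real n * h)" and ?G = "\<lambda>\<eta>. snk m (merge_from m n \<eta>)"
  have G: "?G \<zeta> = real (\<Sum>i\<in>{m..n}. \<zeta> i)" for \<zeta> by (simp add: merge_from_def)
  have inc: "merge_from m n (incr_at j \<eta>) = incr_at j (merge_from m n \<eta>)"
    using assms(2) by (auto simp: merge_from_def incr_at_def fun_eq_iff intro!: sum.cong)
  have "(\<Sum>ls\<in>words n K. prod_list (map (letter_prob n h) ls) * passes m n j ls \<eta>) =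
    (\<Sum>ls\<in>words n K. prod_list (map (letter_prob n h) ls) * ?G (run ls (incr_at j \<eta>))) -
    (\<Sum>ls\<in>words n K. prod_list (map (letter_prob n h) ls) * ?G (run ls \<eta>))"
    unfolding passes_def G by (simp add: sum_subtractf right_diff_distrib)
  also have "\<dots> = (exp (- (real n * h)) * (1 + real n * h)) ^ K *
    (ev ?p 0 n K ?G (incr_at j \<eta>) - ev ?p 0 n K ?G \<eta>)"
    using sum_words[OF assms(1), where n=n and K=K and f="?G"] by (simp add: right_diff_distrib)
  also have "ev ?p 0 n K ?G (incr_at j \<eta>) - ev ?p 0 n K ?G \<eta> = Dsnk ?p 0 m K j (merge_from m n \<eta>)"
    using ev_merge_from[OF assms(3), where p="?p" and a=0 and K=K and g="snk m"] by (simp add: Dsnk_def inc)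
  finally show ?thesis by (simp only: Dsnk_merge_from)
qed

text \<open>Behind a silent bond there are no arrivals. The chains with and without arrivals differ
  at the sink only through arrivals that have crossed all \<open>n\<close> sites, and
  \<open>discrepancy_bound\<close> makes these exponentially rare.\<close>

lemma Dsnk_arrivals:
  assumes "0 \<le> p" "0 \<le> a" "a \<le> 1" "p * (real n + 1) \<le> 1" "j \<le> n"
  shows "Dsnk p a n K j x \<le> Dsnk p 0 n K j x" "Dsnk p 0 n K j x \<le> Dsnk p a n K j x + (1 + p) ^ K / 2 ^ n"
proof -
  show "Dsnk p a n K j x \<le> Dsnk p 0 n K j x" by (rule Dsnk_antimono) (use assms in auto)
  have "ev p 0 n K (snk n) (incr_at j x) \<le> ev p a n K (snk n) (incr_at j x)"
    by (rule ev_arrivals_mono) (use assms in auto)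
  moreover have "ev p a n K (snk n) x - ev p 0 n K (snk n) x \<le> (1 + p) ^ K / 2 ^ n"
    using discrepancy_bound[of p 0 a n x x K] assms by simp
  ultimately show "Dsnk p 0 n K j x \<le> Dsnk p a n K j x + (1 + p) ^ K / 2 ^ n" by (simp add: Dsnk_def)
qed

context chain begin

lemma qpass_le:
  assumes "0 \<le> a" "a < 1" "1 \<le> n"
  shows "qpass p a K n \<le> 2 * (1 + p) ^ K / 2 ^ n"
proof -
  have z: "mid_radius a > 1" "a * mid_radius a < 1" using mid_radius assms by auto
  let ?ws = "hw a # replicate (n - 1) (gw a)" and ?B = "2 * (1 + p) ^ K / 2 ^ n :: real"
  have ok: "\<forall>w\<in>set ?ws. okw (mid_radius a) w" using assms z by (auto intro!: okw_gw okw_hw)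
  have "Dsnk p a n K 0 \<eta> \<le> ?B" for \<eta>
  proof -
    have "(\<Sum>i\<le>n. 2 ^ i * (real (incr_at 0 \<eta> i) - real (\<eta> i))) = (\<Sum>i\<le>n. if i = 0 then 1 else 0 :: real)"
      by (rule sum.cong) (auto simp: incr_at_def)
    then have "(\<Sum>i\<le>n. 2 ^ i * (real (incr_at 0 \<eta> i) - real (\<eta> i))) = 1" by simp
    moreover have "\<eta> \<le> incr_at 0 \<eta>" by (simp add: le_fun_def incr_at_def)
    ultimately show ?thesis using discrepancy_bound[of p a a n \<eta> "incr_at 0 \<eta>" K] p0 pn assms
      by (simp only: Dsnk_def) (simp add: mult.commute)
  qed
  then have "pavg ?ws (Dsnk p a n K 0) (\<lambda>_. 0) \<le> pavg ?ws (\<lambda>_. ?B) (\<lambda>_. 0)"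
    using assms z by (intro pavg_mono[OF ok tame_Dsnk tame_const]) auto
  also have "\<dots> = ?B"
    by (rule pavg_const) (use assms in \<open>auto intro: gw_sums hw_sums\<close>)
  finally show ?thesis by (simp add: qpass_def)
qed

lemma blocked_qpass:
  assumes "0 \<le> a" "a < 1" "i < n"
  shows "\<bar>pavg (replicate i (gw a) @ hw a # replicate (n - Suc i) (gw a)) (Dsnk p 0 n K i) (\<lambda>_. 0) - qpass p a K (n - i)\<bar>
    \<le> (1 + p) ^ K / 2 ^ n"
proof -
  have z: "mid_radius a > 1" "a * mid_radius a < 1" using mid_radius assms by auto
  let ?ws = "replicate i (gw a) @ hw a # replicate (n - Suc i) (gw a)" and ?B = "(1 + p) ^ K / 2 ^ n :: real"
  have ok: "\<forall>w\<in>set ?ws. okw (mid_radius a) w" using assms z by (auto intro!: okw_gw okw_hw)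
  have len: "length ?ws = n" using assms by simp
  note D = Dsnk_arrivals[OF p0 assms(1) less_imp_le[OF assms(2)] pn less_imp_le[OF assms(3)]]
  have c: "pavg ?ws (\<lambda>_. ?B) (\<lambda>_. 0) = ?B"
    by (rule pavg_const) (use assms in \<open>auto intro: gw_sums hw_sums\<close>)
  have t: "tame (mid_radius a) (length ?ws) (\<lambda>_. 0) (Dsnk p 0 n K i)" "tame (mid_radius a) (length ?ws) (\<lambda>_. 0) (Dsnk p a n K i)"
    "tame (mid_radius a) (length ?ws) (\<lambda>_. 0) (\<lambda>_. ?B)"
    using assms z by (auto intro!: tame_Dsnk tame_const)
  have "pavg ?ws (Dsnk p a n K i) (\<lambda>_. 0) \<le> pavg ?ws (Dsnk p 0 n K i) (\<lambda>_. 0)"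
    by (rule pavg_mono[OF ok t(2,1)]) (rule D(1))
  moreover have "pavg ?ws (Dsnk p 0 n K i) (\<lambda>_. 0) \<le> pavg ?ws (\<lambda>\<eta>. Dsnk p a n K i \<eta> + ?B) (\<lambda>_. 0)"
    by (rule pavg_mono[OF ok t(1) tame_add[OF t(2,3)]]) (rule D(2))
  moreover have "pavg ?ws (\<lambda>\<eta>. Dsnk p a n K i \<eta> + ?B) (\<lambda>_. 0) = pavg ?ws (Dsnk p a n K i) (\<lambda>_. 0) + ?B"
    unfolding pavg_add[OF ok t(2,3)] c ..
  ultimately show ?thesis unfolding site_qpass[OF assms] by linarith
qed

end

lemma survival_ge:
  fixes u :: real
  assumes "0 \<le> u" "u \<le> 1"
  shows "1 - real K * u\<^sup>2 \<le> (exp (- u) * (1 + u)) ^ K"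
proof -
  have "1 - u\<^sup>2 = (1 - u) * (1 + u)" by (simp add: power2_eq_square algebra_simps)
  also have "\<dots> \<le> exp (- u) * (1 + u)" using exp_ge_add_one_self[of "- u"] assms by (intro mult_right_mono) auto
  finally have "1 - u\<^sup>2 \<le> exp (- u) * (1 + u)" .
  then have "(1 - u\<^sup>2) ^ K \<le> (exp (- u) * (1 + u)) ^ K" using assms by (intro power_mono) (auto simp: power_le_one)
  moreover have "1 + real K * (- u\<^sup>2) \<le> (1 + (- u\<^sup>2)) ^ K"
    by (rule Bernoulli_inequality) (use assms in \<open>auto simp: power_le_one\<close>)
  ultimately show ?thesis by simp
qed

lemma survival_le:
  fixes u :: real
  assumes "0 \<le> u" shows "(exp (- u) * (1 + u)) ^ K \<le> 1"
proof -
  have "exp (- u) * (1 + u) \<le> exp (- u) * exp u" by (intro mult_left_mono) auto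
  then have "exp (- u) * (1 + u) \<le> 1" by (simp add: exp_minus)
  then show ?thesis using assms by (metis add_nonneg_nonneg exp_ge_zero mult_nonneg_nonneg power_le_one zero_le_one)
qed

section \<open>The coupled process\<close>

definition conf_of :: "nat list \<Rightarrow> conf" where
  "conf_of ks = (\<lambda>k. if k < length ks then ks ! k else 0)"

lemma conf_of_simps: "conf_of [] = (\<lambda>_. 0)" "conf_of (k # ks) = case_nat k (conf_of ks)"
  by (auto simp: conf_of_def fun_eq_iff split: nat.split)

text \<open>The tail of the list is the first component of the pair, so iterated integration
  averages the leftmost site first, as \<open>pavg\<close> does.\<close>

fun pmf_prod :: "nat pmf list \<Rightarrow> nat list pmf" where
  "pmf_prod [] = return_pmf []"
| "pmf_prod (p # ps) = map_pmf (\<lambda>(ks, k). k # ks) (pair_pmf (pmf_prod ps) p)"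

lemma pmf_pmf_prod:
  "pmf (pmf_prod ps) ks = (if length ks = length ps then (\<Prod>i<length ps. pmf (ps ! i) (ks ! i)) else 0)"
proof (induction ps arbitrary: ks)
  case Nil
  then show ?case by simp
next
  case (Cons p ps)
  show ?case
  proof (cases ks)
    case Nil
    have "[] \<notin> (\<lambda>(ks, k). k # ks) ` set_pmf (pair_pmf (pmf_prod ps) p)" by auto
    then show ?thesis using Nil by (simp add: pmf_eq_0_set_pmf)
  next
    case (Cons k ks')
    have "pmf (map_pmf (\<lambda>(ks, k). k # ks) (pair_pmf (pmf_prod ps) p)) ((\<lambda>(ks, k). k # ks) (ks', k)) = pmf (pair_pmf (pmf_prod ps) p) (ks', k)"
      by (rule pmf_map_inj') (auto simp: inj_on_def)
    then show ?thesis using Cons Cons.IH[of ks'] by (simp add: pmf_pair prod.lessThan_Suc_shift mult.commute del: prod.lessThan_Suc)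
  qed
qed

lemma pmf_sums_1: "pmf (p :: nat pmf) sums 1"
proof -
  have "(\<Sum>k. ennreal (pmf p k)) = emeasure (measure_pmf p) UNIV"
    using nn_integral_measure_pmf[of p "\<lambda>_. 1"] by (simp add: nn_integral_count_space_nat)
  also have "\<dots> = 1" using measure_pmf.emeasure_space_1[of p] by simp
  finally have 1: "(\<Sum>k. ennreal (pmf p k)) = 1" .
  then have "summable (pmf p)" by (intro summable_suminf_not_top) auto
  moreover from this 1 have "ennreal (\<Sum>k. pmf p k) = 1" by (simp add: suminf_ennreal2)
  ultimately show ?thesis by (simp add: sums_iff)
qed

lemma nn_integral_wavg:
  assumes "\<And>k. 0 \<le> f k" "\<And>k. f k \<le> B"
  shows "(\<integral>\<^sup>+k. ennreal (f k) \<partial>measure_pmf p) = ennreal (wavg (pmf p) f)" "0 \<le> wavg (pmf p) f" "wavg (pmf p) f \<le> B"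
proof -
  have s: "summable (\<lambda>k. pmf p k * f k)"
    by (rule summable_comparison_test[OF _ summable_mult[OF sums_summable[OF pmf_sums_1], of B]])
      (use assms in \<open>auto simp: mult.commute intro!: exI[of _ 0] mult_right_mono\<close>)
  show "(\<integral>\<^sup>+k. ennreal (f k) \<partial>measure_pmf p) = ennreal (wavg (pmf p) f)"
    using s assms(1) by (simp add: nn_integral_measure_pmf nn_integral_count_space_nat wavg_def suminf_ennreal2 flip: ennreal_mult)
  show "0 \<le> wavg (pmf p) f" unfolding wavg_def by (rule suminf_nonneg[OF s]) (use assms in auto)
  have "wavg (pmf p) f \<le> (\<Sum>k. pmf p k * B)"
    unfolding wavg_def by (rule suminf_le[OF _ s]) (use assms pmf_sums_1[of p] in \<open>auto intro: mult_left_mono summable_mult2 sums_summable\<close>)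
  also have "\<dots> = B" using sums_mult2[OF pmf_sums_1[of p], of B] by (simp add: sums_iff)
  finally show "wavg (pmf p) f \<le> B" .
qed

lemma nn_integral_pmf_prod:
  assumes "\<And>\<eta>. 0 \<le> g \<eta>" "\<And>\<eta>. g \<eta> \<le> B"
  shows "(\<integral>\<^sup>+ks. ennreal (g (conf_of ks)) \<partial>measure_pmf (pmf_prod ps)) = ennreal (pavg (map pmf ps) g (\<lambda>_. 0))"
  using assms
proof (induction ps arbitrary: g)
  case Nil
  then show ?case by (simp add: conf_of_simps)
next
  case (Cons p ps)
  have "(\<integral>\<^sup>+ks. ennreal (g (conf_of ks)) \<partial>measure_pmf (pmf_prod (p # ps))) =
    (\<integral>\<^sup>+ks. (\<integral>\<^sup>+k. ennreal (g (case_nat k (conf_of ks))) \<partial>measure_pmf p) \<partial>measure_pmf (pmf_prod ps))"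
    by (simp add: nn_integral_pair_pmf' conf_of_simps)
  also have "\<dots> = (\<integral>\<^sup>+ks. ennreal (wavg (pmf p) (\<lambda>k. g (case_nat k (conf_of ks)))) \<partial>measure_pmf (pmf_prod ps))"
    using Cons.prems by (intro nn_integral_cong nn_integral_wavg)
  also have "\<dots> = ennreal (pavg (map pmf ps) (\<lambda>\<eta>. wavg (pmf p) (\<lambda>k. g (case_nat k \<eta>))) (\<lambda>_. 0))"
    using Cons.prems by (intro Cons.IH[of "\<lambda>\<eta>. wavg (pmf p) (\<lambda>k. g (case_nat k \<eta>))"] nn_integral_wavg)
  finally show ?case by simp
qed

lemma space_config: "space config_space = UNIV"
  by (simp add: config_space_def space_PiM)

lemma config_component: "(\<lambda>\<eta>. \<eta> i) \<in> measurable config_space (count_space UNIV)"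
  unfolding config_space_def by (rule measurable_component_singleton) simp

text \<open>Site \<open>k\<close> of the stretch is site \<open>k - L\<close> of the line, so the antiparticle starts at site \<open>L\<close>.\<close>

definition window :: "nat \<Rightarrow> nat \<Rightarrow> config \<Rightarrow> nat list" where
  "window L n \<eta> = map (\<lambda>k. \<eta> (int k - int L)) [0..<n]"

lemma window_eq_iff: "window L n \<eta> = ks \<longleftrightarrow> length ks = n \<and> (\<forall>k\<in>{..<n}. \<eta> (int k - int L) = ks ! k)"
  unfolding window_def by (subst list_eq_iff_nth_eq) auto

lemma measurable_window [measurable]: "window L n \<in> measurable config_space (count_space UNIV)"
proof -
  note [measurable] = config_component
  have "window L n -` {ks} \<inter> space config_space = {\<eta> \<in> space config_space. length ks = n \<and> (\<forall>k\<in>{..<n}. \<eta> (int k - int L) = ks ! k)}" for ks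
    by (auto simp: window_eq_iff[symmetric])
  moreover have "{\<eta> \<in> space config_space. length ks = n \<and> (\<forall>k\<in>{..<n}. \<eta> (int k - int L) = ks ! k)} \<in> sets config_space" for ks
    by measurable
  ultimately show ?thesis by (subst measurable_count_space_eq2_countable) auto
qed

locale coupled_tazrp =
  fixes M :: "'a measure" and N :: "int \<Rightarrow> real \<Rightarrow> 'a \<Rightarrow> nat" and \<omega>m \<omega> :: "real \<Rightarrow> 'a \<Rightarrow> config" and \<rho> :: real
  assumes rho: "\<rho> > 0" and bc: "basic_coupling M N \<omega>m \<omega>"
    and law: "distr M (config_space \<Otimes>\<^sub>M config_space) (\<lambda>x. (\<omega>m 0 x, \<omega> 0 x)) = initial_law \<rho>"
begin

sublocale prob_space M
  using bc by (simp add: basic_coupling_def)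

definition a where "a = \<rho> / (1 + \<rho>)"

lemma a: "0 < a" "a < 1" "(1 - a)\<^sup>2 = char_speed \<rho>"
proof -
  have "1 - a = 1 / (1 + \<rho>)" using rho by (simp add: a_def field_simps)
  then show "(1 - a)\<^sup>2 = char_speed \<rho>" by (simp add: char_speed_def power_divide)
qed (use rho in \<open>auto simp: a_def\<close>)

lemma pmf_gw: "pmf (mu \<rho>) = gw a" "pmf (mu_hat \<rho>) = hw a"
proof -
  have "1 - a = 1 / (1 + \<rho>)" using rho by (simp add: a_def field_simps)
  then show "pmf (mu \<rho>) = gw a" "pmf (mu_hat \<rho>) = hw a"
    using pmf_mu[OF rho] pmf_mu_hat[OF rho] by (auto simp: gw_def hw_def a_def fun_eq_iff)
qed

lemma omega_measurable:
  assumes "0 \<le> t" shows "\<omega>m t \<in> measurable M config_space" "\<omega> t \<in> measurable M config_space"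
  using bc assms by (auto simp: basic_coupling_def tazrp_def)

abbreviation "marg i \<equiv> if i = (0::int) then mu_hat \<rho> else mu \<rho>"

lemma add_particle_measurable:
  "(\<lambda>\<eta>. (\<eta>, add_config \<eta> (single_particle 0))) \<in> measurable (PiM UNIV (\<lambda>i::int. measure_pmf (marg i))) (config_space \<Otimes>\<^sub>M config_space)"
proof -
  have "sets (PiM UNIV (\<lambda>i::int. measure_pmf (marg i))) = sets config_space"
    unfolding config_space_def by (intro sets_PiM_cong) auto
  moreover have "(\<lambda>\<eta> j. \<eta> j + (if j = (0::int) then 1 else 0)) \<in> config_space \<rightarrow>\<^sub>M config_space"
    unfolding config_space_def
    by (rule measurable_PiM_single') (auto intro!: measurable_compose[OF measurable_component_singleton])
  then have "(\<lambda>\<eta>. (\<eta>, add_config \<eta> (single_particle 0))) \<in> measurable config_space (config_space \<Otimes>\<^sub>M config_space)"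
    unfolding add_config_def single_particle_def by (intro measurable_Pair) auto
  ultimately show ?thesis by (simp cong: measurable_cong_sets)
qed

text \<open>Laws on a countable type are compared on singletons, and the event that the window
  equals a given list is a cylinder event of the product measure.\<close>

lemma window_law:
  "distr M (count_space UNIV) (\<lambda>x. window L n (\<omega>m 0 x)) = measure_pmf (pmf_prod (map (\<lambda>k. marg (int k - int L)) [0..<n]))"
proof (rule measure_eqI_countable)
  note [measurable] = omega_measurable[OF order_refl]
  interpret P: product_prob_space "\<lambda>i::int. measure_pmf (marg i)" UNIV by unfold_locales
  let ?P = "PiM UNIV (\<lambda>i::int. measure_pmf (marg i))"
  note m1 = add_particle_measurable
  fix ks :: "nat list" assume "ks \<in> UNIV"
  let ?f = "\<lambda>i. ks ! nat (i + int L)" and ?J = "(\<lambda>k. int k - int L) ` {..<n}"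
  let ?A = "{\<eta> \<in> space config_space. window L n \<eta> = ks}"
  have A: "?A \<in> sets config_space" by measurable
  have "emeasure (distr M (count_space UNIV) (\<lambda>x. window L n (\<omega>m 0 x))) {ks} = emeasure M ((\<lambda>x. window L n (\<omega>m 0 x)) -` {ks} \<inter> space M)"
    by (rule emeasure_distr) auto
  also have "(\<lambda>x. window L n (\<omega>m 0 x)) -` {ks} \<inter> space M = (\<lambda>x. (\<omega>m 0 x, \<omega> 0 x)) -` (?A \<times> space config_space) \<inter> space M"
    by (auto simp: space_config)
  also have "emeasure M \<dots> = emeasure (distr M (config_space \<Otimes>\<^sub>M config_space) (\<lambda>x. (\<omega>m 0 x, \<omega> 0 x))) (?A \<times> space config_space)"
    by (rule emeasure_distr[symmetric]) (use A in auto)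
  also have "\<dots> = emeasure ?P ((\<lambda>\<eta>. (\<eta>, add_config \<eta> (single_particle 0))) -` (?A \<times> space config_space) \<inter> space ?P)"
    unfolding law initial_law_def by (rule emeasure_distr[OF m1]) (use A in auto)
  also have "(\<lambda>\<eta>. (\<eta>, add_config \<eta> (single_particle 0))) -` (?A \<times> space config_space) \<inter> space ?P = {\<eta>. window L n \<eta> = ks}"
    by (auto simp: space_config space_PiM)
  also have "emeasure ?P \<dots> = ennreal (pmf (pmf_prod (map (\<lambda>k. marg (int k - int L)) [0..<n])) ks)"
  proof (cases "length ks = n")
    case True
    have "{\<eta>. window L n \<eta> = ks} = prod_emb UNIV (\<lambda>i. measure_pmf (marg i)) ?J (Pi\<^sub>E ?J (\<lambda>i. {?f i}))"
      using True by (auto simp: window_eq_iff prod_emb_def PiE_iff)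
    also have "emeasure ?P \<dots> = (\<Prod>i\<in>?J. emeasure (measure_pmf (marg i)) {?f i})"
      by (rule P.emeasure_PiM_emb) auto
    also have "\<dots> = (\<Prod>k<n. emeasure (measure_pmf (marg (int k - int L))) {ks ! k})"
      by (subst prod.reindex) (auto simp: inj_on_def)
    finally show ?thesis using True by (simp add: pmf_pmf_prod emeasure_pmf_single prod_ennreal)
  next
    case False
    then have "{\<eta>. window L n \<eta> = ks} = {}" by (auto simp: window_def)
    then show ?thesis using False by (simp add: pmf_pmf_prod)
  qed
  finally show "emeasure (distr M (count_space UNIV) (\<lambda>x. window L n (\<omega>m 0 x))) {ks} =
    emeasure (measure_pmf (pmf_prod (map (\<lambda>k. marg (int k - int L)) [0..<n]))) {ks}"
    by (simp add: emeasure_pmf_single)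
qed auto

lemma window_measurable [measurable]: "(\<lambda>x. window L n (\<omega>m 0 x)) \<in> measurable M (count_space UNIV)"
  using measurable_compose[OF omega_measurable(1)[OF order_refl] measurable_window] .

lemma expectation_window:
  assumes "\<And>\<eta>. 0 \<le> g \<eta>" "\<And>\<eta>. g \<eta> \<le> B" "L < n"
  shows "expectation (\<lambda>x. g (conf_of (window L n (\<omega>m 0 x)))) =
    pavg (replicate L (gw a) @ hw a # replicate (n - Suc L) (gw a)) g (\<lambda>_. 0)"
proof -
  let ?ps = "map (\<lambda>k. marg (int k - int L)) [0..<n]" and ?ws = "replicate L (gw a) @ hw a # replicate (n - Suc L) (gw a)"
  have ws: "map pmf ?ps = ?ws"
    using assms(3) by (intro nth_equalityI) (auto simp: nth_append nth_Cons' pmf_gw)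
  have "(\<integral>\<^sup>+x. ennreal (g (conf_of (window L n (\<omega>m 0 x)))) \<partial>M) =
    (\<integral>\<^sup>+ks. ennreal (g (conf_of ks)) \<partial>distr M (count_space UNIV) (\<lambda>x. window L n (\<omega>m 0 x)))"
    by (subst nn_integral_distr) auto
  also have "\<dots> = ennreal (pavg ?ws g (\<lambda>_. 0))"
    unfolding window_law ws[symmetric] using assms(1,2) by (rule nn_integral_pmf_prod)
  finally have 1: "(\<integral>\<^sup>+x. ennreal (g (conf_of (window L n (\<omega>m 0 x)))) \<partial>M) = ennreal (pavg ?ws g (\<lambda>_. 0))" .
  have "0 \<le> pavg (map pmf ps) f \<zeta>" if "\<And>\<eta>. 0 \<le> f \<eta>" "\<And>\<eta>. f \<eta> \<le> B" for f ps \<zeta>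
    using that
  proof (induction ps arbitrary: f)
    case (Cons p ps)
    then show ?case by (auto intro!: Cons.IH nn_integral_wavg)
  qed simp
  then have "0 \<le> pavg ?ws g (\<lambda>_. 0)" unfolding ws[symmetric] using assms by blast
  moreover have "expectation (\<lambda>x. g (conf_of (window L n (\<omega>m 0 x)))) = enn2real (\<integral>\<^sup>+x. ennreal (g (conf_of (window L n (\<omega>m 0 x)))) \<partial>M)"
    by (rule integral_eq_nn_integral) (use assms(1) in auto)
  ultimately show ?thesis using 1 by simp
qed

text \<open>The initial law is carried by the graph of the map adding a particle at
  \<open>0\<close>. This is transported site by site, each site giving a measurable event, and there
  are countably many sites.\<close>

lemma initial_pair: "AE x in M. \<omega> 0 x = add_config (\<omega>m 0 x) (single_particle 0)"
proof -
  note [measurable] = omega_measurable[OF order_refl]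
  have "AE x in M. \<omega> 0 x i = \<omega>m 0 x i + single_particle 0 i" for i
  proof -
    note m1 = add_particle_measurable
    have "(\<lambda>p. snd p i = fst p i + single_particle 0 i) \<in> measurable (config_space \<Otimes>\<^sub>M config_space) (count_space UNIV)"
      by (rule measurable_compose_countable[where f="\<lambda>k p. snd p i = k + single_particle 0 i"])
        (rule measurable_compose[OF measurable_compose[OF measurable_snd config_component]], simp,
         rule measurable_compose[OF measurable_fst config_component])
    then have m2: "{p \<in> space (config_space \<Otimes>\<^sub>M config_space). snd p i = fst p i + single_particle 0 i} \<in> sets (config_space \<Otimes>\<^sub>M config_space)"
      by (simp add: pred_def)
    have "AE p in initial_law \<rho>. snd p i = fst p i + single_particle 0 i"
      unfolding initial_law_def by (subst AE_distr_iff[OF m1 m2]) (simp add: add_config_def)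
    then have "AE p in distr M (config_space \<Otimes>\<^sub>M config_space) (\<lambda>x. (\<omega>m 0 x, \<omega> 0 x)). snd p i = fst p i + single_particle 0 i"
      unfolding law .
    moreover have "(\<lambda>x. (\<omega>m 0 x, \<omega> 0 x)) \<in> measurable M (config_space \<Otimes>\<^sub>M config_space)" by measurable
    ultimately show ?thesis using AE_distr_iff[OF _ m2, of "\<lambda>x. (\<omega>m 0 x, \<omega> 0 x)" M] by simp
  qed
  then have "AE x in M. \<forall>i. \<omega> 0 x i = \<omega>m 0 x i + single_particle 0 i" by (simp add: AE_all_countable)
  then show ?thesis by eventually_elim (auto simp: add_config_def fun_eq_iff)
qed

end

section \<open>Clocks observed on a mesh\<close>

lemma prod_list_map_nth: "prod_list (map f xs) = (\<Prod>i<length xs. f (xs ! i) :: real)"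
  by (induction xs) (simp_all add: prod.lessThan_Suc_shift del: prod.lessThan_Suc)

lemma sets_Collect_count_space2:
  fixes f :: "'a \<Rightarrow> 'b :: countable"
  assumes f: "f \<in> measurable M (count_space UNIV)" and g: "g \<in> measurable M (count_space UNIV)"
  shows "{x \<in> space M. P (f x) (g x)} \<in> sets M"
proof -
  have "(\<lambda>x. P (f x) (g x)) \<in> measurable M (count_space UNIV)"
  proof (rule measurable_compose_countable[where f="\<lambda>k x. P k (g x)", OF _ f])
    fix k
    show "(\<lambda>x. P k (g x)) \<in> measurable M (count_space UNIV)"
      by (rule measurable_compose[OF g]) simp
  qed
  then show ?thesis by (simp add: pred_def)
qed

context coupled_tazrp begin

lemma clock: "poisson_process M 1 (N i)" "indep_vars (\<lambda>_. path_space) (\<lambda>i. path_of (N i)) UNIV"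
  using bc by (auto simp: basic_coupling_def poisson_clocks_def)

lemma clock_measurable: "0 \<le> t \<Longrightarrow> N i t \<in> measurable M (count_space UNIV)"
  using clock(1)[of i] by (simp add: poisson_process_def)

lemma path_measurable: "path_of (N i) \<in> measurable M path_space"
  using clock(2) by (simp add: indep_vars_def)

lemma prob_increments:
  assumes "0 < h"
  shows "prob {x \<in> space M. \<forall>k<K. N i (real (Suc k) * h) x - N i (real k * h) x = e k} = (\<Prod>k<K. pmf (poisson_pmf h) (e k))"
proof (cases "K = 0")
  case True
  then show ?thesis using prob_space by simp
next
  case False
  let ?\<tau> = "\<lambda>k. real k * h"
  let ?X = "\<lambda>k x. N i (?\<tau> (Suc k)) x - N i (?\<tau> k) x"
  have "mono ?\<tau>" using assms by (intro monoI mult_right_mono) auto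
  then have iv: "indep_vars (\<lambda>_. count_space UNIV) ?X {..<K}"
    using clock(1)[of i, unfolded poisson_process_def, THEN conjunct2, THEN conjunct2, THEN conjunct2, rule_format, of ?\<tau> K] by simp
  have one: "prob (?X k -` {e k} \<inter> space M) = pmf (poisson_pmf h) (e k)" for k
  proof -
    have "0 \<le> ?\<tau> k" "?\<tau> k < ?\<tau> (Suc k)" "1 * (?\<tau> (Suc k) - ?\<tau> k) = h" using assms by (auto simp: algebra_simps)
    then have d: "distr M (count_space UNIV) (?X k) = measure_pmf (poisson_pmf h)"
      using clock(1)[of i, unfolded poisson_process_def, THEN conjunct2, THEN conjunct2, THEN conjunct1, rule_format, of "?\<tau> k" "?\<tau> (Suc k)"] by simp
    have X: "?X k \<in> measurable M (count_space UNIV)"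
    proof -
      have [measurable]: "N i (?\<tau> (Suc k)) \<in> measurable M (count_space UNIV)" "N i (?\<tau> k) \<in> measurable M (count_space UNIV)"
        using assms by (auto intro!: clock_measurable)
      show ?thesis by measurable
    qed
    have "prob (?X k -` {e k} \<inter> space M) = measure (distr M (count_space UNIV) (?X k)) {e k}"
      by (rule measure_distr[symmetric, OF X]) simp
    then show ?thesis unfolding d by (simp add: pmf.rep_eq)
  qed
  have "{x \<in> space M. \<forall>k<K. ?X k x = e k} = (\<Inter>k\<in>{..<K}. ?X k -` {e k} \<inter> space M)" using False by auto
  also have "prob \<dots> = (\<Prod>k\<in>{..<K}. prob (?X k -` {e k} \<inter> space M))"
    by (rule indep_varsD[OF iv]) (use False in auto)
  finally show ?thesis unfolding one .
qed

lemma prob_paths: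
  assumes "finite J" "\<And>i. i \<in> J \<Longrightarrow> S i \<in> sets path_space"
  shows "prob {x \<in> space M. \<forall>i\<in>J. path_of (N i) x \<in> S i} = (\<Prod>i\<in>J. prob {x \<in> space M. path_of (N i) x \<in> S i})"
proof (cases "J = {}")
  case True
  then show ?thesis using prob_space by simp
next
  case False
  have "{x \<in> space M. \<forall>i\<in>J. path_of (N i) x \<in> S i} = (\<Inter>i\<in>J. path_of (N i) -` S i \<inter> space M)" using False by auto
  also have "prob \<dots> = (\<Prod>i\<in>J. prob (path_of (N i) -` S i \<inter> space M))"
    by (rule indep_varsD[OF clock(2) False assms(1)]) (use assms in auto)
  finally show ?thesis by (simp add: vimage_def Int_def conj_commute)
qed

lemma paths_event:
  assumes "finite J" "\<And>i. i \<in> J \<Longrightarrow> S i \<in> sets path_space"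
  shows "{x \<in> space M. \<forall>i\<in>J. path_of (N i) x \<in> S i} \<in> sets M"
proof -
  have "{x \<in> space M. path_of (N i) x \<in> S i} \<in> sets M" if "i \<in> J" for i
    using measurable_sets[OF path_measurable assms(2)[OF that]] by (simp add: vimage_def Int_def conj_commute)
  then show ?thesis using assms(1) by (intro sets.sets_Collect_finite_All) auto
qed

text \<open>Independence is given between the sigma-algebras generated by the initial pair and by
  all clocks; both events are exhibited as preimages under the generating maps.\<close>

lemma prob_window_paths:
  assumes "finite J" "\<And>i. i \<in> J \<Longrightarrow> S i \<in> sets path_space"
  shows "prob {x \<in> space M. window L n (\<omega>m 0 x) \<in> A \<and> (\<forall>i\<in>J. path_of (N i) x \<in> S i)} =
    prob {x \<in> space M. window L n (\<omega>m 0 x) \<in> A} * prob {x \<in> space M. \<forall>i\<in>J. path_of (N i) x \<in> S i}"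
proof -
  let ?I = "vimage_algebra (space M) (\<lambda>x. (\<omega>m 0 x, \<omega> 0 x)) (config_space \<Otimes>\<^sub>M config_space)"
  let ?P = "vimage_algebra (space M) (\<lambda>x i. path_of (N i) x) (PiM UNIV (\<lambda>_. path_space))"
  have ind: "indep_set (sets ?I) (sets ?P)" using bc by (simp add: basic_coupling_def)
  let ?A = "{x \<in> space M. window L n (\<omega>m 0 x) \<in> A}" and ?B = "{x \<in> space M. \<forall>i\<in>J. path_of (N i) x \<in> S i}"
  have "(\<lambda>p. window L n (fst p)) \<in> measurable (config_space \<Otimes>\<^sub>M config_space) (count_space UNIV)"
    by (rule measurable_compose[OF measurable_fst measurable_window])
  then have "(\<lambda>p. window L n (fst p)) -` A \<inter> space (config_space \<Otimes>\<^sub>M config_space) \<in> sets (config_space \<Otimes>\<^sub>M config_space)"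
    by (rule measurable_sets) simp
  from in_vimage_algebra[OF this, of "\<lambda>x. (\<omega>m 0 x, \<omega> 0 x)" "space M"] have A: "?A \<in> sets ?I"
    by (rule back_subst[where P="\<lambda>B. B \<in> sets ?I"]) (auto simp: space_pair_measure space_config)
  have "{g \<in> space (PiM UNIV (\<lambda>_. path_space)). \<forall>i\<in>J. g i \<in> S i} \<in> sets (PiM (UNIV :: int set) (\<lambda>_. path_space))"
  proof (intro sets.sets_Collect_finite_All assms(1))
    fix i assume "i \<in> J"
    have "(\<lambda>g. g i) \<in> measurable (PiM (UNIV :: int set) (\<lambda>_. path_space)) path_space"
      by (rule measurable_component_singleton) simp
    from measurable_sets[OF this assms(2)[OF \<open>i \<in> J\<close>]]
    show "{g \<in> space (PiM UNIV (\<lambda>_. path_space)). g i \<in> S i} \<in> sets (PiM (UNIV :: int set) (\<lambda>_. path_space))"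
      by (simp add: vimage_def Int_def conj_commute)
  qed
  from in_vimage_algebra[OF this, of "\<lambda>x i. path_of (N i) x" "space M"] have B: "?B \<in> sets ?P"
  proof (rule back_subst[where P="\<lambda>B. B \<in> sets ?P"])
    have sp: "(\<lambda>i. path_of (N i) x) \<in> space (PiM (UNIV :: int set) (\<lambda>_. path_space))" for x
      by (auto simp: space_PiM path_of_def split: if_splits)
    show "(\<lambda>x i. path_of (N i) x) -` {g \<in> space (PiM UNIV (\<lambda>_. path_space)). \<forall>i\<in>J. g i \<in> S i} \<inter> space M = ?B"
      using sp by (simp add: vimage_def Int_def conj_commute)
  qed
  have "{x \<in> space M. window L n (\<omega>m 0 x) \<in> A \<and> (\<forall>i\<in>J. path_of (N i) x \<in> S i)} = ?A \<inter> ?B" by auto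
  then show ?thesis using indep_setD[OF ind A B] by simp
qed

definition ring_pattern :: "nat \<Rightarrow> nat \<Rightarrow> real \<Rightarrow> nat list \<Rightarrow> 'a set" where
  "ring_pattern L n h ls = {x \<in> space M. \<forall>i\<in>{- int L..<int n - int L}. \<forall>k<length ls.
    N i (real (Suc k) * h) x - N i (real k * h) x = (if ls ! k = Suc (nat (i + int L)) then 1 else 0)}"

lemma prod_bonds:
  assumes "l \<le> n" "0 < h"
  shows "(\<Prod>i\<in>{- int L..<int n - int L}. pmf (poisson_pmf h) (if l = Suc (nat (i + int L)) then 1 else 0)) = letter_prob n h l"
proof -
  have "(\<Prod>i\<in>{- int L..<int n - int L}. pmf (poisson_pmf h) (if l = Suc (nat (i + int L)) then 1 else 0)) =
    (\<Prod>i<n. pmf (poisson_pmf h) (if l = Suc i then 1 else 0))"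
    by (rule prod.reindex_bij_witness[of _ "\<lambda>i. int i - int L" "\<lambda>i. nat (i + int L)"]) auto
  also have "\<dots> = (\<Prod>i<n. exp (- h) * (if l = Suc i then h else 1))"
    using assms(2) by (intro prod.cong) auto
  also have "\<dots> = exp (- (real n * h)) * (\<Prod>i<n. if l = Suc i then h else 1)"
    by (simp add: prod.distrib exp_of_nat_mult[symmetric])
  also have "(\<Prod>i<n. if l = Suc i then h else 1) = (if l = 0 then 1 else h)"
  proof (cases l)
    case (Suc i0)
    then show ?thesis using assms prod.delta[of "{..<n}" i0 "\<lambda>_. h"] by (simp add: eq_commute)
  qed simp
  finally show ?thesis by (simp add: letter_prob_def)
qed

lemma ring_pattern_paths:
  assumes "0 < h"
  shows "ring_pattern L n h ls = {x \<in> space M. \<forall>i\<in>{- int L..<int n - int L}. path_of (N i) x \<in>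
    {f \<in> space path_space. \<forall>k<length ls. f (real (Suc k) * h) - f (real k * h) = (if ls ! k = Suc (nat (i + int L)) then 1 else 0)}}"
proof -
  have sp: "path_of (N i) x \<in> space path_space" for i x by (auto simp: path_of_def space_PiM split: if_splits)
  have pt: "path_of (N i) x u = N i u x" if "0 \<le> u" for i x u using that by (simp add: path_of_def)
  show ?thesis
    unfolding ring_pattern_def by (intro Collect_cong conj_cong ball_cong refl) (use assms in \<open>simp add: sp pt\<close>)
qed

lemma increments_event:
  assumes "0 < h"
  shows "{f \<in> space path_space. \<forall>k<K. f (real (Suc k) * h) - f (real k * h) = e k} \<in> sets path_space"
proof -
  have [measurable]: "(\<lambda>f. f (real k * h)) \<in> measurable path_space (count_space UNIV)" for k
    using assms by (intro measurable_component_singleton) auto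
  have "{f \<in> space path_space. f (real (Suc k) * h) - f (real k * h) = e k} \<in> sets path_space" for k
    by measurable
  then have "{f \<in> space path_space. \<forall>k\<in>{..<K}. f (real (Suc k) * h) - f (real k * h) = e k} \<in> sets path_space"
    by (intro sets.sets_Collect_finite_All) auto
  then show ?thesis unfolding Ball_def lessThan_iff .
qed

lemma ring_pattern_event: "0 < h \<Longrightarrow> ring_pattern L n h ls \<in> sets M"
  unfolding ring_pattern_paths by (intro paths_event increments_event) auto

lemma prob_ring_pattern:
  assumes "0 < h" "ls \<in> words n K"
  shows "prob {x \<in> space M. window L n (\<omega>m 0 x) \<in> A \<and> x \<in> ring_pattern L n h ls} =
    prob {x \<in> space M. window L n (\<omega>m 0 x) \<in> A} * prod_list (map (letter_prob n h) ls)"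
proof -
  let ?J = "{- int L..<int n - int L}"
  let ?e = "\<lambda>i k. if ls ! k = Suc (nat (i + int L)) then 1 else 0 :: nat"
  define S where "S i = {f \<in> space path_space. \<forall>k<length ls. f (real (Suc k) * h) - f (real k * h) = ?e i k}" for i
  have S: "S i \<in> sets path_space" for i unfolding S_def by (rule increments_event[OF assms(1)])
  have sp: "path_of (N i) x \<in> space path_space" for i x by (auto simp: path_of_def space_PiM split: if_splits)
  have pt: "path_of (N i) x u = N i u x" if "0 \<le> u" for i x u using that by (simp add: path_of_def)
  have path: "{x \<in> space M. path_of (N i) x \<in> S i} = {x \<in> space M. \<forall>k<length ls. N i (real (Suc k) * h) x - N i (real k * h) x = ?e i k}" for i
    using assms(1) sp unfolding S_def by (intro Collect_cong conj_cong refl) (simp add: pt)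
  have "prob {x \<in> space M. \<forall>i\<in>?J. path_of (N i) x \<in> S i} = (\<Prod>i\<in>?J. prob {x \<in> space M. path_of (N i) x \<in> S i})"
    by (rule prob_paths[where S=S], rule finite_atLeastLessThan_int, rule S)
  also have "\<dots> = (\<Prod>i\<in>?J. \<Prod>k<length ls. pmf (poisson_pmf h) (?e i k))"
    unfolding path prob_increments[OF assms(1)] ..
  \<comment> \<open>The product over bonds and intervals is regrouped by intervals, each of which
    contributes one letter.\<close>
  also have "\<dots> = (\<Prod>k<length ls. letter_prob n h (ls ! k))"
  proof (subst prod.swap, rule prod.cong)
    fix k assume "k \<in> {..<length ls}"
    then have "ls ! k \<in> set ls" by simp
    then have "ls ! k \<le> n" using assms(2) by (auto simp: words_def)
    then show "(\<Prod>i\<in>?J. pmf (poisson_pmf h) (?e i k)) = letter_prob n h (ls ! k)" by (rule prod_bonds[OF _ assms(1)])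
  qed simp
  also have "\<dots> = prod_list (map (letter_prob n h) ls)" by (simp add: prod_list_map_nth)
  finally have R: "prob {x \<in> space M. \<forall>i\<in>?J. path_of (N i) x \<in> S i} = prod_list (map (letter_prob n h) ls)" .
  have "{x \<in> space M. window L n (\<omega>m 0 x) \<in> A \<and> x \<in> ring_pattern L n h ls} =
    {x \<in> space M. window L n (\<omega>m 0 x) \<in> A \<and> (\<forall>i\<in>?J. path_of (N i) x \<in> S i)}"
    unfolding ring_pattern_paths[OF assms(1)] S_def by auto
  also have "prob \<dots> = prob {x \<in> space M. window L n (\<omega>m 0 x) \<in> A} * prob {x \<in> space M. \<forall>i\<in>?J. path_of (N i) x \<in> S i}"
    by (rule prob_window_paths[where S=S], rule finite_atLeastLessThan_int, rule S)
  finally show ?thesis unfolding R .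
qed

lemma ring_patternD:
  assumes "x \<in> ring_pattern L n h ls" "i < n" "k < length ls"
  shows "N (int i - int L) (real (Suc k) * h) x - N (int i - int L) (real k * h) x = (if ls ! k = Suc i then 1 else 0)"
proof -
  have i: "int i - int L \<in> {- int L..<int n - int L}" using assms(2) by simp
  have "\<forall>i\<in>{- int L..<int n - int L}. \<forall>k<length ls.
    N i (real (Suc k) * h) x - N i (real k * h) x = (if ls ! k = Suc (nat (i + int L)) then 1 else 0)"
    using assms(1) unfolding ring_pattern_def mem_Collect_eq by (rule conjunct2)
  from this[rule_format, OF i assms(3)] show ?thesis by simp
qed

text \<open>The increments determine the letter of each interval: it is \<open>0\<close> if no bond
  rings, and otherwise it names the ringing bond.\<close>

lemma ring_pattern_disjoint: "disjoint_family_on (ring_pattern L n h) (words n K)"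
proof -
  have *: "ls = ls'" if ls: "ls \<in> words n K" "ls' \<in> words n K" "x \<in> ring_pattern L n h ls" "x \<in> ring_pattern L n h ls'" for ls ls' x
  proof (rule nth_equalityI)
    show "length ls = length ls'" using ls by (simp add: words_def)
    fix k assume k: "k < length ls"
    then have k': "k < length ls'" using ls by (simp add: words_def)
    have b: "ls ! k \<le> n" "ls' ! k \<le> n" using ls k k' nth_mem by (force simp: words_def)+
    have eq: "ls ! k = Suc i \<longleftrightarrow> ls' ! k = Suc i" if "i < n" for i
    proof -
      have "(if ls ! k = Suc i then 1 else 0 :: nat) = (if ls' ! k = Suc i then 1 else 0)"
        using ring_patternD[OF ls(3) that k] ring_patternD[OF ls(4) that k'] by simp
      then show ?thesis by (simp split: if_splits)
    qed
    show "ls ! k = ls' ! k"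
    proof (cases "ls ! k")
      case 0
      then show ?thesis using eq[of "ls' ! k - 1"] b by (cases "ls' ! k") auto
    next
      case (Suc i)
      then show ?thesis using eq[of i] b by auto
    qed
  qed
  then show ?thesis by (auto simp: disjoint_family_on_def)
qed

text \<open>Each of the \<open>L - m\<close> independent bonds rings with probability at most
  \<open>1 - exp (- t)\<close>. For large \<open>L\<close> one of them is therefore very likely
  silent, and it serves as the barrier.\<close>

lemma prob_ring:
  assumes "0 < t"
  shows "prob {x \<in> space M. \<forall>j\<in>{- int L..<- int m}. N j t x \<noteq> N j 0 x} \<le> (1 - exp (- t)) ^ (L - m)"
proof -
  let ?S = "{f \<in> space path_space. f t \<noteq> f 0}" and ?J = "{- int L..<- int m}"
  have [measurable]: "(\<lambda>f. f t) \<in> measurable path_space (count_space UNIV)" "(\<lambda>f. f 0) \<in> measurable path_space (count_space UNIV)"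
    using assms by (auto intro!: measurable_component_singleton)
  have S: "?S \<in> sets path_space" by measurable
  have p: "{x \<in> space M. path_of (N i) x \<in> ?S} = {x \<in> space M. N i t x \<noteq> N i 0 x}" for i
    using assms by (auto simp: path_of_def space_PiM split: if_splits)
  have q: "prob {x \<in> space M. N i t x \<noteq> N i 0 x} \<le> 1 - exp (- t)" for i
  proof -
    let ?E = "{x \<in> space M. \<forall>k<1. N i (real (Suc k) * t) x - N i (real k * t) x = 0}"
    \<comment> \<open>A zero difference of natural numbers only says \<open>\<le>\<close>; almost
      sure monotonicity of the clock turns it into equality.\<close>
    have E: "?E = {x \<in> space M. N i t x \<le> N i 0 x}" by auto
    have m: "N i t \<in> measurable M (count_space UNIV)" "N i 0 \<in> measurable M (count_space UNIV)"
      using assms by (auto intro!: clock_measurable)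
    have Em: "?E \<in> events" unfolding E by (rule sets_Collect_count_space2[OF m])
    have AE: "AE x in M. x \<in> {x \<in> space M. N i t x \<noteq> N i 0 x} \<longrightarrow> x \<in> space M - ?E"
    proof -
      have "AE x in M. mono_on {0..} (\<lambda>t. N i t x)" using clock(1)[of i] by (auto simp: poisson_process_def)
      then show ?thesis
      proof eventually_elim
        case (elim x)
        then have "N i 0 x \<le> N i t x" using assms by (auto simp: mono_on_def)
        then show ?case by auto
      qed
    qed
    have "prob {x \<in> space M. N i t x \<noteq> N i 0 x} \<le> prob (space M - ?E)"
      by (rule finite_measure_mono_AE[OF AE]) (use Em in auto)
    also have "\<dots> = 1 - exp (- t)" using prob_compl[OF Em] prob_increments[OF assms, of 1 i "\<lambda>_. 0"] assms by simp
    finally show ?thesis .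
  qed
  have "{x \<in> space M. \<forall>j\<in>?J. N j t x \<noteq> N j 0 x} = {x \<in> space M. \<forall>j\<in>?J. path_of (N j) x \<in> ?S}"
    using p by blast
  then have "prob {x \<in> space M. \<forall>j\<in>?J. N j t x \<noteq> N j 0 x} = (\<Prod>j\<in>?J. prob {x \<in> space M. N j t x \<noteq> N j 0 x})"
    using prob_paths[of ?J "\<lambda>_. ?S"] S by (simp only: p) simp
  also have "\<dots> \<le> (\<Prod>j\<in>?J. 1 - exp (- t))" by (rule prod_mono) (use q in auto)
  also have "\<dots> = (1 - exp (- t)) ^ (L - m)"
  proof -
    have "nat (int L - int m) = L - m" by linarith
    then show ?thesis by simp
  qed
  finally show ?thesis .
qed

end

context coupled_tazrp begin

section \<open>Paths with a silent bond and no double rings\<close>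

definition good :: "'a \<Rightarrow> bool" where
  "good x \<longleftrightarrow> (\<forall>i. good_clock (\<lambda>u. N i u x)) \<and> tazrp_path (\<lambda>i t. N i t x) (\<lambda>t. \<omega>m t x) \<and>
    tazrp_path (\<lambda>i t. N i t x) (\<lambda>t. \<omega> t x) \<and> \<omega> 0 x = add_config (\<omega>m 0 x) (single_particle 0)"

lemma AE_good: "AE x in M. good x"
proof -
  have "AE x in M. good_clock (\<lambda>u. N i u x)" for i
    using clock(1)[of i] by (simp add: poisson_process_def good_clock_def)
  then have "AE x in M. \<forall>i. good_clock (\<lambda>u. N i u x)" by (simp add: AE_all_countable)
  moreover have "AE x in M. tazrp_path (\<lambda>i t. N i t x) (\<lambda>t. \<omega>m t x)" "AE x in M. tazrp_path (\<lambda>i t. N i t x) (\<lambda>t. \<omega> t x)"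
    using bc by (auto simp: basic_coupling_def tazrp_def)
  ultimately show ?thesis using initial_pair by eventually_elim (simp add: good_def)
qed

text \<open>The clock of bond \<open>j\<close> has not moved by the final time, so its letter cannot
  occur in the word. This is the barrier that \<open>chain_follows\<close> asks for.\<close>

lemma word_path:
  assumes x: "good x" and h: "0 < h" and ls: "ls \<in> words n K" "x \<in> ring_pattern L n h ls" and n: "n = L + Y"
    and j: "j \<in> {- int L..<0}" "N j (real K * h) x = N j 0 x" and i: "i \<in> {j<..<int Y}"
  shows "\<omega>m (real K * h) x i = run ls (conf_of (window L n (\<omega>m 0 x))) (nat (i + int L))"
    and "\<omega> (real K * h) x i = run ls (incr_at L (conf_of (window L n (\<omega>m 0 x)))) (nat (i + int L))"
proof -
  let ?W = "conf_of (window L n (\<omega>m 0 x))"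
  have gc: "good_clock (\<lambda>u. N i u x)" for i using x by (simp add: good_def)
  have len: "length ls = K" using ls by (simp add: words_def)
  have ring: "N i (real (Suc k) * h) x = N i (real k * h) x + (if ls ! k = Suc (nat (i + int L)) then 1 else 0)"
    if "k < length ls" "i \<in> {j..int Y - 1}" for k i
  proof -
    define c where "c = nat (i + int L)"
    have c: "c < n" "int c - int L = i" using that(2) j(1) n by (auto simp: c_def)
    have "N i (real k * h) x \<le> N i (real (Suc k) * h) x"
      using h by (intro good_clock_mono[OF gc]) (auto intro: mult_right_mono)
    then show ?thesis using ring_patternD[OF ls(2) c(1) that(1), unfolded c(2)] unfolding c_def[symmetric] by linarith
  qed
  have block: "ls ! k \<noteq> Suc (nat (j + int L))" if k: "k < length ls" for k
  proof
    assume "ls ! k = Suc (nat (j + int L))"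
    moreover have "j \<in> {j..int Y - 1}" using j(1) by auto
    ultimately have "N j (real (Suc k) * h) x = Suc (N j (real k * h) x)" using ring[OF k, of j] by simp
    moreover have "N j 0 x \<le> N j (real k * h) x" using h by (intro good_clock_mono[OF gc]) auto
    moreover have "N j (real (Suc k) * h) x \<le> N j (real K * h) x"
      using h k len by (intro good_clock_mono[OF gc] mult_right_mono) auto
    ultimately show False using j(2) by linarith
  qed
  have W: "?W (nat (i + int L)) = \<omega>m 0 x i" if "i \<in> {j<..int Y - 1}" for i
    using that j(1) n by (auto simp: conf_of_def window_def)
  have L: "- int L \<le> j" using j(1) by simp
  have i': "i \<in> {j<..int Y - 1}" using i by auto
  have t: "take K ls = ls" using len by simp
  have tz: "tazrp_path (\<lambda>i t. N i t x) (\<lambda>t. \<omega>m t x)" "tazrp_path (\<lambda>i t. N i t x) (\<lambda>t. \<omega> t x)"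
    using x by (auto simp: good_def)
  have len': "K \<le> length ls" using len by simp
  from chain_follows[OF tz(1) gc less_imp_le[OF h] L ring block, of "int Y - 1" ?W K, OF _ _ _ _ len', THEN conjunct1] W i'
  show "\<omega>m (real K * h) x i = run ls ?W (nat (i + int L))" unfolding t by simp
  have "\<omega> 0 x i = incr_at L ?W (nat (i + int L))" if "i \<in> {j<..int Y - 1}" for i
  proof -
    have "nat (i + int L) = L \<longleftrightarrow> i = 0" using that j(1) by auto
    moreover have "\<omega> 0 x i = \<omega>m 0 x i + (if i = 0 then 1 else 0)"
      using x by (simp add: good_def add_config_def single_particle_def)
    ultimately show ?thesis using W[OF that] by (auto simp: incr_at_def)
  qed
  with chain_follows[OF tz(2) gc less_imp_le[OF h] L ring block, of "int Y - 1" "incr_at L ?W" K, OF _ _ _ _ len', THEN conjunct1] i'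
  show "\<omega> (real K * h) x i = run ls (incr_at L ?W) (nat (i + int L))" unfolding t by simp
qed

lemma word_discrepancy:
  assumes x: "good x" and h: "0 < h" and ls: "ls \<in> words n K" "x \<in> ring_pattern L n h ls" and n: "n = L + Y"
    and j: "j \<in> {- int L..<0}" "N j (real K * h) x = N j 0 x"
  shows "\<exists>q. L \<le> q \<and> q \<le> n \<and> (\<forall>m. passes m n L ls (conf_of (window L n (\<omega>m 0 x))) = (if m \<le> q then 1 else 0)) \<and>
    (\<forall>i\<in>{j<..<int Y}. \<omega> (real K * h) x i = \<omega>m (real K * h) x i + (if i = int q - int L then 1 else 0))"
proof -
  let ?W = "conf_of (window L n (\<omega>m 0 x))"
  have "set ls \<subseteq> {..n}" "L \<le> n" using ls(1) n by (auto simp: words_def)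
  from run_incr_at[OF this, of ?W] obtain q where q: "L \<le> q" "q \<le> n" "run ls (incr_at L ?W) = incr_at q (run ls ?W)" by blast
  have "\<omega> (real K * h) x i = \<omega>m (real K * h) x i + (if i = int q - int L then 1 else 0)" if i: "i \<in> {j<..<int Y}" for i
  proof -
    have "nat (i + int L) = q \<longleftrightarrow> i = int q - int L" using i j(1) by auto
    then show ?thesis using word_path[OF assms i] q(3) by (auto simp: incr_at_def)
  qed
  moreover have "passes m n L ls ?W = (if m \<le> q then 1 else 0)" for m by (rule passes_iff[OF q(2,3)])
  ultimately show ?thesis using q(1,2) by blast
qed

text \<open>The probability that no interval of length \<open>h\<close> sees two rings.\<close>

abbreviation surv :: "nat \<Rightarrow> real \<Rightarrow> nat \<Rightarrow> real" where
  "surv n h K \<equiv> (exp (- (real n * h)) * (1 + real n * h)) ^ K"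

lemma prob_patterns:
  assumes h: "0 < h"
  shows "prob (\<Union>ls\<in>words n K. ring_pattern L n h ls) = surv n h K"
proof -
  have "prob (\<Union>ls\<in>words n K. ring_pattern L n h ls) = (\<Sum>ls\<in>words n K. prob (ring_pattern L n h ls))"
    by (rule finite_measure_finite_Union[OF finite_words]) (auto intro: ring_pattern_event[OF h] ring_pattern_disjoint)
  also have "\<dots> = (\<Sum>ls\<in>words n K. prod_list (map (letter_prob n h) ls))"
  proof (rule sum.cong)
    fix ls assume "ls \<in> words n K"
    from prob_ring_pattern[OF h this, of L UNIV] show "prob (ring_pattern L n h ls) = prod_list (map (letter_prob n h) ls)"
      using prob_space by (simp add: ring_pattern_def)
  qed simp
  also have "\<dots> = surv n h K" using sum_words[OF less_imp_le[OF h], where f="\<lambda>_. 1"] by (simp add: ev_0_const)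
  finally show ?thesis .
qed

text \<open>No interval sees two rings of the bonds of the window, and one of the bonds from
  \<open>- L\<close> to \<open>- m - 1\<close> is silent throughout. The parameter \<open>m\<close>
  leaves room for sites to the left of the origin.\<close>

definition covered :: "nat \<Rightarrow> nat \<Rightarrow> nat \<Rightarrow> real \<Rightarrow> nat \<Rightarrow> 'a set" where
  "covered m L n h K = (\<Union>ls\<in>words n K. ring_pattern L n h ls) \<inter>
    (space M - {x \<in> space M. \<forall>j\<in>{- int L..<- int m}. N j (real K * h) x \<noteq> N j 0 x})"

lemma ring_event:
  assumes "0 \<le> t" shows "{x \<in> space M. \<forall>j\<in>{- int L..<- int m}. N j t x \<noteq> N j 0 x} \<in> events"
proof -
  have E: "{x \<in> space M. N j t x \<noteq> N j 0 x} \<in> events" for j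
    using sets_Collect_count_space2[OF clock_measurable[OF assms] clock_measurable[OF order_refl], where P="\<lambda>b c. b \<noteq> c"] .
  show ?thesis by (rule sets.sets_Collect_finite_All[OF E finite_atLeastLessThan_int])
qed

lemma covered:
  assumes h: "0 < h" and K: "0 < K"
  shows "covered m L n h K \<in> events" "surv n h K - (1 - exp (- (real K * h))) ^ (L - m) \<le> prob (covered m L n h K)"
proof -
  let ?P = "\<Union>ls\<in>words n K. ring_pattern L n h ls" and ?R = "{x \<in> space M. \<forall>j\<in>{- int L..<- int m}. N j (real K * h) x \<noteq> N j 0 x}"
  have P: "?P \<in> events" by (intro sets.finite_UN finite_words ring_pattern_event h)
  have R: "?R \<in> events" by (rule ring_event) (use h in simp)
  show C: "covered m L n h K \<in> events" unfolding covered_def by (intro sets.Int P sets.compl_sets R)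
  have "?P \<subseteq> covered m L n h K \<union> ?R" unfolding covered_def using sets.sets_into_space[OF P] by blast
  then have "prob ?P \<le> prob (covered m L n h K \<union> ?R)"
    by (rule finite_measure_mono) (intro sets.Un C R)
  also have "\<dots> \<le> prob (covered m L n h K) + prob ?R"
    by (rule measure_Un_le[OF C R])
  also have "prob ?R \<le> (1 - exp (- (real K * h))) ^ (L - m)" by (rule prob_ring) (use h K in simp)
  finally show "surv n h K - (1 - exp (- (real K * h))) ^ (L - m) \<le> prob (covered m L n h K)"
    by (simp add: prob_patterns[OF h])
qed

lemma coveredD:
  assumes "x \<in> covered m L n h K" "good x" "n = L + Y" "0 < h"
  shows "\<exists>ls q. ls \<in> words n K \<and> x \<in> ring_pattern L n h ls \<and> L \<le> q \<and> q \<le> n \<and>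
    (\<forall>m. passes m n L ls (conf_of (window L n (\<omega>m 0 x))) = (if m \<le> q then 1 else 0)) \<and>
    (\<forall>i\<in>{- int m..<int Y}. \<omega> (real K * h) x i = \<omega>m (real K * h) x i + (if i = int q - int L then 1 else 0))"
proof -
  from assms(1) obtain ls j where ls: "ls \<in> words n K" "x \<in> ring_pattern L n h ls" and j: "j \<in> {- int L..<- int m}" "N j (real K * h) x = N j 0 x"
    unfolding covered_def by blast
  have "j \<in> {- int L..<0}" using j(1) by auto
  from word_discrepancy[OF assms(2,4) ls assms(3) this j(2)] obtain q where q: "L \<le> q" "q \<le> n"
    "\<forall>m. passes m n L ls (conf_of (window L n (\<omega>m 0 x))) = (if m \<le> q then 1 else 0)"
    "\<forall>i\<in>{j<..<int Y}. \<omega> (real K * h) x i = \<omega>m (real K * h) x i + (if i = int q - int L then 1 else 0)" by blast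
  have "\<omega> (real K * h) x i = \<omega>m (real K * h) x i + (if i = int q - int L then 1 else 0)" if "i \<in> {- int m..<int Y}" for i
    using q(4)[rule_format, of i] j(1) that by simp
  then show ?thesis using ls q(1,2,3) by blast
qed

text \<open>Almost surely the event that the antiparticle is at \<open>y\<close> or further right.\<close>

definition agree :: "real \<Rightarrow> nat \<Rightarrow> 'a set" where
  "agree t y = {x \<in> space M. \<forall>i\<in>{0..<int y}. \<omega> t x i = \<omega>m t x i}"

lemma component_measurable:
  assumes "0 \<le> t"
  shows "(\<lambda>x. \<omega> t x i) \<in> measurable M (count_space UNIV)" "(\<lambda>x. \<omega>m t x i) \<in> measurable M (count_space UNIV)"
  using measurable_compose[OF omega_measurable(1)[OF assms] config_component]
    measurable_compose[OF omega_measurable(2)[OF assms] config_component] by auto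

lemma agree_event: "0 \<le> t \<Longrightarrow> agree t y \<in> events"
  unfolding agree_def
  by (rule sets.sets_Collect_finite_All[OF _ finite_atLeastLessThan_int],
    rule sets_Collect_count_space2[OF component_measurable(1) component_measurable(2), where P="\<lambda>b c. b = c"])

text \<open>Independence of the window from the clocks turns each word into its probability weight.
  Summing over the words first produces \<open>Dsnk\<close> as a function of the window, and the
  initial state is averaged afterwards.\<close>

lemma prob_passes:
  assumes h: "0 < h" and y: "L < m" "m \<le> n" "p = h / (1 + real n * h)" "p * (real m + 1) \<le> 1"
  shows "prob (\<Union>ls\<in>words n K. ring_pattern L n h ls \<inter> {x \<in> space M. passes m n L ls (conf_of (window L n (\<omega>m 0 x))) = 1}) =
    surv n h K * pavg (replicate L (gw a) @ hw a # replicate (m - Suc L) (gw a)) (Dsnk p 0 m K L) (\<lambda>_. 0)"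
proof -
  let ?F = "\<lambda>ls x. passes m n L ls (conf_of (window L n (\<omega>m 0 x)))"
  let ?E = "\<lambda>ls. {x \<in> space M. ?F ls x = 1}"
  have pass01: "?F ls x = 0 \<or> ?F ls x = 1" if "ls \<in> words n K" for ls x
  proof -
    have "set ls \<subseteq> {..n}" "L \<le> n" using that y by (auto simp: words_def)
    from run_incr_at[OF this] show ?thesis using passes_iff by metis
  qed
  have F [measurable]: "?F ls \<in> borel_measurable M" for ls
    by (rule measurable_compose[OF window_measurable]) simp
  have E: "?E ls \<in> events" for ls by measurable
  have p: "0 \<le> p" using h y by simp
  have int: "integrable M (?F ls)" if "ls \<in> words n K" for ls
  proof (rule integrable_const_bound[of _ 1])
    have "\<bar>?F ls x\<bar> \<le> 1" for x using pass01[OF that, of x] by auto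
    then show "AE x in M. norm (?F ls x) \<le> 1" by simp
  qed (rule F)
  have "prob (\<Union>ls\<in>words n K. ring_pattern L n h ls \<inter> ?E ls) = (\<Sum>ls\<in>words n K. prob (ring_pattern L n h ls \<inter> ?E ls))"
  proof (rule finite_measure_finite_Union[OF finite_words])
    show "(\<lambda>ls. ring_pattern L n h ls \<inter> ?E ls) ` words n K \<subseteq> events" using ring_pattern_event[OF h] E by blast
    show "disjoint_family_on (\<lambda>ls. ring_pattern L n h ls \<inter> ?E ls) (words n K)"
      using ring_pattern_disjoint[of L n h K] unfolding disjoint_family_on_def by blast
  qed
  also have "\<dots> = (\<Sum>ls\<in>words n K. expectation (\<lambda>x. prod_list (map (letter_prob n h) ls) * ?F ls x))"
  proof (rule sum.cong)
    fix ls assume ls: "ls \<in> words n K"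
    let ?A = "{ks. passes m n L ls (conf_of ks) = 1}"
    have "ring_pattern L n h ls \<inter> ?E ls = {x \<in> space M. window L n (\<omega>m 0 x) \<in> ?A \<and> x \<in> ring_pattern L n h ls}" by (auto simp: ring_pattern_def)
    then have "prob (ring_pattern L n h ls \<inter> ?E ls) = prob (?E ls) * prod_list (map (letter_prob n h) ls)" using prob_ring_pattern[OF h ls, of L ?A] by simp
    moreover have "expectation (?F ls) = expectation (indicator (?E ls))"
    proof (rule Bochner_Integration.integral_cong)
      fix x assume "x \<in> space M"
      then show "?F ls x = indicator (?E ls) x" using pass01[OF ls, of x] by (auto simp: indicator_def)
    qed simp
    ultimately show "prob (ring_pattern L n h ls \<inter> ?E ls) = expectation (\<lambda>x. prod_list (map (letter_prob n h) ls) * ?F ls x)"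
      using E[of ls] by simp
  qed simp
  also have "\<dots> = expectation (\<lambda>x. \<Sum>ls\<in>words n K. prod_list (map (letter_prob n h) ls) * ?F ls x)"
    by (rule Bochner_Integration.integral_sum[symmetric]) (use int in simp)
  also have "\<dots> = expectation (\<lambda>x. surv n h K * Dsnk p 0 m K L (conf_of (window L m (\<omega>m 0 x))))"
  proof (rule Bochner_Integration.integral_cong)
    fix x
    have "cut m (conf_of (window L n (\<omega>m 0 x))) = conf_of (window L m (\<omega>m 0 x))"
      using y(2) by (auto simp: cut_def conf_of_def window_def fun_eq_iff)
    then show "(\<Sum>ls\<in>words n K. prod_list (map (letter_prob n h) ls) * ?F ls x) = surv n h K * Dsnk p 0 m K L (conf_of (window L m (\<omega>m 0 x)))"
      unfolding sum_passes[OF less_imp_le[OF h] y(1,2)] y(3) by simp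
  qed simp
  also have "\<dots> = surv n h K * expectation (\<lambda>x. Dsnk p 0 m K L (conf_of (window L m (\<omega>m 0 x))))" by simp
  also have "expectation (\<lambda>x. Dsnk p 0 m K L (conf_of (window L m (\<omega>m 0 x)))) =
    pavg (replicate L (gw a) @ hw a # replicate (m - Suc L) (gw a)) (Dsnk p 0 m K L) (\<lambda>_. 0)"
    using Dsnk_bounds[OF p _ _ y(4), of 0 L K] y(1) by (intro expectation_window[where B=1]) auto
  finally show ?thesis .
qed

text \<open>Three errors occur: intervals with two rings, once for the event and once for the factor
  \<open>surv\<close>; the absence of a silent bond; and the missing arrivals behind the silent
  bond.\<close>

lemma prob_agree_qpass:
  assumes h: "0 < h" and K: "0 < K" and y: "1 \<le> y" "y \<le> Y" and n: "n = L + Y" and p: "p = h / (1 + real n * h)" "p * (real n + 1) \<le> 1"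
  shows "\<bar>prob (agree (real K * h) y) - qpass p a K y\<bar> \<le>
    2 * (1 - surv n h K) + (1 - exp (- (real K * h))) ^ L + (1 + p) ^ K / 2 ^ L"
proof -
  let ?t = "real K * h" and ?m = "L + y"
  let ?F = "\<lambda>ls x. passes ?m n L ls (conf_of (window L n (\<omega>m 0 x)))"
  let ?B = "\<Union>ls\<in>words n K. ring_pattern L n h ls \<inter> {x \<in> space M. ?F ls x = 1}"
  let ?C = "covered 0 L n h K"
  have p0: "0 \<le> p" using h p by simp
  have mn: "L < ?m" "?m \<le> n" using y n by auto
  have chain_le: "p * (real ?m + 1) \<le> 1" using p(2) p0 mn mult_left_mono[of "real ?m + 1" "real n + 1" p] by simp
  interpret c: chain p ?m using p0 chain_le by unfold_locales
  have A: "agree ?t y \<in> events" using h by (intro agree_event) simp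
  have F [measurable]: "?F ls \<in> borel_measurable M" for ls
    by (rule measurable_compose[OF window_measurable]) simp
  have "{x \<in> space M. ?F ls x = 1} \<in> events" for ls by measurable
  then have B: "?B \<in> events" by (intro sets.finite_UN finite_words sets.Int ring_pattern_event h)
  have C: "?C \<in> events" by (rule covered[OF h K])
  have key: "x \<in> agree ?t y \<longleftrightarrow> x \<in> ?B" if x: "x \<in> ?C" "good x" for x
  proof -
    have xs: "x \<in> space M" using x(1) C sets.sets_into_space by blast
    obtain ls q where q: "ls \<in> words n K" "x \<in> ring_pattern L n h ls" "L \<le> q" "q \<le> n" "\<And>m. passes m n L ls (conf_of (window L n (\<omega>m 0 x))) = (if m \<le> q then 1 else 0)"
      "\<And>i. i \<in> {- int 0..<int Y} \<Longrightarrow> \<omega> ?t x i = \<omega>m ?t x i + (if i = int q - int L then 1 else 0)"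
      using coveredD[OF x n h] by blast
    have "x \<in> agree ?t y \<longleftrightarrow> ?m \<le> q"
    proof
      assume ag: "x \<in> agree ?t y"
      show "?m \<le> q"
      proof (rule ccontr)
        assume "\<not> ?m \<le> q"
        then have i: "int q - int L \<in> {0..<int y}" "int q - int L \<in> {- int 0..<int Y}" using q(3) y by auto
        have "\<omega> ?t x (int q - int L) = \<omega>m ?t x (int q - int L)" using ag i(1) by (simp add: agree_def)
        then show False using q(6)[OF i(2)] by simp
      qed
    next
      assume "?m \<le> q"
      then show "x \<in> agree ?t y" using q(6) y xs by (simp add: agree_def)
    qed
    also have "?m \<le> q \<longleftrightarrow> ?F ls x = 1" using q(5)[of ?m] by simp
    also have "\<dots> \<longleftrightarrow> x \<in> ?B"
    proof
      assume "?F ls x = 1"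
      then show "x \<in> ?B" using q(1,2) xs by blast
    next
      assume "x \<in> ?B"
      then obtain ls' where ls': "ls' \<in> words n K" "x \<in> ring_pattern L n h ls'" "?F ls' x = 1" by blast
      then have "ls' = ls" using ring_pattern_disjoint[of L n h K] q(1,2) unfolding disjoint_family_on_def by blast
      then show "?F ls x = 1" using ls'(3) by simp
    qed
    finally show ?thesis .
  qed
  have nC: "prob (space M - ?C) \<le> 1 - surv n h K + (1 - exp (- ?t)) ^ L"
    using covered(2)[OF h K, where n=n and m=0 and L=L] prob_compl[OF C] by simp
  have "prob (agree ?t y) \<le> prob (?B \<union> (space M - ?C))"
  proof (rule finite_measure_mono_AE)
    show "AE x in M. x \<in> agree ?t y \<longrightarrow> x \<in> ?B \<union> (space M - ?C)"
      using AE_good AE_space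
    proof eventually_elim
      case (elim x)
      then show ?case using key[of x] by blast
    qed
  qed (rule sets.Un[OF B sets.compl_sets[OF C]])
  also have "\<dots> \<le> prob ?B + prob (space M - ?C)" by (rule measure_Un_le[OF B sets.compl_sets[OF C]])
  finally have 1: "prob (agree ?t y) \<le> prob ?B + (1 - surv n h K + (1 - exp (- ?t)) ^ L)" using nC by simp
  have "prob ?B \<le> prob (agree ?t y \<union> (space M - ?C))"
  proof (rule finite_measure_mono_AE)
    show "AE x in M. x \<in> ?B \<longrightarrow> x \<in> agree ?t y \<union> (space M - ?C)"
      using AE_good AE_space
    proof eventually_elim
      case (elim x)
      then show ?case using key[of x] by blast
    qed
  qed (rule sets.Un[OF A sets.compl_sets[OF C]])
  also have "\<dots> \<le> prob (agree ?t y) + prob (space M - ?C)" by (rule measure_Un_le[OF A sets.compl_sets[OF C]])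
  finally have 2: "prob ?B \<le> prob (agree ?t y) + (1 - surv n h K + (1 - exp (- ?t)) ^ L)" using nC by simp
  let ?P = "pavg (replicate L (gw a) @ hw a # replicate (?m - Suc L) (gw a)) (Dsnk p 0 ?m K L) (\<lambda>_. 0)"
  have PB: "prob ?B = surv n h K * ?P" by (rule prob_passes[OF h mn p(1) chain_le])
  have "\<bar>?P - qpass p a K (?m - L)\<bar> \<le> (1 + p) ^ K / 2 ^ ?m"
    by (rule c.blocked_qpass) (use a mn in auto)
  also have "(1 + p) ^ K / 2 ^ ?m \<le> (1 + p) ^ K / 2 ^ L" using p0 by (intro divide_left_mono) auto
  finally have 3: "\<bar>?P - qpass p a K y\<bar> \<le> (1 + p) ^ K / 2 ^ L" by simp
  have s: "0 \<le> surv n h K" "surv n h K \<le> 1" using h survival_le[of "real n * h" K] by auto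
  have P: "0 \<le> ?P" "?P \<le> 1"
  proof -
    note D = Dsnk_bounds[OF p0 order_refl zero_le_one chain_le less_imp_le[OF mn(1)], of K]
    have e: "?P = expectation (\<lambda>x. Dsnk p 0 ?m K L (conf_of (window L ?m (\<omega>m 0 x))))"
      by (rule expectation_window[where B=1, symmetric]) (use D mn in auto)
    have i: "integrable M (\<lambda>x. Dsnk p 0 ?m K L (conf_of (window L ?m (\<omega>m 0 x))))"
      by (rule integrable_const_bound[of _ 1]) (use D in \<open>auto intro: measurable_compose[OF window_measurable]\<close>)
    show "0 \<le> ?P" unfolding e by (rule integral_ge_const[OF i]) (use D in simp)
    show "?P \<le> 1" unfolding e by (rule integral_le_const[OF i]) (use D in simp)
  qed
  have 4: "\<bar>surv n h K * ?P - ?P\<bar> \<le> 1 - surv n h K"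
  proof -
    have "(1 - surv n h K) * ?P \<le> (1 - surv n h K) * 1" using s P(2) by (intro mult_left_mono) auto
    moreover have "0 \<le> (1 - surv n h K) * ?P" using s P(1) by simp
    ultimately show ?thesis by (simp add: algebra_simps abs_le_iff)
  qed
  have chain: "\<bar>A - Q\<bar> \<le> 2 * (1 - s) + r + e"
    if "A \<le> B + (1 - s + r)" "B \<le> A + (1 - s + r)" "B = S" "\<bar>P - Q\<bar> \<le> e" "\<bar>S - P\<bar> \<le> 1 - s" for A B S P Q s r e :: real
    using that unfolding abs_le_iff by argo
  show ?thesis by (rule chain[OF 1 2 PB 3 4])
qed

end

section \<open>Removal of the mesh and of the barrier\<close>

lemma fine_mesh:
  assumes t: "0 < t" and e: "0 < e"
  shows "\<exists>K>0. 1 - (exp (- (real n * (t / real K))) * (1 + real n * (t / real K))) ^ K \<le> e \<and>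
    (\<exists>p. p = (t / real K) / (1 + real n * (t / real K)) \<and> 0 < p \<and> p * (real n + 1) \<le> e \<and> t - e \<le> real K * p \<and> real K * p \<le> t)"
proof -
  \<comment> \<open>Dominates the numerators of the three error terms \<open>b1\<close>,
    \<open>b2\<close> and \<open>b3\<close>, all of which have denominator \<open>K\<close>.\<close>
  define c where "c = (real n + 1)\<^sup>2 * (t\<^sup>2 + t)"
  have c0: "c > 0" using t by (simp add: c_def add_pos_pos)
  obtain K :: nat where K: "c / min e 1 < real K" using reals_Archimedean2 by blast
  have m: "0 < min e 1" using e by simp
  have K0: "0 < real K" using K c0 m divide_pos_pos[OF c0 m] by linarith
  have cK: "c / real K \<le> min e 1" using less_imp_le[OF K] unfolding pos_divide_le_eq[OF K0] pos_divide_le_eq[OF m] by (simp only: mult.commute)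
  define h where "h = t / real K"
  have h: "0 < h" "real K * h = t" using t K0 by (auto simp: h_def)
  have N: "1 \<le> real n + 1" "real n \<le> (real n + 1)\<^sup>2" "real n + 1 \<le> (real n + 1)\<^sup>2" "(real n)\<^sup>2 \<le> (real n + 1)\<^sup>2"
    by (auto simp: power2_eq_square algebra_simps)
  have b1: "(real n)\<^sup>2 * t\<^sup>2 / real K \<le> c / real K"
    unfolding c_def using t K0 N by (intro divide_right_mono mult_mono) auto
  have b2: "(real n + 1) * t / real K \<le> c / real K"
    unfolding c_def using t K0 N by (intro divide_right_mono mult_mono) auto
  have b3: "real n * t\<^sup>2 / real K \<le> c / real K"
    unfolding c_def using t K0 N by (intro divide_right_mono mult_mono) auto
  have nh: "(real n + 1) * h \<le> min e 1" using b2 cK by (simp add: h_def)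
  have nh0: "0 \<le> real n * h" using h by simp
  have nh1: "real n * h \<le> 1" using nh h(1) by (simp add: algebra_simps)
  have "real K * (real n * h)\<^sup>2 = (real n)\<^sup>2 * t\<^sup>2 / real K"
    using K0 by (simp add: h_def power2_eq_square)
  then have s: "1 - (exp (- (real n * h)) * (1 + real n * h)) ^ K \<le> e"
    using survival_ge[OF nh0 nh1, of K] b1 cK by simp
  define p where "p = h / (1 + real n * h)"
  have v: "0 < 1 + real n * h" using nh0 by simp
  have p: "0 < p" "p \<le> h" using h(1) v nh0 by (auto simp: p_def field_simps)
  have "p * (real n + 1) \<le> h * (real n + 1)" using p by (intro mult_right_mono) auto
  then have pn: "p * (real n + 1) \<le> e" using nh unfolding mult.commute[of "real n + 1" h] by linarith
  have "real K * p \<le> real K * h" using p K0 by simp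
  then have Kp: "real K * p \<le> t" using h by simp
  have "h * (1 - real n * h) * (1 + real n * h) \<le> h"
  proof -
    have "h * (1 - real n * h) * (1 + real n * h) = h - h * (real n * h)\<^sup>2" by (simp add: power2_eq_square algebra_simps)
    then show ?thesis using h by simp
  qed
  then have "h * (1 - real n * h) \<le> p" unfolding p_def pos_le_divide_eq[OF v] .
  then have "real K * (h * (1 - real n * h)) \<le> real K * p" using K0 by simp
  moreover have "real K * (h * (1 - real n * h)) = t - real n * t\<^sup>2 / real K"
  proof -
    have "real K * (h * (1 - real n * h)) = (real K * h) - real n * (real K * h) * h" by (simp add: algebra_simps)
    also have "\<dots> = t - real n * t * h" by (simp only: h(2))
    finally show ?thesis by (simp add: h_def power2_eq_square)
  qed
  ultimately have "t - e \<le> real K * p" using b3 cK by simp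
  then show ?thesis using K0 s p pn Kp unfolding h_def p_def by (intro exI[of _ K] conjI exI[of _ "t / real K / (1 + real n * (t / real K))"]) simp_all
qed

lemma power_small:
  assumes "0 \<le> r" "r < 1" "0 < (e :: real)"
  shows "\<exists>L0. \<forall>L\<ge>L0. r ^ L \<le> e"
proof -
  have "(\<lambda>L. r ^ L) \<longlonglongrightarrow> 0" using assms by (intro LIMSEQ_realpow_zero) auto
  from order_tendstoD(2)[OF this assms(3)] show ?thesis
    unfolding eventually_sequentially by (meson less_imp_le)
qed

lemma power_1p_le:
  assumes "0 \<le> p" "real K * p \<le> t" shows "(1 + p) ^ K \<le> exp t"
proof -
  have "(1 + p) ^ K \<le> exp p ^ K" using assms by (intro power_mono) auto
  also have "\<dots> = exp (real K * p)" by (simp add: exp_of_nat_mult)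
  also have "\<dots> \<le> exp t" using assms by simp
  finally show ?thesis .
qed

context coupled_tazrp begin

text \<open>The distance \<open>L\<close> to the left end is fixed first and does not depend on the
  mesh, because \<open>(1 + p) ^ K \<le> exp t\<close> for every mesh. The mesh is then refined for
  the resulting number \<open>n\<close> of bonds.\<close>

lemma bridge:
  assumes t: "0 < t" and e: "0 < e"
  shows "\<exists>K p. 0 < p \<and> p * (real Y + 1) \<le> e \<and> t - e \<le> real K * p \<and> real K * p \<le> t \<and>
    (\<forall>y\<in>{1..Y}. \<bar>prob (agree t y) - qpass p a K y\<bar> \<le> e)"
proof -
  define d where "d = min (e / 4) 1"
  have d: "0 < d" "d \<le> e / 4" "d \<le> 1" using e by (auto simp: d_def)
  obtain L1 where L1: "\<And>L. L1 \<le> L \<Longrightarrow> (1 - exp (- t)) ^ L \<le> d"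
    using power_small[of "1 - exp (- t)" d] t d by auto
  obtain L2 where L2: "\<And>L. L2 \<le> L \<Longrightarrow> (1 / 2) ^ L \<le> d / exp t"
    using power_small[of "1 / 2" "d / exp t"] d by auto
  define L where "L = max L1 L2"
  have L: "(1 - exp (- t)) ^ L \<le> d" "exp t / 2 ^ L \<le> d"
    using L1[of L] L2[of L] by (auto simp: L_def power_divide field_simps)
  define n where "n = L + Y"
  from fine_mesh[OF t d(1), of n] obtain K p where K: "0 < K"
    and s: "1 - (exp (- (real n * (t / real K))) * (1 + real n * (t / real K))) ^ K \<le> d"
    and p: "p = (t / real K) / (1 + real n * (t / real K))" "0 < p" "p * (real n + 1) \<le> d" "t - d \<le> real K * p" "real K * p \<le> t" by blast
  have h: "0 < t / real K" "real K * (t / real K) = t" using t K by auto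
  have p1: "p * (real n + 1) \<le> 1" using p(3) d by simp
  have "(1 + p) ^ K / 2 ^ L \<le> exp t / 2 ^ L" using power_1p_le[of p K t] p by (intro divide_right_mono) auto
  then have r: "(1 + p) ^ K / 2 ^ L \<le> d" using L(2) by simp
  have "\<bar>prob (agree t y) - qpass p a K y\<bar> \<le> e" if "y \<in> {1..Y}" for y
  proof -
    have y: "1 \<le> y" "y \<le> Y" using that by auto
    have le: "x \<le> e" if "x \<le> 2 * s + q + r" "s \<le> d" "q \<le> d" "r \<le> d" for x s q r :: real
      using that d by linarith
    show ?thesis by (rule le[OF prob_agree_qpass[OF h(1) K y n_def p(1) p1, unfolded h(2)] s L(1) r])
  qed
  moreover have "p * (real Y + 1) \<le> p * (real n + 1)" using p(2) by (simp add: n_def)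
  then have "p * (real Y + 1) \<le> e" using p(3) d e by linarith
  moreover have "t - e \<le> real K * p" using p(4) d e by linarith
  ultimately show ?thesis using p(2,5) by blast
qed

lemma prob_agree_le:
  assumes t: "0 < t" and y: "1 \<le> y"
  shows "prob (agree t y) \<le> 2 * exp t / 2 ^ y"
proof (rule field_le_epsilon)
  fix e :: real assume "0 < e"
  define d where "d = min e 1"
  have d: "0 < d" "d \<le> e" "d \<le> 1" using \<open>0 < e\<close> by (auto simp: d_def)
  from bridge[OF t d(1), of y] obtain K p where p: "0 < p" "p * (real y + 1) \<le> d" "real K * p \<le> t"
    and q: "\<forall>y\<in>{1..y}. \<bar>prob (agree t y) - qpass p a K y\<bar> \<le> d" by blast
  interpret c: chain p y using p d by unfold_locales auto
  have "qpass p a K y \<le> 2 * (1 + p) ^ K / 2 ^ y" using a y by (intro c.qpass_le) auto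
  also have "\<dots> \<le> 2 * exp t / 2 ^ y" using power_1p_le[of p K t] p by (intro divide_right_mono mult_left_mono) auto
  finally have "qpass p a K y \<le> 2 * exp t / 2 ^ y" .
  moreover have "\<bar>prob (agree t y) - qpass p a K y\<bar> \<le> d" using q y by simp
  ultimately show "prob (agree t y) \<le> 2 * exp t / 2 ^ y + e" using d by linarith
qed

text \<open>The value \<open>q = int Y\<close> stands for an antiparticle beyond the window: the two
  configurations then agree on all of it.\<close>

definition located :: "real \<Rightarrow> nat \<Rightarrow> nat \<Rightarrow> 'a set" where
  "located t m Y = {x \<in> space M. \<exists>q\<in>{0..int Y}. \<forall>i\<in>{- int m..<int Y}. \<omega> t x i = \<omega>m t x i + (if i = q then 1 else 0)}"

lemma located_event: "0 \<le> t \<Longrightarrow> located t m Y \<in> events"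
  unfolding located_def
  by (rule sets.sets_Collect_finite_Ex[OF _ finite_atLeastAtMost_int],
      rule sets.sets_Collect_finite_All[OF _ finite_atLeastLessThan_int],
      rule sets_Collect_count_space2[OF component_measurable(1) component_measurable(2)])

lemma AE_located:
  assumes t: "0 < t" shows "AE x in M. x \<in> located t m Y"
proof -
  have ev: "located t m Y \<in> events" using t by (intro located_event) simp
  have "1 \<le> prob (located t m Y)"
  proof (rule field_le_epsilon)
    fix e :: real assume e: "0 < e"
    obtain L1 where L1: "\<And>L. L1 \<le> L \<Longrightarrow> (1 - exp (- t)) ^ L \<le> e / 2"
      using power_small[of "1 - exp (- t)" "e / 2"] t e by auto
    define L where "L = L1 + m"
    define n where "n = L + Y"
    have e2: "0 < e / 2" using e by simp
    from fine_mesh[OF t e2, of n] obtain K where K: "0 < K"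
      and s: "1 - (exp (- (real n * (t / real K))) * (1 + real n * (t / real K))) ^ K \<le> e / 2" by blast
    have h: "0 < t / real K" "real K * (t / real K) = t" using t K by auto
    let ?C = "covered m L n (t / real K) K"
    have "AE x in M. x \<in> ?C \<longrightarrow> x \<in> located t m Y"
      using AE_good AE_space
    proof eventually_elim
      case (elim x)
      show ?case
      proof
        assume "x \<in> ?C"
        from coveredD[OF this elim(1) n_def h(1)] obtain q where q: "L \<le> q" "q \<le> n"
          "\<forall>i\<in>{- int m..<int Y}. \<omega> t x i = \<omega>m t x i + (if i = int q - int L then 1 else 0)"
          unfolding h(2) by blast
        moreover have "int q - int L \<in> {0..int Y}" using q n_def by auto
        ultimately show "x \<in> located t m Y" using elim(2) unfolding located_def by blast
      qed
    qed
    then have C1: "prob ?C \<le> prob (located t m Y)" by (rule finite_measure_mono_AE[OF _ ev])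
    have C2: "(1 - exp (- t)) ^ (L - m) \<le> e / 2" using L1[of "L - m"] by (simp add: L_def)
    have "1 \<le> y + e" if "x \<le> y" "q \<le> e / 2" "s - q \<le> x" "1 - s \<le> e / 2" for x y q s :: real
      using that by linarith
    note le = this
    show "1 \<le> prob (located t m Y) + e"
      by (rule le[OF C1 C2 covered(2)[OF h(1) K, where n=n and m=m and L=L, unfolded h(2)] s])
  qed
  then have "prob (located t m Y) = 1" using prob_le_1 by (simp add: order_antisym)
  then show ?thesis using ev by (simp add: prob_eq_1)
qed

lemma AE_not_agree:
  assumes t: "0 < t" shows "AE x in M. \<exists>y. x \<notin> agree t y"
proof -
  have ev: "agree t y \<in> events" for y using t by (intro agree_event) simp
  have I: "(\<Inter>y. agree t y) \<in> events" using ev by (intro sets.countable_INT) auto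
  have "prob (\<Inter>y. agree t y) \<le> 0"
  proof (rule field_le_epsilon)
    fix e :: real assume e: "0 < e"
    obtain L where L: "\<And>y. L \<le> y \<Longrightarrow> (1 / 2) ^ y \<le> e / (2 * exp t)"
      using power_small[of "1 / 2" "e / (2 * exp t)"] e by auto
    have "prob (\<Inter>y. agree t y) \<le> prob (agree t (Suc L))" by (rule finite_measure_mono) (use ev in auto)
    also have "\<dots> \<le> 2 * exp t / 2 ^ Suc L" by (rule prob_agree_le[OF t]) simp
    also have "\<dots> = 2 * exp t * (1 / 2) ^ Suc L" by (simp add: power_divide)
    also have "\<dots> \<le> 2 * exp t * (e / (2 * exp t))" by (intro mult_left_mono L) auto
    also have "\<dots> = 0 + e" by simp
    finally show "prob (\<Inter>y. agree t y) \<le> 0 + e" .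
  qed
  then have "prob (\<Inter>y. agree t y) = 0" by (simp add: measure_le_0_iff)
  then have "AE x in M. x \<notin> (\<Inter>y. agree t y)" using I by (simp add: prob_eq_0)
  then show ?thesis by eventually_elim blast
qed

text \<open>Once \<open>agree\<close> fails for some \<open>y\<close>, a finite window contains a
  site \<open>q\<close> with one extra particle. Every larger window has at most one such site,
  which must again be \<open>q\<close>.\<close>

lemma AE_antiparticle:
  assumes t: "0 < t"
  shows "AE x in M. \<exists>q::nat. \<omega> t x = add_config (\<omega>m t x) (single_particle (int q))"
proof -
  have "AE x in M. \<forall>m Y. x \<in> located t m Y" using AE_located[OF t] by (simp add: AE_all_countable)
  then show ?thesis using AE_not_agree[OF t]
  proof eventually_elim
    case (elim x)
    then obtain y where y: "x \<notin> agree t y" by blast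
    have loc: "\<exists>q\<in>{0..int Y}. \<forall>i\<in>{- int m..<int Y}. \<omega> t x i = \<omega>m t x i + (if i = q then 1 else 0)" for m Y
      using elim(1) by (simp add: located_def)
    have "x \<in> space M" using elim(1) by (simp add: located_def)
    obtain q where q: "q \<in> {0..int y}" "\<forall>i\<in>{- int 0..<int y}. \<omega> t x i = \<omega>m t x i + (if i = q then 1 else 0)"
      using loc[of y 0] by blast
    have qy: "q \<noteq> int y"
    proof
      assume "q = int y"
      then have "\<forall>i\<in>{0..<int y}. \<omega> t x i = \<omega>m t x i" using q(2) by simp
      then show False using y \<open>x \<in> space M\<close> by (simp add: agree_def)
    qed
    then have qi: "q \<in> {- int 0..<int y}" using q(1) by auto
    have d: "\<omega> t x q = \<omega>m t x q + 1" using q(2)[rule_format, OF qi] by simp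
    have "\<omega> t x i = \<omega>m t x i + (if i = q then 1 else 0)" for i
    proof -
      define Y where "Y = max y (nat (i + 1))"
      define m where "m = nat (- i)"
      obtain q' where q': "\<forall>i\<in>{- int m..<int Y}. \<omega> t x i = \<omega>m t x i + (if i = q' then 1 else 0)"
        using loc[of Y m] by blast
      have qm: "q \<in> {- int m..<int Y}" and im: "i \<in> {- int m..<int Y}" using qi by (auto simp: m_def Y_def)
      have "\<omega>m t x q + (if q = q' then 1 else 0) = \<omega>m t x q + 1"
        by (rule trans[OF sym[OF q'[rule_format, OF qm]] d])
      then have "q = q'" by (simp split: if_splits)
      then show ?thesis using q'[rule_format, OF im] by simp
    qed
    then have "\<omega> t x = add_config (\<omega>m t x) (single_particle (int (nat q)))"
      using q(1) by (auto simp: add_config_def single_particle_def fun_eq_iff)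
    then show ?case by blast
  qed
qed

abbreviation "Q t x \<equiv> antiparticle \<omega>m \<omega> t x"

lemma Q_eqI: "\<omega> t x = add_config (\<omega>m t x) (single_particle q) \<Longrightarrow> Q t x = q"
  by (rule antiparticle_eqI[where \<eta>=\<omega>m and \<omega>=\<omega> and t=t and x=x])

lemma AE_Q:
  assumes t: "0 < t"
  shows "AE x in M. 0 \<le> Q t x \<and> (\<forall>y. x \<in> agree t y \<longleftrightarrow> int y \<le> Q t x)"
  using AE_antiparticle[OF t] AE_space
proof eventually_elim
  case (elim x)
  then obtain q :: nat where q: "\<omega> t x = add_config (\<omega>m t x) (single_particle (int q))" by blast
  have Q: "Q t x = int q" by (rule Q_eqI[OF q])
  have c: "\<omega> t x i = \<omega>m t x i + (if i = int q then 1 else 0)" for i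
    unfolding q by (simp add: add_config_def single_particle_def)
  have "x \<in> agree t y \<longleftrightarrow> y \<le> q" for y
  proof -
    have "x \<in> agree t y \<longleftrightarrow> (\<forall>i\<in>{0..<int y}. i \<noteq> int q)" using elim(2) c by (simp add: agree_def)
    also have "\<dots> \<longleftrightarrow> y \<le> q" by (metis atLeastLessThan_iff linorder_not_less of_nat_0_le_iff of_nat_less_iff)
    finally show ?thesis .
  qed
  then show ?case unfolding Q by simp
qed

lemma Q_measurable:
  assumes t: "0 < t" shows "Q t \<in> measurable M (count_space UNIV)"
proof -
  define D where "D q = {x \<in> space M. \<forall>i. \<omega> t x i = \<omega>m t x i + single_particle q i}" for q
  have D: "D q \<in> events" for q
    unfolding D_def
    by (rule sets.sets_Collect_countable_All, rule sets_Collect_count_space2[OF component_measurable(1) component_measurable(2)])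
      (use t in auto)
  have mem: "x \<in> D q \<longleftrightarrow> \<omega> t x = add_config (\<omega>m t x) (single_particle q)" if "x \<in> space M" for x q
    using that by (auto simp: D_def add_config_def fun_eq_iff)
  \<comment> \<open>The constant to which \<open>antiparticle\<close> reduces when no site
    qualifies.\<close>
  define c where "c = (THE q :: int. False)"
  have "Q t -` {q} \<inter> space M = D q \<union> (if q = c then space M - (\<Union>q. D q) else {})" for q
  proof (intro equalityI subsetI)
    fix x assume x: "x \<in> Q t -` {q} \<inter> space M"
    show "x \<in> D q \<union> (if q = c then space M - (\<Union>q. D q) else {})"
    proof (cases "\<exists>q'. x \<in> D q'")
      case True
      then obtain q' where "x \<in> D q'" by blast
      then have "Q t x = q'" using Q_eqI[of t x q'] mem[of x q'] x by simp
      then show ?thesis using x \<open>x \<in> D q'\<close> by simp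
    next
      case False
      then have "\<omega> t x \<noteq> add_config (\<omega>m t x) (single_particle q')" for q' using mem[of x q'] x by simp
      then have "Q t x = c" by (simp add: antiparticle_def c_def)
      then show ?thesis using x False by simp
    qed
  next
    fix x assume x: "x \<in> D q \<union> (if q = c then space M - (\<Union>q. D q) else {})"
    then have xs: "x \<in> space M" by (auto simp: D_def split: if_splits)
    show "x \<in> Q t -` {q} \<inter> space M"
    proof (cases "x \<in> D q")
      case True
      then have "Q t x = q" using Q_eqI[of t x q] mem[of x q] xs by simp
      then show ?thesis using xs by simp
    next
      case False
      then have qc: "q = c" and "x \<notin> (\<Union>q. D q)" using x by (auto split: if_splits)
      then have "\<omega> t x \<noteq> add_config (\<omega>m t x) (single_particle q')" for q' using mem[of x q'] xs by blast
      then have "Q t x = c" by (simp add: antiparticle_def c_def)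
      then show ?thesis using xs qc by simp
    qed
  qed
  moreover have "D q \<union> (if q = c then space M - (\<Union>q. D q) else {}) \<in> events" for q
    using D by (auto intro!: sets.Un sets.compl_sets sets.countable_UN)
  ultimately show ?thesis by (subst measurable_count_space_eq2_countable) auto
qed

end

section \<open>Tails and moments of the antiparticle\<close>

text \<open>The mesh loses at most \<open>1\<close> of the time \<open>l ^ 3\<close>, and this
  lowers the cube root by at most \<open>1\<close>.\<close>

lemma cube_root_ge:
  assumes "1 \<le> l" "0 \<le> L" "l ^ 3 - 1 \<le> L ^ 3"
  shows "l - 1 \<le> (L :: real)"
proof (rule ccontr)
  assume "\<not> l - 1 \<le> L"
  then have "L ^ 3 < (l - 1) ^ 3" using assms by (intro power_strict_mono) auto
  also have "(l - 1) ^ 3 = l ^ 3 - 1 - 3 * l * (l - 1)" by (simp add: power3_eq_cube algebra_simps)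
  also have "\<dots> \<le> l ^ 3 - 1" using assms by simp
  finally show False using assms by simp
qed

context coupled_tazrp begin

section \<open>Passage bounds in continuous time\<close>

definition V where "V = (1 - a)\<^sup>2"

lemma V: "0 < V" "V \<le> 1"
  using a(1,2) by (auto simp: V_def power_le_one)

lemma critical_chain_floor:
  assumes p: "0 < p" "p * (real NN + 1) \<le> 1" and L: "real K * p = L ^ 3" "6 / min a (1 - a) \<le> L" and NN: "NN = nat \<lfloor>V * L ^ 3\<rfloor>"
  shows "critical_chain p NN a K L"
proof
  have "0 \<le> real K * p" using p by simp
  then have "0 \<le> V * L ^ 3" using V L by simp
  then show "\<bar>(1 - a)\<^sup>2 * L ^ 3 - real NN\<bar> \<le> 3" unfolding NN V_def by linarith
qed (use p L a in auto)

lemma tail_const_pos: "0 < tail_const a"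
proof -
  have "0 \<le> 8 * (3 * a / (1 - a)\<^sup>2 + 6 * a * exp (2 * (36 / (1 - a)\<^sup>2) / a)) + 4194304 / (1 - a) ^ 4"
    using a(1,2) by (intro add_nonneg_nonneg mult_nonneg_nonneg divide_nonneg_nonneg) auto
  then show ?thesis by (simp add: tail_const_def)
qed

text \<open>The added \<open>2\<close> pays for the loss of \<open>1\<close> between
  \<open>l\<close> and \<open>L\<close> and keeps \<open>l\<close> at least
  \<open>2\<close>.\<close>

definition l0 where "l0 = 6 / min a (1 - a) + 2"

lemma l0: "2 \<le> l0"
proof -
  have "0 < min a (1 - a)" using a by simp
  then have "0 \<le> 6 / min a (1 - a)" by simp
  then show ?thesis by (simp add: l0_def)
qed

text \<open>The error of \<open>bridge\<close> is incurred once for each of the \<open>n\<close>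
  positions, hence the division by \<open>real n + 1\<close> in \<open>e\<close>. The range
  \<open>Y\<close> is large enough to contain the critical length \<open>NN\<close>.\<close>

lemma sum_passed_left:
  assumes l: "l0 \<le> l" and u: "u = V * l ^ 3 - real n" "2 * l\<^sup>2 \<le> u"
  shows "(\<Sum>m\<in>{1..n}. 1 - prob (agree (l ^ 3) m)) \<le> (32 * tail_const a + 1) * (l ^ 8 / u ^ 3)"
proof -
  have l2: "2 \<le> l" using l l0 by simp
  have lsq: "1 \<le> l\<^sup>2" using l2 by simp
  have u0: "0 < u" "2 \<le> u" using u(2) lsq by auto
  define e where "e = min 1 (l ^ 8 / u ^ 3 / (real n + 1))"
  have e: "0 < e" "e \<le> 1" "e * (real n + 1) \<le> l ^ 8 / u ^ 3"
  proof -
    show "0 < e" "e \<le> 1" using l2 u0 by (auto simp: e_def)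
    have "e * (real n + 1) \<le> l ^ 8 / u ^ 3 / (real n + 1) * (real n + 1)" by (intro mult_right_mono) (auto simp: e_def)
    then show "e * (real n + 1) \<le> l ^ 8 / u ^ 3" by simp
  qed
  have t: "0 < l ^ 3" using l2 by simp
  define Y where "Y = nat \<lceil>l ^ 3\<rceil>"
  have Y: "l ^ 3 \<le> real Y" unfolding Y_def by linarith
  from bridge[OF t e(1), of Y] obtain K p where p: "0 < p" "p * (real Y + 1) \<le> e" "l ^ 3 - e \<le> real K * p" "real K * p \<le> l ^ 3"
    and q: "\<forall>y\<in>{1..Y}. \<bar>prob (agree (l ^ 3) y) - qpass p a K y\<bar> \<le> e" by blast
  define L where "L = root 3 (real K * p)"
  have L3: "L ^ 3 = real K * p" unfolding L_def using p by (intro real_root_pow_pos2) auto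
  have L0: "0 \<le> L" using p by (simp add: L_def)
  have L1: "l - 1 \<le> L" by (rule cube_root_ge) (use l2 L0 L3 p e in auto)
  have Ll: "L \<le> l"
  proof (rule ccontr)
    assume "\<not> L \<le> l"
    then have "l ^ 3 < L ^ 3" using l2 by (intro power_strict_mono) auto
    then show False using L3 p by simp
  qed
  define u' where "u' = V * L ^ 3 - real n"
  have "V * (l ^ 3 - L ^ 3) \<le> 1 * (l ^ 3 - L ^ 3)" using V L3 p by (intro mult_right_mono) auto
  then have u': "u / 2 \<le> u'" using u L3 p e u0 by (simp add: u'_def algebra_simps)
  define NN where "NN = nat \<lfloor>V * L ^ 3\<rfloor>"
  have nN: "n \<le> NN" using u' u0 by (simp add: NN_def u'_def le_nat_floor)
  have "V * L ^ 3 \<le> 1 * l ^ 3" using V L0 Ll by (intro mult_mono power_mono) auto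
  then have NY: "NN \<le> Y" using Y V L0 unfolding NN_def by linarith
  have pN: "p * (real NN + 1) \<le> 1"
  proof -
    have "p * (real NN + 1) \<le> p * (real Y + 1)" using p NY by simp
    then show ?thesis using p e by linarith
  qed
  have crit: "critical_chain p NN a K L"
    by (rule critical_chain_floor[OF p(1) pN L3[symmetric] _ NN_def]) (use L1 l in \<open>simp add: l0_def\<close>)
  have "L\<^sup>2 \<le> l\<^sup>2" using L0 Ll by (intro power_mono) auto
  then have Lu: "L\<^sup>2 \<le> u'" using u(2) u' by linarith
  have "qsum p a K n \<le> 4 * tail_const a * (L ^ 8 / u' ^ 3)"
    by (rule qsum_left[OF crit nN _ Lu]) (simp add: u'_def V_def)
  also have "L ^ 8 / u' ^ 3 \<le> l ^ 8 / (u / 2) ^ 3"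
    using L0 Ll u' u0 l2 by (intro frac_le power_mono) auto
  also have "l ^ 8 / (u / 2) ^ 3 = 8 * (l ^ 8 / u ^ 3)" by (simp add: power_divide)
  finally have Q: "qsum p a K n \<le> 32 * tail_const a * (l ^ 8 / u ^ 3)" using tail_const_pos by simp
  have "(\<Sum>m\<in>{1..n}. 1 - prob (agree (l ^ 3) m)) \<le> (\<Sum>m\<in>{1..n}. (1 - qpass p a K m) + e)"
  proof (rule sum_mono)
    fix m assume "m \<in> {1..n}"
    then have "m \<in> {1..Y}" using nN NY by simp
    then show "1 - prob (agree (l ^ 3) m) \<le> (1 - qpass p a K m) + e" using q[rule_format, of m] by linarith
  qed
  also have "\<dots> = qsum p a K n + real n * e" by (simp add: qsum_def sum.distrib)
  also have "real n * e \<le> e * (real n + 1)" using e by (simp add: algebra_simps)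
  finally show ?thesis using Q e(3) unfolding distrib_right by linarith
qed

text \<open>\<open>qsum_right\<close> bounds a sum over times. The chain is run for \<open>D\<close>
  further steps, an additional time between \<open>u / 4\<close> and \<open>u / 2\<close>, after
  which the length still exceeds the critical one by at least \<open>u / 2\<close>. Passage
  probabilities increase in time, so each of the \<open>D\<close> last terms is at least
  \<open>qpass p a K n\<close>; this gains the factor \<open>1 / u\<close>.\<close>

lemma prob_passed_right:
  assumes l: "l0 \<le> l" and u: "u = real n - V * l ^ 3" "4 * l\<^sup>2 \<le> u" "u \<le> a / 2 * l ^ 3"
  shows "prob (agree (l ^ 3) n) \<le> (2048 * tail_const a + 1) * (l ^ 8 / u ^ 4)"
proof -
  have l2: "2 \<le> l" using l l0 by simp
  have lsq: "2 * 2 \<le> l\<^sup>2" unfolding power2_eq_square using l2 by (intro mult_mono) auto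
  have u0: "0 < u" "8 \<le> u" using u(2) lsq by auto
  have l3: "0 < l ^ 3" using l2 by simp
  have n1: "1 \<le> n"
  proof -
    have "0 \<le> V * l ^ 3" using V l3 by simp
    then have "0 < real n" using u(1) u0 by linarith
    then show ?thesis by simp
  qed
  define e where "e = min 1 (l ^ 8 / u ^ 4)"
  have e: "0 < e" "e \<le> 1" "e \<le> l ^ 8 / u ^ 4" using l2 u0 by (auto simp: e_def)
  from bridge[OF l3 e(1), of n] obtain K p where p: "0 < p" "p * (real n + 1) \<le> e" "l ^ 3 - e \<le> real K * p" "real K * p \<le> l ^ 3"
    and q: "\<forall>y\<in>{1..n}. \<bar>prob (agree (l ^ 3) y) - qpass p a K y\<bar> \<le> e" by blast
  have p1: "p \<le> 1"
  proof -
    have "p * 1 \<le> p * (real n + 1)" using p by (intro mult_left_mono) auto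
    then show ?thesis using p e by linarith
  qed
  have pn: "p * (real n + 1) \<le> 1" using p e by linarith
  define D where "D = nat \<lfloor>u / (2 * p)\<rfloor>"
  have "0 \<le> u / (2 * p)" using u0 p by simp
  then have "real D \<le> u / (2 * p)" "u / (2 * p) < real D + 1" unfolding D_def by linarith+
  then have "real D * p \<le> u / (2 * p) * p" "u / (2 * p) * p \<le> (real D + 1) * p"
    using p(1) by (intro mult_right_mono; linarith)+
  moreover have "u / (2 * p) * p = u / 2" using p by simp
  ultimately have D: "real D * p \<le> u / 2" "u / 4 \<le> real D * p" using p1 u0 by (auto simp: algebra_simps)
  define T where "T = real (K + D) * p"
  have T: "l ^ 3 \<le> T" "T \<le> l ^ 3 + u / 2" using D p e u0 by (auto simp: T_def algebra_simps)
  have "a / 2 * l ^ 3 \<le> 2 * l ^ 3" using a l3 by (intro mult_right_mono) auto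
  then have T2: "T \<le> 2 * l ^ 3" using T u(3) by linarith
  define L where "L = root 3 T"
  have T0: "0 \<le> T" using T l3 by linarith
  have L3: "L ^ 3 = T" unfolding L_def using T0 by (intro real_root_pow_pos2) auto
  have L0: "0 \<le> L" using T0 by (simp add: L_def)
  have L1: "l - 1 \<le> L" by (rule cube_root_ge) (use l2 L0 L3 T in auto)
  have L2: "L\<^sup>2 \<le> 2 * l\<^sup>2"
  proof (rule ccontr)
    assume "\<not> L\<^sup>2 \<le> 2 * l\<^sup>2"
    then have "(2 * l\<^sup>2) ^ 3 < (L\<^sup>2) ^ 3" by (intro power_strict_mono) auto
    also have "(L\<^sup>2) ^ 3 = (L ^ 3)\<^sup>2" by (simp flip: power_mult)
    also have "\<dots> \<le> (2 * l ^ 3)\<^sup>2" using T2 T0 L3 by (intro power_mono) auto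
    also have "\<dots> = 4 * (l\<^sup>2) ^ 3" by (simp add: power_mult_distrib flip: power_mult)
    finally have "8 * (l\<^sup>2) ^ 3 < 4 * (l\<^sup>2) ^ 3" by (simp add: power_mult_distrib)
    moreover have "0 \<le> (l\<^sup>2) ^ 3" by simp
    ultimately show False by linarith
  qed
  have L8: "L ^ 8 \<le> 16 * l ^ 8"
  proof -
    have "L ^ 8 = (L\<^sup>2) ^ 4" by (simp flip: power_mult)
    also have "\<dots> \<le> (2 * l\<^sup>2) ^ 4" using L2 by (intro power_mono) auto
    also have "\<dots> = 16 * l ^ 8" by (simp add: power_mult_distrib flip: power_mult)
    finally show ?thesis .
  qed
  define u' where "u' = real n - V * L ^ 3"
  have "V * (T - l ^ 3) \<le> 1 * (T - l ^ 3)" "0 \<le> V * (T - l ^ 3)" using V T by (intro mult_right_mono mult_nonneg_nonneg; simp)+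
  then have u': "u / 2 \<le> u'" "u' \<le> u" using u(1) T by (auto simp: u'_def L3 algebra_simps)
  define NN where "NN = nat \<lfloor>V * L ^ 3\<rfloor>"
  have "V * L ^ 3 \<le> real n" using u' u0 by (simp add: u'_def)
  then have Nn: "NN \<le> n" unfolding NN_def by linarith
  have pN: "p * (real NN + 1) \<le> 1"
  proof -
    have "p * (real NN + 1) \<le> p * (real n + 1)" using p Nn by simp
    then show ?thesis using pn by linarith
  qed
  have crit: "critical_chain p NN a (K + D) L"
    by (rule critical_chain_floor[OF p(1) pN _ _ NN_def]) (use L1 L3 l in \<open>auto simp: l0_def T_def\<close>)
  have Lu: "L\<^sup>2 \<le> u'" using L2 u(2) u' by linarith
  have "a / 2 * l ^ 3 \<le> a * L ^ 3" unfolding L3 using a T l3 by (intro mult_mono) auto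
  then have ua: "u' \<le> a * L ^ 3" using u(3) u' by linarith
  have "p * (\<Sum>s<K + D. qpass p a s n) \<le> 4 * tail_const a * (L ^ 8 / u' ^ 3)"
    by (rule qsum_right[OF crit Nn pn _ Lu ua]) (simp add: u'_def V_def)
  also have "L ^ 8 / u' ^ 3 \<le> (16 * l ^ 8) / (u / 2) ^ 3"
    using L8 u' u0 by (intro frac_le power_mono) auto
  also have "(16 * l ^ 8) / (u / 2) ^ 3 = 128 * (l ^ 8 / u ^ 3)" by (simp add: power_divide)
  finally have R: "p * (\<Sum>s<K + D. qpass p a s n) \<le> 512 * tail_const a * (l ^ 8 / u ^ 3)" using tail_const_pos by simp
  interpret c: chain p n using p pn by unfold_locales auto
  have qb: "0 \<le> qpass p a s n" for s using a n1 by (intro c.qpass_bounds) auto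
  have "real D * qpass p a K n = (\<Sum>s\<in>{K..<K + D}. qpass p a K n)" by simp
  also have "\<dots> \<le> (\<Sum>s\<in>{K..<K + D}. qpass p a s n)"
    using a n1 by (intro sum_mono c.qpass_time_mono) auto
  also have "\<dots> \<le> (\<Sum>s<K + D. qpass p a s n)" using qb by (intro sum_mono2) auto
  finally have "p * (real D * qpass p a K n) \<le> 512 * tail_const a * (l ^ 8 / u ^ 3)"
    using R mult_left_mono[of "real D * qpass p a K n" "\<Sum>s<K + D. qpass p a s n" p] p by linarith
  moreover have "u / 4 * qpass p a K n \<le> (real D * p) * qpass p a K n" using D(2) qb by (intro mult_right_mono)
  moreover have "(real D * p) * qpass p a K n = p * (real D * qpass p a K n)" by simp
  ultimately have "u / 4 * qpass p a K n \<le> 512 * tail_const a * (l ^ 8 / u ^ 3)" by linarith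
  then have "(u / 4 * qpass p a K n) * (4 / u) \<le> (512 * tail_const a * (l ^ 8 / u ^ 3)) * (4 / u)"
    using u0 by (intro mult_right_mono) auto
  also have "(512 * tail_const a * (l ^ 8 / u ^ 3)) * (4 / u) = 2048 * tail_const a * (l ^ 8 / u ^ 4)"
    by (simp add: power4_eq_xxxx power3_eq_cube)
  also have "(u / 4 * qpass p a K n) * (4 / u) = qpass p a K n" using u0 by simp
  finally have "qpass p a K n \<le> 2048 * tail_const a * (l ^ 8 / u ^ 4)" .
  moreover have "prob (agree (l ^ 3) n) \<le> qpass p a K n + e" using q[rule_format, of n] n1 by simp
  ultimately show ?thesis using e(3) unfolding distrib_right by linarith
qed

lemma sum_passed_ge:
  shows "\<exists>c>0. \<exists>l1. \<forall>l\<ge>l1. \<exists>n. real n \<le> V * l ^ 3 \<and> c * l\<^sup>2 \<le> (\<Sum>m\<in>{1..n}. 1 - prob (agree (l ^ 3) m))"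
proof -
  define c where "c = (1 - a)\<^sup>2 * a / (8192 * (2 * exp (4 * (36 / (1 - a)\<^sup>2) / a)))"
  have c0: "0 < c" using a(1,2) by (simp add: c_def)
  define l1 where "l1 = max l0 (max (2 / V) (32 / c))"
  have "\<exists>n. real n \<le> V * l ^ 3 \<and> c / 8 * l\<^sup>2 \<le> (\<Sum>m\<in>{1..n}. 1 - prob (agree (l ^ 3) m))" if l: "l1 \<le> l" for l
  proof -
    have l2: "2 \<le> l" "l0 \<le> l" "2 / V \<le> l" "32 / c \<le> l" using l l0 by (auto simp: l1_def)
    have l3: "0 < l ^ 3" using l2 by simp
    have lsq: "l \<le> l\<^sup>2" "l \<le> l ^ 3" using l2 self_le_power[of l 2] self_le_power[of l 3] by auto
    have Vl: "2 \<le> V * l ^ 3"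
    proof -
      have "2 = V * (2 / V)" using V by simp
      also have "\<dots> \<le> V * l ^ 3" using l2(3) lsq(2) V by (intro mult_left_mono) auto
      finally show ?thesis .
    qed
    \<comment> \<open>One below the floor, so that the length stays below the critical one also for
      the slightly shorter time \<open>L ^ 3\<close>.\<close>
    define n where "n = nat \<lfloor>V * l ^ 3\<rfloor> - 1"
    have n: "real n \<le> V * l ^ 3 - 1" "V * l ^ 3 - 2 \<le> real n" using Vl unfolding n_def by linarith+
    \<comment> \<open>The first bound secures \<open>p * L \<le> 1 / 32\<close>; the second keeps
      the error accumulated over \<open>n\<close> positions below \<open>1\<close>.\<close>
    define e where "e = min (1 / (32 * l)) (1 / (real n + 1))"
    have e: "0 < e" "e * l \<le> 1 / 32" "e \<le> 1" "e * (real n + 1) \<le> 1"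
    proof -
      show "0 < e" using l2 by (simp add: e_def)
      have "e * l \<le> 1 / (32 * l) * l" using l2 by (intro mult_right_mono) (auto simp: e_def)
      then show "e * l \<le> 1 / 32" using l2 by simp
      have "e * (real n + 1) \<le> 1 / (real n + 1) * (real n + 1)" by (intro mult_right_mono) (auto simp: e_def)
      then show "e * (real n + 1) \<le> 1" by simp
      have "1 / (real n + 1) \<le> 1" by simp
      then show "e \<le> 1" unfolding e_def by linarith
    qed
    define Y where "Y = nat \<lceil>l ^ 3\<rceil>"
    have Y: "l ^ 3 \<le> real Y" unfolding Y_def by linarith
    from bridge[OF l3 e(1), of Y] obtain K p where p: "0 < p" "p * (real Y + 1) \<le> e" "l ^ 3 - e \<le> real K * p" "real K * p \<le> l ^ 3"
      and q: "\<forall>y\<in>{1..Y}. \<bar>prob (agree (l ^ 3) y) - qpass p a K y\<bar> \<le> e" by blast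
    have "p * 1 \<le> p * (real Y + 1)" using p by (intro mult_left_mono) auto
    then have pe: "p \<le> e" using p by linarith
    define L where "L = root 3 (real K * p)"
    have L3: "L ^ 3 = real K * p" unfolding L_def using p by (intro real_root_pow_pos2) auto
    have L0: "0 \<le> L" using p by (simp add: L_def)
    have L1: "l - 1 \<le> L" by (rule cube_root_ge) (use l2 L0 L3 p e in auto)
    have Ll: "L \<le> l"
    proof (rule ccontr)
      assume "\<not> L \<le> l"
      then have "l ^ 3 < L ^ 3" using l2 by (intro power_strict_mono) auto
      then show False using L3 p by simp
    qed
    have VL: "V * L ^ 3 \<le> V * l ^ 3" "V * l ^ 3 - 1 \<le> V * L ^ 3"
    proof -
      show "V * L ^ 3 \<le> V * l ^ 3" using V L0 Ll by (intro mult_left_mono power_mono) auto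
      have "V * (l ^ 3 - L ^ 3) \<le> 1 * 1" using V L3 p e by (intro mult_mono) auto
      then show "V * l ^ 3 - 1 \<le> V * L ^ 3" by (simp add: algebra_simps)
    qed
    have "V * l ^ 3 \<le> 1 * l ^ 3" using V l3 by (intro mult_right_mono) auto
    then have nY: "n \<le> Y" using n Y by linarith
    have pn: "p * (real n + 1) \<le> 1"
    proof -
      have "p * (real n + 1) \<le> p * (real Y + 1)" using p nY by simp
      then show ?thesis using p e by linarith
    qed
    interpret c: critical_chain p n a K L
    proof
      show "\<bar>(1 - a)\<^sup>2 * L ^ 3 - real n\<bar> \<le> 3" using n VL unfolding V_def[symmetric] by linarith
      show "6 / min a (1 - a) \<le> L" using L1 l2 by (simp add: l0_def)
    qed (use p pn a L3 in auto)
    have pL: "p * L \<le> 1 / 32"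
    proof -
      have "p * L \<le> e * l" using pe Ll L0 p l2 e by (intro mult_mono) auto
      then show ?thesis using e by linarith
    qed
    have "real n \<le> (1 - a)\<^sup>2 * L ^ 3" using n VL unfolding V_def[symmetric] by linarith
    from c.qsum_lower[OF this pL] have Q: "c * L\<^sup>2 - 3 \<le> qsum p a K n" by (simp add: c_def)
    have "(l / 2)\<^sup>2 \<le> L\<^sup>2" using L1 l2 by (intro power_mono) auto
    then have "c * (l / 2)\<^sup>2 \<le> c * L\<^sup>2" using c0 by simp
    then have cl: "c / 4 * l\<^sup>2 \<le> c * L\<^sup>2" by (simp add: power_divide)
    have "32 \<le> c * l" using l2(4) c0 by (simp add: pos_divide_le_eq mult.commute)
    also have "c * l \<le> c * l\<^sup>2" using c0 lsq by simp
    finally have cl2: "32 \<le> c * l\<^sup>2" .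
    have "qsum p a K n = (\<Sum>m\<in>{1..n}. 1 - qpass p a K m)" by (simp add: qsum_def)
    also have "\<dots> \<le> (\<Sum>m\<in>{1..n}. (1 - prob (agree (l ^ 3) m)) + e)"
    proof (rule sum_mono)
      fix m assume "m \<in> {1..n}"
      then have "m \<in> {1..Y}" using nY by simp
      then show "1 - qpass p a K m \<le> (1 - prob (agree (l ^ 3) m)) + e" using q[rule_format, of m] by linarith
    qed
    also have "\<dots> = (\<Sum>m\<in>{1..n}. 1 - prob (agree (l ^ 3) m)) + real n * e" by (simp add: sum.distrib)
    also have "real n * e \<le> 1" using e by (simp add: algebra_simps)
    finally have "c / 8 * l\<^sup>2 \<le> (\<Sum>m\<in>{1..n}. 1 - prob (agree (l ^ 3) m))" using Q cl cl2 by simp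
    then show ?thesis using n by (intro exI[of _ n]) simp
  qed
  then show ?thesis using c0 by (intro exI[of _ "c / 8"] conjI exI[of _ l1]) auto
qed

end

section \<open>Moments from tails\<close>

lemma exp_quarter_bound:
  assumes "0 < (w :: real)" shows "exp (- (w / 4)) \<le> 65536 / w ^ 4"
proof -
  have "(w / 16) ^ 4 \<le> (1 + w / 4 / real 4) ^ 4" using assms by (intro power_mono) auto
  also have "\<dots> \<le> exp (w / 4)" using assms by (intro exp_ge_one_plus_x_over_n_power_n) auto
  finally have "w ^ 4 / 65536 \<le> exp (w / 4)" by (simp add: power_divide)
  then have "1 / exp (w / 4) \<le> 1 / (w ^ 4 / 65536)" using assms by (intro divide_left_mono) auto
  then show ?thesis by (simp add: exp_minus inverse_eq_divide)
qed

context prob_space begin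

text \<open>A layer-cake sum: \<open>?d k\<close> is the difference of consecutive cubes, of order
  \<open>(real k)\<^sup>2\<close>, so a tail with exponent four leaves a convergent series of
  inverse squares.\<close>

lemma third_moment_le:
  fixes Z :: "'a \<Rightarrow> real"
  assumes Z: "Z \<in> borel_measurable M" "\<And>x. 0 \<le> Z x"
    and C: "1 \<le> C" "\<And>k::nat. 1 \<le> k \<Longrightarrow> prob {x \<in> space M. real k \<le> Z x} \<le> C / real k ^ 4"
  shows "integrable M (\<lambda>x. Z x ^ 3)" "expectation (\<lambda>x. Z x ^ 3) \<le> 112 * C * (\<Sum>k. 1 / (real k + 1)\<^sup>2)"
proof -
  note [measurable] = Z(1)
  let ?S = "\<Sum>k. 1 / (real k + 1)\<^sup>2"
  let ?d = "\<lambda>k::nat. 3 * (real k)\<^sup>2 + 3 * real k + 1"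
  have sm: "summable (\<lambda>k. 1 / (real k + 1)\<^sup>2)" using sums_summable[OF inverse_squares_sums] by (simp add: add.commute)
  have pt: "ennreal (Z x ^ 3) \<le> (\<Sum>k. ennreal (?d k) * indicator {x \<in> space M. real k \<le> Z x} x)" if x: "x \<in> space M" for x
  proof -
    define n where "n = Suc (nat \<lfloor>Z x\<rfloor>)"
    have n: "Z x \<le> real n" unfolding n_def by linarith
    have cube: "(\<Sum>k<n. ?d k) = real n ^ 3" for n
      by (induction n) (simp_all add: power3_eq_cube power2_eq_square algebra_simps)
    have "ennreal (Z x ^ 3) \<le> ennreal (real n ^ 3)" using n Z(2)[of x] by (intro ennreal_leI power_mono) auto
    also have "\<dots> = (\<Sum>k<n. ennreal (?d k))" unfolding cube[symmetric] by (rule sum_ennreal[symmetric]) simp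
    also have "\<dots> = (\<Sum>k<n. ennreal (?d k) * indicator {x \<in> space M. real k \<le> Z x} x)"
    proof (rule sum.cong)
      fix k assume "k \<in> {..<n}"
      then have "k \<le> nat \<lfloor>Z x\<rfloor>" by (simp add: n_def)
      then have "real k \<le> Z x" using Z(2)[of x] by linarith
      then show "ennreal (?d k) = ennreal (?d k) * indicator {x \<in> space M. real k \<le> Z x} x" using x by simp
    qed simp
    also have "\<dots> \<le> (\<Sum>k. ennreal (?d k) * indicator {x \<in> space M. real k \<le> Z x} x)"
      by (rule sum_le_suminf) auto
    finally show ?thesis .
  qed
  have trm: "ennreal (?d k) * emeasure M {x \<in> space M. real k \<le> Z x} \<le> ennreal (112 * C * (1 / (real k + 1)\<^sup>2))" for k
  proof -
    have "?d k * prob {x \<in> space M. real k \<le> Z x} \<le> 112 * C * (1 / (real k + 1)\<^sup>2)"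
    proof (cases "k = 0")
      case True
      have "prob {x \<in> space M. 0 \<le> Z x} \<le> 112 * C" by (rule order_trans[OF prob_le_1]) (use C(1) in simp)
      then show ?thesis using True by simp
    next
      case False
      then have k: "1 \<le> real k" "1 \<le> k" by auto
      have "?d k \<le> 7 * (real k)\<^sup>2"
      proof -
        have "real k * 1 \<le> real k * real k" "1 * 1 \<le> real k * real k" using k(1) mult_mono[of 1 "real k" 1 "real k"] by simp_all
        then show ?thesis unfolding power2_eq_square by linarith
      qed
      then have "?d k * prob {x \<in> space M. real k \<le> Z x} \<le> (7 * (real k)\<^sup>2) * (C / real k ^ 4)"
        using C(2)[OF k(2)] by (intro mult_mono) auto
      also have "\<dots> = 7 * C / (real k)\<^sup>2" using k by (simp add: power4_eq_xxxx power2_eq_square)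
      also have "\<dots> \<le> 7 * C / ((real k + 1) / 2)\<^sup>2" using k C(1) by (intro divide_left_mono power_mono) auto
      also have "\<dots> = 28 * C * (1 / (real k + 1)\<^sup>2)" by (simp add: power_divide)
      also have "\<dots> \<le> 112 * C * (1 / (real k + 1)\<^sup>2)" using C(1) by (intro mult_right_mono) auto
      finally show ?thesis .
    qed
    moreover have "ennreal (?d k) * ennreal (prob {x \<in> space M. real k \<le> Z x}) = ennreal (?d k * prob {x \<in> space M. real k \<le> Z x})"
      by (rule ennreal_mult[symmetric]) auto
    ultimately show ?thesis unfolding emeasure_eq_measure by (simp only: ennreal_leI)
  qed
  have "(\<integral>\<^sup>+x. ennreal (Z x ^ 3) \<partial>M) \<le> (\<integral>\<^sup>+x. (\<Sum>k. ennreal (?d k) * indicator {x \<in> space M. real k \<le> Z x} x) \<partial>M)"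
    by (rule nn_integral_mono[OF pt])
  also have "\<dots> = (\<Sum>k. \<integral>\<^sup>+x. ennreal (?d k) * indicator {x \<in> space M. real k \<le> Z x} x \<partial>M)"
    by (rule nn_integral_suminf) measurable
  also have "\<dots> = (\<Sum>k. ennreal (?d k) * emeasure M {x \<in> space M. real k \<le> Z x})"
    by (subst nn_integral_cmult_indicator) auto
  also have "\<dots> \<le> (\<Sum>k. ennreal (112 * C * (1 / (real k + 1)\<^sup>2)))"
    by (intro suminf_le trm) auto
  also have "\<dots> = ennreal (\<Sum>k. 112 * C * (1 / (real k + 1)\<^sup>2))"
    using C(1) by (intro suminf_ennreal2 summable_mult sm) auto
  also have "(\<Sum>k. 112 * C * (1 / (real k + 1)\<^sup>2)) = 112 * C * ?S" by (rule suminf_mult[OF sm])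
  finally have le: "(\<integral>\<^sup>+x. ennreal (Z x ^ 3) \<partial>M) \<le> ennreal (112 * C * ?S)" .
  then have "(\<integral>\<^sup>+x. ennreal (norm (Z x ^ 3)) \<partial>M) < \<infinity>" using Z(2) by (simp add: le_less_trans)
  then show int: "integrable M (\<lambda>x. Z x ^ 3)" by (intro integrableI_bounded) measurable
  have "ennreal (expectation (\<lambda>x. Z x ^ 3)) = (\<integral>\<^sup>+x. ennreal (Z x ^ 3) \<partial>M)"
    by (rule nn_integral_eq_integral[OF int, symmetric]) (use Z(2) in simp)
  then have "ennreal (expectation (\<lambda>x. Z x ^ 3)) \<le> ennreal (112 * C * ?S)" using le by (simp only:)
  moreover have "0 \<le> 112 * C * ?S" using C(1) by (intro mult_nonneg_nonneg suminf_nonneg sm) auto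
  ultimately show "expectation (\<lambda>x. Z x ^ 3) \<le> 112 * C * ?S" by (simp only: ennreal_le_iff)
qed

text \<open>The constants are uniform in \<open>m\<close>. From above,
  \<open>Z x powr m \<le> 1 + Z x ^ 3\<close>. From below,
  \<open>Z x \<le> d + d powr (1 - m) * Z x powr m\<close> converts the bound on the first moment
  into \<open>d powr m\<close>, which is at least \<open>d ^ 3\<close>.\<close>

lemma powr_moment_bounds:
  fixes Z :: "'a \<Rightarrow> real"
  assumes Z: "Z \<in> borel_measurable M" "\<And>x. 0 \<le> Z x" "integrable M (\<lambda>x. Z x ^ 3)"
    and m: "1 \<le> m" "m < 3" and d: "0 < d" "d \<le> 1" "2 * d \<le> expectation Z"
  shows "integrable M (\<lambda>x. Z x powr m)" "expectation (\<lambda>x. Z x powr m) \<le> 1 + expectation (\<lambda>x. Z x ^ 3)"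
    "d ^ 3 \<le> expectation (\<lambda>x. Z x powr m)"
proof -
  note [measurable] = Z(1)
  have pw: "Z x powr r \<le> 1 + Z x ^ 3" if "1 \<le> r" "r \<le> 3" for x r
  proof (cases "Z x \<le> 1")
    case True
    then have "Z x powr r \<le> 1" using Z(2)[of x] that by (intro powr_le1) auto
    moreover have "0 \<le> Z x ^ 3" using Z(2)[of x] by simp
    ultimately show ?thesis by linarith
  next
    case False
    then have "Z x powr r \<le> Z x powr 3" using that by (intro powr_mono) auto
    also have "\<dots> = Z x ^ 3" using False by simp
    finally show ?thesis by simp
  qed
  have i3: "integrable M (\<lambda>x. 1 + Z x ^ 3)" using Z(3) by simp
  have ip: "integrable M (\<lambda>x. Z x powr r)" if "1 \<le> r" "r \<le> 3" for r
    by (rule Bochner_Integration.integrable_bound[OF i3]) (use pw[OF that] Z(2) in \<open>auto intro!: AE_I2 simp: abs_of_nonneg\<close>)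
  show im: "integrable M (\<lambda>x. Z x powr m)" using ip m by simp
  have "expectation (\<lambda>x. Z x powr m) \<le> expectation (\<lambda>x. 1 + Z x ^ 3)"
    by (rule integral_mono[OF im i3]) (use pw m in simp)
  also have "\<dots> = 1 + expectation (\<lambda>x. Z x ^ 3)" using Z(3) prob_space by simp
  finally show "expectation (\<lambda>x. Z x powr m) \<le> 1 + expectation (\<lambda>x. Z x ^ 3)" .
  have i1: "integrable M Z" using ip[of 1] Z(2) by simp
  have pt: "Z x \<le> d + d powr (1 - m) * Z x powr m" for x
  proof (cases "Z x \<le> d")
    case True
    then show ?thesis using d(1) by (simp add: add_increasing2)
  next
    case False
    then have z: "0 < Z x" "d \<le> Z x" using d by auto
    have "Z x = Z x powr (1 - m) * Z x powr m" using z by (simp flip: powr_add)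
    also have "\<dots> \<le> d powr (1 - m) * Z x powr m"
      using z d m by (intro mult_right_mono powr_mono2') auto
    finally show ?thesis using d by simp
  qed
  have "2 * d \<le> expectation Z" by (rule d(3))
  also have "\<dots> \<le> expectation (\<lambda>x. d + d powr (1 - m) * Z x powr m)"
    by (rule integral_mono[OF i1]) (use im pt in auto)
  also have "\<dots> = d + d powr (1 - m) * expectation (\<lambda>x. Z x powr m)" using im prob_space by simp
  finally have "d \<le> d powr (1 - m) * expectation (\<lambda>x. Z x powr m)" by simp
  then have "d powr (m - 1) * d \<le> d powr (m - 1) * (d powr (1 - m) * expectation (\<lambda>x. Z x powr m))"
    by (intro mult_left_mono) auto
  also have "\<dots> = expectation (\<lambda>x. Z x powr m)" using d by (simp add: mult.assoc[symmetric] flip: powr_add)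
  also have "d powr (m - 1) * d = d powr m" using d powr_add[of d "m - 1" 1] by simp
  finally have "d powr m \<le> expectation (\<lambda>x. Z x powr m)" .
  moreover have "d powr 3 \<le> d powr m" using d m by (intro powr_mono') auto
  moreover have "d powr 3 = d ^ 3" using d by simp
  ultimately show "d ^ 3 \<le> expectation (\<lambda>x. Z x powr m)" by simp
qed

end

context coupled_tazrp begin

section \<open>Two-sided tails of the position and the final bounds\<close>

lemma prob_agree_antimono:
  assumes "0 \<le> t" "n \<le> y" shows "prob (agree t y) \<le> prob (agree t n)"
  by (rule finite_measure_mono[OF _ agree_event[OF assms(1)]]) (use assms(2) in \<open>auto simp: agree_def\<close>)

text \<open>Four ranges of \<open>w\<close>. Below \<open>4 * l\<^sup>2\<close> the bound is
  trivial. The range of \<open>prob_passed_right\<close> ends at a multiple of \<open>l ^ 3\<close>;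
  monotonicity in the position extends it to \<open>4 * l ^ 3\<close> at the cost of a constant.
  Beyond that the position is so large compared with the time that \<open>prob_agree_le\<close>
  gives exponential decay.\<close>

lemma tail_right:
  "\<exists>C>0. \<exists>l1. \<forall>l\<ge>l1. \<forall>w y. l\<^sup>2 \<le> w \<longrightarrow> V * l ^ 3 + w \<le> real y \<longrightarrow> prob (agree (l ^ 3) y) \<le> C * (l ^ 8 / w ^ 4)"
proof -
  define B where "B = 2048 * tail_const a + 1"
  define C where "C = 131072 + B * (16 / a) ^ 4"
  have B: "1 \<le> B" using tail_const_pos by (simp add: B_def)
  have a16: "1 \<le> 16 / a" using a by simp
  have C: "0 < C" "131072 \<le> C" "B \<le> C" "B * (16 / a) ^ 4 \<le> C"
  proof -
    have "B * 1 \<le> B * (16 / a) ^ 4" using B a16 by (intro mult_left_mono one_le_power) auto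
    then show "0 < C" "131072 \<le> C" "B \<le> C" "B * (16 / a) ^ 4 \<le> C" using B unfolding C_def by linarith+
  qed
  have mid: "prob (agree (l ^ 3) y) \<le> B * (l ^ 8 / w ^ 4)"
    if l: "l0 \<le> l" and w: "4 * l\<^sup>2 \<le> w" "w + 1 \<le> a / 2 * l ^ 3" and y: "V * l ^ 3 + w \<le> real y" for l w y
  proof -
    have l2: "2 \<le> l" using l l0 by simp
    have w0: "0 < w" using w(1) l2 by (smt (verit) zero_less_power)
    define n where "n = nat \<lceil>V * l ^ 3 + w\<rceil>"
    have "0 < V * l ^ 3 + w" using V l2 w0 by (intro add_pos_pos) auto
    then have n: "V * l ^ 3 + w \<le> real n" "real n \<le> V * l ^ 3 + w + 1" unfolding n_def by linarith+
    have "n \<le> y" using y unfolding n_def by linarith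
    then have "prob (agree (l ^ 3) y) \<le> prob (agree (l ^ 3) n)" using l2 by (intro prob_agree_antimono) auto
    also have "\<dots> \<le> B * (l ^ 8 / (real n - V * l ^ 3) ^ 4)"
      unfolding B_def by (rule prob_passed_right[OF l refl]) (use n w in linarith)+
    also have "\<dots> \<le> B * (l ^ 8 / w ^ 4)"
      using n B w0 l2 by (intro mult_left_mono divide_left_mono power_mono) auto
    finally show ?thesis .
  qed
  define l1 where "l1 = max l0 (max (4 / a) (16 / a))"
  have "prob (agree (l ^ 3) y) \<le> C * (l ^ 8 / w ^ 4)" if l: "l1 \<le> l" and w: "l\<^sup>2 \<le> w" and y: "V * l ^ 3 + w \<le> real y" for l w y
  proof -
    have l2: "2 \<le> l" "l0 \<le> l" "16 / a \<le> l" using l l0 by (auto simp: l1_def)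
    have al: "16 \<le> a * l" using l2(3) a by (simp add: pos_divide_le_eq mult.commute)
    have lsq: "2 * 2 \<le> l\<^sup>2" unfolding power2_eq_square using l2 by (intro mult_mono) auto
    have w0: "0 < w" "4 \<le> w" using w lsq by auto
    have r0: "0 \<le> l ^ 8 / w ^ 4" using l2 w0 by simp
    have al3: "16 * l\<^sup>2 \<le> a * l ^ 3"
    proof -
      have "16 * l\<^sup>2 \<le> (a * l) * l\<^sup>2" using al by (intro mult_right_mono) auto
      then show ?thesis by (simp add: power3_eq_cube power2_eq_square mult_ac)
    qed
    consider "w < 4 * l\<^sup>2" | "4 * l\<^sup>2 \<le> w" "w + 1 \<le> a / 2 * l ^ 3" | "a / 2 * l ^ 3 < w + 1" "w \<le> 4 * l ^ 3" | "4 * l ^ 3 < w" by linarith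
    then show ?thesis
    proof cases
      case 1
      have "w ^ 4 \<le> (4 * l\<^sup>2) ^ 4" using 1 w0 by (intro power_mono) auto
      also have "\<dots> = 256 * l ^ 8" by (simp add: power_mult_distrib flip: power_mult)
      finally have "1 \<le> 256 * (l ^ 8 / w ^ 4)" using w0 by (simp add: field_simps)
      also have "\<dots> \<le> C * (l ^ 8 / w ^ 4)" using r0 C by (intro mult_right_mono) auto
      finally show ?thesis using prob_le_1[of "agree (l ^ 3) y"] by linarith
    next
      case 2
      have "prob (agree (l ^ 3) y) \<le> B * (l ^ 8 / w ^ 4)" by (rule mid[OF l2(2) 2 y])
      also have "\<dots> \<le> C * (l ^ 8 / w ^ 4)" using r0 C by (intro mult_right_mono) auto
      finally show ?thesis .
    next
      case 3
      \<comment> \<open>A deviation still within reach of \<open>mid\<close>, smaller than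
        \<open>w\<close> by at most the factor \<open>16 / a\<close>.\<close>
      define v where "v = a / 4 * l ^ 3"
      have v: "4 * l\<^sup>2 \<le> v" "v + 1 \<le> a / 2 * l ^ 3" "v \<le> w" using al3 lsq 3 by (auto simp: v_def)
      have "prob (agree (l ^ 3) y) \<le> B * (l ^ 8 / v ^ 4)"
        by (rule mid[OF l2(2) v(1,2)]) (use y v in linarith)
      also have "l ^ 8 / v ^ 4 \<le> (16 / a) ^ 4 * (l ^ 8 / w ^ 4)"
      proof -
        have "w \<le> 16 / a * v" using 3(2) a by (simp add: v_def)
        then have "w ^ 4 \<le> (16 / a * v) ^ 4" using w0 by (intro power_mono) auto
        also have "\<dots> = (16 / a) ^ 4 * v ^ 4" by (rule power_mult_distrib)
        finally have "w ^ 4 \<le> (16 / a) ^ 4 * v ^ 4" .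
        moreover have vw: "0 < v ^ 4" "0 < w ^ 4" using v lsq w0 by auto
        ultimately have "w ^ 4 / v ^ 4 \<le> (16 / a) ^ 4" by (simp only: pos_divide_le_eq)
        then have "w ^ 4 / v ^ 4 * (l ^ 8 / w ^ 4) \<le> (16 / a) ^ 4 * (l ^ 8 / w ^ 4)" using r0 by (rule mult_right_mono)
        moreover have "w ^ 4 / v ^ 4 * (l ^ 8 / w ^ 4) = l ^ 8 / v ^ 4" using vw by simp
        ultimately show ?thesis by simp
      qed
      also have "B * ((16 / a) ^ 4 * (l ^ 8 / w ^ 4)) = B * (16 / a) ^ 4 * (l ^ 8 / w ^ 4)" by simp
      also have "\<dots> \<le> C * (l ^ 8 / w ^ 4)" using r0 C by (intro mult_right_mono) auto
      finally show ?thesis using B by simp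
    next
      case 4
      have l3: "0 < l ^ 3" using l2 by simp
      have "0 \<le> V * l ^ 3" using V l3 by simp
      then have wy: "w \<le> real y" using y by linarith
      then have y1: "1 \<le> y" using w0 by linarith
      have "(1 / 2 :: real) \<le> ln 2" using ln2_ge_two_thirds by simp
      have "prob (agree (l ^ 3) y) \<le> 2 * exp (l ^ 3) / 2 ^ y" by (rule prob_agree_le[OF l3 y1])
      also have "2 ^ y = exp (real y * ln 2)" by (simp add: exp_of_nat_mult)
      also have "2 * exp (l ^ 3) / exp (real y * ln 2) = 2 * exp (l ^ 3 - real y * ln 2)" by (simp add: exp_diff)
      also have "\<dots> \<le> 2 * exp (- (w / 4))"
      proof -
        have "w * (1 / 2) \<le> real y * ln 2" using wy w0 \<open>1 / 2 \<le> ln 2\<close> by (intro mult_mono) auto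
        then show ?thesis using 4 by simp
      qed
      also have "\<dots> \<le> 2 * (65536 / w ^ 4)" using exp_quarter_bound[OF w0(1)] by simp
      also have "\<dots> \<le> 131072 * (l ^ 8 / w ^ 4)" using w0 l2 by (simp add: divide_right_mono)
      also have "\<dots> \<le> C * (l ^ 8 / w ^ 4)" using r0 C by (intro mult_right_mono) auto
      finally show ?thesis .
    qed
  qed
  then show ?thesis using C(1) by blast
qed

lemma Q_le_event: "0 < t \<Longrightarrow> {x \<in> space M. real_of_int (Q t x) \<le> r} \<in> events"
  using measurable_sets[OF Q_measurable, of t "{q. real_of_int q \<le> r}"] by (simp add: vimage_def Int_def conj_commute)

text \<open>\<open>sum_passed_left\<close> bounds a sum over positions. On the event, no position
  between \<open>V * l ^ 3 - w\<close> and \<open>V * l ^ 3 - w / 2\<close> has been reached; there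
  are at least \<open>w / 4\<close> of them, which gains the factor \<open>1 / w\<close>. If
  \<open>w\<close> exceeds \<open>V * l ^ 3\<close>, the event is null because the antiparticle is
  never left of its starting site.\<close>

lemma tail_left:
  "\<exists>C>0. \<exists>l1. \<forall>l\<ge>l1. \<forall>w. l\<^sup>2 \<le> w \<longrightarrow> prob {x \<in> space M. real_of_int (Q (l ^ 3) x) \<le> V * l ^ 3 - w} \<le> C * (l ^ 8 / w ^ 4)"
proof -
  define B where "B = 32 * tail_const a + 1"
  define C where "C = 4096 + 32 * B"
  have B: "1 \<le> B" using tail_const_pos by (simp add: B_def)
  have C: "0 < C" "4096 \<le> C" "32 * B \<le> C" using B by (auto simp: C_def)
  have "prob {x \<in> space M. real_of_int (Q (l ^ 3) x) \<le> V * l ^ 3 - w} \<le> C * (l ^ 8 / w ^ 4)"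
    if l: "l0 \<le> l" and w: "l\<^sup>2 \<le> w" for l w
  proof -
    have l2: "2 \<le> l" using l l0 by auto
    have l3: "0 < l ^ 3" using l2 by simp
    have lsq: "2 * 2 \<le> l\<^sup>2" unfolding power2_eq_square using l2 by (intro mult_mono) auto
    have w0: "0 < w" "4 \<le> w" using w lsq by auto
    have r0: "0 \<le> l ^ 8 / w ^ 4" using l2 w0 by simp
    let ?E = "{x \<in> space M. real_of_int (Q (l ^ 3) x) \<le> V * l ^ 3 - w}"
    have E: "?E \<in> events" by (rule Q_le_event[OF l3])
    have ag: "agree (l ^ 3) m \<in> events" for m using l3 by (intro agree_event) simp
    consider "w < 8 * l\<^sup>2" | "8 * l\<^sup>2 \<le> w" "V * l ^ 3 < w" | "8 * l\<^sup>2 \<le> w" "w \<le> V * l ^ 3" by linarith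
    then show ?thesis
    proof cases
      case 1
      have "w ^ 4 \<le> (8 * l\<^sup>2) ^ 4" using 1 w0 by (intro power_mono) auto
      also have "\<dots> = 4096 * l ^ 8" by (simp add: power_mult_distrib flip: power_mult)
      finally have "1 \<le> 4096 * (l ^ 8 / w ^ 4)" using w0 by (simp add: field_simps)
      also have "\<dots> \<le> C * (l ^ 8 / w ^ 4)" using r0 C by (intro mult_right_mono) auto
      finally show ?thesis using prob_le_1[of ?E] by linarith
    next
      case 2
      have "AE x in M. x \<notin> ?E"
        using AE_Q[OF l3]
      proof eventually_elim
        case (elim x)
        then have "0 \<le> real_of_int (Q (l ^ 3) x)" by simp
        then show ?case using 2 by simp
      qed
      then have "prob ?E = 0" using E by (simp add: prob_eq_0)
      then show ?thesis using r0 C by simp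
    next
      case 3
      define n where "n = nat \<lfloor>V * l ^ 3 - w / 2\<rfloor>"
      have n: "real n \<le> V * l ^ 3 - w / 2" "V * l ^ 3 - w / 2 - 1 \<le> real n" using 3 w0 unfolding n_def by linarith+
      define m1 where "m1 = nat \<lfloor>V * l ^ 3 - w\<rfloor>"
      have m1: "real m1 \<le> V * l ^ 3 - w" "V * l ^ 3 - w < real m1 + 1" using 3 unfolding m1_def by linarith+
      have mn: "m1 \<le> n" using m1 n w0 by linarith
      define u where "u = V * l ^ 3 - real n"
      have u: "w / 2 \<le> u" "2 * l\<^sup>2 \<le> u" using n 3 w0 lsq by (auto simp: u_def)
      have P: "prob ?E \<le> 1 - prob (agree (l ^ 3) m)" if m: "m \<in> {m1<..n}" for m
      proof -
        have "V * l ^ 3 - w < real m" using m m1 by simp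
        have "prob ?E \<le> prob (space M - agree (l ^ 3) m)"
        proof (rule finite_measure_mono_AE)
          show "AE x in M. x \<in> ?E \<longrightarrow> x \<in> space M - agree (l ^ 3) m"
            using AE_Q[OF l3]
          proof eventually_elim
            case (elim x)
            show ?case
            proof
              assume x: "x \<in> ?E"
              then have "real_of_int (Q (l ^ 3) x) < real m" using \<open>V * l ^ 3 - w < real m\<close> by simp
              then have "\<not> int m \<le> Q (l ^ 3) x" by linarith
              then show "x \<in> space M - agree (l ^ 3) m" using elim[THEN conjunct2, rule_format, of m] x by simp
            qed
          qed
        qed (rule sets.compl_sets[OF ag])
        then show ?thesis using prob_compl[OF ag] by simp
      qed
      have "real (n - m1) * prob ?E = (\<Sum>m\<in>{m1<..n}. prob ?E)" by simp
      also have "\<dots> \<le> (\<Sum>m\<in>{m1<..n}. 1 - prob (agree (l ^ 3) m))" by (rule sum_mono[OF P])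
      also have "\<dots> \<le> (\<Sum>m\<in>{1..n}. 1 - prob (agree (l ^ 3) m))"
        by (rule sum_mono2) (use prob_le_1 in auto)
      also have "\<dots> \<le> B * (l ^ 8 / u ^ 3)" unfolding B_def by (rule sum_passed_left[OF l u_def u(2)])
      also have "\<dots> \<le> B * (l ^ 8 / (w / 2) ^ 3)"
        using u w0 l2 B by (intro mult_left_mono divide_left_mono power_mono) auto
      also have "\<dots> = 8 * B * (l ^ 8 / w ^ 3)" by (simp add: power_divide)
      finally have S: "real (n - m1) * prob ?E \<le> 8 * B * (l ^ 8 / w ^ 3)" .
      have "w / 4 \<le> real (n - m1)" using n m1 mn w0 by (simp add: of_nat_diff)
      then have "w / 4 * prob ?E \<le> real (n - m1) * prob ?E" by (intro mult_right_mono) auto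
      then have "w / 4 * prob ?E \<le> 8 * B * (l ^ 8 / w ^ 3)" using S by linarith
      then have "(w / 4 * prob ?E) * (4 / w) \<le> (8 * B * (l ^ 8 / w ^ 3)) * (4 / w)" using w0 by (intro mult_right_mono) auto
      also have "(8 * B * (l ^ 8 / w ^ 3)) * (4 / w) = 32 * B * (l ^ 8 / w ^ 4)" by (simp add: power4_eq_xxxx power3_eq_cube)
      also have "(w / 4 * prob ?E) * (4 / w) = prob ?E" using w0 by simp
      also have "32 * B * (l ^ 8 / w ^ 4) \<le> C * (l ^ 8 / w ^ 4)" using r0 C by (intro mult_right_mono) auto
      finally show ?thesis .
    qed
  qed
  then show ?thesis using C(1) by blast
qed

definition dev :: "real \<Rightarrow> 'a \<Rightarrow> real" where
  "dev l x = \<bar>real_of_int (Q (l ^ 3) x) - V * l ^ 3\<bar> / l\<^sup>2"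

lemma dev_measurable: "0 < l \<Longrightarrow> dev l \<in> borel_measurable M"
  unfolding dev_def by (rule measurable_compose[OF Q_measurable]) auto

lemma dev_tail: "\<exists>C\<ge>1. \<exists>l1. \<forall>l\<ge>l1. \<forall>k::nat. 1 \<le> k \<longrightarrow> prob {x \<in> space M. real k \<le> dev l x} \<le> C / real k ^ 4"
proof -
  obtain C1 l1 where C1: "0 < C1" and R: "\<And>l w y. l1 \<le> l \<Longrightarrow> l\<^sup>2 \<le> w \<Longrightarrow> V * l ^ 3 + w \<le> real y \<Longrightarrow> prob (agree (l ^ 3) y) \<le> C1 * (l ^ 8 / w ^ 4)"
    using tail_right by blast
  obtain C2 l2 where C2: "0 < C2" and Lf: "\<And>l w. l2 \<le> l \<Longrightarrow> l\<^sup>2 \<le> w \<Longrightarrow> prob {x \<in> space M. real_of_int (Q (l ^ 3) x) \<le> V * l ^ 3 - w} \<le> C2 * (l ^ 8 / w ^ 4)"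
    using tail_left by blast
  have "prob {x \<in> space M. real k \<le> dev l x} \<le> (C1 + C2 + 1) / real k ^ 4" if l: "max 1 (max l1 l2) \<le> l" and k: "1 \<le> k" for l k
  proof -
    have l': "1 \<le> l" "l1 \<le> l" "l2 \<le> l" using l by auto
    have l3: "0 < l ^ 3" "0 < l\<^sup>2" using l' by auto
    define w where "w = real k * l\<^sup>2"
    have w: "l\<^sup>2 \<le> w" using mult_right_mono[of 1 "real k" "l\<^sup>2"] k by (simp add: w_def)
    have lw: "l ^ 8 / w ^ 4 = 1 / real k ^ 4"
      using l' k by (simp add: w_def power_mult_distrib flip: power_mult)
    define y where "y = nat \<lceil>V * l ^ 3 + w\<rceil>"
    have y: "V * l ^ 3 + w \<le> real y" unfolding y_def by linarith
    let ?L = "{x \<in> space M. real_of_int (Q (l ^ 3) x) \<le> V * l ^ 3 - w}"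
    have ev: "agree (l ^ 3) y \<in> events" "?L \<in> events" using l3 by (auto intro!: agree_event Q_le_event)
    have "prob {x \<in> space M. real k \<le> dev l x} \<le> prob (agree (l ^ 3) y \<union> ?L)"
    proof (rule finite_measure_mono_AE)
      show "AE x in M. x \<in> {x \<in> space M. real k \<le> dev l x} \<longrightarrow> x \<in> agree (l ^ 3) y \<union> ?L"
        using AE_Q[OF l3(1)]
      proof eventually_elim
        case (elim x)
        show ?case
        proof
          assume x: "x \<in> {x \<in> space M. real k \<le> dev l x}"
          then have "w \<le> \<bar>real_of_int (Q (l ^ 3) x) - V * l ^ 3\<bar>" using l3 by (simp add: dev_def w_def pos_le_divide_eq)
          then consider "V * l ^ 3 + w \<le> real_of_int (Q (l ^ 3) x)" | "real_of_int (Q (l ^ 3) x) \<le> V * l ^ 3 - w" by linarith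
          then show "x \<in> agree (l ^ 3) y \<union> ?L"
          proof cases
            case 1
            then have "int y \<le> Q (l ^ 3) x" using elim[THEN conjunct1] unfolding y_def by linarith
            then show ?thesis using elim[THEN conjunct2, rule_format, of y] by simp
          qed (use x in simp)
        qed
      qed
    qed (rule sets.Un[OF ev])
    also have "\<dots> \<le> prob (agree (l ^ 3) y) + prob ?L" by (rule measure_Un_le[OF ev])
    also have "\<dots> \<le> C1 * (1 / real k ^ 4) + C2 * (1 / real k ^ 4)"
      unfolding lw[symmetric] by (intro add_mono R Lf l' w y)
    also have "\<dots> = (C1 + C2) / real k ^ 4" by (simp add: add_divide_distrib)
    also have "\<dots> \<le> (C1 + C2 + 1) / real k ^ 4" by (intro divide_right_mono) auto
    finally show ?thesis .
  qed
  then show ?thesis using C1 C2 by (intro exI[of _ "C1 + C2 + 1"] conjI exI[of _ "max 1 (max l1 l2)"]) auto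
qed

text \<open>The sum is the mean number of positions up to \<open>n\<close> not yet reached. Since
  \<open>n\<close> does not exceed \<open>V * l ^ 3\<close>, this number is at most the absolute
  deviation.\<close>

lemma expectation_dev_ge:
  assumes l: "0 < l" and i: "integrable M (dev l)" and n: "real n \<le> V * l ^ 3"
  shows "(\<Sum>m\<in>{1..n}. 1 - prob (agree (l ^ 3) m)) \<le> l\<^sup>2 * expectation (dev l)"
proof -
  have l3: "0 < l ^ 3" using l by simp
  have ag: "agree (l ^ 3) m \<in> events" for m using l3 by (intro agree_event) simp
  let ?I = "\<lambda>m. indicator (space M - agree (l ^ 3) m) :: 'a \<Rightarrow> real"
  have iI: "integrable M (?I m)" for m using ag by (intro integrable_real_indicator) (auto simp: emeasure_eq_measure)
  have "(\<Sum>m\<in>{1..n}. 1 - prob (agree (l ^ 3) m)) = (\<Sum>m\<in>{1..n}. expectation (?I m))"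
  proof (rule sum.cong)
    fix m
    have "expectation (?I m) = prob (space M - agree (l ^ 3) m)" using sets.compl_sets[OF ag] by simp
    then show "1 - prob (agree (l ^ 3) m) = expectation (?I m)" using prob_compl[OF ag] by simp
  qed simp
  also have "\<dots> = expectation (\<lambda>x. \<Sum>m\<in>{1..n}. ?I m x)" by (rule Bochner_Integration.integral_sum[symmetric]) (rule iI)
  also have "\<dots> \<le> expectation (\<lambda>x. l\<^sup>2 * dev l x)"
  proof (rule integral_mono_AE)
    show "AE x in M. (\<Sum>m\<in>{1..n}. ?I m x) \<le> l\<^sup>2 * dev l x"
      using AE_Q[OF l3]
    proof eventually_elim
      case (elim x)
      obtain q :: nat where q: "Q (l ^ 3) x = int q" using elim nonneg_int_cases by blast
      have "(\<Sum>m\<in>{1..n}. ?I m x) \<le> (\<Sum>m\<in>{1..n}. indicator {q<..n} m)"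
      proof (rule sum_mono)
        fix m assume "m \<in> {1..n}"
        then show "?I m x \<le> indicator {q<..n} m"
          using elim[THEN conjunct2, rule_format, of m] unfolding q by (simp add: indicator_def)
      qed
      also have "\<dots> \<le> (\<Sum>m\<in>{..n}. indicator {q<..n} m)" by (rule sum_mono2) auto
      also have "\<dots> = (\<Sum>m\<in>{q<..n}. 1)" by (rule sum.mono_neutral_cong_right) auto
      also have "\<dots> = real (n - q)" by simp
      also have "\<dots> \<le> \<bar>real_of_int (Q (l ^ 3) x) - V * l ^ 3\<bar>" using n unfolding q by linarith
      also have "\<dots> = l\<^sup>2 * dev l x" using l by (simp add: dev_def)
      finally show ?case .
    qed
  qed (use i iI in auto)
  finally show ?thesis by simp
qed

lemma dev_moments:
  "\<exists>C>0. \<exists>l1>0. \<forall>l\<ge>l1. \<forall>m. 1 \<le> m \<longrightarrow> m < 3 \<longrightarrow> integrable M (\<lambda>x. dev l x powr m) \<and>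
    inverse C \<le> expectation (\<lambda>x. dev l x powr m) \<and> expectation (\<lambda>x. dev l x powr m) \<le> C"
proof -
  obtain C1 l1 where C1: "1 \<le> C1" and tail: "\<And>l k. l1 \<le> l \<Longrightarrow> 1 \<le> k \<Longrightarrow> prob {x \<in> space M. real k \<le> dev l x} \<le> C1 / real k ^ 4"
    using dev_tail by blast
  obtain c l2 where c: "0 < c" and low: "\<And>l. l2 \<le> l \<Longrightarrow> \<exists>n. real n \<le> V * l ^ 3 \<and> c * l\<^sup>2 \<le> (\<Sum>m\<in>{1..n}. 1 - prob (agree (l ^ 3) m))"
    using sum_passed_ge by blast
  define B where "B = 1 + 112 * C1 * (\<Sum>k. 1 / (real k + 1)\<^sup>2)"
  define d where "d = min 1 (c / 2)"
  have d: "0 < d" "d \<le> 1" "2 * d \<le> c" using c by (auto simp: d_def)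
  define C where "C = max B (inverse (d ^ 3))"
  have C: "0 < C" "B \<le> C" "inverse C \<le> d ^ 3"
  proof -
    have d3: "0 < inverse (d ^ 3)" "inverse (d ^ 3) \<le> C" using d by (auto simp: C_def)
    then show "0 < C" by linarith
    show "B \<le> C" by (simp add: C_def)
    have "inverse C \<le> inverse (inverse (d ^ 3))" using d3 by (intro le_imp_inverse_le)
    then show "inverse C \<le> d ^ 3" by simp
  qed
  have "integrable M (\<lambda>x. dev l x powr m) \<and> inverse C \<le> expectation (\<lambda>x. dev l x powr m) \<and> expectation (\<lambda>x. dev l x powr m) \<le> C"
    if l: "max 1 (max l1 l2) \<le> l" and m: "1 \<le> m" "m < 3" for l m
  proof -
    have l': "0 < l" "l1 \<le> l" "l2 \<le> l" using l by auto
    have nn: "0 \<le> dev l x" for x by (simp add: dev_def)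
    note meas = dev_measurable[OF l'(1)]
    note third = third_moment_le[OF meas nn C1 tail[OF l'(2)]]
    have id: "integrable M (dev l)"
    proof (rule Bochner_Integration.integrable_bound[of M "\<lambda>x. 1 + dev l x ^ 3"])
      have "dev l x \<le> 1 + dev l x ^ 3" for x
      proof (cases "dev l x \<le> 1")
        case False
        then show ?thesis using self_le_power[of "dev l x" 3] by simp
      qed (use nn[of x] in \<open>simp add: add_increasing2\<close>)
      then show "AE x in M. norm (dev l x) \<le> norm (1 + dev l x ^ 3)" using nn by (intro AE_I2) (simp add: abs_of_nonneg)
    qed (use third(1) meas in auto)
    obtain n where n: "real n \<le> V * l ^ 3" "c * l\<^sup>2 \<le> (\<Sum>m\<in>{1..n}. 1 - prob (agree (l ^ 3) m))"
      using low[OF l'(3)] by blast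
    have "c * l\<^sup>2 \<le> l\<^sup>2 * expectation (dev l)" using n(2) expectation_dev_ge[OF l'(1) id n(1)] by linarith
    then have "l\<^sup>2 * c \<le> l\<^sup>2 * expectation (dev l)" by (simp only: mult.commute)
    then have "c \<le> expectation (dev l)" using l' by (simp add: mult_le_cancel_left_pos)
    then have "2 * d \<le> expectation (dev l)" using d by linarith
    note mom = powr_moment_bounds[OF meas nn third(1) m d(1,2) this]
    show ?thesis using mom third(2) C unfolding B_def by linarith
  qed
  then show ?thesis using C(1) by (intro exI[of _ C] conjI exI[of _ "max 1 (max l1 l2)"]) auto
qed

end

theorem theorem2p2:
  fixes M :: "'a measure"
    and N :: "int \<Rightarrow> real \<Rightarrow> 'a \<Rightarrow> nat"
    and \<omega>m \<omega> :: "real \<Rightarrow> 'a \<Rightarrow> config"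
    and \<rho> :: real
  assumes "\<rho> > 0"
    and "basic_coupling M N \<omega>m \<omega>"
    and "distr M (config_space \<Otimes>\<^sub>M config_space) (\<lambda>x. (\<omega>m 0 x, \<omega> 0 x)) = initial_law \<rho>"
  shows "\<exists>t0 C :: real. 0 < t0 \<and> 0 < C \<and>
    (\<forall>m t :: real. 1 \<le> m \<longrightarrow> m < 3 \<longrightarrow> t0 \<le> t \<longrightarrow>
      (let Z = \<lambda>x. \<bar>(real_of_int (antiparticle \<omega>m \<omega> t x) - char_speed \<rho> * t) / t powr (2/3)\<bar> powr m
       in integrable M Z \<and>
          inverse C \<le> prob_space.expectation M Z \<and>
          prob_space.expectation M Z \<le> C))"
proof -
  interpret coupled_tazrp M N \<omega>m \<omega> \<rho> using assms by unfold_locales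
  obtain C l1 where C: "0 < C" "0 < l1" and mom: "\<And>l m. l1 \<le> l \<Longrightarrow> 1 \<le> m \<Longrightarrow> m < 3 \<Longrightarrow>
    integrable M (\<lambda>x. dev l x powr m) \<and> inverse C \<le> expectation (\<lambda>x. dev l x powr m) \<and> expectation (\<lambda>x. dev l x powr m) \<le> C"
    using dev_moments by blast
  show ?thesis
  proof (rule exI[of _ "l1 ^ 3"], rule exI[of _ C], intro conjI allI impI)
    show "0 < l1 ^ 3" using C by simp
    fix m t :: real assume m: "1 \<le> m" "m < 3" and t: "l1 ^ 3 \<le> t"
    have t0: "0 < t" using t C zero_less_power[of l1 3] by linarith
    define l where "l = root 3 t"
    have l: "0 < l" "l ^ 3 = t" using t0 by (auto simp: l_def real_root_pow_pos2)
    have l2: "l\<^sup>2 = t powr (2 / 3)"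
    proof -
      have "t = l powr 3" using l by simp
      then have "t powr (2 / 3) = l powr 2" by (simp add: powr_powr)
      then show ?thesis using l by simp
    qed
    have "l1 \<le> l"
    proof (rule ccontr)
      assume "\<not> l1 \<le> l"
      then have "l ^ 3 < l1 ^ 3" using l by (intro power_strict_mono) auto
      then show False using l t by simp
    qed
    have "dev l = (\<lambda>x. \<bar>(real_of_int (antiparticle \<omega>m \<omega> t x) - char_speed \<rho> * t) / t powr (2/3)\<bar>)"
      unfolding dev_def l(2) l2 V_def a(3) by (simp add: abs_divide)
    from mom[OF \<open>l1 \<le> l\<close> m, unfolded this] show "let Z = \<lambda>x. \<bar>(real_of_int (antiparticle \<omega>m \<omega> t x) - char_speed \<rho> * t) / t powr (2/3)\<bar> powr m
       in integrable M Z \<and> inverse C \<le> prob_space.expectation M Z \<and> prob_space.expectation M Z \<le> C"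
      unfolding Let_def .
  qed (rule C(1))
qed

end
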